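(* Consider the regression model $dy_t=S(t)\,dt+d\xi_t$, $0\le t\le n$, with the semi-Markov noise $\xi$ described in the context, observed at the times $t_j=j/p$, $0\le j\le np$, where $p=p(n)$. Assume that the law $\eta$ of $\tau_1$ has a density $g$ such that: (1) for every $x\in\mathbb R$ the one-sided limits $g(x-),g(x+)$ exist and are finite, and for every $K>0$ there is $\delta_K>0$ with $\sup_{|x|\le K}\int_0^{\delta_K}t^{-1}|g(x+t)+g(x-t)-g(x+)-g(x-)|\,dt<\infty$; (2) for every $\gamma>0$, $\sup_{z\ge 0}z^{\gamma}|2g(z)-g(z-)-g(z+)|<\infty$; (3) there is $\beta>0$ with $\int_{\mathbb R}e^{\beta x}g(x)\,dx<\infty$; (4) there is $t^*>0$ such that for every $0\le t\le t^*$ the function $\theta\mapsto\widehat g(\theta-it)=\frac1{2\pi}\int_{\mathbb R}e^{i(\theta-it)x}g(x)\,dx$ belongs to $L_1(\mathbb R)$. Assume moreover that (5) $p\ge n^{5/6}$ for every $n\ge3$. Let $k\ge1$ be an integer and $r>0$. Then $$\lim_{n\to\infty}\ \upsilon_n^{2k/(2k+1)}\inf_{\widehat S_n\in\Pi_n}\ \sup_{S\in W^k_r}\mathcal R^*_n(\widehat S_n,S)=r^*_k,\qquad r^*_k=\left((2k+1)r\right)^{1/(2k+1)}\left(\frac{k}{(k+1)\pi}\right)^{2k/(2k+1)},$$ where $\upsilon_n=n/\varsigma^*(n)$ and $\Pi_n$ is the set of all estimators measurable with respect to $\sigma\{y_t,\,0\le t\le n\}$.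
   Context: Model and noise. $n,p\ge1$ are integers, $S:\mathbb R\to\mathbb R$ is an unknown $1$-periodic function, $dy_t=S(t)dt+d\xi_t$ on $[0,n]$. The noise is $\xi_t=\varrho_1w_t+\varrho_2L_t+\varrho_3z_t$, with unknown real coefficients $\varrho_1,\varrho_2,\varrho_3$; $w$ is a standard Brownian motion; $L_t=\int_0^t\int_{\mathbb R\setminus\{0\}}x(\mu(ds,dx)-ds\,\Pi(dx))$ is a pure jump Lévy process with jump measure $\mu$ and Lévy measure $\Pi$ with $\int x^2\Pi(dx)=1$, $\int x^8\Pi(dx)<\infty$; $z_t=\sum_{i=1}^{N_t}Y_i$, $N_t=\sum_{k\ge1}1_{\{T_k\le t\}}$, $T_k=\sum_{l=1}^k\tau_l$, where $(\tau_l)_{l\ge1}$ are i.i.d. positive integrable random variables with law $\eta$ and mean $\check\tau>0$. The random variables $(Y_i)_{i\ge1}$ satisfy: $\mathbf E Y_i^2=1$, $\mathbf E Y_{i_1}Y_{i_2}=0$ for $i_1\ne i_2$, $\sup_i\mathbf E Y_i^4<\infty$, and for all $i_1<i_2<i_3<i_4$ and $p_1,\dots,p_4\in\{0,\dots,4\}$ with $p_1+\dots+p_4=4$, $\mathbf E Y_{i_1}^{p_1}Y_{i_2}^{p_2}Y_{i_3}^{p_3}Y_{i_4}^{p_4}=0$ whenever some $p_i$ is odd. The processes $w$, $L$, $(N_t)$ and $(Y_i)$ are mutually independent. $\Pi$, $\eta$ and the law of $(Y_i)$ are fixed; $Q$ denotes the distribution of $(\xi_t)_{0\le t\le n}$ in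 the Skorokhod space $\mathcal D[0,n]$ (so it varies with $\varrho_1,\varrho_2,\varrho_3$). Put $\sigma_Q=\varrho_1^2+\varrho_2^2+\varrho_3^2/\check\tau$. $\mathbf E_{Q,S}$ is expectation under the law of $y$ with noise law $Q$ and function $S$. Robust risk. $0<\varsigma_*(n)\le\varsigma^*(n)$ are such that for any $\check\epsilon>0$, $n^{\check\epsilon}\varsigma_*(n)\to+\infty$ and $\varsigma^*(n)/n^{\check\epsilon}\to0$ as $n\to\infty$. $\mathcal Q_n$ is the family of all distributions $Q$ of the noise with $\varsigma_*\le\sigma_Q\le\varsigma^*$. $\mathcal R_Q(\widetilde S,S)=\mathbf E_{Q,S}\|\widetilde S-S\|^2$, $\|f\|^2=\int_0^1f^2(s)ds$, and $\mathcal R^*_n(\widetilde S,S)=\sup_{Q\in\mathcal Q_n}\mathcal R_Q(\widetilde S,S)$. Sobolev ball. $W^k_r=\{f\in C^k_{per}[0,1]:\sum_{j=0}^k\|f^{(j)}\|^2\le r\}$, where $C^k_{per}[0,1]$ is the set of $k$ times continuously differentiable $f:[0,1]\to\mathbb R$ with $f^{(i)}(0)=f^{(i)}(1)$ for $0\le i\le k$; elements are identified with their $1$-periodic extensions. *)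

theory Defs
  imports "HOL-Probability.Probability"
begin

section \<open>Paths and the space D[0,n]\<close>

definition cadlag_on :: "real set \<Rightarrow> (real \<Rightarrow> real) \<Rightarrow> bool" where
  "cadlag_on T f \<longleftrightarrow>
     (\<forall>t\<in>T. (f \<longlongrightarrow> f t) (at t within T \<inter> {t<..}) \<and>
            (\<exists>l. (f \<longlongrightarrow> l) (at t within T \<inter> {..<t})))"

text \<open>The Skorokhod space \<open>D[0,n]\<close> as a measurable space. Paths are functions that are
  \<open>undefined\<close> outside \<open>[0,n]\<close>. The sigma-algebra is generated by the
  coordinates \<open>y \<mapsto> y t\<close>, \<open>0 \<le> t \<le> n\<close>; it is \<open>\<sigma>{y\<^sub>t, 0 \<le> t \<le> n}\<close> and coincides with the
  Borel sigma-algebra of the Skorokhod topology.\<close>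

definition skorokhod_space :: "nat \<Rightarrow> (real \<Rightarrow> real) measure" where
  "skorokhod_space n =
     restrict_space (Pi\<^sub>M {0..real n} (\<lambda>_. borel)) {f. cadlag_on {0..real n} f}"

text \<open>\<open>Q\<close> is the distribution on \<open>D[0,n]\<close> of the process \<open>X\<close> on the probability space \<open>M\<close>.
  The paths of \<open>X\<close> only need to lie in \<open>D[0,n]\<close> almost surely, so a plain \<open>distr\<close> does not apply.\<close>

definition is_path_law ::
  "'a measure \<Rightarrow> nat \<Rightarrow> (real \<Rightarrow> 'a \<Rightarrow> real) \<Rightarrow> (real \<Rightarrow> real) measure \<Rightarrow> bool" where
  "is_path_law M n X Q \<longleftrightarrow>
     sets Q = sets (skorokhod_space n) \<and>
     (\<forall>A\<in>sets (Pi\<^sub>M {0..real n} (\<lambda>_. borel)).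
        emeasure Q (A \<inter> space (skorokhod_space n)) =
        emeasure M {\<omega>\<in>space M. (\<lambda>t\<in>{0..real n}. X t \<omega>) \<in> A})"

section \<open>Brownian motion and Levy processes\<close>

definition indep_increments :: "'a measure \<Rightarrow> (real \<Rightarrow> 'a \<Rightarrow> real) \<Rightarrow> bool" where
  "indep_increments M X \<longleftrightarrow>
     (\<forall>t :: nat \<Rightarrow> real. 0 \<le> t 0 \<longrightarrow> incseq t \<longrightarrow>
        prob_space.indep_vars M (\<lambda>_. borel) (\<lambda>i \<omega>. X (t (Suc i)) \<omega> - X (t i) \<omega>) UNIV)"

definition standard_brownian_motion :: "'a measure \<Rightarrow> (real \<Rightarrow> 'a \<Rightarrow> real) \<Rightarrow> bool" where
  "standard_brownian_motion M w \<longleftrightarrow>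
     (\<forall>t\<ge>0. w t \<in> borel_measurable M) \<and>
     (AE \<omega> in M. w 0 \<omega> = 0) \<and>
     (\<forall>\<omega>\<in>space M. continuous_on {0..} (\<lambda>t. w t \<omega>)) \<and>
     indep_increments M w \<and>
     (\<forall>s t. 0 \<le> s \<longrightarrow> s < t \<longrightarrow>
        distributed M lborel (\<lambda>\<omega>. w t \<omega> - w s \<omega>) (normal_density 0 (sqrt (t - s))))"

definition levy_process :: "'a measure \<Rightarrow> (real \<Rightarrow> 'a \<Rightarrow> real) \<Rightarrow> bool" where
  "levy_process M X \<longleftrightarrow>
     (\<forall>t\<ge>0. X t \<in> borel_measurable M) \<and>
     (AE \<omega> in M. X 0 \<omega> = 0) \<and>
     (\<forall>\<omega>\<in>space M. cadlag_on {0..} (\<lambda>t. X t \<omega>)) \<and>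
     indep_increments M X \<and>
     (\<forall>s h. 0 \<le> s \<longrightarrow> 0 \<le> h \<longrightarrow>
        distr M borel (\<lambda>\<omega>. X (s + h) \<omega> - X s \<omega>) = distr M borel (X h))"

definition jump :: "(real \<Rightarrow> 'a \<Rightarrow> real) \<Rightarrow> real \<Rightarrow> 'a \<Rightarrow> real" where
  "jump X s \<omega> = X s \<omega> - Lim (at_left s) (\<lambda>u. X u \<omega>)"

text \<open>The jump measure \<open>\<mu>\<close> of a path: the sum of the unit masses at \<open>(s, \<Delta>X\<^sub>s)\<close> over all jump
  times \<open>s > 0\<close>.\<close>

definition jump_measure :: "(real \<Rightarrow> 'a \<Rightarrow> real) \<Rightarrow> 'a \<Rightarrow> (real \<times> real) measure" where
  "jump_measure X \<omega> =
     distr (count_space {s. 0 < s \<and> jump X s \<omega> \<noteq> 0}) (borel \<Otimes>\<^sub>M borel) (\<lambda>s. (s, jump X s \<omega>))"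

text \<open>\<open>\<nu>\<close> is the Levy measure of \<open>X\<close>: the expected number of jumps per unit time
  with size in a given set.\<close>

definition is_levy_measure :: "'a measure \<Rightarrow> (real \<Rightarrow> 'a \<Rightarrow> real) \<Rightarrow> real measure \<Rightarrow> bool" where
  "is_levy_measure M X \<nu> \<longleftrightarrow>
     sets \<nu> = sets borel \<and> emeasure \<nu> {0} = 0 \<and>
     (\<forall>A\<in>sets borel. 0 \<notin> A \<longrightarrow>
        emeasure \<nu> A = (\<integral>\<^sup>+\<omega>. emeasure (jump_measure X \<omega>) ({0<..1} \<times> A) \<partial>M))"

text \<open>The integral of \<open>x\<close> with respect to \<open>\<mu>(ds,dx) - ds \<nu>(dx)\<close> over
  \<open>0 < s \<le> t\<close>, \<open>\<bar>x\<bar> > \<epsilon>\<close>, where both parts are finite.\<close>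

definition truncated_compensated_integral ::
  "(real \<Rightarrow> 'a \<Rightarrow> real) \<Rightarrow> real measure \<Rightarrow> real \<Rightarrow> real \<Rightarrow> 'a \<Rightarrow> real" where
  "truncated_compensated_integral X \<nu> \<epsilon> t \<omega> =
     (LINT z:({0<..t} \<times> {x. \<epsilon> < \<bar>x\<bar>})|jump_measure X \<omega>. snd z) -
     (LINT z:({0<..t} \<times> {x. \<epsilon> < \<bar>x\<bar>})|(lborel \<Otimes>\<^sub>M \<nu>). snd z)"

text \<open>A Levy process with Levy measure \<open>\<nu>\<close> and \<open>X\<^sub>t = \<integral>\<^sub>0\<^sup>t\<integral> x (\<mu>(ds,dx) - ds \<nu>(dx))\<close>. The stochastic
  integral is the limit in \<open>L\<^sup>2\<close> of its truncations as \<open>\<epsilon> \<rightarrow> 0\<close>; the small jumps need not be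
  absolutely summable.\<close>

definition pure_jump_levy_process ::
  "'a measure \<Rightarrow> (real \<Rightarrow> 'a \<Rightarrow> real) \<Rightarrow> real measure \<Rightarrow> bool" where
  "pure_jump_levy_process M X \<nu> \<longleftrightarrow>
     levy_process M X \<and> is_levy_measure M X \<nu> \<and>
     (\<forall>t\<ge>0. ((\<lambda>\<epsilon>. \<integral>\<^sup>+\<omega>. ennreal ((X t \<omega> - truncated_compensated_integral X \<nu> \<epsilon> t \<omega>)\<^sup>2) \<partial>M)
              \<longlongrightarrow> 0) (at_right 0))"

section \<open>The semi-Markov noise\<close>

definition sigma_gen :: "'a measure \<Rightarrow> 'i set \<Rightarrow> ('i \<Rightarrow> 'a \<Rightarrow> real) \<Rightarrow> 'a set set" where
  "sigma_gen M I X = sigma_sets (space M) {X i -` A \<inter> space M | i A. i \<in> I \<and> A \<in> sets borel}"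

text \<open>The sequences \<open>\<tau>\<close> and \<open>Y\<close> are indexed by \<open>{1..}\<close>; their values at \<open>0\<close> are irrelevant.\<close>

definition renewal_time :: "(nat \<Rightarrow> 'a \<Rightarrow> real) \<Rightarrow> nat \<Rightarrow> 'a \<Rightarrow> real" where
  "renewal_time \<tau> k \<omega> = (\<Sum>l=1..k. \<tau> l \<omega>)"

text \<open>Almost surely only finitely many renewal times lie in \<open>[0,t]\<close>; on the exceptional null event
  \<open>card\<close> of an infinite set is \<open>0\<close>.\<close>

definition renewal_count :: "(nat \<Rightarrow> 'a \<Rightarrow> real) \<Rightarrow> real \<Rightarrow> 'a \<Rightarrow> nat" where
  "renewal_count \<tau> t \<omega> = card {k. 1 \<le> k \<and> renewal_time \<tau> k \<omega> \<le> t}"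

definition renewal_reward ::
  "(nat \<Rightarrow> 'a \<Rightarrow> real) \<Rightarrow> (nat \<Rightarrow> 'a \<Rightarrow> real) \<Rightarrow> real \<Rightarrow> 'a \<Rightarrow> real" where
  "renewal_reward \<tau> Y t \<omega> = (\<Sum>i=1..renewal_count \<tau> t \<omega>. Y i \<omega>)"

locale semi_markov_noise = prob_space M
  for M :: "'a measure" +
  fixes w L :: "real \<Rightarrow> 'a \<Rightarrow> real"
    and \<nu> \<eta> :: "real measure"
    and \<tau> Y :: "nat \<Rightarrow> 'a \<Rightarrow> real"
  assumes brownian: "standard_brownian_motion M w"
    and levy: "pure_jump_levy_process M L \<nu>"
    and levy_2: "(\<integral>\<^sup>+x. ennreal (x\<^sup>2) \<partial>\<nu>) = 1"
    and levy_8: "(\<integral>\<^sup>+x. ennreal (x ^ 8) \<partial>\<nu>) < \<infinity>"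
    and tau_indep: "indep_vars (\<lambda>_. borel) \<tau> {1..}"
    and tau_distr: "\<And>l. 1 \<le> l \<Longrightarrow> distr M borel (\<tau> l) = \<eta>"
    and tau_pos: "\<And>l. 1 \<le> l \<Longrightarrow> AE \<omega> in M. 0 < \<tau> l \<omega>"
    and tau_integrable: "\<And>l. 1 \<le> l \<Longrightarrow> integrable M (\<tau> l)"
    and Y_measurable: "\<And>i. 1 \<le> i \<Longrightarrow> Y i \<in> borel_measurable M"
    and Y_4: "(SUP i\<in>{1..}. \<integral>\<^sup>+\<omega>. ennreal ((Y i \<omega>) ^ 4) \<partial>M) < \<infinity>"
    and Y_2: "\<And>i. 1 \<le> i \<Longrightarrow> expectation (\<lambda>\<omega>. (Y i \<omega>)\<^sup>2) = 1"
    and Y_uncorrelated: "\<And>i j. 1 \<le> i \<Longrightarrow> 1 \<le> j \<Longrightarrow> i \<noteq> j \<Longrightarrow>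
           expectation (\<lambda>\<omega>. Y i \<omega> * Y j \<omega>) = 0"
    and Y_mixed: "\<And>i1 i2 i3 i4 p1 p2 p3 p4 :: nat.
           1 \<le> i1 \<Longrightarrow> i1 < i2 \<Longrightarrow> i2 < i3 \<Longrightarrow> i3 < i4 \<Longrightarrow> p1 + p2 + p3 + p4 = 4 \<Longrightarrow>
           odd p1 \<or> odd p2 \<or> odd p3 \<or> odd p4 \<Longrightarrow>
           expectation (\<lambda>\<omega>. Y i1 \<omega> ^ p1 * Y i2 \<omega> ^ p2 * Y i3 \<omega> ^ p3 * Y i4 \<omega> ^ p4) = 0"
    and mutual_indep: "indep_sets
           (\<lambda>j. [sigma_gen M {0..} w,
                 sigma_gen M {0..} L,
                 sigma_gen M {0..} (\<lambda>t \<omega>. real (renewal_count \<tau> t \<omega>)),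
                 sigma_gen M {1..} Y] ! j)
           {..<4::nat}"
begin

definition tau_mean :: real where
  "tau_mean = (LINT x|\<eta>. x)"

definition noise :: "real \<Rightarrow> real \<Rightarrow> real \<Rightarrow> real \<Rightarrow> 'a \<Rightarrow> real" where
  "noise \<rho>1 \<rho>2 \<rho>3 t \<omega> = \<rho>1 * w t \<omega> + \<rho>2 * L t \<omega> + \<rho>3 * renewal_reward \<tau> Y t \<omega>"

definition noise_sigma :: "real \<Rightarrow> real \<Rightarrow> real \<Rightarrow> real" where
  "noise_sigma \<rho>1 \<rho>2 \<rho>3 = \<rho>1\<^sup>2 + \<rho>2\<^sup>2 + \<rho>3\<^sup>2 / tau_mean"

text \<open>The family \<open>\<Q>\<^sub>n\<close> for the bounds \<open>lo \<le> \<sigma>\<^sub>Q \<le> hi\<close>.\<close>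

definition noise_laws :: "nat \<Rightarrow> real \<Rightarrow> real \<Rightarrow> (real \<Rightarrow> real) measure set" where
  "noise_laws n lo hi =
     {Q. \<exists>\<rho>1 \<rho>2 \<rho>3. is_path_law M n (noise \<rho>1 \<rho>2 \<rho>3) Q \<and>
           lo \<le> noise_sigma \<rho>1 \<rho>2 \<rho>3 \<and> noise_sigma \<rho>1 \<rho>2 \<rho>3 \<le> hi}"

end

section \<open>Estimators and risks\<close>

definition sq_norm :: "(real \<Rightarrow> real) \<Rightarrow> ennreal" where
  "sq_norm f = (\<integral>\<^sup>+s\<in>{0..1}. ennreal ((f s)\<^sup>2) \<partial>lborel)"

text \<open>The law of \<open>y\<^sub>t = \<integral>\<^sub>0\<^sup>t S(s) ds + \<xi>\<^sub>t\<close>, \<open>0 \<le> t \<le> n\<close>, when \<open>\<xi>\<close> has law \<open>Q\<close>.\<close>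

definition observation_law ::
  "nat \<Rightarrow> (real \<Rightarrow> real) measure \<Rightarrow> (real \<Rightarrow> real) \<Rightarrow> (real \<Rightarrow> real) measure" where
  "observation_law n Q S =
     distr Q (skorokhod_space n) (\<lambda>x. \<lambda>t\<in>{0..real n}. (LBINT s:{0..t}. S s) + x t)"

text \<open>An estimator maps the observed path to a function on \<open>[0,1]\<close>, jointly measurably in the path
  and the argument. It need not be square integrable; the loss is then infinite.\<close>

definition estimators :: "nat \<Rightarrow> ((real \<Rightarrow> real) \<Rightarrow> real \<Rightarrow> real) set" where
  "estimators n =
     {Sh. (\<lambda>(y, s). Sh y s) \<in> borel_measurable (skorokhod_space n \<Otimes>\<^sub>M restrict_space borel {0..1})}"

definition risk ::
  "nat \<Rightarrow> (real \<Rightarrow> real) measure \<Rightarrow> ((real \<Rightarrow> real) \<Rightarrow> real \<Rightarrow> real) \<Rightarrow> (real \<Rightarrow> real) \<Rightarrow> ennreal" where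
  "risk n Q Sh S = (\<integral>\<^sup>+y. sq_norm (\<lambda>s. Sh y s - S s) \<partial>observation_law n Q S)"

definition robust_risk ::
  "nat \<Rightarrow> (real \<Rightarrow> real) measure set \<Rightarrow> ((real \<Rightarrow> real) \<Rightarrow> real \<Rightarrow> real) \<Rightarrow> (real \<Rightarrow> real) \<Rightarrow> ennreal"
  where "robust_risk n \<Q> Sh S = (SUP Q\<in>\<Q>. risk n Q Sh S)"

section \<open>The Sobolev ball\<close>

text \<open>One-sided at the endpoints of \<open>[0,1]\<close>.\<close>

definition deriv01 :: "(real \<Rightarrow> real) \<Rightarrow> real \<Rightarrow> real" where
  "deriv01 f x = vector_derivative f (at x within {0..1})"

definition Ck_per :: "nat \<Rightarrow> (real \<Rightarrow> real) set" where
  "Ck_per k =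
     {f. (\<forall>j<k. \<forall>x\<in>{0..1}. (deriv01 ^^ j) f differentiable (at x within {0..1})) \<and>
         continuous_on {0..1} ((deriv01 ^^ k) f) \<and>
         (\<forall>i\<le>k. (deriv01 ^^ i) f 0 = (deriv01 ^^ i) f 1)}"

text \<open>Elements of the ball are given by their 1-periodic extensions to \<open>\<real>\<close>.\<close>

definition sobolev_ball :: "nat \<Rightarrow> real \<Rightarrow> (real \<Rightarrow> real) set" where
  "sobolev_ball k r =
     {S. (\<forall>x. S (x + 1) = S x) \<and> S \<in> Ck_per k \<and>
         (\<Sum>j\<le>k. sq_norm ((deriv01 ^^ j) S)) \<le> ennreal r}"

definition pinsker_constant :: "nat \<Rightarrow> real \<Rightarrow> real" where
  "pinsker_constant k r =
     ((2 * real k + 1) * r) powr (1 / (2 * real k + 1)) *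
     (real k / ((real k + 1) * pi)) powr (2 * real k / (2 * real k + 1))"

section \<open>Conditions on the density of the renewal times\<close>

definition left_limit :: "(real \<Rightarrow> real) \<Rightarrow> real \<Rightarrow> real" where
  "left_limit g x = Lim (at_left x) g"

definition right_limit :: "(real \<Rightarrow> real) \<Rightarrow> real \<Rightarrow> real" where
  "right_limit g x = Lim (at_right x) g"

definition fourier_hat :: "(real \<Rightarrow> real) \<Rightarrow> complex \<Rightarrow> complex" where
  "fourier_hat g z =
     1 / (2 * complex_of_real pi) * (LBINT x. exp (\<i> * z * complex_of_real x) * complex_of_real (g x))"

end

theory Submission
  imports Defs "HOL-Real_Asymp.Real_Asymp"
begin

text \<open>The functions \<open>cos (2 \<pi> j x) + sin (2 \<pi> j x)\<close>, \<open>j\<close> an integer, are orthonormal on \<open>[0,1]\<close> and turn the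
Sobolev ball into an ellipsoid. Upper bound: for a fixed \<open>n\<close> the Fourier coefficients of the signal are estimated
from increments over a grid whose mesh tends to \<open>0\<close> and are shrunk by Pinsker's weights. Only the second moments
of the noise enter. They are those of white noise of intensity \<open>\<sigma>\<^sub>Q\<close>, up to the renewal theorem for the expected
number of renewals and up to the means of the marks, which are negligible by Bessel's inequality.
Lower bound: the noise \<open>\<surd>(\<varsigma>\<^sup>*) w\<close> belongs to the family. Under a product Gaussian prior on the Fourier coefficients
the posterior of \<open>S(x)\<close> is Gaussian by the Cameron-Martin formula, and its variance does not depend on the observation.
Clipping the estimator at the largest value attained by \<open>S(x)\<close> on the ball reduces the passage from the prior to the
ball to an exponentially small chi-square tail.\<close>

section \<open>Fourier analysis on the Sobolev ball\<close>

text \<open>One set of weights serves all noise laws because the squares of \<open>cas j\<close> and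
  \<open>cas (- j)\<close> add up to 2 at every point: with symmetric weights the renewal intensity,
  which varies in time, enters only through the expected number of renewals up to time n. The Levy
  part is the laborious one. Its second moments are not given; known are the Levy measure, as an
  expected number of jumps, and an L2 approximation of \<open>L\<close> by compensated sums of large
  jumps, so the variance is extracted from clipped jump sums over fine partitions. The scale of
  frequencies is u = (n / hi)^(1/(2k+1)). A cutoff W close to \<alpha> u gives squared bias r / (2
  pi W)^(2k) and variance u^-(2k+1) times the sum of the squared weights, and \<alpha> minimises the
  limit of their sum. The same \<alpha> makes Pinsker's prior variances e ((W/|j|)^k - 1), with e =
  hi / n, exhaust the energy r; the posterior variances e (1 - (|j|/W)^k) then add up to the same
  constant. In the lower bound the energy is lowered to (1 - \<delta>) r, and this slack pays for
  the prior mass outside the ball.\<close>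

definition U01 :: "real measure" where
 "U01 = restrict_space lborel {0..1}"

lemma space_U01 [simp]: "space U01 = {0..1}"
 by (simp add: U01_def space_restrict_space)

text \<open>Identifies the sigma-algebra with the one in \<open>estimators\<close>, so that the
  joint measurability of an estimator can be used with the probability measure \<open>U01\<close> in
  Tonelli arguments.\<close>

lemma sets_U01 [measurable_cong]: "sets U01 = sets (restrict_space borel {0..1})"
 by (simp add: U01_def sets_restrict_space)

lemma prob_space_U01: "prob_space U01"
 by (rule prob_spaceI) (simp add: U01_def emeasure_restrict_space space_restrict_space)

interpretation U01: prob_space U01 by (rule prob_space_U01)

lemma sq_norm_U01: "sq_norm f = (\<integral>\<^sup>+s. ennreal ((f s)^2) \<partial>U01)"
 unfolding sq_norm_def U01_def
 by (subst nn_integral_restrict_space) (auto simp: mult.commute)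

lemma integral_U01: "(LINT x|U01. f x) = (LBINT x:{0..1}. f x)" for f :: "real => real"
 unfolding U01_def set_lebesgue_integral_def by (subst integral_restrict_space) auto

lemma integrable_U01:
 fixes f :: "real => real"
 assumes "continuous_on {0..1} f"
 shows "integrable U01 f"
proof -
 have "integrable lborel (%x. indicator {0..1} x *\<^sub>R f x)"
  by (rule borel_integrable_compact) (use assms in auto)
 then show ?thesis
  unfolding U01_def by (subst integrable_restrict_space) auto
qed

lemma integral_U01_deriv:
 fixes F f :: "real => real"
 assumes "\<And>x. x \<in> {0..1} ==> (F has_vector_derivative f x) (at x within {0..1})"
  and "continuous_on {0..1} f"
 shows "(LINT x|U01. f x) = F 1 - F 0"
 unfolding integral_U01 set_lebesgue_integral_def
 by (rule integral_FTC_atLeastAtMost) (use assms in auto)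

lemma sq_norm_eq_integral:
 assumes "continuous_on {0..1} f"
 shows "sq_norm f = ennreal (LINT x|U01. (f x)^2)"
 unfolding sq_norm_U01
 by (rule nn_integral_eq_integral) (auto intro!: integrable_U01 continuous_intros assms)

section \<open>The Hartley system and its coefficients\<close>

definition cas :: "int => real => real" where
 "cas j x = cos (2 * pi * real_of_int j * x) + sin (2 * pi * real_of_int j * x)"

text \<open>The difference frequency comes with a cosine and the sum frequency with a sine. Sines
  integrate to 0 at every integer frequency, so only \<open>i = j\<close> survives
  integration.\<close>

lemma cas_mult:
 "cas i x * cas j x = cos (2 * pi * real_of_int (i - j) * x) + sin (2 * pi * real_of_int (i + j) * x)"
proof -
 have 1: "2 * pi * real_of_int (i - j) * x = 2 * pi * real_of_int i * x - 2 * pi * real_of_int j * x"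
  by (simp add: algebra_simps)
 have 2: "2 * pi * real_of_int (i + j) * x = 2 * pi * real_of_int i * x + 2 * pi * real_of_int j * x"
  by (simp add: algebra_simps)
 show ?thesis unfolding 1 2 cas_def cos_diff sin_add by (simp add: algebra_simps)
qed

lemma cas_0 [simp]: "cas 0 x = 1"
 by (simp add: cas_def)

lemma cas_minus: "cas (- j) x = cos (2 * pi * real_of_int j * x) - sin (2 * pi * real_of_int j * x)"
 by (simp add: cas_def)

text \<open>This constancy in \<open>x\<close> later removes the dependence of the variance on the
  way the noise intensity is spread over time.\<close>

lemma cas_sq_pair: "(cas j x)^2 + (cas (- j) x)^2 = 2"
 unfolding cas_minus cas_def power2_sum power2_diff
 using sin_cos_squared_add[of "2 * pi * real_of_int j * x"] by (simp add: algebra_simps)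

lemma cas_sq_le: "(cas j x)^2 <= 2"
 using cas_sq_pair[of j x] zero_le_power2[of "cas (-j) x"] by linarith

lemma abs_cas_le: "\<bar>cas j x\<bar> <= 2"
 unfolding cas_def using abs_cos_le_one[of "2 * pi * real_of_int j * x"] abs_sin_le_one[of "2 * pi * real_of_int j * x"] by linarith

lemma cas_periodic: "cas j (x + 1) = cas j x"
proof -
 have "2 * pi * real_of_int j * (x + 1) = 2 * pi * real_of_int j * x + 2 * pi * real_of_int j"
  by (simp add: algebra_simps)
 then show ?thesis
  unfolding cas_def by (simp only: sin_add cos_add sin_int_2pin cos_int_2pin)
qed

lemma continuous_on_cas [continuous_intros]: "continuous_on A (cas j)"
 unfolding cas_def by (intro continuous_intros)

lemma continuous_on_cas' [continuous_intros]:
 "continuous_on A f ==> continuous_on A (%x. cas j (f x))"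
 using continuous_on_compose2[OF continuous_on_cas[of UNIV j], of A f] by simp

lemma measurable_cas [measurable]: "cas j \<in> borel_measurable borel"
 by (intro borel_measurable_continuous_onI continuous_intros)

lemma cas_has_derivative:
 "(cas j has_real_derivative (2 * pi * real_of_int j * cas (- j) x)) (at x within A)"
 unfolding cas_minus unfolding cas_def
 by (auto intro!: derivative_eq_intros simp: algebra_simps)

lemma integral_cos_U01: "(LINT x|U01. cos (2 * pi * real_of_int m * x)) = (if m = 0 then 1 else 0)"
proof (cases "m = 0")
 case True
 then show ?thesis by (simp add: U01.prob_space[simplified])
next
 case False
 have "(LINT x|U01. cos (2 * pi * real_of_int m * x)) =
   sin (2 * pi * real_of_int m * 1) / (2 * pi * real_of_int m) - sin (2 * pi * real_of_int m * 0) / (2 * pi * real_of_int m)"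
  by (rule integral_U01_deriv)
    (use False in \<open>auto intro!: derivative_eq_intros continuous_intros
     simp: has_real_derivative_iff_has_vector_derivative[symmetric]\<close>)
 then show ?thesis using False by (simp only: mult_1_right sin_int_2pin) simp
qed

lemma integral_sin_U01: "(LINT x|U01. sin (2 * pi * real_of_int m * x)) = 0"
proof (cases "m = 0")
 case False
 have "(LINT x|U01. sin (2 * pi * real_of_int m * x)) =
   - cos (2 * pi * real_of_int m * 1) / (2 * pi * real_of_int m) - (- cos (2 * pi * real_of_int m * 0) / (2 * pi * real_of_int m))"
  by (rule integral_U01_deriv)
    (use False in \<open>auto intro!: derivative_eq_intros continuous_intros
     simp: has_real_derivative_iff_has_vector_derivative[symmetric]\<close>)
 then show ?thesis using False by (simp only: mult_1_right cos_int_2pin) simp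
qed simp

lemma cas_orthonormal: "(LINT x|U01. cas i x * cas j x) = (if i = j then 1 else 0)"
proof -
 have "(LINT x|U01. cas i x * cas j x) =
   (LINT x|U01. cos (2 * pi * real_of_int (i - j) * x)) + (LINT x|U01. sin (2 * pi * real_of_int (i + j) * x))"
  unfolding cas_mult
  by (rule Bochner_Integration.integral_add) (auto intro!: integrable_U01 continuous_intros)
 then show ?thesis unfolding integral_cos_U01 integral_sin_U01 by simp
qed

definition coef :: "(real => real) => int => real" where
 "coef f j = (LINT x|U01. f x * cas j x)"

definition trig :: "nat => (int => real) => real => real" where
 "trig J c x = (\<Sum>j\<in>{- int J..int J}. c j * cas j x)"

lemma continuous_on_trig [continuous_intros]: "continuous_on A (trig J c)"
 unfolding trig_def by (intro continuous_intros)

lemma trig_periodic: "trig J c (x + 1) = trig J c x"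
 by (simp add: trig_def cas_periodic)

lemma integral_trig_mult:
 assumes f: "continuous_on {0..1} f"
 shows "(LINT x|U01. f x * trig J c x) = (\<Sum>j\<in>{- int J..int J}. c j * coef f j)"
proof -
 have "(LINT x|U01. f x * trig J c x) = (LINT x|U01. (\<Sum>j\<in>{- int J..int J}. c j * (f x * cas j x)))"
  unfolding trig_def by (simp add: sum_distrib_left algebra_simps)
 also have "\<dots> = (\<Sum>j\<in>{- int J..int J}. LINT x|U01. c j * (f x * cas j x))"
  by (rule Bochner_Integration.integral_sum) (auto intro!: integrable_U01 continuous_intros f)
 finally show ?thesis by (simp add: coef_def)
qed

lemma coef_cas: "coef (cas i) j = (if i = j then 1 else 0)"
 unfolding coef_def by (rule cas_orthonormal)

lemma coef_trig: "coef (trig J c) j = (if j \<in> {- int J..int J} then c j else 0)"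
proof -
 have "coef (trig J c) j = (LINT x|U01. cas j x * trig J c x)"
  by (simp add: coef_def mult.commute)
 also have "\<dots> = (\<Sum>i\<in>{- int J..int J}. c i * coef (cas j) i)"
  by (rule integral_trig_mult) (intro continuous_intros)
 also have "\<dots> = (\<Sum>i\<in>{- int J..int J}. if i = j then c j else 0)"
  by (rule sum.cong) (auto simp: coef_cas)
 finally show ?thesis by (simp add: sum.delta)
qed

lemma integral_trig_sq: "(LINT x|U01. (trig J c x)^2) = (\<Sum>j\<in>{- int J..int J}. (c j)^2)"
proof -
 have "(LINT x|U01. (trig J c x)^2) = (LINT x|U01. trig J c x * trig J c x)"
  by (simp add: power2_eq_square)
 also have "\<dots> = (\<Sum>j\<in>{- int J..int J}. c j * coef (trig J c) j)"
  by (rule integral_trig_mult) (intro continuous_intros)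
 also have "\<dots> = (\<Sum>j\<in>{- int J..int J}. (c j)^2)"
  by (rule sum.cong) (auto simp: coef_trig power2_eq_square)
 finally show ?thesis .
qed

text \<open>Pythagoras: the error of the coefficients plus the energy of \<open>f\<close> outside
  the span. Writing that energy as total minus captured energy avoids infinite series
  throughout.\<close>

lemma integral_diff_trig_sq:
 assumes f: "continuous_on {0..1} f"
 shows "(LINT x|U01. (trig J c x - f x)^2) =
  (\<Sum>j\<in>{- int J..int J}. (c j - coef f j)^2) + ((LINT x|U01. (f x)^2) - (\<Sum>j\<in>{- int J..int J}. (coef f j)^2))"
proof -
 have "(LINT x|U01. (trig J c x - f x)^2) =
   (LINT x|U01. (trig J c x)^2 - 2 * (f x * trig J c x) + (f x)^2)"
  by (simp add: power2_diff algebra_simps)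
 also have "\<dots> = (LINT x|U01. (trig J c x)^2) - 2 * (LINT x|U01. f x * trig J c x) + (LINT x|U01. (f x)^2)"
  by (subst Bochner_Integration.integral_add Bochner_Integration.integral_diff,
    (intro integrable_U01 continuous_intros f)+)+ simp
 also have "\<dots> = (\<Sum>j\<in>{- int J..int J}. (c j)^2 - 2 * (c j * coef f j)) + (LINT x|U01. (f x)^2)"
  unfolding integral_trig_sq integral_trig_mult[OF f] by (simp add: sum_subtractf sum_distrib_left)
 also have "(\<Sum>j\<in>{- int J..int J}. (c j)^2 - 2 * (c j * coef f j)) =
   (\<Sum>j\<in>{- int J..int J}. (c j - coef f j)^2 - (coef f j)^2)"
  by (rule sum.cong) (auto simp: power2_diff algebra_simps)
 finally show ?thesis by (simp add: sum_subtractf)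
qed

lemma bessel:
 assumes f: "continuous_on {0..1} f"
 shows "(\<Sum>j\<in>{- int J..int J}. (coef f j)^2) <= (LINT x|U01. (f x)^2)"
proof -
 have "0 <= (LINT x|U01. (trig J (coef f) x - f x)^2)" by simp
 then show ?thesis unfolding integral_diff_trig_sq[OF f] by simp
qed

text \<open>Integration by parts; the boundary terms cancel by periodicity. The reflection of the
  frequency comes from the derivative of \<open>cas j\<close>, a multiple of
  \<open>cas (- j)\<close>.\<close>

lemma coef_deriv:
 assumes f: "\<And>x. x \<in> {0..1} ==> (f has_vector_derivative f' x) (at x within {0..1})"
  and f': "continuous_on {0..1} f'" and per: "f 0 = f 1"
 shows "coef f' j = - (2 * pi * real_of_int j) * coef f (- j)"
proof -
 have cf: "continuous_on {0..1} f"
  using f by (rule continuous_on_vector_derivative)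
 have "(LINT x|U01. f' x * cas j x + f x * (2 * pi * real_of_int j * cas (- j) x)) = f 1 * cas j 1 - f 0 * cas j 0"
 proof (rule integral_U01_deriv)
  fix x :: real assume x: "x \<in> {0..1}"
  have "(f has_real_derivative f' x) (at x within {0..1})"
   using f[OF x] by (simp add: has_real_derivative_iff_has_vector_derivative)
  then have "((%x. f x * cas j x) has_real_derivative
    (f' x * cas j x + f x * (2 * pi * real_of_int j * cas (- j) x))) (at x within {0..1})"
   by (auto intro!: derivative_eq_intros cas_has_derivative)
  then show "((%x. f x * cas j x) has_vector_derivative
    (f' x * cas j x + f x * (2 * pi * real_of_int j * cas (- j) x))) (at x within {0..1})"
   by (simp add: has_real_derivative_iff_has_vector_derivative)
 qed (intro continuous_intros f' cf)
 moreover have "(LINT x|U01. f' x * cas j x + f x * (2 * pi * real_of_int j * cas (- j) x)) =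
   (LINT x|U01. f' x * cas j x) + (LINT x|U01. (2 * pi * real_of_int j) * (f x * cas (- j) x))"
  by (subst Bochner_Integration.integral_add[symmetric])
    (auto intro!: integrable_U01 continuous_intros f' cf Bochner_Integration.integral_cong)
 moreover have "cas j 1 = 1" using cas_periodic[of j 0] by (simp add: cas_def)
 moreover have "cas j 0 = 1" by (simp add: cas_def)
 ultimately show ?thesis by (simp add: coef_def per)
qed

section \<open>Density of trigonometric polynomials\<close>

inductive trig_poly :: "(real => real) => bool" where
 cas: "trig_poly (%x. a * cas j x)"
| add: "trig_poly f ==> trig_poly g ==> trig_poly (%x. f x + g x)"

lemma trig_poly_cos: "trig_poly (%x. a * cos (2 * pi * real_of_int m * x))"
proof -
 have "trig_poly (%x. a / 2 * cas m x + a / 2 * cas (- m) x)"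
  by (intro trig_poly.intros)
 moreover have "(%x. a / 2 * cas m x + a / 2 * cas (- m) x) = (%x. a * cos (2 * pi * real_of_int m * x))"
  by (rule ext) (simp add: cas_def algebra_simps)
 ultimately show ?thesis by simp
qed

lemma trig_poly_sin: "trig_poly (%x. a * sin (2 * pi * real_of_int m * x))"
proof -
 have "trig_poly (%x. a / 2 * cas m x + (- a / 2) * cas (- m) x)"
  by (intro trig_poly.intros)
 moreover have "(%x. a / 2 * cas m x + (- a / 2) * cas (- m) x) = (%x. a * sin (2 * pi * real_of_int m * x))"
  by (rule ext) (simp add: cas_def algebra_simps)
 ultimately show ?thesis by simp
qed

text \<open>The product formula for \<open>cas\<close> leaves one cosine and one sine, each a
  combination of two basis functions; a nested induction extends this bilinearly.\<close>

lemma trig_poly_mult: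
 assumes "trig_poly f" "trig_poly g"
 shows "trig_poly (%x. f x * g x)"
 using assms
proof (induction rule: trig_poly.induct)
 case (cas a i)
 from cas.prems show ?case
 proof (induction rule: trig_poly.induct)
  case (cas b j)
  have "trig_poly (%x. (a * b) * cos (2 * pi * real_of_int (i - j) * x) + (a * b) * sin (2 * pi * real_of_int (i + j) * x))"
   by (intro trig_poly.add trig_poly_cos trig_poly_sin)
  moreover have "(a * b) * cos (2 * pi * real_of_int (i - j) * x) + (a * b) * sin (2 * pi * real_of_int (i + j) * x)
    = a * cas i x * (b * cas j x)" for x
   using cas_mult[of i x j] by (simp add: algebra_simps)
  ultimately show ?case by simp
 next
  case (add f g)
  then show ?case using trig_poly.add[OF add.IH] by (simp add: algebra_simps)
 qed
next
 case (add f1 f2)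
 have "trig_poly (%x. f1 x * g x + f2 x * g x)"
  using add by (intro trig_poly.add) auto
 then show ?case by (simp add: algebra_simps)
qed

lemma trig_mono:
 assumes "J <= J'"
 shows "trig J c = trig J' (%j. if \<bar>j\<bar> <= int J then c j else 0)"
proof
 fix x
 show "trig J c x = trig J' (%j. if \<bar>j\<bar> <= int J then c j else 0) x"
  unfolding trig_def
  by (rule sum.mono_neutral_cong_left) (use assms in \<open>auto simp: abs_le_iff\<close>)
qed

text \<open>Returns from the inductive class, which is convenient for products, to sums over an
  explicit range. Two summands are brought to a common range by padding with zero
  coefficients.\<close>

lemma trig_poly_iff_trig:
 assumes "trig_poly f" obtains J c where "f = trig J c"
proof -
 have "\<exists>J c. f = trig J c"
  using assms
 proof (induction rule: trig_poly.induct)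
  case (cas a j)
  have "(%x. a * cas j x) = trig (nat \<bar>j\<bar>) (%i. if i = j then a else 0)"
  proof
   fix x
   have "trig (nat \<bar>j\<bar>) (%i. if i = j then a else 0) x =
     (\<Sum>i\<in>{- int (nat \<bar>j\<bar>)..int (nat \<bar>j\<bar>)}. if i = j then a * cas j x else 0)"
    unfolding trig_def by (rule sum.cong) auto
   then show "a * cas j x = trig (nat \<bar>j\<bar>) (%i. if i = j then a else 0) x"
    by (subst (asm) sum.delta) auto
  qed
  then show ?case by blast
 next
  case (add f g)
  then obtain J c J' c' where "f = trig J c" "g = trig J' c'" by blast
  moreover define K where "K = max J J'"
  ultimately obtain d d' where "f = trig K d" "g = trig K d'"
   using trig_mono[of J K c] trig_mono[of J' K c'] by auto
  then have "(%x. f x + g x) = trig K (%j. d j + d' j)"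
   by (auto simp: trig_def fun_eq_iff algebra_simps sum.distrib)
  then show ?case by blast
 qed
 then show ?thesis using that by blast
qed

text \<open>Stone-Weierstrass on the unit circle: a 1-periodic function is a function of
  \<open>cis (2 * pi * x)\<close>, and polynomials in the real and imaginary part of that point are
  trigonometric polynomials in \<open>x\<close>.\<close>

lemma trig_dense:
 assumes cont: "continuous_on UNIV f" and per: "\<And>x. f (x + 1) = f x" and e: "0 < e"
 obtains J c where "\<And>x. \<bar>f x - trig J c x\<bar> < e"
proof -
 have perN: "f (x + real n) = f x" for x n
  by (induction n) (simp_all add: per add.assoc[symmetric] add.commute[of 1])
 have perZ: "f (x + real_of_int m) = f x" for x m
 proof (cases "m \<ge> 0")
  case True then show ?thesis using perN[of x "nat m"] by simp
 next
  case False then show ?thesis using perN[of "x + real_of_int m" "nat (- m)"] by simp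
 qed
 \<comment> \<open>\<open>Arg\<close> jumps across the negative real axis. Periodicity of
   \<open>f\<close> hides the jump, but the continuity of \<open>F\<close> has to be shown
   separately.\<close>
 define F where "F z = f (Arg z / (2 * pi))" for z
 have F_cis: "F (cis (2 * pi * x)) = f x" for x
 proof -
  have "cis (Arg (cis (2 * pi * x))) = cis (2 * pi * x)"
   by (metis cis_Arg cis_neq_zero norm_cis sgn_div_norm div_by_1 of_real_1 scaleR_one inverse_1)
  then have "sin (Arg (cis (2 * pi * x))) = sin (2 * pi * x) \<and> cos (Arg (cis (2 * pi * x))) = cos (2 * pi * x)"
   by (auto simp: complex_eq_iff)
  then have "\<exists>m::int. Arg (cis (2 * pi * x)) = 2 * pi * x + 2 * pi * of_int m"
   by (simp only: sin_cos_eq_iff)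
  then obtain m :: int where m: "Arg (cis (2 * pi * x)) = 2 * pi * x + 2 * pi * of_int m" by blast
  have "Arg (cis (2 * pi * x)) / (2 * pi) = x + of_int m"
   unfolding m by (simp add: field_simps)
  then show ?thesis unfolding F_def using perZ by simp
 qed
 have F_cont: "continuous_on (sphere 0 1) F"
  unfolding continuous_on_eq_continuous_within
 proof
  fix z0 :: complex assume z0: "z0 \<in> sphere 0 1"
  define x0 where "x0 = Arg z0 / (2 * pi)"
  have z0c: "z0 = cis (2 * pi * x0)" 
   unfolding x0_def using z0 cis_Arg[of z0] by (cases "z0 = 0") (auto simp: sgn_div_norm)
  \<comment> \<open>Rotating by \<open>z0\<close> moves the cut away: for \<open>z\<close> near
    \<open>z0\<close> the quotient is near 1, where \<open>Arg\<close> is continuous.\<close>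
  have eq: "F z = f (x0 + Arg (z / z0) / (2 * pi))" if "z \<in> sphere 0 1" for z
  proof -
   have "norm (z / z0) = 1" using that z0 by (simp add: norm_divide)
   then have "cis (Arg (z / z0)) = z / z0" 
    using cis_Arg[of "z / z0"] by (metis norm_zero scaleR_one sgn_div_norm inverse_1 zero_neq_one)
   then have "z = cis (2 * pi * (x0 + Arg (z / z0) / (2 * pi)))"
    using z0 by (simp add: z0c distrib_left cis_mult[symmetric])
   then show ?thesis using F_cis by metis
  qed
  have "isCont (%z. f (x0 + Arg (z / z0) / (2 * pi))) z0"
  proof -
   have nz: "z0 \<noteq> 0" using z0 by auto
   have A: "isCont Arg (z0 / z0)" using nz by (intro continuous_at_Arg) (auto simp: complex_nonpos_Reals_iff)
   have "isCont (%z. Arg (z / z0)) z0"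
    by (rule isCont_o2[where g = Arg and f = "%z. z / z0", OF _ A]) (use nz in \<open>auto intro!: continuous_intros\<close>)
   moreover have "isCont f y" for y using cont by (simp add: continuous_on_eq_continuous_at)
   ultimately show ?thesis
    by (intro isCont_o2[where g = f and f = "%z. x0 + Arg (z / z0) / (2 * pi)"] continuous_intros) auto
  qed
  then have "continuous (at z0 within sphere 0 1) (%z. f (x0 + Arg (z / z0) / (2 * pi)))"
   by (rule continuous_at_imp_continuous_within)
  then show "continuous (at z0 within sphere 0 1) F"
   by (rule continuous_transform_within[OF _ zero_less_one z0]) (use eq in simp)
 qed
 obtain g where g: "real_polynomial_function g" "\<And>z. z \<in> sphere 0 1 ==> \<bar>F z - g z\<bar> < e"
  using Stone_Weierstrass_real_polynomial_function[OF compact_sphere F_cont e] by blast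
 have "trig_poly (%x. g (cis (2 * pi * x)))"
  using g(1)
 proof (induction rule: real_polynomial_function.induct)
  \<comment> \<open>A real-linear functional on the plane is determined by its values at 1 and the
    imaginary unit, so on the circle it has frequency one.\<close>
  case (linear h)
  have "h (cis (2 * pi * x)) = h 1 * cos (2 * pi * real_of_int 1 * x) + h \<i> * sin (2 * pi * real_of_int 1 * x)" for x
  proof -
   interpret h: bounded_linear h by fact
   have "cis (2 * pi * x) = cos (2 * pi * x) *\<^sub>R 1 + sin (2 * pi * x) *\<^sub>R \<i>"
    by (simp add: complex_eq_iff)
   then show ?thesis by (simp only: h.add h.scaleR) (simp add: mult.commute)
  qed
  then show ?case
   by (simp only:) (intro trig_poly.add trig_poly_cos trig_poly_sin)
 next
  case (const c)
  then show ?case using trig_poly.cas[of c 0] by simp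
 next
  case (add f g)
  then show ?case by (intro trig_poly.add)
 next
  case (mult f g)
  then show ?case by (intro trig_poly_mult)
 qed
 then obtain J c where "(%x. g (cis (2 * pi * x))) = trig J c"
  by (rule trig_poly_iff_trig)
 then have "\<bar>f x - trig J c x\<bar> < e" for x
  using g(2)[of "cis (2 * pi * x)"] F_cis[of x] by (auto simp: fun_eq_iff)
 then show ?thesis using that by blast
qed


section \<open>The Sobolev ball in coefficients, and the bias of Pinsker's weights\<close>

lemma continuous_on_periodic_extension:
 fixes f :: "real => real"
 assumes cont: "continuous_on {0..1} f" and per: "\<And>x. f (x + 1) = f x"
 shows "continuous_on UNIV f"
proof -
 have perN: "f (x + real n) = f x" for x n
  by (induction n) (simp_all add: per add.assoc[symmetric] add.commute[of 1])
 have perZ: "f (x + real_of_int m) = f x" for x m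
 proof (cases "m \<ge> 0")
  case True then show ?thesis using perN[of x "nat m"] by simp
 next
  case False then show ?thesis using perN[of "x + real_of_int m" "nat (- m)"] by simp
 qed
 have cI: "continuous_on {real_of_int m..real_of_int m + 1} f" for m
 proof -
  have "continuous_on {real_of_int m..real_of_int m + 1} (%x. f (x + real_of_int (- m)))"
   by (rule continuous_on_compose2[OF cont]) (auto intro!: continuous_intros)
  then show ?thesis unfolding perZ .
 qed
 have "isCont f x" for x
 proof -
  define m where "m = \<lfloor>x\<rfloor>"
  have mx: "real_of_int m <= x" "x < real_of_int m + 1" unfolding m_def by linarith+
  \<comment> \<open>Gluing the two unit intervals that meet at \<open>m\<close> makes
    \<open>x\<close> an interior point even when it is an integer.\<close>
  have "continuous_on ({real_of_int (m - 1)..real_of_int (m - 1) + 1} \<union> {real_of_int m..real_of_int m + 1}) f"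
   by (intro continuous_on_closed_Un cI) auto
  moreover have "{real_of_int (m - 1)..real_of_int (m - 1) + 1} \<union> {real_of_int m..real_of_int m + 1} = {real_of_int m - 1..real_of_int m + 1}"
   by auto
  ultimately have "continuous_on {real_of_int m - 1..real_of_int m + 1} f" by simp
  then show ?thesis
   by (rule continuous_on_interior) (use mx in auto)
 qed
 then show ?thesis by (simp add: continuous_at_imp_continuous_on)
qed

text \<open>Each derivative multiplies the coefficients by 2 pi j and reflects the frequency. After
  squaring, Bessel's inequality for the derivative of order \<open>k\<close> is the ellipsoid
  inequality. The terms of lower order in the Sobolev norm are dropped; they do not affect the
  limiting constant.\<close>

lemma sobolev_ball_facts:
 assumes S: "S \<in> sobolev_ball k r" and k: "1 <= k" and r: "0 <= r"
 shows "continuous_on UNIV S" and "S (x + 1) = S x"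
  and "(\<Sum>j\<in>{- int J..int J}. (2 * pi * real_of_int j) ^ (2 * k) * (coef S j)^2) <= r"
proof -
 define D where "D i = (deriv01 ^^ i) S" for i
 have per: "S (x + 1) = S x" for x using S by (simp add: sobolev_ball_def)
 have D0: "D 0 = S" by (simp add: D_def)
 have diff: "D i differentiable (at x within {0..1})" if "i < k" "x \<in> {0..1}" for i x
  using S that by (auto simp: sobolev_ball_def Ck_per_def D_def)
 have deriv: "(D i has_vector_derivative D (Suc i) x) (at x within {0..1})"
  if "i < k" "x \<in> {0..1}" for i x
 proof -
  have "D (Suc i) x = vector_derivative (D i) (at x within {0..1})"
   by (simp add: D_def deriv01_def)
  then show ?thesis using diff[OF that] by (simp add: vector_derivative_works)
 qed
 have cont: "continuous_on {0..1} (D i)" if "i <= k" for i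
 proof (cases "i = k")
  case True then show ?thesis using S by (simp add: sobolev_ball_def Ck_per_def D_def)
 next
  case False
  then have "i < k" using that by simp
  then show ?thesis using deriv by (intro continuous_on_vector_derivative) auto
 qed
 have ends: "D i 0 = D i 1" if "i <= k" for i
  using S that by (auto simp: sobolev_ball_def Ck_per_def D_def)
 show "S (x + 1) = S x" by (rule per)
 show "continuous_on UNIV S"
  using cont[of 0] per by (intro continuous_on_periodic_extension) (auto simp: D0)
 have coef_D: "(coef (D i) j)^2 = (2 * pi * real_of_int j) ^ (2 * i) * (coef S ((- 1) ^ i * j))^2"
  if "i <= k" for i j using that
 proof (induction i arbitrary: j)
  case 0 then show ?case by (simp add: D0)
 next
  case (Suc i)
  have "coef (D (Suc i)) j = - (2 * pi * real_of_int j) * coef (D i) (- j)"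
   using Suc.prems by (intro coef_deriv deriv cont ends) auto
  moreover have "(2 * pi * real_of_int (- j)) ^ (2 * i) = (2 * pi * real_of_int j) ^ (2 * i)"
   by (simp add: power_mult)
  ultimately show ?case using Suc.IH[of "- j"] Suc.prems
   by (simp add: power_mult_distrib power2_eq_square mult.assoc)
 qed
 have "sq_norm (D k) <= (\<Sum>j\<le>k. sq_norm (D j))"
  by (rule member_le_sum) auto
 also have "\<dots> <= ennreal r" using S by (simp add: sobolev_ball_def D_def)
 finally have "(LINT x|U01. (D k x)^2) <= r"
  using cont[of k] r by (simp add: sq_norm_eq_integral)
 then have "(\<Sum>j\<in>{- int J..int J}. (coef (D k) j)^2) <= r"
  using bessel[OF cont[of k], of J] by simp
 \<comment> \<open>The reflections accumulated in \<open>k\<close> derivatives form the involution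
   \<open>j\<close> to \<open>(- 1) ^ k * j\<close> of the symmetric range.\<close>
 moreover have "(\<Sum>j\<in>{- int J..int J}. (coef (D k) j)^2) =
   (\<Sum>j\<in>{- int J..int J}. (2 * pi * real_of_int j) ^ (2 * k) * (coef S j)^2)"
 proof (rule sum.reindex_bij_witness[where i = "%j. (- 1) ^ k * j" and j = "%j. (- 1) ^ k * j"])
  fix j assume "j \<in> {- int J..int J}"
  show "(2 * pi * real_of_int ((- 1) ^ k * j)) ^ (2 * k) * (coef S ((- 1) ^ k * j))^2 = (coef (D k) j)^2"
   unfolding coef_D[OF order_refl] by (cases "even k") (auto simp: power_mult)
 qed (auto simp: uminus_power_if mult.assoc[symmetric])
 ultimately show "(\<Sum>j\<in>{- int J..int J}. (2 * pi * real_of_int j) ^ (2 * k) * (coef S j)^2) <= r"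
  by simp
qed

text \<open>Pinsker's optimal linear filter with cutoff \<open>W\<close>. The squared defect of the
  weight at \<open>j\<close> is exactly the ratio of (2 pi j)^(2k) to (2 pi W)^(2k).\<close>

definition pinsker_weight :: "nat => nat => int => real" where
 "pinsker_weight k W j = 1 - (\<bar>real_of_int j\<bar> / real W) ^ k"

text \<open>Inside the cutoff the squared bias factor equals the ratio of Sobolev weights, and
  outside this ratio is at least 1. Hence both contributions are bounded by the ellipsoid sum over
  (2 pi W)^(2k).\<close>

lemma pinsker_bias:
 assumes S: "S \<in> sobolev_ball k r" and k: "1 <= k" and r: "0 <= r" and W: "1 <= W"
 shows "(\<Sum>j\<in>{- int W..int W}. ((1 - pinsker_weight k W j) * coef S j)^2) +
   ((LINT x|U01. (S x)^2) - (\<Sum>j\<in>{- int W..int W}. (coef S j)^2)) <= r / (2 * pi * real W) ^ (2 * k)"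
  (is "?B + (?N - ?T) <= ?R")
proof (rule field_le_epsilon)
 fix e :: real assume e: "0 < e"
 note facts = sobolev_ball_facts[OF S k r]
 have cont: "continuous_on {0..1} S" using facts(1) by (rule continuous_on_subset) simp
 obtain J0 c0 where J0: "\<And>x. \<bar>S x - trig J0 c0 x\<bar> < sqrt e"
  by (rule trig_dense[of S "sqrt e"]) (use facts e in auto)
 define J where "J = max J0 W"
 obtain c where c: "trig J0 c0 = trig J c" using trig_mono[of J0 J c0] by (auto simp: J_def)
 \<comment> \<open>Uniform approximation within \<open>sqrt e\<close> stands in for Parseval's
   identity: dropping the coefficient errors shows that at most \<open>e\<close> of the energy lies
   beyond \<open>J\<close>.\<close>
 have "(\<Sum>j\<in>{- int J..int J}. (c j - coef S j)^2) + (?N - (\<Sum>j\<in>{- int J..int J}. (coef S j)^2)) =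
   (LINT x|U01. (trig J c x - S x)^2)"
  by (rule integral_diff_trig_sq[OF cont, symmetric])
 also have "\<dots> <= (LINT x|U01. e)"
 proof (rule integral_mono)
  fix x assume "x \<in> space U01"
  have "\<bar>trig J c x - S x\<bar> <= sqrt e" using J0[of x] c by (simp add: abs_minus_commute less_imp_le)
  then have "(trig J c x - S x)^2 <= (sqrt e)^2" by (rule abs_le_square_iff[THEN iffD1, OF order_trans]) simp
  then show "(trig J c x - S x)^2 <= e" using e by simp
 qed (auto intro!: integrable_U01 continuous_intros cont)
 also have "\<dots> = e" by (simp add: U01.prob_space[simplified])
 finally have tail: "?N - (\<Sum>j\<in>{- int J..int J}. (coef S j)^2) <= e"
  using sum_nonneg[of "{- int J..int J}" "%j. (c j - coef S j)^2"] by simp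
 have w: "0 < (2 * pi * real W) ^ (2 * k)" using W by simp
 let ?f = "%j. (2 * pi * real_of_int j) ^ (2 * k) * (coef S j)^2 / (2 * pi * real W) ^ (2 * k)"
 have "?B = (\<Sum>j\<in>{- int W..int W}. ?f j)"
 proof (rule sum.cong[OF refl])
  fix j :: int
  have "((1 - pinsker_weight k W j))^2 = (\<bar>real_of_int j\<bar> / real W) ^ (2 * k)"
   by (simp add: pinsker_weight_def power_mult[symmetric] mult.commute)
  also have "\<dots> = (2 * pi * real_of_int j) ^ (2 * k) / (2 * pi * real W) ^ (2 * k)"
   using W by (simp add: power_divide power_mult_distrib power_even_abs)
  finally show "((1 - pinsker_weight k W j) * coef S j)^2 = ?f j"
   by (simp add: power_mult_distrib)
 qed
 moreover have "(\<Sum>j\<in>{- int J..int J}. (coef S j)^2) - ?T = (\<Sum>j\<in>{- int J..int J} - {- int W..int W}. (coef S j)^2)"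
  by (subst sum_diff) (auto simp: J_def)
 moreover have "(\<Sum>j\<in>{- int J..int J} - {- int W..int W}. (coef S j)^2) <= (\<Sum>j\<in>{- int J..int J} - {- int W..int W}. ?f j)"
 proof (rule sum_mono)
  fix j assume "j \<in> {- int J..int J} - {- int W..int W}"
  then have "real W <= \<bar>real_of_int j\<bar>" by auto
  then have "(2 * pi * real W) ^ (2 * k) <= (2 * pi * \<bar>real_of_int j\<bar>) ^ (2 * k)"
   by (intro power_mono) auto
  also have "\<dots> = (2 * pi * real_of_int j) ^ (2 * k)"
   by (simp add: power_mult_distrib power_even_abs)
  finally have "(2 * pi * real W) ^ (2 * k) * (coef S j)^2 <= (2 * pi * real_of_int j) ^ (2 * k) * (coef S j)^2"
   by (rule mult_right_mono) simp
  then show "(coef S j)^2 <= ?f j" using w by (simp add: pos_le_divide_eq mult.commute)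
 qed
 moreover have "(\<Sum>j\<in>{- int W..int W}. ?f j) + (\<Sum>j\<in>{- int J..int J} - {- int W..int W}. ?f j) = (\<Sum>j\<in>{- int J..int J}. ?f j)"
  by (subst sum.subset_diff[of "{- int W..int W}" "{- int J..int J}"]) (auto simp: J_def)
 moreover have "(\<Sum>j\<in>{- int J..int J}. ?f j) <= ?R"
  using facts(3)[of J] w by (simp add: sum_divide_distrib[symmetric] divide_right_mono)
 ultimately show "?B + (?N - ?T) <= ?R + e" using tail by linarith
qed

text \<open>The map \<open>d\<close> is differentiation written on coefficients; its iterates carry
  both the derivatives and their norms, and summing over the orders gives the weight in the
  hypothesis.\<close>

lemma trig_in_sobolev_ball:
 assumes "(\<Sum>j\<in>{- int J..int J}. (\<Sum>i\<le>k. (2 * pi * real_of_int j) ^ (2 * i)) * (c j)^2) <= r"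
 shows "trig J c \<in> sobolev_ball k r"
proof -
 define d where "d c j = - (2 * pi * real_of_int j) * c (- j)" for c :: "int => real" and j
 have der: "(trig J c has_vector_derivative trig J (d c) x) (at x within A)" for c x A
 proof -
  have "(trig J c has_real_derivative (\<Sum>j\<in>{- int J..int J}. c j * (2 * pi * real_of_int j * cas (- j) x))) (at x within A)"
   unfolding trig_def
   by (auto intro!: derivative_eq_intros cas_has_derivative sum.cong simp: mult_ac)
  also have "(\<Sum>j\<in>{- int J..int J}. c j * (2 * pi * real_of_int j * cas (- j) x)) = trig J (d c) x"
   unfolding trig_def
   by (rule sum.reindex_bij_witness[where i = uminus and j = uminus]) (auto simp: d_def)
  finally show ?thesis by (simp add: has_real_derivative_iff_has_vector_derivative)
 qed
 \<comment> \<open>\<open>deriv01\<close> is one-sided at the endpoints and iterates are controlled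
   on \<open>{0..1}\<close> only, so derivatives are transferred through agreement on this
   interval.\<close>
 have D: "(deriv01 ^^ i) (trig J c) x = trig J ((d ^^ i) c) x" if "x \<in> {0..1}" for i x
  using that
 proof (induction i arbitrary: x)
  case (Suc i)
  have "(trig J ((d ^^ i) c) has_vector_derivative trig J (d ((d ^^ i) c)) x) (at x within {0..1})"
   by (rule der)
  then have "((deriv01 ^^ i) (trig J c) has_vector_derivative trig J (d ((d ^^ i) c)) x) (at x within {0..1})"
   by (rule has_vector_derivative_transform[OF Suc.prems, rotated]) (use Suc.IH in auto)
  then have "vector_derivative ((deriv01 ^^ i) (trig J c)) (at x within {0..1}) = trig J (d ((d ^^ i) c)) x"
   using Suc.prems by (intro vector_derivative_within_closed_interval) auto
  then show ?case
   by (simp only: funpow.simps o_def deriv01_def[of "(deriv01 ^^ i) (trig J c)"])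
 qed simp
 have diff: "(deriv01 ^^ i) (trig J c) differentiable (at x within {0..1})" if x: "x \<in> {0..1}" for i x
 proof -
  have "((deriv01 ^^ i) (trig J c) has_vector_derivative trig J (d ((d ^^ i) c)) x) (at x within {0..1})"
   by (rule has_vector_derivative_transform[OF x _ der]) (use D in auto)
  then show ?thesis by (auto simp: has_vector_derivative_def differentiable_def)
 qed
 have cont: "continuous_on {0..1} ((deriv01 ^^ i) (trig J c))" for i
  using continuous_on_trig by (rule continuous_on_eq) (use D in auto)
 have sq: "sq_norm ((deriv01 ^^ i) (trig J c)) = ennreal (\<Sum>j\<in>{- int J..int J}. (2 * pi * real_of_int j) ^ (2 * i) * (c j)^2)" for i
 proof -
  have "sq_norm ((deriv01 ^^ i) (trig J c)) = ennreal (LINT x|U01. (trig J ((d ^^ i) c) x)^2)"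
   unfolding sq_norm_eq_integral[OF cont] by (intro arg_cong[of _ _ ennreal] Bochner_Integration.integral_cong) (auto simp: D)
  also have "(LINT x|U01. (trig J ((d ^^ i) c) x)^2) = (\<Sum>j\<in>{- int J..int J}. (2 * pi * real_of_int j) ^ (2 * i) * (c j)^2)"
   unfolding integral_trig_sq
  proof (induction i arbitrary: c)
   case (Suc i)
   have "(\<Sum>j\<in>{- int J..int J}. ((d ^^ Suc i) c j)^2) = (\<Sum>j\<in>{- int J..int J}. (2 * pi * real_of_int j) ^ (2 * i) * (d c j)^2)"
    using Suc.IH[of "d c"] by (simp only: funpow_Suc_right o_def)
   also have "\<dots> = (\<Sum>j\<in>{- int J..int J}. (2 * pi * real_of_int j) ^ (2 * Suc i) * (c j)^2)"
    by (rule sum.reindex_bij_witness[where i = uminus and j = uminus])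
      (auto simp: d_def power_mult power_mult_distrib power2_eq_square)
   finally show ?case .
  qed simp
  finally show ?thesis .
 qed
 have ends: "(deriv01 ^^ i) (trig J c) 0 = (deriv01 ^^ i) (trig J c) 1" for i
  using trig_periodic[of J "(d ^^ i) c" 0] by (simp add: D)
 have "(\<Sum>i\<le>k. sq_norm ((deriv01 ^^ i) (trig J c))) =
   ennreal (\<Sum>i\<le>k. \<Sum>j\<in>{- int J..int J}. (2 * pi * real_of_int j) ^ (2 * i) * (c j)^2)"
  unfolding sq by (rule sum_ennreal) (auto intro!: sum_nonneg mult_nonneg_nonneg simp: power_mult)
 also have "(\<Sum>i\<le>k. \<Sum>j\<in>{- int J..int J}. (2 * pi * real_of_int j) ^ (2 * i) * (c j)^2) =
   (\<Sum>j\<in>{- int J..int J}. (\<Sum>i\<le>k. (2 * pi * real_of_int j) ^ (2 * i)) * (c j)^2)"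
  by (subst sum.swap) (simp add: sum_distrib_right)
 finally have "(\<Sum>i\<le>k. sq_norm ((deriv01 ^^ i) (trig J c))) <= ennreal r"
  using assms by (simp add: ennreal_leI)
 then show ?thesis
  unfolding sobolev_ball_def Ck_per_def using diff cont ends trig_periodic by auto
qed

section \<open>Second moments: orthogonal sums and passage to the limit\<close>

lemma (in prob_space) integrable_of_square:
 fixes X :: "'a => real"
 assumes "X \<in> borel_measurable M" "integrable M (%x. (X x)^2)"
 shows "integrable M X"
 using square_integrable_imp_integrable[OF assms] .

lemma integrable_mult_of_squares:
 fixes X Y :: "'a => real"
 assumes [measurable]: "X \<in> borel_measurable M" "Y \<in> borel_measurable M"
  and X: "integrable M (%x. (X x)^2)" and Y: "integrable M (%x. (Y x)^2)"
 shows "integrable M (%x. X x * Y x)"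
proof (rule Bochner_Integration.integrable_bound)
 show "integrable M (%x. (X x)^2 + (Y x)^2)" using X Y by simp
 show "AE x in M. norm (X x * Y x) <= norm ((X x)^2 + (Y x)^2)"
 proof (rule AE_I2)
  fix x
  have "0 <= (\<bar>X x\<bar> - \<bar>Y x\<bar>)^2" by simp
  then have "2 * (\<bar>X x\<bar> * \<bar>Y x\<bar>) <= (X x)^2 + (Y x)^2" by (simp add: power2_diff)
  moreover have "0 <= \<bar>X x\<bar> * \<bar>Y x\<bar>" by simp
  moreover have "\<bar>(X x)^2 + (Y x)^2\<bar> = (X x)^2 + (Y x)^2" by simp
  ultimately show "norm (X x * Y x) <= norm ((X x)^2 + (Y x)^2)"
   unfolding real_norm_def abs_mult by linarith
 qed
qed simp

lemma integrable_square_sum: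
 fixes X :: "'i => 'a => real"
 assumes fin: "finite I" and meas: "\<And>i. i \<in> I ==> X i \<in> borel_measurable M"
  and sq: "\<And>i. i \<in> I ==> integrable M (%x. (X i x)^2)"
 shows "integrable M (%x. (\<Sum>i\<in>I. X i x)^2)"
proof -
 have "integrable M (%x. \<Sum>i\<in>I. \<Sum>j\<in>I. X i x * X j x)"
  by (intro Bochner_Integration.integrable_sum integrable_mult_of_squares meas sq)
 then show ?thesis by (simp add: power2_eq_square sum_product)
qed

lemma integral_square_sum_orthogonal:
 fixes X :: "'i => 'a => real"
 assumes fin: "finite I" and meas: "\<And>i. i \<in> I ==> X i \<in> borel_measurable M"
  and sq: "\<And>i. i \<in> I ==> integrable M (%x. (X i x)^2)"
  and orth: "\<And>i j. i \<in> I ==> j \<in> I ==> i \<noteq> j ==> (\<integral>x. X i x * X j x \<partial>M) = 0"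
 shows "(\<integral>x. (\<Sum>i\<in>I. X i x)^2 \<partial>M) = (\<Sum>i\<in>I. \<integral>x. (X i x)^2 \<partial>M)"
proof -
 have "(\<integral>x. (\<Sum>i\<in>I. X i x)^2 \<partial>M) = (\<integral>x. (\<Sum>i\<in>I. \<Sum>j\<in>I. X i x * X j x) \<partial>M)"
  by (simp add: power2_eq_square sum_product)
 also have "\<dots> = (\<Sum>i\<in>I. \<Sum>j\<in>I. \<integral>x. X i x * X j x \<partial>M)"
  by (simp add: Bochner_Integration.integral_sum integrable_mult_of_squares meas sq)
 also have "\<dots> = (\<Sum>i\<in>I. \<Sum>j\<in>I. if j = i then \<integral>x. (X i x)^2 \<partial>M else 0)"
  by (intro sum.cong) (auto simp: orth power2_eq_square)
 finally show ?thesis using fin by simp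
qed

text \<open>Uniform integrability from second moments: truncation at level \<open>K\<close> costs at most \<open>C / K\<close>.\<close>

lemma (in prob_space) LIMSEQ_expectation_L2_bounded:
 fixes X :: "nat => 'a => real"
 assumes [measurable]: "\<And>i. X i \<in> borel_measurable M" "Y \<in> borel_measurable M"
  and lim: "AE x in M. (%i. X i x) \<longlonglongrightarrow> Y x"
  and sq: "\<And>i. integrable M (%x. (X i x)^2)" and bd: "\<And>i. expectation (%x. (X i x)^2) <= C"
 shows "integrable M (%x. (Y x)^2)" and "expectation (%x. (Y x)^2) <= C"
  and "(%i. expectation (X i)) \<longlonglongrightarrow> expectation Y"
proof -
 have C: "0 <= C" using order_trans[OF _ bd[of 0]] by simp
 have "(\<integral>\<^sup>+x. ennreal ((Y x)^2) \<partial>M) = (\<integral>\<^sup>+x. liminf (%i. ennreal ((X i x)^2)) \<partial>M)"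
 proof (rule nn_integral_cong_AE, use lim in eventually_elim)
  fix x assume "(%i. X i x) \<longlonglongrightarrow> Y x"
  then have "(%i. ennreal ((X i x)^2)) \<longlonglongrightarrow> ennreal ((Y x)^2)"
   by (intro tendsto_ennrealI tendsto_power)
  then show "ennreal ((Y x)^2) = liminf (%i. ennreal ((X i x)^2))"
   by (rule lim_imp_Liminf[symmetric, rotated]) simp
 qed
 also have "\<dots> <= liminf (%i. \<integral>\<^sup>+x. ennreal ((X i x)^2) \<partial>M)"
  by (rule nn_integral_liminf) simp
 also have "\<dots> = liminf (%i. ennreal (expectation (%x. (X i x)^2)))"
  by (simp add: nn_integral_eq_integral[OF sq])
 also have "\<dots> <= liminf (%i::nat. ennreal C)"
  by (rule Liminf_mono) (auto intro!: always_eventually ennreal_leI bd)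
 finally have fat: "(\<integral>\<^sup>+x. ennreal ((Y x)^2) \<partial>M) <= ennreal C"
  by (simp add: Liminf_const)
 show sqY: "integrable M (%x. (Y x)^2)"
  by (rule integrableI_bounded) (use le_less_trans[OF fat ennreal_less_top] in simp_all)
 show bdY: "expectation (%x. (Y x)^2) <= C"
  using fat C by (simp add: nn_integral_eq_integral[OF sqY])
 define cl where "cl K y = max (- K) (min K y)" for K y :: real
 have cl_err: "\<bar>Z - cl K Z\<bar> <= Z^2 / K" if "K > 0" for Z K
 proof (cases "\<bar>Z\<bar> <= K")
  case True then show ?thesis using that by (auto simp: cl_def)
 next
  case False
  then have "\<bar>Z - cl K Z\<bar> <= \<bar>Z\<bar>" using that by (auto simp: cl_def max_def min_def split: if_splits)
  also have "\<dots> <= Z^2 / K"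
   using False that mult_left_mono[of K "\<bar>Z\<bar>" "\<bar>Z\<bar>"]
   by (simp add: pos_le_divide_eq power2_eq_square abs_mult[symmetric])
  finally show ?thesis .
 qed
 have cl_meas [measurable]: "cl K \<in> borel_measurable borel" for K
  unfolding cl_def by measurable
 have cl_int: "integrable M (%x. cl K (Z x))" if "Z \<in> borel_measurable M" "K > 0" for Z K
  by (rule integrable_const_bound[of _ K]) (use that in \<open>auto simp: cl_def\<close>)
 have err: "\<bar>expectation Z - expectation (%x. cl K (Z x))\<bar> <= C / K"
  if Z: "Z \<in> borel_measurable M" "integrable M (%x. (Z x)^2)" "expectation (%x. (Z x)^2) <= C" and K: "K > 0" for Z K
 proof -
  have iZ: "integrable M Z" by (rule integrable_of_square[OF Z(1,2)])
  have "\<bar>expectation Z - expectation (%x. cl K (Z x))\<bar> = \<bar>expectation (%x. Z x - cl K (Z x))\<bar>"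
   using iZ cl_int[OF Z(1) K] by simp
  also have "\<dots> <= expectation (%x. \<bar>Z x - cl K (Z x)\<bar>)"
   by (rule integral_abs_bound)
  also have "\<dots> <= expectation (%x. (Z x)^2 / K)"
   by (rule integral_mono) (use iZ cl_int[OF Z(1) K] Z(2) cl_err[OF K] in auto)
  also have "\<dots> <= C / K" using Z(3) K by (simp add: divide_right_mono)
  finally show ?thesis .
 qed
 show "(%i. expectation (X i)) \<longlonglongrightarrow> expectation Y"
 proof (rule LIMSEQ_I)
  fix e :: real assume e: "0 < e"
  define K where "K = 3 * (C + 1) / e"
  have K: "0 < K" using C e by (simp add: K_def)
  have CK: "C / K < e / 3" using C e by (simp add: K_def field_simps)
  have "(%i. expectation (%x. cl K (X i x))) \<longlonglongrightarrow> expectation (%x. cl K (Y x))"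
  proof (rule integral_dominated_convergence[where w = "%_. K"])
   show "AE x in M. (%i. cl K (X i x)) \<longlonglongrightarrow> cl K (Y x)"
    using lim unfolding cl_def by eventually_elim (intro tendsto_intros)
   show "AE x in M. norm (cl K (X i x)) <= K" for i using K by (auto simp: cl_def)
  qed auto
  then obtain N where N: "\<And>i. i \<ge> N ==> \<bar>expectation (%x. cl K (X i x)) - expectation (%x. cl K (Y x))\<bar> < e / 3"
   using LIMSEQ_D[of _ _ "e / 3"] e by fastforce
  show "\<exists>N. \<forall>i\<ge>N. norm (expectation (X i) - expectation Y) < e"
  proof (intro exI allI impI)
   fix i assume "N <= i"
   then have "\<bar>expectation (%x. cl K (X i x)) - expectation (%x. cl K (Y x))\<bar> < e / 3" by (rule N)
   moreover have "\<bar>expectation (X i) - expectation (%x. cl K (X i x))\<bar> <= C / K"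
    by (intro err sq bd K) simp
   moreover have "\<bar>expectation Y - expectation (%x. cl K (Y x))\<bar> <= C / K"
    by (intro err sqY bdY K) simp
   ultimately show "norm (expectation (X i) - expectation Y) < e"
    using CK unfolding real_norm_def by linarith
  qed
 qed
qed

lemma sigma_gen_measurable:
 assumes "i \<in> I"
 shows "X i \<in> borel_measurable (sigma (space M) (sigma_gen M I X))"
proof (rule measurableI)
 have sub: "sigma_gen M I X \<subseteq> Pow (space M)"
  unfolding sigma_gen_def by (rule subsetI, rule PowI, rule sigma_sets_into_sp) auto
 fix A :: "real set" assume "A \<in> sets borel"
 then have "X i -` A \<inter> space M \<in> sigma_gen M I X"
  unfolding sigma_gen_def using assms by (intro sigma_sets.Basic) auto
 then show "X i -` A \<inter> space (sigma (space M) (sigma_gen M I X)) \<in> sets (sigma (space M) (sigma_gen M I X))"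
  by (simp add: sub sigma_sets.Basic)
qed auto

section \<open>Renewal counts\<close>

text \<open>The product rule is assumed for two generated families, so that it can be read off for
  any pair taken from a larger independent family of sigma-algebras.\<close>

lemma (in prob_space) indep_var_sigma_gen:
 fixes X Z :: "'a => real"
 assumes G: "\<And>A B. A \<in> sigma_gen M I V ==> B \<in> sigma_gen M J V' ==>
   A \<in> events \<and> B \<in> events \<and> prob (A \<inter> B) = prob A * prob B"
  and X: "X \<in> borel_measurable (sigma (space M) (sigma_gen M I V))"
  and Z: "Z \<in> borel_measurable (sigma (space M) (sigma_gen M J V'))"
 shows "indep_var borel X borel Z"
proof -
 have alg: "sigma_algebra (space M) (sigma_gen M I V)"
  unfolding sigma_gen_def by (rule sigma_algebra_sigma_sets) auto
 have sets: "sets (sigma (space M) (sigma_gen M I V)) = sigma_gen M I V"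
  using sigma_algebra.sets_measure_of_eq[OF alg] by blast
 have alg': "sigma_algebra (space M) (sigma_gen M J V')"
  unfolding sigma_gen_def by (rule sigma_algebra_sigma_sets) auto
 have sets': "sets (sigma (space M) (sigma_gen M J V')) = sigma_gen M J V'"
  using sigma_algebra.sets_measure_of_eq[OF alg'] by blast
 have sub: "sigma_sets (space M) {X -` A \<inter> space M |A. A \<in> sets borel} \<subseteq> sigma_gen M I V"
  using measurable_sets[OF X] unfolding sets
  by (intro sigma_algebra.sigma_sets_subset[OF alg]) (auto simp: space_measure_of_conv)
 have sub': "sigma_sets (space M) {Z -` A \<inter> space M |A. A \<in> sets borel} \<subseteq> sigma_gen M J V'"
  using measurable_sets[OF Z] unfolding sets'
  by (intro sigma_algebra.sigma_sets_subset[OF alg']) (auto simp: space_measure_of_conv)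
 have "space M \<in> sigma_gen M I V" "space M \<in> sigma_gen M J V'"
  using sets.top[of "sigma (space M) (sigma_gen M I V)"] sets.top[of "sigma (space M) (sigma_gen M J V')"]
  unfolding sets sets' by (auto simp: space_measure_of_conv)
 then have evI: "A \<in> sigma_gen M I V ==> A \<in> events" and evJ: "B \<in> sigma_gen M J V' ==> B \<in> events" for A B
  using G by blast+
 have "random_variable borel X"
  by (rule measurableI) (use measurable_sets[OF X] evI in \<open>auto simp: sets space_measure_of_conv\<close>)
 moreover have "random_variable borel Z"
  by (rule measurableI) (use measurable_sets[OF Z] evJ in \<open>auto simp: sets' space_measure_of_conv\<close>)
 moreover have "indep_set (sigma_sets (space M) {X -` A \<inter> space M |A. A \<in> sets borel})
   (sigma_sets (space M) {Z -` A \<inter> space M |A. A \<in> sets borel})"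
  by (rule indep_setI) (use sub sub' evI evJ G in blast)+
 ultimately show ?thesis by (simp add: indep_var_eq)
qed

text \<open>The waiting time that crosses \<open>t\<close> is cut at \<open>c\<close>, so the
  overshoot is at most \<open>c\<close>, and later summands vanish. The bound by the partial sum
  itself is there to carry the induction.\<close>

lemma min_sum_stopped_le:
 fixes a :: "nat => real"
 assumes pos: "\<And>i. 1 <= i ==> 0 < a i" and t: "0 <= t" and c: "0 < c"
 shows "(\<Sum>i=1..K. min (a i) c * (if (\<Sum>l=1..i-1. a l) <= t then 1 else 0)) <= min (\<Sum>l=1..K. a l) (t + c)"
proof (induction K)
 case 0 then show ?case using t c by simp
next
 case (Suc K)
 have "0 < a (Suc K)" using pos by simp
 then show ?case using Suc.IH c t by auto
qed

context semi_markov_noise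
begin

lemma tau_measurable: "1 <= l ==> \<tau> l \<in> borel_measurable M"
 using tau_indep by (auto simp: indep_vars_def)

lemma renewal_time_measurable [measurable]: "renewal_time \<tau> k \<in> borel_measurable M"
 unfolding renewal_time_def using tau_measurable by (intro borel_measurable_sum) auto

lemma tau_integral:
 fixes f :: "real => real"
 assumes "1 <= l" "f \<in> borel_measurable borel"
 shows "expectation (%om. f (\<tau> l om)) = (LINT x|\<eta>. f x)"
 unfolding tau_distr[OF assms(1), symmetric]
 by (rule integral_distr[symmetric]) (use tau_measurable assms in auto)

lemma tau_mean_eq: "tau_mean = expectation (\<tau> 1)"
 using tau_integral[of 1 "%x. x"] by (simp add: tau_mean_def)

lemma AE_tau_pos: "AE om in M. \<forall>l\<ge>1. 0 < \<tau> l om"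
 unfolding AE_all_countable by (intro allI AE_impI tau_pos)

lemma min_tau_pos:
 assumes c: "0 < c" shows "0 < expectation (%om. min (\<tau> 1 om) c)"
proof -
 note [measurable] = tau_measurable[of 1, simplified]
 have int: "integrable M (%om. min (\<tau> 1 om) c)" using tau_integrable[of 1] by simp
 have nn: "AE om in M. 0 <= min (\<tau> 1 om) c" using tau_pos[of 1] c by auto
 have "expectation (%om. min (\<tau> 1 om) c) \<noteq> 0"
 proof
  assume "expectation (%om. min (\<tau> 1 om) c) = 0"
  then have "AE om in M. min (\<tau> 1 om) c = 0"
   using integral_nonneg_eq_0_iff_AE[OF int nn] by simp
  moreover have "AE om in M. 0 < min (\<tau> 1 om) c" using tau_pos[of 1] c by auto
  ultimately have "AE om in M. False" by eventually_elim simp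
  then show False by simp
 qed
 moreover have "0 <= expectation (%om. min (\<tau> 1 om) c)" by (rule integral_nonneg_AE[OF nn])
 ultimately show ?thesis by simp
qed

lemma tau_mean_pos: "0 < tau_mean"
proof -
 have "expectation (%om. min (\<tau> 1 om) 1) <= expectation (\<tau> 1)"
  by (rule integral_mono) (use tau_integrable[of 1] in auto)
 then show ?thesis using min_tau_pos[of 1] by (simp add: tau_mean_eq)
qed

lemma min_tau_tendsto: "(%c. expectation (%om. min (\<tau> 1 om) (real c))) \<longlonglongrightarrow> tau_mean"
 unfolding tau_mean_eq
proof (rule integral_dominated_convergence[where w = "%om. \<bar>\<tau> 1 om\<bar>"])
 note [measurable] = tau_measurable[of 1, simplified]
 show "\<tau> 1 \<in> borel_measurable M" by simp
 show "(%om. min (\<tau> 1 om) (real c)) \<in> borel_measurable M" for c by simp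
 show "integrable M (%om. \<bar>\<tau> 1 om\<bar>)" using tau_integrable[of 1] by simp
 show "AE om in M. (%c. min (\<tau> 1 om) (real c)) \<longlonglongrightarrow> \<tau> 1 om"
 proof (rule AE_I2)
  fix om
  have "eventually (%c. min (\<tau> 1 om) (real c) = \<tau> 1 om) sequentially"
   using eventually_ge_at_top[of "nat \<lceil>\<tau> 1 om\<rceil>"]
   by eventually_elim (simp add: nat_ceiling_le_eq)
  then show "(%c. min (\<tau> 1 om) (real c)) \<longlonglongrightarrow> \<tau> 1 om" by (rule tendsto_eventually)
 qed
 show "AE om in M. norm (min (\<tau> 1 om) (real c)) <= \<bar>\<tau> 1 om\<bar>" for c
  by (rule AE_I2) (auto simp: min_def)
qed

text \<open>Wald's identity for truncated waiting times: whether the first \<open>i - 1\<close> of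
  them stay below \<open>t\<close> is independent of the \<open>i\<close>-th. Truncation bounds the
  overshoot; its price is the truncated mean in the denominator, which tends to
  \<open>tau_mean\<close> as \<open>c\<close> grows.\<close>

lemma sum_prob_renewal_le:
 assumes t: "0 <= t" and c: "0 < c"
 shows "(\<Sum>k<K. prob {om\<in>space M. renewal_time \<tau> k om <= t}) <= (t + c) / expectation (%om. min (\<tau> 1 om) c)"
proof -
 let ?m = "expectation (%om. min (\<tau> 1 om) c)"
 let ?f = "%i om. min (\<tau> i om) c * (if renewal_time \<tau> (i - 1) om <= t then 1 else 0)"
 have mean: "integrable M (?f i) \<and> expectation (?f i) = ?m * prob {om\<in>space M. renewal_time \<tau> (i - 1) om <= t}"
  if i: "i \<in> {1..K}" for i
 proof -
  note [measurable] = tau_measurable[of i]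
  have "indep_var borel (\<tau> i) borel (%om. \<Sum>l\<in>{1..i - 1}. \<tau> l om)"
   by (rule indep_vars_sum) (use i in \<open>auto intro!: indep_vars_subset[OF tau_indep]\<close>)
  then have "indep_var borel ((%x. min x c) \<circ> \<tau> i) borel ((%x. if x <= t then 1 else 0 :: real) \<circ> (%om. \<Sum>l\<in>{1..i - 1}. \<tau> l om))"
   by (rule indep_var_compose) auto
  then have ind: "indep_var borel (%om. min (\<tau> i om) c) borel (%om. if renewal_time \<tau> (i - 1) om <= t then 1 else 0 :: real)"
   by (simp add: o_def renewal_time_def)
  have int1: "integrable M (%om. min (\<tau> i om) c)" using tau_integrable[of i] i by auto
  have int2: "integrable M (%om. if renewal_time \<tau> (i - 1) om <= t then 1 else 0 :: real)"
   by (rule integrable_const_bound[of _ 1]) auto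
  have "expectation (%om. if renewal_time \<tau> (i - 1) om <= t then 1 else 0 :: real) =
    expectation (indicator {om\<in>space M. renewal_time \<tau> (i - 1) om <= t})"
   by (rule Bochner_Integration.integral_cong) (auto simp: indicator_def)
  also have "\<dots> = prob {om\<in>space M. renewal_time \<tau> (i - 1) om <= t}" by simp
  finally have e2: "expectation (%om. if renewal_time \<tau> (i - 1) om <= t then 1 else 0 :: real) = prob {om\<in>space M. renewal_time \<tau> (i - 1) om <= t}" .
  have e1: "expectation (%om. min (\<tau> i om) c) = ?m"
   using tau_integral[of i "%x. min x c"] tau_integral[of 1 "%x. min x c"] i by simp
  show ?thesis
   using indep_var_integrable[OF ind int1 int2] indep_var_lebesgue_integral[OF ind int1 int2] e1 e2 by simp
 qed
 have "(\<Sum>k<K. ?m * prob {om\<in>space M. renewal_time \<tau> k om <= t}) = (\<Sum>i=1..K. expectation (?f i))"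
 proof (rule sum.reindex_bij_witness[where i = "%i. i - 1" and j = Suc])
  fix k assume "k \<in> {..<K}"
  then have "Suc k \<in> {1..K}" by auto
  from mean[OF this] show "expectation (?f (Suc k)) = ?m * prob {om\<in>space M. renewal_time \<tau> k om <= t}"
   by simp
 qed auto
 also have "\<dots> = expectation (%om. \<Sum>i=1..K. ?f i om)"
  by (rule Bochner_Integration.integral_sum[symmetric]) (use mean in auto)
 also have "\<dots> <= expectation (%om. t + c)"
 proof (rule integral_mono_AE)
  show "AE om in M. (\<Sum>i=1..K. ?f i om) <= t + c"
   using AE_tau_pos
  proof eventually_elim
   fix om assume "\<forall>l\<ge>1. 0 < \<tau> l om"
   then show "(\<Sum>i=1..K. ?f i om) <= t + c"
    using min_sum_stopped_le[of "%i. \<tau> i om" t c K] t c by (simp add: renewal_time_def)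
  qed
 qed (use mean in auto)
 finally have "?m * (\<Sum>k<K. prob {om\<in>space M. renewal_time \<tau> k om <= t}) <= t + c"
  by (simp add: sum_distrib_left prob_space)
 then show ?thesis using min_tau_pos[OF c] by (simp add: pos_le_divide_eq mult.commute)
qed

lemma nn_integral_renewal_le:
 assumes t: "0 <= t" and c: "0 < c"
 shows "(\<integral>\<^sup>+om. (\<Sum>k. indicator {om\<in>space M. renewal_time \<tau> k om <= t} om) \<partial>M) <=
   ennreal ((t + c) / expectation (%om. min (\<tau> 1 om) c))"
proof -
 have "(\<integral>\<^sup>+om. (\<Sum>k. indicator {om\<in>space M. renewal_time \<tau> k om <= t} om) \<partial>M) =
   (\<Sum>k. ennreal (prob {om\<in>space M. renewal_time \<tau> k om <= t}))"
  by (subst nn_integral_suminf) (auto simp: emeasure_eq_measure)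
 also have "\<dots> <= ennreal ((t + c) / expectation (%om. min (\<tau> 1 om) c))"
  by (rule suminf_le_const) (auto simp: sum_ennreal simp del: One_nat_def intro!: ennreal_leI sum_prob_renewal_le t c)
 finally show ?thesis .
qed

text \<open>A finite expected number of renewals before each natural number gives almost sure
  finiteness; monotonicity in \<open>t\<close> then allows all real \<open>t\<close> outside a
  single null event.\<close>

lemma AE_renewal_finite: "AE om in M. \<forall>t. finite {k. 1 <= k \<and> renewal_time \<tau> k om <= t}"
proof -
 have "AE om in M. (\<Sum>k. indicator {om\<in>space M. renewal_time \<tau> k om <= real n} om) \<noteq> (\<infinity>::ennreal)" for n
  by (rule nn_integral_PInf_AE)
    (use nn_integral_renewal_le[of "real n" 1] in \<open>auto simp: top_unique\<close>)
 then have "AE om in M. \<forall>n. (\<Sum>k. indicator {om\<in>space M. renewal_time \<tau> k om <= real n} om) \<noteq> (\<infinity>::ennreal)"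
  by (simp add: AE_all_countable)
 then show ?thesis
 proof (rule AE_mp, intro AE_I2 impI allI)
  fix om t assume om: "om \<in> space M" and fin: "\<forall>n. (\<Sum>k. indicator {om\<in>space M. renewal_time \<tau> k om <= real n} om) \<noteq> (\<infinity>::ennreal)"
  obtain n where n: "t <= real n" using real_arch_simple by blast
  have "finite {k. renewal_time \<tau> k om <= real n}"
  proof (rule ccontr)
   assume inf: "infinite {k. renewal_time \<tau> k om <= real n}"
   have "(\<Sum>k. indicator {om\<in>space M. renewal_time \<tau> k om <= real n} om) =
     (\<integral>\<^sup>+k. indicator {k. renewal_time \<tau> k om <= real n} k \<partial>count_space UNIV :: ennreal)"
    by (subst nn_integral_count_space_nat) (use om in \<open>auto simp: indicator_def intro!: suminf_cong\<close>)
   also have "\<dots> = \<infinity>" using inf by (simp add: emeasure_count_space)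
   finally show False using fin by blast
  qed
  then show "finite {k. 1 <= k \<and> renewal_time \<tau> k om <= t}"
   by (rule finite_subset[rotated]) (use n in auto)
 qed
qed

text \<open>The series starts at \<open>k = 0\<close>, whose renewal time is 0, while the count
  starts at 1. The surplus of one disappears after division by \<open>n\<close>.\<close>

lemma renewal_count_le: "ennreal (real (renewal_count \<tau> t om)) <= (\<Sum>k. indicator {om\<in>space M. renewal_time \<tau> k om <= t} om)"
 if "om \<in> space M"
proof (cases "finite {k. 1 <= k \<and> renewal_time \<tau> k om <= t}")
 case True
 have "ennreal (real (renewal_count \<tau> t om)) = (\<Sum>k\<in>{k. 1 <= k \<and> renewal_time \<tau> k om <= t}. 1)"
  by (simp add: renewal_count_def ennreal_of_nat_eq_real_of_nat)
 also have "\<dots> = (\<Sum>k\<in>{k. 1 <= k \<and> renewal_time \<tau> k om <= t}. indicator {om\<in>space M. renewal_time \<tau> k om <= t} om)"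
  by (rule sum.cong) (use that in auto)
 also have "\<dots> <= (\<Sum>k. indicator {om\<in>space M. renewal_time \<tau> k om <= t} om)"
  by (rule sum_le_suminf) (use True in auto)
 finally show ?thesis .
qed (simp add: renewal_count_def)

text \<open>\<open>card\<close> is 0 on infinite sets, so the event is split according to whether
  the renewal times eventually exceed \<open>t\<close>. Both parts are countable combinations of
  events about finitely many times.\<close>

lemma renewal_count_measurable [measurable]: "renewal_count \<tau> t \<in> measurable M (count_space UNIV)"
proof -
 have fin: "finite {k. 1 <= k \<and> renewal_time \<tau> k om <= t} \<longleftrightarrow> (\<exists>K. \<forall>k>K. \<not> renewal_time \<tau> k om <= t)" for om
 proof
  assume "finite {k. 1 <= k \<and> renewal_time \<tau> k om <= t}"
  then obtain K where "\<forall>k\<in>{k. 1 <= k \<and> renewal_time \<tau> k om <= t}. k <= K"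
   using finite_nat_set_iff_bounded_le by blast
  then have bound: "k <= K" if "0 < k" "renewal_time \<tau> k om <= t" for k using that by auto
  show "\<exists>K. \<forall>k>K. \<not> renewal_time \<tau> k om <= t"
  proof (intro exI[of _ K] allI impI notI)
   fix k assume "K < k" "renewal_time \<tau> k om <= t"
   then show False using bound[of k] by simp
  qed
 next
  assume "\<exists>K. \<forall>k>K. \<not> renewal_time \<tau> k om <= t"
  then obtain K where "\<forall>k>K. \<not> renewal_time \<tau> k om <= t" by blast
  then have "{k. 1 <= k \<and> renewal_time \<tau> k om <= t} \<subseteq> {..K}" by (force simp: not_less)
  then show "finite {k. 1 <= k \<and> renewal_time \<tau> k om <= t}" by (rule finite_subset) simp
 qed
 let ?A = "%K om. \<Sum>k=1..K. if renewal_time \<tau> k om <= t then 1 else (0::nat)"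
 have A: "?A K om = card {k. 1 <= k \<and> renewal_time \<tau> k om <= t}" if "\<forall>k>K. \<not> renewal_time \<tau> k om <= t" for K om
 proof -
  have "{k. 1 <= k \<and> renewal_time \<tau> k om <= t} = {k\<in>{1..K}. renewal_time \<tau> k om <= t}"
   using that by (force simp: not_less)
  then show ?thesis by (simp add: sum.If_cases Int_def)
 qed
 have "(%om. renewal_count \<tau> t om = m) \<in> measurable M (count_space UNIV)" for m
 proof -
  have "renewal_count \<tau> t om = m \<longleftrightarrow>
    ((\<exists>K. (\<forall>k>K. \<not> renewal_time \<tau> k om <= t) \<and> ?A K om = m) \<or> (\<not> (\<exists>K. \<forall>k>K. \<not> renewal_time \<tau> k om <= t)) \<and> m = 0)" for om
  proof (cases "\<exists>K. \<forall>k>K. \<not> renewal_time \<tau> k om <= t")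
   case True
   then obtain K0 where K0: "\<forall>k>K0. \<not> renewal_time \<tau> k om <= t" by blast
   have "(\<exists>K. (\<forall>k>K. \<not> renewal_time \<tau> k om <= t) \<and> ?A K om = m) \<longleftrightarrow> renewal_count \<tau> t om = m"
   proof
    assume "\<exists>K. (\<forall>k>K. \<not> renewal_time \<tau> k om <= t) \<and> ?A K om = m"
    then obtain K where K: "\<forall>k>K. \<not> renewal_time \<tau> k om <= t" "?A K om = m" by (elim exE conjE)
    show "renewal_count \<tau> t om = m"
     unfolding renewal_count_def A[OF K(1), symmetric] by (rule K(2))
   next
    assume "renewal_count \<tau> t om = m"
    then have "?A K0 om = m" unfolding renewal_count_def A[OF K0] .
    with K0 show "\<exists>K. (\<forall>k>K. \<not> renewal_time \<tau> k om <= t) \<and> ?A K om = m"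
     by (intro exI[of _ K0] conjI)
   qed
   then show ?thesis using True by blast
  next
   case False
   then have "infinite {k. 1 <= k \<and> renewal_time \<tau> k om <= t}" using fin by blast
   then have "renewal_count \<tau> t om = 0" unfolding renewal_count_def by (rule card.infinite)
   then show ?thesis using False by blast
  qed
  then show ?thesis by simp
 qed
 then show ?thesis
  by (intro measurable_count_space_eq2_countable[THEN iffD2]) (auto simp: pred_def Int_def vimage_def conj_commute)
qed

lemma renewal_count_integrable:
 assumes t: "0 <= t"
 shows "integrable M (%om. real (renewal_count \<tau> t om))"
  and "0 < c ==> expectation (%om. real (renewal_count \<tau> t om)) <= (t + c) / expectation (%om. min (\<tau> 1 om) c)"
proof -
 have le: "(\<integral>\<^sup>+om. ennreal (real (renewal_count \<tau> t om)) \<partial>M) <= ennreal ((t + c) / expectation (%om. min (\<tau> 1 om) c))" if "0 < c" for c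
  by (rule order_trans[OF nn_integral_mono nn_integral_renewal_le[OF t that]]) (rule renewal_count_le)
 show int: "integrable M (%om. real (renewal_count \<tau> t om))"
  by (rule integrableI_bounded) (use le_less_trans[OF le[of 1] ennreal_less_top] in simp_all)
 show "expectation (%om. real (renewal_count \<tau> t om)) <= (t + c) / expectation (%om. min (\<tau> 1 om) c)" if c: "0 < c"
  using le[OF c] t c min_tau_pos[OF c]
  by (subst (asm) nn_integral_eq_integral[OF int]) (auto simp: ennreal_le_iff)
qed

text \<open>The upper half of the elementary renewal theorem. Half of \<delta> is spent on the
  truncated mean, by the choice of \<open>c\<close>, and half on the additive \<open>c\<close>, by
  large \<open>n\<close>.\<close>

lemma renewal_mean_limit:
 assumes d: "0 < \<delta>"
 shows "eventually (%n. expectation (%om. real (renewal_count \<tau> (real n) om)) <= (1 + \<delta>) * real n / tau_mean) sequentially"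
proof -
 have "eventually (%c. expectation (%om. min (\<tau> 1 om) (real c)) > tau_mean / (1 + \<delta> / 2)) sequentially"
  by (rule order_tendstoD(1)[OF min_tau_tendsto]) (use tau_mean_pos d in \<open>simp add: field_simps\<close>)
 then have "eventually (%c. expectation (%om. min (\<tau> 1 om) (real c)) > tau_mean / (1 + \<delta> / 2) \<and> 0 < c) sequentially"
  using eventually_gt_at_top[of "0::nat"] by eventually_elim simp
 then obtain c :: nat where c: "expectation (%om. min (\<tau> 1 om) (real c)) > tau_mean / (1 + \<delta> / 2)" "0 < c"
  using eventually_happens'[OF sequentially_bot] by blast
 have "eventually (%n. (1 + \<delta> / 2) * (real n + real c) <= (1 + \<delta>) * real n) sequentially"
  using d by real_asymp
 then show ?thesis
 proof eventually_elim
  fix n assume n: "(1 + \<delta> / 2) * (real n + real c) <= (1 + \<delta>) * real n"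
  let ?m = "expectation (%om. min (\<tau> 1 om) (real c))"
  have "expectation (%om. real (renewal_count \<tau> (real n) om)) <= (real n + real c) / ?m"
   by (rule renewal_count_integrable(2)) (use c in auto)
  also have "\<dots> <= (real n + real c) / (tau_mean / (1 + \<delta> / 2))"
   by (rule divide_left_mono) (use c tau_mean_pos d min_tau_pos[of "real c"] in \<open>auto intro!: mult_pos_pos divide_pos_pos\<close>)
  also have "\<dots> = (1 + \<delta> / 2) * (real n + real c) / tau_mean" by simp
  also have "\<dots> <= (1 + \<delta>) * real n / tau_mean"
   by (rule divide_right_mono[OF n]) (use tau_mean_pos in simp)
  finally show "expectation (%om. real (renewal_count \<tau> (real n) om)) <= (1 + \<delta>) * real n / tau_mean" .
 qed
qed

end

section \<open>Grid sums of the Brownian and renewal parts\<close>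

lemma (in prob_space) indep_var_pair:
 assumes "indep_vars (%_. borel) X I" "i \<in> I" "j \<in> I" "i \<noteq> j"
 shows "indep_var borel (X i :: 'a => real) borel (X j)"
 using indep_vars_sum[of "{j}" i X] indep_vars_subset[OF assms(1), of "{i, j}"] assms(2-4) by simp

lemma (in prob_space) weighted_indep_sum:
 fixes X :: "'i => 'a => real"
 assumes fin: "finite I" and ind: "indep_vars (%_. borel) X I"
  and sq: "\<And>i. i \<in> I ==> integrable M (%x. (X i x)^2)"
  and mean: "\<And>i. i \<in> I ==> expectation (X i) = 0"
  and var: "\<And>i. i \<in> I ==> expectation (%x. (X i x)^2) <= v"
 shows "integrable M (%x. (\<Sum>i\<in>I. a i * X i x)^2)"
  and "expectation (%x. \<Sum>i\<in>I. a i * X i x) = 0"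
  and "expectation (%x. (\<Sum>i\<in>I. a i * X i x)^2) <= v * (\<Sum>i\<in>I. (a i)^2)"
proof -
 have [measurable]: "i \<in> I ==> X i \<in> borel_measurable M" for i
  using ind by (auto simp: indep_vars_def)
 have int: "i \<in> I ==> integrable M (X i)" for i
  by (rule integrable_of_square[OF _ sq]) auto
 have sq': "i \<in> I ==> integrable M (%x. (a i * X i x)^2)" for i
  using sq by (simp add: power_mult_distrib)
 show "integrable M (%x. (\<Sum>i\<in>I. a i * X i x)^2)"
  by (intro integrable_square_sum fin sq') auto
 show "expectation (%x. \<Sum>i\<in>I. a i * X i x) = 0"
  using int by (simp add: mean)
 have "expectation (%x. (\<Sum>i\<in>I. a i * X i x)^2) = (\<Sum>i\<in>I. expectation (%x. (a i * X i x)^2))"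
 proof (rule integral_square_sum_orthogonal[OF fin _ sq'])
  fix i j assume ij: "i \<in> I" "j \<in> I" "i \<noteq> j"
  have "expectation (%x. X i x * X j x) = expectation (X i) * expectation (X j)"
   by (rule indep_var_lebesgue_integral[OF indep_var_pair[OF ind ij] int int]) (use ij in auto)
  then have "expectation (%x. a i * a j * (X i x * X j x)) = 0"
   using ij by (simp add: mean)
  then show "expectation (%x. a i * X i x * (a j * X j x)) = 0" by (simp add: mult_ac)
 qed auto
 also have "\<dots> = (\<Sum>i\<in>I. (a i)^2 * expectation (%x. (X i x)^2))"
  by (simp add: power_mult_distrib)
 also have "\<dots> <= (\<Sum>i\<in>I. (a i)^2 * v)"
  by (intro sum_mono mult_left_mono var) auto
 finally show "expectation (%x. (\<Sum>i\<in>I. a i * X i x)^2) <= v * (\<Sum>i\<in>I. (a i)^2)"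
  by (simp add: sum_distrib_left mult.commute)
qed

definition grid :: "nat => nat => real" where
 "grid N l = real l / real N"

lemma grid_nonneg [simp]: "0 <= grid N l"
 by (simp add: grid_def)

lemma grid_mono: "l <= l' ==> grid N l <= grid N l'"
 by (simp add: grid_def divide_right_mono)

lemma grid_Suc: "grid N (Suc l) = grid N l + 1 / real N"
 by (simp add: grid_def add_divide_distrib)

lemma grid_less: "1 <= N ==> grid N l < grid N (Suc l)"
 by (simp add: grid_Suc)

text \<open>The elementary stochastic integral, along the path \<open>x\<close>, of the step
  function with value \<open>a l\<close> on the \<open>l\<close>-th cell of mesh
  \<open>1 / N\<close>.\<close>

definition grid_sum :: "nat => nat => (nat => real) => (real => real) => real" where
 "grid_sum N m a x = (\<Sum>l<m. a l * (x (grid N (Suc l)) - x (grid N l)))"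

lemma grid_sum_measurable:
 assumes "\<And>t. 0 <= t ==> X t \<in> borel_measurable M'"
 shows "(%om. grid_sum N m a (%t. X t om)) \<in> borel_measurable M'"
 unfolding grid_sum_def using assms by (intro borel_measurable_sum borel_measurable_times borel_measurable_diff) auto

lemma (in prob_space) indep_increments_grid:
 assumes "indep_increments M X"
 shows "indep_vars (%_. borel) (%l om. X (grid N (Suc l)) om - X (grid N l) om) I"
proof -
 have "indep_vars (%_. borel) (%l om. X (grid N (Suc l)) om - X (grid N l) om) UNIV"
  using assms unfolding indep_increments_def
  by (elim allE[of _ "grid N"]) (auto simp: incseq_def grid_mono)
 then show ?thesis by (rule indep_vars_subset) simp
qed

lemma (in prob_space) brownian_grid_sum:
 assumes w: "standard_brownian_motion M w" and N: "1 <= N"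
 shows "integrable M (%om. (grid_sum N m a (%t. w t om))^2)"
  and "expectation (%om. grid_sum N m a (%t. w t om)) = 0"
  and "expectation (%om. (grid_sum N m a (%t. w t om))^2) <= 1 / real N * (\<Sum>l<m. (a l)^2)"
proof -
 let ?X = "%l om. w (grid N (Suc l)) om - w (grid N l) om"
 have D: "distributed M lborel (?X l) (normal_density 0 (sqrt (1 / real N)))" for l
 proof -
  have "distributed M lborel (?X l) (normal_density 0 (sqrt (grid N (Suc l) - grid N l)))"
   using w grid_less[OF N, of l] unfolding standard_brownian_motion_def by simp
  then show ?thesis by (simp add: grid_Suc)
 qed
 have s: "0 < sqrt (1 / real N)" using N by simp
 have sq: "integrable M (%om. (?X l om)^2)" for l
  using integrable_normal_moment[OF s, of 0 2]
  by (subst distributed_integrable[OF D, symmetric]) auto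
 have mean: "expectation (?X l) = 0" for l
  by (rule normal_distributed_expectation[OF s D])
 have var: "expectation (%om. (?X l om)^2) <= 1 / real N" for l
  using normal_distributed_variance[OF s D] N unfolding mean by simp
 have ind: "indep_vars (%_. borel) ?X {..<m}"
  using w unfolding standard_brownian_motion_def by (intro indep_increments_grid) simp
 note W = weighted_indep_sum[OF finite_lessThan ind sq mean var, of a]
 show "integrable M (%om. (grid_sum N m a (%t. w t om))^2)"
  and "expectation (%om. grid_sum N m a (%t. w t om)) = 0"
  and "expectation (%om. (grid_sum N m a (%t. w t om))^2) <= 1 / real N * (\<Sum>l<m. (a l)^2)"
  unfolding grid_sum_def by (fact W)+
qed

context semi_markov_noise
begin

text \<open>The independent sigma-algebras are held in a list, in the order \<open>w\<close>,
  \<open>L\<close>, counts, marks; positions in this list are used as their names.\<close>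

lemma mutual_pair:
 assumes "a < 4" "b < 4" "a \<noteq> b"
  and "A \<in> [sigma_gen M {0..} w, sigma_gen M {0..} L,
         sigma_gen M {0..} (%t om. real (renewal_count \<tau> t om)), sigma_gen M {1..} Y] ! a"
  and "B \<in> [sigma_gen M {0..} w, sigma_gen M {0..} L,
         sigma_gen M {0..} (%t om. real (renewal_count \<tau> t om)), sigma_gen M {1..} Y] ! b"
 shows "A \<in> events \<and> B \<in> events \<and> prob (A \<inter> B) = prob A * prob B"
proof -
 have "A \<in> events" "B \<in> events"
  using mutual_indep assms unfolding indep_sets_def by (meson lessThan_iff subsetD)+
 moreover have "prob (\<Inter>j\<in>{a, b}. (if j = a then A else B)) = (\<Prod>j\<in>{a, b}. prob (if j = a then A else B))"
  by (rule indep_setsD[OF mutual_indep]) (use assms in auto)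
 ultimately show ?thesis using assms(3) by (auto split: if_splits simp: Int_commute)
qed

lemma w_measurable [measurable]: "0 <= t ==> w t \<in> borel_measurable M"
 using brownian by (simp add: standard_brownian_motion_def)

lemma L_measurable [measurable]: "0 <= t ==> L t \<in> borel_measurable M"
 using levy by (simp add: pure_jump_levy_process_def levy_process_def)

lemma renewal_reward_measurable [measurable]: "renewal_reward \<tau> Y t \<in> borel_measurable M"
proof -
 have "(%om. \<Sum>i=1..k. Y i om) \<in> borel_measurable M" for k
  using Y_measurable by (intro borel_measurable_sum) auto
 then show ?thesis
  unfolding renewal_reward_def
  by (intro measurable_compose_countable[where f = "%k om. \<Sum>i=1..k. Y i om" and g = "renewal_count \<tau> t"]) auto
qed

lemma Y_sq_integrable: "1 <= i ==> integrable M (%om. (Y i om)^2)"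
 by (rule ccontr) (use Y_2 not_integrable_integral_eq in fastforce)

section \<open>Renewals sorted into grid cells\<close>

lemma AE_renewal_count_mono: "AE om in M. \<forall>s t. s <= t \<longrightarrow> renewal_count \<tau> s om <= renewal_count \<tau> t om"
 using AE_renewal_finite
proof eventually_elim
 case (elim om)
 then show ?case unfolding renewal_count_def by (auto intro!: card_mono)
qed

text \<open>Indicator that the \<open>i\<close>-th renewal falls into the \<open>l\<close>-th cell.
  It is expressed through the counts at the two endpoints because the counting process, not the
  waiting times, generates the sigma-algebra that is independent of the marks.\<close>

definition cell :: "nat => nat => nat => 'a => real" where
 "cell N l i om = (if real (renewal_count \<tau> (grid N l) om) < real i \<and>
   real i <= real (renewal_count \<tau> (grid N (Suc l)) om) then 1 else 0)"

text \<open>The random factor with which the mark \<open>Y i\<close> enters the grid sum with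
  integrand \<open>a\<close>.\<close>

definition cell_weight :: "nat => nat => (nat => real) => nat => 'a => real" where
 "cell_weight N m a i om = (\<Sum>l<m. a l * cell N l i om)"

lemma cell_measurable [measurable]: "cell N l i \<in> borel_measurable M"
 unfolding cell_def by measurable

lemma cell_weight_measurable [measurable]: "cell_weight N m a i \<in> borel_measurable M"
 unfolding cell_weight_def by measurable

lemma cell_weight_measurable_sigma:
 "cell_weight N m a i \<in> borel_measurable (sigma (space M) (sigma_gen M {0..} (%t om. real (renewal_count \<tau> t om))))"
proof -
 let ?S = "sigma (space M) (sigma_gen M {0..} (%t om. real (renewal_count \<tau> t om)))"
 have [measurable]: "(%om. real (renewal_count \<tau> (grid N l) om)) \<in> borel_measurable ?S" for l
  using sigma_gen_measurable[of "grid N l" "{0..}" "%t om. real (renewal_count \<tau> t om)" M] by simp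
 show ?thesis unfolding cell_weight_def cell_def by measurable
qed

lemma abs_cell_weight_le: "\<bar>cell_weight N m a i om\<bar> <= (\<Sum>l<m. \<bar>a l\<bar>)"
 unfolding cell_weight_def
 by (rule order_trans[OF sum_abs sum_mono]) (auto simp: cell_def)

text \<open>A renewal lies in at most one cell, so all cross products vanish. Monotone counts are
  assumed because the count falls back to 0 on the null event where renewals accumulate.\<close>

lemma cell_weight_sq:
 assumes mono: "\<forall>s t. s <= t \<longrightarrow> renewal_count \<tau> s om <= renewal_count \<tau> t om"
 shows "(cell_weight N m a i om)^2 = (\<Sum>l<m. (a l)^2 * cell N l i om)"
proof -
 have disj: "cell N l i om * cell N l' i om = 0" if "l < l'" for l l'
 proof -
  have "grid N (Suc l) <= grid N l'" using that by (intro grid_mono) simp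
  then have "renewal_count \<tau> (grid N (Suc l)) om <= renewal_count \<tau> (grid N l') om" using mono by blast
  then show ?thesis by (auto simp: cell_def)
 qed
 have disj': "cell N l i om * cell N l' i om = 0" if "l \<noteq> l'" for l l'
  using disj[of l l'] disj[of l' l] that by (cases "l < l'") auto
 have "(cell_weight N m a i om)^2 = (\<Sum>l<m. \<Sum>l'<m. a l * a l' * (cell N l i om * cell N l' i om))"
  by (simp add: cell_weight_def power2_eq_square sum_product mult_ac)
 also have "\<dots> = (\<Sum>l<m. \<Sum>l'<m. if l' = l then (a l)^2 * cell N l i om else 0)"
 proof (intro sum.cong refl)
  fix l l'
  show "a l * a l' * (cell N l i om * cell N l' i om) = (if l' = l then (a l)^2 * cell N l i om else 0)"
   using disj'[of l l'] by (cases "l' = l") (simp_all add: power2_eq_square cell_def)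
 qed
 finally show ?thesis by simp
qed

lemma sum_cell_le:
 assumes mono: "\<forall>s t. s <= t \<longrightarrow> renewal_count \<tau> s om <= renewal_count \<tau> t om"
 shows "(\<Sum>i=1..K. cell N l i om) <= real (renewal_count \<tau> (grid N (Suc l)) om) - real (renewal_count \<tau> (grid N l) om)"
proof -
 have le: "renewal_count \<tau> (grid N l) om <= renewal_count \<tau> (grid N (Suc l)) om"
  using mono grid_mono[of l "Suc l" N] by simp
 have "(\<Sum>i=1..K. cell N l i om) = real (card {i\<in>{1..K}. renewal_count \<tau> (grid N l) om < i \<and> i <= renewal_count \<tau> (grid N (Suc l)) om})"
  by (simp add: cell_def sum.If_cases Int_def)
 also have "\<dots> <= real (card {renewal_count \<tau> (grid N l) om<..renewal_count \<tau> (grid N (Suc l)) om})"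
  by (intro of_nat_mono card_mono) auto
 also have "\<dots> = real (renewal_count \<tau> (grid N (Suc l)) om) - real (renewal_count \<tau> (grid N l) om)"
  using le by simp
 finally show ?thesis .
qed

text \<open>Reordering by marks instead of cells writes the integral as a sum of marks with weights
  independent of them. Any \<open>K\<close> beyond the last renewal gives the same sum.\<close>

lemma grid_sum_renewal_reward:
 assumes mono: "\<forall>s t. s <= t \<longrightarrow> renewal_count \<tau> s om <= renewal_count \<tau> t om"
  and K: "renewal_count \<tau> (grid N m) om <= K"
 shows "grid_sum N m a (%t. renewal_reward \<tau> Y t om) = (\<Sum>i=1..K. cell_weight N m a i om * Y i om)"
proof -
 have inc: "renewal_reward \<tau> Y (grid N (Suc l)) om - renewal_reward \<tau> Y (grid N l) om = (\<Sum>i=1..K. cell N l i om * Y i om)"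
  if l: "l < m" for l
 proof -
  let ?A = "renewal_count \<tau> (grid N l) om" and ?B = "renewal_count \<tau> (grid N (Suc l)) om"
  have AB: "?A <= ?B" "?B <= K"
   using mono grid_mono[of l "Suc l" N] grid_mono[of "Suc l" m N] l K
   by (simp, meson Suc_leI le_trans)
  have "renewal_reward \<tau> Y (grid N (Suc l)) om - renewal_reward \<tau> Y (grid N l) om = (\<Sum>i\<in>{1..?B} - {1..?A}. Y i om)"
   unfolding renewal_reward_def by (rule sum_diff[symmetric]) (use AB in auto)
  also have "\<dots> = (\<Sum>i\<in>{1..K}. cell N l i om * Y i om)"
   by (rule sum.mono_neutral_cong_left) (use AB in \<open>auto simp: cell_def\<close>)
  finally show ?thesis .
 qed
 have "grid_sum N m a (%t. renewal_reward \<tau> Y t om) = (\<Sum>l<m. \<Sum>i=1..K. a l * cell N l i om * Y i om)"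
  by (simp add: grid_sum_def inc sum_distrib_left mult.assoc)
 also have "\<dots> = (\<Sum>i=1..K. cell_weight N m a i om * Y i om)"
  by (subst sum.swap) (simp add: cell_weight_def sum_distrib_right)
 finally show ?thesis .
qed

definition cell_mean :: "nat => nat => real" where
 "cell_mean N l = expectation (%om. real (renewal_count \<tau> (grid N (Suc l)) om)) -
   expectation (%om. real (renewal_count \<tau> (grid N l) om))"

lemma sum_cell_mean_le: "(\<Sum>l<m. cell_mean N l) <= expectation (%om. real (renewal_count \<tau> (grid N m) om))"
proof -
 have "(\<Sum>l<m. cell_mean N l) = expectation (%om. real (renewal_count \<tau> (grid N m) om)) - expectation (%om. real (renewal_count \<tau> (grid N 0) om))"
  unfolding cell_mean_def by (rule sum_lessThan_telescope)
 then show ?thesis by simp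
qed

lemma cell_mean_nonneg: "0 <= cell_mean N l"
proof -
 have "expectation (%om. real (renewal_count \<tau> (grid N l) om)) <= expectation (%om. real (renewal_count \<tau> (grid N (Suc l)) om))"
 proof (rule integral_mono_AE)
  show "AE om in M. real (renewal_count \<tau> (grid N l) om) <= real (renewal_count \<tau> (grid N (Suc l)) om)"
   using AE_renewal_count_mono by eventually_elim (simp add: grid_mono)
 qed (auto intro!: renewal_count_integrable)
 then show ?thesis by (simp add: cell_mean_def)
qed

lemma sum_cell_weight_sq_le:
 "(\<Sum>i=1..K. expectation (%om. (cell_weight N m a i om)^2)) <= (\<Sum>l<m. (a l)^2 * cell_mean N l)"
proof -
 have int: "integrable M (%om. (cell_weight N m a i om)^2)" for i
 proof (rule integrable_const_bound[of _ "(\<Sum>l<m. \<bar>a l\<bar>)^2"])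
  show "AE om in M. norm ((cell_weight N m a i om)^2) <= (\<Sum>l<m. \<bar>a l\<bar>)^2"
   using abs_cell_weight_le by (intro AE_I2) (simp add: power2_le_iff_abs_le sum_nonneg)
 qed simp
 have intc: "integrable M (%om. (a l)^2 * (real (renewal_count \<tau> (grid N (Suc l)) om) - real (renewal_count \<tau> (grid N l) om)))" for l
  by (intro integrable_mult_right Bochner_Integration.integrable_diff renewal_count_integrable) auto
 have "(\<Sum>i=1..K. expectation (%om. (cell_weight N m a i om)^2)) = expectation (%om. \<Sum>i=1..K. (cell_weight N m a i om)^2)"
  by (rule Bochner_Integration.integral_sum[symmetric]) (rule int)
 also have "\<dots> <= expectation (%om. \<Sum>l<m. (a l)^2 * (real (renewal_count \<tau> (grid N (Suc l)) om) - real (renewal_count \<tau> (grid N l) om)))"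
 proof (rule integral_mono_AE)
  show "AE om in M. (\<Sum>i=1..K. (cell_weight N m a i om)^2) <= (\<Sum>l<m. (a l)^2 * (real (renewal_count \<tau> (grid N (Suc l)) om) - real (renewal_count \<tau> (grid N l) om)))"
   using AE_renewal_count_mono
  proof eventually_elim
   fix om assume mono: "\<forall>s t. s <= t \<longrightarrow> renewal_count \<tau> s om <= renewal_count \<tau> t om"
   have "(\<Sum>i=1..K. (cell_weight N m a i om)^2) = (\<Sum>l<m. (a l)^2 * (\<Sum>i=1..K. cell N l i om))"
    unfolding cell_weight_sq[OF mono] by (subst sum.swap) (simp add: sum_distrib_left)
   also have "\<dots> <= (\<Sum>l<m. (a l)^2 * (real (renewal_count \<tau> (grid N (Suc l)) om) - real (renewal_count \<tau> (grid N l) om)))"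
    by (intro sum_mono mult_left_mono sum_cell_le[OF mono]) simp
   finally show "(\<Sum>i=1..K. (cell_weight N m a i om)^2) <= (\<Sum>l<m. (a l)^2 * (real (renewal_count \<tau> (grid N (Suc l)) om) - real (renewal_count \<tau> (grid N l) om)))" .
  qed
 qed (intro Bochner_Integration.integrable_sum int intc)+
 also have "\<dots> = (\<Sum>l<m. (a l)^2 * cell_mean N l)"
  unfolding cell_mean_def
  by (subst Bochner_Integration.integral_sum[OF intc])
    (simp add: Bochner_Integration.integral_diff renewal_count_integrable)
 finally show ?thesis .
qed

lemma cell_weight_Y_product:
 assumes i: "1 <= i" "1 <= j"
 shows "integrable M (%om. (cell_weight N m a i om * Y i om) * (cell_weight N m a j om * Y j om))"
  and "expectation (%om. (cell_weight N m a i om * Y i om) * (cell_weight N m a j om * Y j om)) =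
    expectation (%om. cell_weight N m a i om * cell_weight N m a j om) * expectation (%om. Y i om * Y j om)"
  and "expectation (%om. cell_weight N m a i om * Y i om) = expectation (cell_weight N m a i) * expectation (Y i)"
proof -
 let ?S = "sigma (space M) (sigma_gen M {1..} Y)"
 have Ym: "1 <= l ==> Y l \<in> borel_measurable ?S" for l by (rule sigma_gen_measurable) simp
 note pair = mutual_pair[of 2 3, simplified]
 have pr: "A \<in> sigma_gen M {0..} (%t om. real (renewal_count \<tau> t om)) ==> B \<in> sigma_gen M {1..} Y ==>
   A \<in> events \<and> B \<in> events \<and> prob (A \<inter> B) = prob A * prob B" for A B
  using mutual_pair[of 2 3 A B] by (simp add: numeral_2_eq_2 numeral_3_eq_3)
 note [measurable] = Y_measurable[OF i(1)] Y_measurable[OF i(2)]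
 have ind: "indep_var borel (%om. cell_weight N m a i om * cell_weight N m a j om) borel (%om. Y i om * Y j om)"
  by (rule indep_var_sigma_gen[OF pr]) (auto simp del: One_nat_def intro!: borel_measurable_times cell_weight_measurable_sigma Ym i)
 have ind1: "indep_var borel (cell_weight N m a i) borel (Y i)"
  by (rule indep_var_sigma_gen[OF pr]) (auto simp del: One_nat_def intro!: cell_weight_measurable_sigma Ym i)
 have int1: "integrable M (%om. cell_weight N m a i om * cell_weight N m a j om)"
  by (rule integrable_const_bound[of _ "(\<Sum>l<m. \<bar>a l\<bar>) * (\<Sum>l<m. \<bar>a l\<bar>)"])
    (auto simp: abs_mult intro!: mult_mono abs_cell_weight_le sum_nonneg)
 have int2: "integrable M (%om. Y i om * Y j om)"
  by (intro integrable_mult_of_squares Y_sq_integrable i) auto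
 have int3: "integrable M (cell_weight N m a i)"
  by (rule integrable_const_bound[of _ "(\<Sum>l<m. \<bar>a l\<bar>)"]) (auto intro!: abs_cell_weight_le)
 have int4: "integrable M (Y i)"
  by (rule integrable_of_square[OF _ Y_sq_integrable]) (use i in auto)
 have eq: "(cell_weight N m a i om * Y i om) * (cell_weight N m a j om * Y j om) =
   (cell_weight N m a i om * cell_weight N m a j om) * (Y i om * Y j om)" for om
  by (simp add: mult_ac)
 show "integrable M (%om. (cell_weight N m a i om * Y i om) * (cell_weight N m a j om * Y j om))"
  unfolding eq by (rule indep_var_integrable[OF ind int1 int2])
 show "expectation (%om. (cell_weight N m a i om * Y i om) * (cell_weight N m a j om * Y j om)) =
    expectation (%om. cell_weight N m a i om * cell_weight N m a j om) * expectation (%om. Y i om * Y j om)"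
  unfolding eq by (rule indep_var_lebesgue_integral[OF ind int1 int2])
 show "expectation (%om. cell_weight N m a i om * Y i om) = expectation (cell_weight N m a i) * expectation (Y i)"
  by (rule indep_var_lebesgue_integral[OF ind1 int3 int4])
qed

text \<open>With the first \<open>K\<close> marks only, all moments are finite sums: weights and
  marks factorise by independence and the marks are orthonormal. Along almost every path the
  sequence in \<open>K\<close> is eventually constant.\<close>

lemma partial_reward_sum:
 defines "C \<equiv> %N m a K om. \<Sum>i=1..K. cell_weight N m a i om * Y i om"
 shows "C N m a K \<in> borel_measurable M"
  and "integrable M (%om. (C N m a K om)^2)"
  and "expectation (%om. (C N m a K om)^2) <= (\<Sum>l<m. (a l)^2 * cell_mean N l)"
  and "expectation (C N m a K) = (\<Sum>i=1..K. expectation (cell_weight N m a i) * expectation (Y i))"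
  and "AE om in M. (%K. C N m a K om) \<longlonglongrightarrow> grid_sum N m a (%t. renewal_reward \<tau> Y t om)"
proof -
 have m: "1 <= i ==> (%om. cell_weight N m a i om * Y i om) \<in> borel_measurable M" for i
  using Y_measurable[of i] by measurable
 have sq: "1 <= i ==> integrable M (%om. (cell_weight N m a i om * Y i om)^2)" for i
  unfolding power2_eq_square by (rule cell_weight_Y_product)
 show "C N m a K \<in> borel_measurable M"
  unfolding C_def using m by (intro borel_measurable_sum) auto
 show "integrable M (%om. (C N m a K om)^2)"
  unfolding C_def by (rule integrable_square_sum) (use m sq in auto)
 have "expectation (%om. (C N m a K om)^2) = (\<Sum>i=1..K. expectation (%om. (cell_weight N m a i om * Y i om)^2))"
  unfolding C_def
  by (rule integral_square_sum_orthogonal) (use m sq in \<open>auto simp: cell_weight_Y_product Y_uncorrelated\<close>)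
 also have "\<dots> = (\<Sum>i=1..K. expectation (%om. (cell_weight N m a i om)^2))"
  by (rule sum.cong[OF refl]) (use Y_2 in \<open>auto simp: power2_eq_square cell_weight_Y_product\<close>)
 also have "\<dots> <= (\<Sum>l<m. (a l)^2 * cell_mean N l)" by (rule sum_cell_weight_sq_le)
 finally show "expectation (%om. (C N m a K om)^2) <= (\<Sum>l<m. (a l)^2 * cell_mean N l)" .
 have "expectation (C N m a K) = (\<Sum>i=1..K. expectation (%om. cell_weight N m a i om * Y i om))"
  unfolding C_def
  by (rule Bochner_Integration.integral_sum) (use integrable_of_square[OF m sq] in auto)
 also have "\<dots> = (\<Sum>i=1..K. expectation (cell_weight N m a i) * expectation (Y i))"
  by (rule sum.cong[OF refl]) (auto simp: cell_weight_Y_product)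
 finally show "expectation (C N m a K) = (\<Sum>i=1..K. expectation (cell_weight N m a i) * expectation (Y i))" .
 show "AE om in M. (%K. C N m a K om) \<longlonglongrightarrow> grid_sum N m a (%t. renewal_reward \<tau> Y t om)"
  using AE_renewal_count_mono
 proof eventually_elim
  fix om assume mono: "\<forall>s t. s <= t \<longrightarrow> renewal_count \<tau> s om <= renewal_count \<tau> t om"
  have "eventually (%K. C N m a K om = grid_sum N m a (%t. renewal_reward \<tau> Y t om)) sequentially"
   using eventually_ge_at_top[of "renewal_count \<tau> (grid N m) om"]
   by eventually_elim (simp add: C_def grid_sum_renewal_reward[OF mono])
  then show "(%K. C N m a K om) \<longlonglongrightarrow> grid_sum N m a (%t. renewal_reward \<tau> Y t om)"
   by (rule tendsto_eventually)
 qed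
qed

text \<open>The bound for the second moment is uniform in \<open>K\<close>, which is what the limit
  of second moments and means requires.\<close>

lemma reward_grid_sum:
 shows "integrable M (%om. (grid_sum N m a (%t. renewal_reward \<tau> Y t om))^2)"
  and "expectation (%om. (grid_sum N m a (%t. renewal_reward \<tau> Y t om))^2) <= (\<Sum>l<m. (a l)^2 * cell_mean N l)"
  and "(%K. \<Sum>i=1..K. expectation (cell_weight N m a i) * expectation (Y i)) \<longlonglongrightarrow>
   expectation (%om. grid_sum N m a (%t. renewal_reward \<tau> Y t om))"
 using LIMSEQ_expectation_L2_bounded[OF partial_reward_sum(1) grid_sum_measurable partial_reward_sum(5) partial_reward_sum(2,3), of N m a]
 unfolding partial_reward_sum(4) by auto

text \<open>The marks \<open>Y i\<close> need not be centred. As they are orthonormal, Bessel's inequality makes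
 their means square summable, and this keeps the mean of the integral small compared with its
 standard deviation.\<close>

lemma sum_Y_mean_sq_le: "(\<Sum>i=1..K. (expectation (Y i))^2) <= 1"
proof -
 let ?P = "%om. \<Sum>i=1..K. expectation (Y i) * Y i om"
 let ?s = "\<Sum>i=1..K. (expectation (Y i))^2"
 have m: "1 <= i ==> (%om. expectation (Y i) * Y i om) \<in> borel_measurable M" for i
  using Y_measurable[of i] by measurable
 have sq: "1 <= i ==> integrable M (%om. (expectation (Y i) * Y i om)^2)" for i
  using Y_sq_integrable[of i] by (simp add: power_mult_distrib)
 have P2: "integrable M (%om. (?P om)^2)"
  by (rule integrable_square_sum) (use m sq in auto)
 have Pm: "?P \<in> borel_measurable M" using m by (intro borel_measurable_sum) auto
 have P1: "integrable M ?P" by (rule integrable_of_square[OF Pm P2])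
 have "expectation (%om. (?P om)^2) = (\<Sum>i=1..K. expectation (%om. (expectation (Y i) * Y i om)^2))"
 proof (rule integral_square_sum_orthogonal)
  fix i j assume ij: "i \<in> {1..K}" "j \<in> {1..K}" "i \<noteq> j"
  have "expectation (%om. (expectation (Y i) * expectation (Y j)) * (Y i om * Y j om)) = 0"
   using ij by (simp add: Y_uncorrelated)
  then show "expectation (%om. expectation (Y i) * Y i om * (expectation (Y j) * Y j om)) = 0"
   by (simp add: mult_ac)
 qed (use m sq in auto)
 then have e2: "expectation (%om. (?P om)^2) = ?s"
  using Y_2 by (simp add: power_mult_distrib)
 have "expectation ?P = (\<Sum>i=1..K. expectation (%om. expectation (Y i) * Y i om))"
  by (rule Bochner_Integration.integral_sum) (use integrable_of_square[OF m sq] in auto)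
 then have e1: "expectation ?P = ?s" by (simp add: power2_eq_square)
 have "0 <= expectation (%om. (1 - ?P om)^2)" by simp
 also have "\<dots> = expectation (%om. 1 - 2 * ?P om + (?P om)^2)"
  by (intro Bochner_Integration.integral_cong refl) (simp add: power2_diff)
 also have "\<dots> = 1 - 2 * ?s + ?s"
  using P1 P2 e1 e2 by (simp add: prob_space del: sum.cl_ivl_Suc)
 finally show ?thesis by simp
qed

text \<open>Finitely many marks contribute at most a constant \<open>B\<close>, uniformly in the
  grid. For the others Cauchy-Schwarz pairs the small tail of the squared means with the second
  moments of the weights.\<close>

lemma reward_mean_bound:
 assumes e: "0 < \<epsilon>"
 obtains B where "0 <= B" and
  "\<And>N m a. (\<And>l. \<bar>a l\<bar> <= 2) ==>
   \<bar>expectation (%om. grid_sum N m a (%t. renewal_reward \<tau> Y t om))\<bar> <=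
    B + \<epsilon> * sqrt (\<Sum>l<m. (a l)^2 * cell_mean N l)"
proof -
 let ?\<mu> = "%i. expectation (Y i)"
 have summ: "summable (%i. (?\<mu> (Suc i))^2)"
 proof (rule summableI_nonneg_bounded[of _ 1])
  fix n show "(\<Sum>i<n. (?\<mu> (Suc i))^2) <= 1"
   using sum_Y_mean_sq_le[of n] by (simp add: sum.shift_bounds_cl_Suc_ivl[symmetric] lessThan_atLeast0 atLeastLessThanSuc_atLeastAtMost sum.atLeast1_atMost_eq)
 qed simp
 \<comment> \<open>\<open>I0\<close> comes from the Cauchy criterion for the squared means at level
   \<open>\<epsilon>^2\<close>; the index is shifted because marks are numbered from 1.\<close>
 obtain I0 where I0: "\<And>k. (\<Sum>i\<in>{I0..<k}. (?\<mu> (Suc i))^2) < \<epsilon>^2"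
 proof -
  obtain I0 where "\<forall>m\<ge>I0. \<forall>n. norm (\<Sum>i\<in>{m..<n}. (?\<mu> (Suc i))^2) < \<epsilon>^2"
   using summable_Cauchy[THEN iffD1, OF summ] e by (meson zero_less_power)
  then show ?thesis using that[of I0] by (auto simp: sum_nonneg)
 qed
 define B where "B = (\<Sum>i<I0. 2 * \<bar>?\<mu> (Suc i)\<bar>)"
 show ?thesis
 proof (rule that[of B])
  show "0 <= B" by (auto simp: B_def intro!: sum_nonneg)
  fix N m and a :: "nat => real" assume a: "\<And>l. \<bar>a l\<bar> <= 2"
  let ?V = "\<Sum>l<m. (a l)^2 * cell_mean N l"
  let ?\<beta> = "%i. expectation (cell_weight N m a i)"
  have V: "0 <= ?V" by (intro sum_nonneg mult_nonneg_nonneg cell_mean_nonneg) auto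
  \<comment> \<open>A weight is a single value \<open>a l\<close> or 0, so 2 bounds it whatever the
    number of cells; the crude bound by the sum of all \<open>\<bar>a l\<bar>\<close> would grow
    with the grid.\<close>
  have b2: "\<bar>?\<beta> i\<bar> <= 2" for i
  proof -
   have "AE om in M. (cell_weight N m a i om)^2 <= 4"
    using AE_renewal_count_mono
   proof eventually_elim
    fix om assume mono: "\<forall>s t. s <= t \<longrightarrow> renewal_count \<tau> s om <= renewal_count \<tau> t om"
    have "(cell_weight N m a i om)^2 = (\<Sum>l<m. (a l)^2 * cell N l i om)" by (rule cell_weight_sq[OF mono])
    also have "\<dots> <= (\<Sum>l<m. 4 * cell N l i om)"
     using a abs_le_square_iff[of "a _" 2] by (intro sum_mono mult_right_mono) (auto simp: cell_def)
    also have "\<dots> = 4 * cell_weight N m (%_. 1) i om" by (simp add: cell_weight_def sum_distrib_left)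
    also have "cell_weight N m (%_. 1) i om <= 1"
    proof -
     have "(cell_weight N m (%_. 1) i om)^2 = cell_weight N m (%_. 1) i om"
      unfolding cell_weight_sq[OF mono] by (simp add: cell_weight_def)
     then have "cell_weight N m (%_. 1) i om = 0 \<or> cell_weight N m (%_. 1) i om = 1"
      by (simp add: power2_eq_square)
     then show ?thesis by auto
    qed
    finally show "(cell_weight N m a i om)^2 <= 4" by simp
   qed
   then have "AE om in M. \<bar>cell_weight N m a i om\<bar> <= 2"
    by eventually_elim (use abs_le_square_iff[of _ "2::real"] in auto)
   moreover have "integrable M (cell_weight N m a i)"
    by (rule integrable_const_bound[of _ "(\<Sum>l<m. \<bar>a l\<bar>)"]) (auto intro!: abs_cell_weight_le)
   ultimately have "expectation (%om. \<bar>cell_weight N m a i om\<bar>) <= expectation (%om. 2)"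
    by (intro integral_mono_AE integrable_abs) auto
   then have "expectation (%om. \<bar>cell_weight N m a i om\<bar>) <= 2" by (simp add: prob_space)
   then show ?thesis by (rule order_trans[OF integral_abs_bound])
  qed
  have \<beta>2: "(\<Sum>i=1..K. (?\<beta> i)^2) <= ?V" for K
  proof -
   have "(?\<beta> i)^2 <= expectation (%om. (cell_weight N m a i om)^2)" for i
   proof -
    have i1: "integrable M (cell_weight N m a i)"
     by (rule integrable_const_bound[of _ "(\<Sum>l<m. \<bar>a l\<bar>)"]) (auto intro!: abs_cell_weight_le)
    have i2: "integrable M (%om. (cell_weight N m a i om)^2)"
     by (rule integrable_const_bound[of _ "(\<Sum>l<m. \<bar>a l\<bar>)^2"])
       (use abs_cell_weight_le in \<open>auto simp: power2_le_iff_abs_le sum_nonneg\<close>)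
    have "0 <= variance (cell_weight N m a i)" by simp
    then show ?thesis by (simp add: variance_eq[OF i1 i2])
   qed
   then show ?thesis by (intro order_trans[OF sum_mono sum_cell_weight_sq_le])
  qed
  have bound: "\<bar>\<Sum>i=1..K. ?\<beta> i * ?\<mu> i\<bar> <= B + \<epsilon> * sqrt ?V" for K
  proof -
   have split: "(\<Sum>i=1..K. ?\<beta> i * ?\<mu> i) = (\<Sum>i<min I0 K. ?\<beta> (Suc i) * ?\<mu> (Suc i)) + (\<Sum>i\<in>{min I0 K..<K}. ?\<beta> (Suc i) * ?\<mu> (Suc i))"
   proof -
    have "(\<Sum>i=1..K. ?\<beta> i * ?\<mu> i) = (\<Sum>i<K. ?\<beta> (Suc i) * ?\<mu> (Suc i))"
     by (simp add: sum.atLeast1_atMost_eq)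
    also have "\<dots> = (\<Sum>i\<in>{..<min I0 K} \<union> {min I0 K..<K}. ?\<beta> (Suc i) * ?\<mu> (Suc i))"
     by (rule sum.cong) auto
    finally show ?thesis by (subst (asm) sum.union_disjoint) auto
   qed
   have "\<bar>\<Sum>i<min I0 K. ?\<beta> (Suc i) * ?\<mu> (Suc i)\<bar> <= (\<Sum>i<min I0 K. 2 * \<bar>?\<mu> (Suc i)\<bar>)"
    by (rule order_trans[OF sum_abs sum_mono]) (auto simp: abs_mult intro!: mult_right_mono b2)
   also have "\<dots> <= B" unfolding B_def by (rule sum_mono2) auto
   finally have 1: "\<bar>\<Sum>i<min I0 K. ?\<beta> (Suc i) * ?\<mu> (Suc i)\<bar> <= B" .
   let ?J = "{min I0 K..<K}"
   have "(\<Sum>i\<in>?J. ?\<beta> (Suc i) * ?\<mu> (Suc i))^2 <= (\<Sum>i\<in>?J. (?\<beta> (Suc i))^2) * (\<Sum>i\<in>?J. (?\<mu> (Suc i))^2)"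
    by (rule Cauchy_Schwarz_ineq_sum)
   also have "\<dots> <= ?V * \<epsilon>^2"
   proof (rule mult_mono)
    have "(\<Sum>i\<in>?J. (?\<beta> (Suc i))^2) <= (\<Sum>i<K. (?\<beta> (Suc i))^2)" by (rule sum_mono2) auto
    also have "\<dots> <= ?V" using \<beta>2[of K] by (simp add: sum.atLeast1_atMost_eq)
    finally show "(\<Sum>i\<in>?J. (?\<beta> (Suc i))^2) <= ?V" .
    show "(\<Sum>i\<in>?J. (?\<mu> (Suc i))^2) <= \<epsilon>^2"
     using I0[of K] by (cases "I0 <= K") (auto simp: min_def)
   qed (use V in \<open>auto intro!: sum_nonneg\<close>)
   finally have "\<bar>\<Sum>i\<in>?J. ?\<beta> (Suc i) * ?\<mu> (Suc i)\<bar> <= sqrt (?V * \<epsilon>^2)"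
    by (simp add: real_le_rsqrt)
   then have "\<bar>\<Sum>i\<in>?J. ?\<beta> (Suc i) * ?\<mu> (Suc i)\<bar> <= \<epsilon> * sqrt ?V"
    using e by (simp add: real_sqrt_mult mult.commute)
   then show ?thesis unfolding split using 1 by linarith
  qed
  show "\<bar>expectation (%om. grid_sum N m a (%t. renewal_reward \<tau> Y t om))\<bar> <= B + \<epsilon> * sqrt ?V"
   by (rule LIMSEQ_le_const2[OF tendsto_rabs[OF reward_grid_sum(3)]]) (use bound in auto)
 qed
qed

end

section \<open>Grid sums and jumps of cadlag paths\<close>

text \<open>The bridge from continuous test functions to indicators: multiples of the distance to
  the complement, cut at 1. The whole line is treated apart because \<open>infdist\<close> to the
  empty set is 0.\<close>

lemma open_indicator_limit:
 fixes S :: "real set"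
 assumes "open S"
 obtains g :: "nat => real => real" where "\<And>i. continuous_on UNIV (g i)" "\<And>i x. 0 <= g i x" "\<And>i x. g i x <= 1"
  "\<And>x. (%i. g i x) \<longlonglongrightarrow> indicator S x" "\<And>i x. x \<notin> S ==> g i x = 0"
proof (cases "S = UNIV")
 case True
 then show ?thesis by (intro that[of "%_ _. 1"]) auto
next
 case False
 let ?C = "- S"
 have C: "closed ?C" "?C \<noteq> {}" using False assms by auto
 have lim: "(%i. min 1 (real i * infdist y ?C)) \<longlonglongrightarrow> indicator S y" for y
 proof (cases "y \<in> ?C")
  case True then show ?thesis by simp
 next
  case False
  then have pos: "0 < infdist y ?C"
   using in_closed_iff_infdist_zero[OF C] infdist_nonneg[of y ?C] by (auto simp: less_le)
  have "eventually (%i. min 1 (real i * infdist y ?C) = 1) sequentially"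
   using eventually_ge_at_top[of "nat \<lceil>1 / infdist y ?C\<rceil>"]
  proof eventually_elim
   fix i assume "nat \<lceil>1 / infdist y ?C\<rceil> <= i"
   then have "1 / infdist y ?C <= real i" by (simp add: nat_ceiling_le_eq)
   then show "min 1 (real i * infdist y ?C) = 1" using pos by (simp add: pos_divide_le_eq)
  qed
  then show ?thesis using False by (simp add: tendsto_eventually)
 qed
 show ?thesis
  by (rule that[of "%i y. min 1 (real i * infdist y ?C)"])
    (use lim in \<open>auto intro!: continuous_intros mult_nonneg_nonneg infdist_nonneg\<close>)
qed

definition path_jump :: "(real => real) => real => real" where
 "path_jump x s = x s - Lim (at_left s) x"

text \<open>On either side of \<open>s\<close> the path is almost constant near \<open>s\<close>,
  and across \<open>s\<close> it changes by about the jump. The disjunction in the second clause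
  says that both points lie on the same side, \<open>s\<close> itself counting as right.\<close>

lemma cadlag_local:
 assumes x: "cadlag_on {0..} x" and s: "0 <= s" and d: "0 < d"
 obtains r where "0 < r"
  and "\<And>u v. 0 <= u ==> u <= v ==> \<bar>u - s\<bar> < r ==> \<bar>v - s\<bar> < r ==> s <= u \<or> v < s ==> \<bar>x v - x u\<bar> < d"
  and "\<And>u v. 0 <= u ==> u < s ==> s <= v ==> \<bar>u - s\<bar> < r ==> \<bar>v - s\<bar> < r ==> \<bar>x v - x u - path_jump x s\<bar> < d"
proof -
 have right: "(x \<longlongrightarrow> x s) (at s within {0..} \<inter> {s<..})"
  and left: "\<exists>l. (x \<longlongrightarrow> l) (at s within {0..} \<inter> {..<s})"
  using x s by (auto simp: cadlag_on_def)
 obtain r1 where r1: "0 < r1" "\<And>v. s < v ==> \<bar>v - s\<bar> < r1 ==> \<bar>x v - x s\<bar> < d / 2"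
  using tendstoD[OF right, of "d / 2"] d s
  by (auto simp: eventually_at dist_real_def)
 obtain l r2 where r2: "0 < r2" "\<And>u. 0 <= u ==> u < s ==> \<bar>u - s\<bar> < r2 ==> \<bar>x u - l\<bar> < d / 2"
  and l: "0 < s ==> Lim (at_left s) x = l"
 proof -
  from left obtain l where l: "(x \<longlongrightarrow> l) (at s within {0..} \<inter> {..<s})" by blast
  obtain r2 where "0 < r2" "\<And>u. 0 <= u ==> u < s ==> \<bar>u - s\<bar> < r2 ==> \<bar>x u - l\<bar> < d / 2"
   using tendstoD[OF l, of "d / 2"] d s by (auto simp: eventually_at dist_real_def)
  moreover have "Lim (at_left s) x = l" if "0 < s"
  proof (rule tendsto_Lim)
   have "at s within {0..} \<inter> {..<s} = at_left s"
    by (rule at_within_nhd[of s "{0<..}"]) (use that in auto)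
   then show "(x \<longlongrightarrow> l) (at_left s)" using l by simp
  qed simp
  ultimately show ?thesis using that by blast
 qed
 have R: "\<bar>x v - x s\<bar> < d / 2" if "s <= v" "\<bar>v - s\<bar> < r1" for v
  using r1(2)[of v] that d by (cases "v = s") auto
 show ?thesis
 proof (rule that[of "min r1 r2"])
  show "0 < min r1 r2" using r1 r2 by simp
  fix u v assume uv: "0 <= u" "u <= v" "\<bar>u - s\<bar> < min r1 r2" "\<bar>v - s\<bar> < min r1 r2" "s <= u \<or> v < s"
  show "\<bar>x v - x u\<bar> < d"
  proof (cases "s <= u")
   case True
   have "\<bar>x v - x s\<bar> < d / 2" by (rule R) (use uv True in auto)
   moreover have "\<bar>x u - x s\<bar> < d / 2" by (rule R) (use uv True in auto)
   ultimately show ?thesis by linarith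
  next
   case False
   have "\<bar>x v - l\<bar> < d / 2" by (rule r2) (use uv False in auto)
   moreover have "\<bar>x u - l\<bar> < d / 2" by (rule r2) (use uv False in auto)
   ultimately show ?thesis by linarith
  qed
 next
  fix u v assume uv: "0 <= u" "u < s" "s <= v" "\<bar>u - s\<bar> < min r1 r2" "\<bar>v - s\<bar> < min r1 r2"
  have "\<bar>x v - x s\<bar> < d / 2" by (rule R) (use uv in auto)
  moreover have "\<bar>x u - l\<bar> < d / 2" by (rule r2) (use uv in auto)
  ultimately show "\<bar>x v - x u - path_jump x s\<bar> < d"
   using l uv unfolding path_jump_def by linarith
 qed
qed

text \<open>Compactness of the unit interval applied to the local description: finitely many
  neighbourhoods suffice, and large jumps can occur only at their centres.\<close>

lemma cadlag_uniform:
 assumes x: "cadlag_on {0..} x" and d: "0 < d"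
 obtains \<rho> where "0 < \<rho>" and "finite {s\<in>{0<..1}. d < \<bar>path_jump x s\<bar>}"
  and "\<And>u v. 0 <= u ==> u <= v ==> v <= 1 ==> v - u < \<rho> ==>
     (\<And>s. u < s ==> s <= v ==> \<bar>path_jump x s\<bar> <= d) ==> \<bar>x v - x u\<bar> < 2 * d"
proof -
 define P where "P s r \<longleftrightarrow> 0 < r \<and>
   (\<forall>u v. 0 <= u \<longrightarrow> u <= v \<longrightarrow> \<bar>u - s\<bar> < r \<longrightarrow> \<bar>v - s\<bar> < r \<longrightarrow> s <= u \<or> v < s \<longrightarrow> \<bar>x v - x u\<bar> < d) \<and>
   (\<forall>u v. 0 <= u \<longrightarrow> u < s \<longrightarrow> s <= v \<longrightarrow> \<bar>u - s\<bar> < r \<longrightarrow> \<bar>v - s\<bar> < r \<longrightarrow> \<bar>x v - x u - path_jump x s\<bar> < d)" for s r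
 have "\<exists>r. P s r" if "s \<in> {0..1}" for s
  by (rule cadlag_local[OF x _ d, of s]) (use that in \<open>auto simp: P_def intro!: exI\<close>)
 then have "\<forall>s\<in>{0..1}. \<exists>r. P s r" by blast
 from bchoice[OF this] obtain r where Pr: "\<forall>s\<in>{0..1}. P s (r s)" by blast
 have r: "\<And>s. s \<in> {0..1} ==> 0 < r s"
  and same: "\<And>s u v. s \<in> {0..1} ==> 0 <= u ==> u <= v ==> \<bar>u - s\<bar> < r s ==> \<bar>v - s\<bar> < r s ==> s <= u \<or> v < s ==> \<bar>x v - x u\<bar> < d"
  and across: "\<And>s u v. s \<in> {0..1} ==> 0 <= u ==> u < s ==> s <= v ==> \<bar>u - s\<bar> < r s ==> \<bar>v - s\<bar> < r s ==> \<bar>x v - x u - path_jump x s\<bar> < d"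
  using Pr unfolding P_def by blast+
 have cover: "{0..1} \<subseteq> (\<Union>s\<in>{0..1}. ball s (r s / 2))" using r by force
 obtain F where F: "F \<subseteq> {0..1}" "finite F" "{0..1} \<subseteq> (\<Union>s\<in>F. ball s (r s / 2))"
  using compactE_image[OF compact_Icc _ cover] by (metis open_ball)
 \<comment> \<open>Covering by balls of half the radius makes \<open>\<rho>\<close> a Lebesgue
   number: if one point lies in a half ball, every point within \<open>\<rho>\<close> of it lies in
   the full ball.\<close>
 define \<rho> where "\<rho> = Min (insert 1 ((%s. r s / 2) ` F))"
 have \<rho>: "0 < \<rho>" unfolding \<rho>_def using F r by (subst Min_gr_iff) auto
 have \<rho>_le: "s \<in> F ==> \<rho> <= r s / 2" for s unfolding \<rho>_def using F by (intro Min_le) auto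
 \<comment> \<open>Suppose \<open>t\<close> is not a centre but carries a jump above
   \<open>d\<close>. A point \<open>u\<close> just left of \<open>t\<close> lies with
   \<open>t\<close> on the same side of the centre, so the increment is below \<open>d\<close>; it
   is also within \<open>e\<close> of the jump, a contradiction.\<close>
 have fin: "finite {s\<in>{0<..1}. d < \<bar>path_jump x s\<bar>}"
 proof (rule finite_subset[OF _ F(2)], rule subsetI, rule ccontr)
  fix t assume t: "t \<in> {s\<in>{0<..1}. d < \<bar>path_jump x s\<bar>}" and nF: "t \<notin> F"
  have "t \<in> {0..1}" using t by auto
  then obtain s where "s \<in> F" "t \<in> ball s (r s / 2)" using F(3) by blast
  moreover have "0 < r s" using r F(1) \<open>s \<in> F\<close> by blast
  ultimately have s: "s \<in> F" "\<bar>t - s\<bar> < r s" by (auto simp: dist_real_def abs_minus_commute)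
  define e where "e = (\<bar>path_jump x t\<bar> - d) / 2"
  have e: "0 < e" using t by (simp add: e_def)
  obtain r' where r': "0 < r'" "\<And>u v. 0 <= u ==> u < t ==> t <= v ==> \<bar>u - t\<bar> < r' ==> \<bar>v - t\<bar> < r' ==> \<bar>x v - x u - path_jump x t\<bar> < e"
   using cadlag_local[OF x _ e, of t] t by (metis (no_types, lifting) greaterThanAtMost_iff less_imp_le mem_Collect_eq)
  have ts: "t \<noteq> s" using s nF by auto
  define g where "g = Min {t, r', r s - \<bar>t - s\<bar>, \<bar>t - s\<bar>}"
  have g: "0 < g" "g <= t" "g <= r'" "g <= r s - \<bar>t - s\<bar>" "g <= \<bar>t - s\<bar>"
   using t r' s ts unfolding g_def by (subst Min_gr_iff, auto)
  define u where "u = t - g / 2"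
  have u: "0 <= u" "u < t" "\<bar>u - t\<bar> < r'" "\<bar>u - s\<bar> < r s" "s <= u \<or> t < s"
   using g s ts unfolding u_def by (auto simp: abs_if split: if_splits)
  have "\<bar>x t - x u\<bar> < d"
   using same[of s u t] u s F(1) by auto
  moreover have "\<bar>x t - x u - path_jump x t\<bar> < e" using r' u by auto
  ultimately show False using e unfolding e_def by (simp add: abs_if split: if_splits)
 qed
 show ?thesis
 proof (rule that[OF \<rho> fin])
  fix u v assume uv: "0 <= u" "u <= v" "v <= 1" "v - u < \<rho>" and small: "\<And>s. u < s ==> s <= v ==> \<bar>path_jump x s\<bar> <= d"
  have "u \<in> {0..1}" using uv by auto
  then obtain s where "s \<in> F" "u \<in> ball s (r s / 2)" using F(3) by blast
  then have s: "s \<in> F" "\<bar>u - s\<bar> < r s / 2" by (simp_all add: dist_real_def abs_minus_commute)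
  have us: "\<bar>u - s\<bar> < r s" "\<bar>v - s\<bar> < r s" using s uv \<rho>_le[OF s(1)] by linarith+
  have s01: "s \<in> {0..1}" using s F by auto
  show "\<bar>x v - x u\<bar> < 2 * d"
  proof (cases "s <= u \<or> v < s")
   case True
   then show ?thesis using same[OF s01 uv(1,2) us True] d by simp
  next
   case False
   then have "\<bar>x v - x u - path_jump x s\<bar> < d" "\<bar>path_jump x s\<bar> <= d"
    using across[OF s01 uv(1) _ _ us] small[of s] by auto
   then show ?thesis by linarith
  qed
 qed
qed

text \<open>Cells are open on the left and closed on the right, so the index is the ceiling minus
  one.\<close>

definition cell_index :: "nat => real => nat" where
 "cell_index n s = nat (\<lceil>real n * s\<rceil> - 1)"

lemma cell_index:
 assumes n: "1 <= n" and s: "0 < s"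
 shows "grid n (cell_index n s) < s" "s <= grid n (Suc (cell_index n s))"
  and "real l < real n * s ==> l <= cell_index n s" and "real n * s <= real l ==> cell_index n s < l"
  and "grid n l < s ==> s <= grid n (Suc l) ==> cell_index n s = l"
proof -
 have ns: "0 < real n * s" using n s by simp
 then have c: "1 <= \<lceil>real n * s\<rceil>" by (simp add: one_le_ceiling)
 then have ri: "real (cell_index n s) = real_of_int \<lceil>real n * s\<rceil> - 1" by (simp add: cell_index_def)
 then have lt: "real (cell_index n s) < real n * s" "real n * s <= real (cell_index n s) + 1" by linarith+
 show "grid n (cell_index n s) < s" "s <= grid n (Suc (cell_index n s))"
  using lt n by (auto simp: grid_def field_simps)
 show A: "real l < real n * s ==> l <= cell_index n s" and B: "real n * s <= real l ==> cell_index n s < l" for l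
  using lt by linarith+
 show "grid n l < s ==> s <= grid n (Suc l) ==> cell_index n s = l"
  using A[of l] B[of "Suc l"] n by (auto simp: grid_def field_simps)
qed

text \<open>Eventually the large jumps lie in different fine cells, whose increments converge to
  them, while every other increment is below \<open>2 * d\<close>, where \<open>f\<close> vanishes.
  Refining by multiples of \<open>m\<close> keeps each coarse cell a union of fine ones.\<close>

lemma LIMSEQ_grid_sum_jumps:
 fixes f :: "real => real"
 assumes x: "cadlag_on {0..} x" and d: "0 < d" and m: "1 <= m" and i: "i < m"
  and f: "continuous_on UNIV f" and f0: "\<And>y. \<bar>y\<bar> <= 2 * d ==> f y = 0"
 shows "(%q. \<Sum>l\<in>{i * Suc q..<Suc i * Suc q}. f (x (grid (m * Suc q) (Suc l)) - x (grid (m * Suc q) l))) \<longlonglongrightarrow>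
  (\<Sum>s | s \<in> {0<..1} \<and> d < \<bar>path_jump x s\<bar> \<and> s \<in> {grid m i<..grid m (Suc i)}. f (path_jump x s))"
proof -
 let ?J = "{s. s \<in> {0<..1} \<and> d < \<bar>path_jump x s\<bar> \<and> s \<in> {grid m i<..grid m (Suc i)}}"
 let ?n = "%q. m * Suc q"
 let ?D = "%q l. x (grid (?n q) (Suc l)) - x (grid (?n q) l)"
 obtain \<rho> where \<rho>: "0 < \<rho>" and fin: "finite {s\<in>{0<..1}. d < \<bar>path_jump x s\<bar>}"
  and small: "\<And>u v. 0 <= u ==> u <= v ==> v <= 1 ==> v - u < \<rho> ==>
     (\<And>s. u < s ==> s <= v ==> \<bar>path_jump x s\<bar> <= d) ==> \<bar>x v - x u\<bar> < 2 * d"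
  by (rule cadlag_uniform[OF x d]) blast
 have finJ: "finite ?J" by (rule finite_subset[OF _ fin]) auto
 have n1: "1 <= ?n q" for q using m by simp
 have inv0: "(%q. 1 / real (?n q)) \<longlonglongrightarrow> 0"
 proof (rule real_tendsto_sandwich[where f = "%_. 0" and h = "%q. 1 / real (Suc q)"])
  show "(%q. 1 / real (Suc q)) \<longlonglongrightarrow> 0" by (rule LIMSEQ_Suc[OF lim_1_over_n])
  show "\<forall>\<^sub>F q in sequentially. 1 / real (?n q) <= 1 / real (Suc q)"
  proof (rule always_eventually, rule allI)
   fix q
   have "1 * Suc q <= m * Suc q" using m by (rule mult_le_mono1)
   then have "real (Suc q) <= real (?n q)" by (simp only: of_nat_le_iff) simp
   then show "1 / real (?n q) <= 1 / real (Suc q)" by (intro divide_left_mono) (use n1[of q] in auto)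
  qed
 qed auto
 have lim_s: "(%q. f (?D q (cell_index (?n q) s))) \<longlonglongrightarrow> f (path_jump x s)" if s: "s \<in> ?J" for s
 proof -
  have s0: "0 < s" using s by simp
  have "(%q. ?D q (cell_index (?n q) s)) \<longlonglongrightarrow> path_jump x s"
  proof (rule LIMSEQ_I)
   fix e :: real assume e: "0 < e"
   obtain r where r: "0 < r" "\<And>u v. 0 <= u ==> u < s ==> s <= v ==> \<bar>u - s\<bar> < r ==> \<bar>v - s\<bar> < r ==> \<bar>x v - x u - path_jump x s\<bar> < e"
    using cadlag_local[OF x _ e, of s] s0 by (metis less_imp_le)
   obtain q0 where q0: "\<And>q. q0 <= q ==> 1 / real (?n q) < r"
    using order_tendstoD(2)[OF inv0 r(1)] by (auto simp: eventually_sequentially)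
   show "\<exists>q0. \<forall>q\<ge>q0. norm (?D q (cell_index (?n q) s) - path_jump x s) < e"
   proof (intro exI allI impI)
    fix q assume "q0 <= q"
    note ci = cell_index(1,2)[OF n1[of q] s0]
    show "norm (?D q (cell_index (?n q) s) - path_jump x s) < e"
     unfolding real_norm_def
     by (rule r(2)) (use ci q0[OF \<open>q0 <= q\<close>] grid_Suc[of "?n q" "cell_index (?n q) s"] in \<open>auto simp del: mult_Suc_right of_nat_mult\<close>)
   qed
  qed
  moreover have "isCont f (path_jump x s)" using f by (simp add: continuous_on_eq_continuous_at)
  ultimately show ?thesis by (rule isCont_tendsto_compose[rotated])
 qed
 have "eventually (%q. inj_on (cell_index (?n q)) ?J) sequentially"
 proof -
  have "eventually (%q. \<forall>s\<in>?J. \<forall>s'\<in>?J. s < s' \<longrightarrow> 1 / real (?n q) < s' - s) sequentially"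
  proof (intro eventually_ball_finite finJ ballI)
   fix s s' assume "s \<in> ?J" "s' \<in> ?J"
   show "eventually (%q. s < s' \<longrightarrow> 1 / real (?n q) < s' - s) sequentially"
    by (cases "s < s'") (use order_tendstoD(2)[OF inv0, of "s' - s"] in auto)
  qed
  then show ?thesis
  proof eventually_elim
   fix q assume sep: "\<forall>s\<in>?J. \<forall>s'\<in>?J. s < s' \<longrightarrow> 1 / real (?n q) < s' - s"
   have no: "cell_index (?n q) s \<noteq> cell_index (?n q) s'" if "s \<in> ?J" "s' \<in> ?J" "s < s'" for s s'
   proof
    assume eq: "cell_index (?n q) s = cell_index (?n q) s'"
    have "grid (?n q) (cell_index (?n q) s) < s" "s' <= grid (?n q) (Suc (cell_index (?n q) s))"
     using cell_index(1)[OF n1[of q], of s] cell_index(2)[OF n1[of q], of s'] that eq by auto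
    then have "s' - s < 1 / real (?n q)" unfolding grid_Suc by linarith
    then show False using sep that by fastforce
   qed
   show "inj_on (cell_index (?n q)) ?J"
   proof (rule inj_onI, rule ccontr)
    fix s s' assume *: "s \<in> ?J" "s' \<in> ?J" "cell_index (?n q) s = cell_index (?n q) s'" "s \<noteq> s'"
    then consider "s < s'" | "s' < s" by linarith
    then show False by cases (use no[of s s'] no[of s' s] * in simp_all)
   qed
  qed
 qed
 moreover have "eventually (%q. 1 / real (?n q) < \<rho>) sequentially" by (rule order_tendstoD(2)[OF inv0 \<rho>])
 ultimately have "eventually (%q. (\<Sum>s\<in>?J. f (?D q (cell_index (?n q) s))) = (\<Sum>l\<in>{i * Suc q..<Suc i * Suc q}. f (?D q l))) sequentially"
 proof eventually_elim
  fix q assume inj: "inj_on (cell_index (?n q)) ?J" and fine: "1 / real (?n q) < \<rho>"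
  have sub: "cell_index (?n q) ` ?J \<subseteq> {i * Suc q..<Suc i * Suc q}"
  proof
   fix l assume "l \<in> cell_index (?n q) ` ?J"
   then obtain s where s: "s \<in> ?J" "l = cell_index (?n q) s" by auto
   have s0: "0 < s" using s by simp
   have mm: "0 < real m" using m by simp
   have "real i < s * real m" "s * real m <= real (Suc i)"
    using s mm by (auto simp: grid_def pos_divide_less_eq pos_le_divide_eq)
   then have "real i * real (Suc q) < s * real m * real (Suc q)" "s * real m * real (Suc q) <= real (Suc i) * real (Suc q)"
    by (intro mult_strict_right_mono mult_right_mono; simp)+
   then have "real (i * Suc q) < real (?n q) * s" "real (?n q) * s <= real (Suc i * Suc q)"
    by (simp_all only: of_nat_mult mult_ac)
   then show "l \<in> {i * Suc q..<Suc i * Suc q}"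
    using cell_index(3,4)[OF n1[of q] s0] s(2) by simp
  qed
  have "(\<Sum>s\<in>?J. f (?D q (cell_index (?n q) s))) = (\<Sum>l\<in>cell_index (?n q) ` ?J. f (?D q l))"
   by (rule sum.reindex[OF inj, unfolded o_def, symmetric])
  also have "\<dots> = (\<Sum>l\<in>{i * Suc q..<Suc i * Suc q}. f (?D q l))"
  proof (rule sum.mono_neutral_left[OF _ sub], simp, rule ballI)
   fix l assume l: "l \<in> {i * Suc q..<Suc i * Suc q} - cell_index (?n q) ` ?J"
   have lm: "Suc l <= ?n q"
   proof -
    have "Suc l <= Suc i * Suc q" using l by auto
    also have "\<dots> <= m * Suc q" using i by (intro mult_le_mono1) simp
    finally show ?thesis .
   qed
   have g1: "grid (?n q) (Suc l) <= 1" 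
   proof -
    have "real (Suc l) <= real (?n q)" using lm by (simp only: of_nat_le_iff)
    moreover have "0 < real (?n q)" using n1[of q] by (simp only: of_nat_0_less_iff)
    ultimately show ?thesis unfolding grid_def by (simp only: divide_le_eq_1_pos)
   qed
   have gi: "grid m i <= grid (?n q) l" "grid (?n q) (Suc l) <= grid m (Suc i)"
   proof -
    have "grid (?n q) (i * Suc q) = grid m i" "grid (?n q) (Suc i * Suc q) = grid m (Suc i)"
     unfolding grid_def of_nat_mult by (simp_all del: of_nat_Suc)
    moreover have "grid (?n q) (i * Suc q) <= grid (?n q) l" "grid (?n q) (Suc l) <= grid (?n q) (Suc i * Suc q)"
     using l by (auto intro!: grid_mono)
    ultimately show "grid m i <= grid (?n q) l" "grid (?n q) (Suc l) <= grid m (Suc i)" by simp_all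
   qed
   have "\<bar>?D q l\<bar> < 2 * d"
   proof (rule small)
    show "grid (?n q) l <= grid (?n q) (Suc l)" by (rule grid_mono) simp
    show "grid (?n q) (Suc l) - grid (?n q) l < \<rho>" using fine unfolding grid_Suc by linarith
    fix s assume s: "grid (?n q) l < s" "s <= grid (?n q) (Suc l)"
    have s0: "0 < s" using s(1) grid_nonneg[of "?n q" l] by linarith
    show "\<bar>path_jump x s\<bar> <= d"
    proof (rule ccontr)
     assume "\<not> \<bar>path_jump x s\<bar> <= d"
     then have "s \<in> ?J" using s s0 g1 gi by auto
     moreover have "cell_index (?n q) s = l" by (rule cell_index(5)[OF n1[of q] s0 s])
     ultimately show False using l by auto
    qed
   qed (use g1 in auto)
   then show "f (?D q l) = 0" by (intro f0) simp
  qed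
  finally show "(\<Sum>s\<in>?J. f (?D q (cell_index (?n q) s))) = (\<Sum>l\<in>{i * Suc q..<Suc i * Suc q}. f (?D q l))" .
 qed
 moreover have "(%q. \<Sum>s\<in>?J. f (?D q (cell_index (?n q) s))) \<longlonglongrightarrow> (\<Sum>s\<in>?J. f (path_jump x s))"
  by (rule tendsto_sum[OF lim_s])
 ultimately show ?thesis by (rule Lim_transform_eventually[rotated])
qed

section \<open>Second moments of the Levy part\<close>

definition clip :: "real => real => real" where
 "clip c y = max (- c) (min c y)"

lemma abs_clip_le: "0 <= c ==> \<bar>clip c y\<bar> <= c" "0 <= c ==> \<bar>clip c y\<bar> <= \<bar>y\<bar>"
 by (auto simp: clip_def max_def min_def)

lemma clip_eq: "\<bar>y\<bar> <= c ==> clip c y = y"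
 by (auto simp: clip_def)

lemma tendsto_clip [tendsto_intros]:
 "(f \<longlongrightarrow> a) F ==> (g \<longlongrightarrow> b) F ==> ((%x. clip (f x) (g x)) \<longlongrightarrow> clip a b) F"
 unfolding clip_def by (intro tendsto_intros)

context semi_markov_noise
begin

text \<open>Only unit time is looked at: stationarity and independence of the increments carry the
  moments of \<open>L 1\<close> over to all grids.\<close>

definition big_jumps :: "real => 'a => real set" where
 "big_jumps d om = {s\<in>{0<..1}. d < \<bar>jump L s om\<bar>}"

definition jump_sum :: "real => real set => (real => real) => 'a => real" where
 "jump_sum d A f om = (\<Sum>s\<in>big_jumps d om \<inter> A. f (jump L s om))"

abbreviation "cell_int m i \<equiv> {grid m i<..grid m (Suc i)}"

lemma jump_eq: "jump L s om = path_jump (%t. L t om) s"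
 by (simp add: jump_def path_jump_def)

lemma L_cadlag: "om \<in> space M ==> cadlag_on {0..} (%t. L t om)"
 using levy by (simp add: pure_jump_levy_process_def levy_process_def)

lemma finite_big_jumps:
 assumes "om \<in> space M" "0 < d" shows "finite (big_jumps d om)"
 using cadlag_uniform[OF L_cadlag[OF assms(1)] assms(2)] unfolding big_jumps_def jump_eq by metis

text \<open>The approximation of the jump sum over the \<open>i\<close>-th of \<open>m\<close> cells
  when that cell is cut into \<open>Suc q\<close> pieces. As a function of increments it is
  measurable, and independent over different \<open>i\<close>.\<close>

definition block_sum :: "(real => real) => nat => nat => nat => 'a => real" where
 "block_sum f m q i om = (\<Sum>l\<in>{i * Suc q..<Suc i * Suc q}.
   f (L (grid (m * Suc q) (Suc l)) om - L (grid (m * Suc q) l) om))"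

lemma block_sum_tendsto:
 assumes "om \<in> space M" "0 < d" "i < m" "continuous_on UNIV f" "\<And>y. \<bar>y\<bar> <= 2 * d ==> f y = 0"
 shows "(%q. block_sum f m q i om) \<longlonglongrightarrow> jump_sum d (cell_int m i) f om"
proof -
 have "(%q. block_sum f m q i om) \<longlonglongrightarrow>
   (\<Sum>s | s \<in> {0<..1} \<and> d < \<bar>path_jump (%t. L t om) s\<bar> \<and> s \<in> cell_int m i. f (path_jump (%t. L t om) s))"
  unfolding block_sum_def
  by (rule LIMSEQ_grid_sum_jumps[OF L_cadlag[OF assms(1)]]) (use assms in auto)
 also have "{s. s \<in> {0<..1} \<and> d < \<bar>path_jump (%t. L t om) s\<bar> \<and> s \<in> cell_int m i} = big_jumps d om \<inter> cell_int m i"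
  by (auto simp: big_jumps_def jump_eq)
 finally show ?thesis by (simp add: jump_sum_def jump_eq)
qed

lemma block_sum_measurable [measurable]:
 assumes [measurable]: "f \<in> borel_measurable borel"
 shows "block_sum f m q i \<in> borel_measurable M"
 unfolding block_sum_def by measurable

lemma jump_sum_cell_measurable:
 assumes "0 < d" "i < m" "continuous_on UNIV f" "\<And>y. \<bar>y\<bar> <= 2 * d ==> f y = 0"
 shows "jump_sum d (cell_int m i) f \<in> borel_measurable M"
proof (rule borel_measurable_LIMSEQ_real)
 show "om \<in> space M ==> (%q. block_sum f m q i om) \<longlonglongrightarrow> jump_sum d (cell_int m i) f om" for om
  by (rule block_sum_tendsto) (use assms in auto)
 show "block_sum f m q i \<in> borel_measurable M" for q
  by (intro block_sum_measurable borel_measurable_continuous_onI assms(3))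
qed

lemma jump_sum_UNIV: "jump_sum d UNIV f om = jump_sum d (cell_int 1 0) f om"
 unfolding jump_sum_def by (rule sum.cong) (auto simp: big_jumps_def grid_def)

lemma jump_sum_measurable:
 assumes "0 < d" "continuous_on UNIV f" "\<And>y. \<bar>y\<bar> <= 2 * d ==> f y = 0"
 shows "jump_sum d UNIV f \<in> borel_measurable M"
 using jump_sum_cell_measurable[of d 0 1 f] assms by (simp add: jump_sum_UNIV[abs_def])

lemma sum_jump_sum_cells:
 assumes om: "om \<in> space M" and d: "0 < d" and m: "1 <= m"
 shows "(\<Sum>i<m. jump_sum d (cell_int m i) f om) = jump_sum d UNIV f om"
proof -
 have "big_jumps d om = (\<Union>i\<in>{..<m}. big_jumps d om \<inter> cell_int m i)"
 proof (intro equalityI subsetI)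
  fix s assume s: "s \<in> big_jumps d om"
  then have s01: "0 < s" "s <= 1" by (auto simp: big_jumps_def)
  have "real m * s <= real m" using s01 m by (simp add: mult_left_le)
  then have "cell_index m s < m" by (rule cell_index(4)[OF m s01(1)])
  then show "s \<in> (\<Union>i\<in>{..<m}. big_jumps d om \<inter> cell_int m i)"
   using s cell_index(1,2)[OF m s01(1)] by auto
 qed auto
 moreover have "(\<Sum>s\<in>(\<Union>i\<in>{..<m}. big_jumps d om \<inter> cell_int m i). f (jump L s om)) =
   (\<Sum>i<m. \<Sum>s\<in>big_jumps d om \<inter> cell_int m i. f (jump L s om))"
 proof (rule sum.UNION_disjoint)
  show "\<forall>i\<in>{..<m}. \<forall>j\<in>{..<m}. i \<noteq> j \<longrightarrow> big_jumps d om \<inter> cell_int m i \<inter> (big_jumps d om \<inter> cell_int m j) = {}"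
  proof (intro ballI impI, rule ccontr)
   fix i j assume "i \<noteq> j" "big_jumps d om \<inter> cell_int m i \<inter> (big_jumps d om \<inter> cell_int m j) \<noteq> {}"
   then obtain s where "s \<in> cell_int m i" "s \<in> cell_int m j" "s \<in> big_jumps d om" by blast
   then show False
    using cell_index(5)[OF m, of s i] cell_index(5)[OF m, of s j] \<open>i \<noteq> j\<close> by (auto simp: big_jumps_def)
  qed
 qed (auto simp: finite_big_jumps[OF om d])
 ultimately show ?thesis by (simp add: jump_sum_def)
qed

section \<open>Campbell's formula for jumps above a threshold\<close>

definition jump_kernel :: "real => 'a => real measure" where
 "jump_kernel e om = distr (count_space (big_jumps e om)) borel (%s. jump L s om)"

lemma sets_jump_kernel [simp, measurable_cong]: "sets (jump_kernel e om) = sets borel"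
 and space_jump_kernel [simp]: "space (jump_kernel e om) = UNIV"
 by (simp_all add: jump_kernel_def)

lemma emeasure_jump_kernel:
 assumes "A \<in> sets borel"
 shows "emeasure (jump_kernel e om) A = emeasure (count_space (big_jumps e om)) {s\<in>big_jumps e om. jump L s om \<in> A}"
 unfolding jump_kernel_def
 by (subst emeasure_distr) (use assms in \<open>auto intro!: arg_cong2[where f = emeasure]\<close>)

lemma nn_integral_jump_kernel:
 assumes om: "om \<in> space M" and d: "0 < d" and f: "f \<in> borel_measurable borel" "\<And>y. 0 <= f y"
 shows "(\<integral>\<^sup>+y. ennreal (f y) \<partial>jump_kernel d om) = ennreal (jump_sum d UNIV f om)"
proof -
 have "(\<integral>\<^sup>+y. ennreal (f y) \<partial>jump_kernel d om) = (\<integral>\<^sup>+s. ennreal (f (jump L s om)) \<partial>count_space (big_jumps d om))"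
  unfolding jump_kernel_def by (rule nn_integral_distr) (use f in auto)
 also have "\<dots> = (\<Sum>s\<in>big_jumps d om. ennreal (f (jump L s om)))"
  by (rule nn_integral_count_space_finite[OF finite_big_jumps[OF om d]])
 also have "\<dots> = ennreal (jump_sum d UNIV f om)"
  unfolding jump_sum_def by (simp add: f sum_ennreal)
 finally show ?thesis .
qed

text \<open>Open sets come first, as limits of jump sums of continuous functions; Dynkin's theorem
  extends this to Borel sets. Complements can be taken because a cadlag path has finitely many jumps
  above \<open>e\<close>.\<close>

lemma jump_kernel_measurable:
 assumes e: "0 < e" and A: "A \<in> sets borel"
 shows "(%om. emeasure (jump_kernel e om) A) \<in> borel_measurable M"
proof -
 have open_case: "(%om. emeasure (jump_kernel e om) S) \<in> borel_measurable M" if S: "open S" for S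
 proof -
  define C where "C = - (S \<inter> {y. e < \<bar>y\<bar>})"
  have "open {y::real. e < \<bar>y\<bar>}" by (intro open_Collect_less continuous_intros)
  then have "open (- C)" unfolding C_def using S by (simp add: open_Int)
  then obtain f where f_cont: "\<And>j. continuous_on UNIV (f j)" and f_lim: "\<And>y. (%j. f j y :: real) \<longlonglongrightarrow> indicator (- C) y"
   and f_out: "\<And>j y. y \<notin> - C ==> f j y = 0"
   using open_indicator_limit[of "- C"] by metis
  \<comment> \<open>The threshold \<open>e / 2\<close> is used because the convergence of grid sums
    asks for test functions that vanish up to twice the threshold.\<close>
  have f0: "f j y = 0" if "\<bar>y\<bar> <= 2 * (e / 2)" for j y
   using that by (intro f_out) (simp add: C_def)
  have "(%om. jump_sum (e / 2) UNIV (indicator (- C)) om) \<in> borel_measurable M"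
  proof (rule borel_measurable_LIMSEQ_real)
   show "jump_sum (e / 2) UNIV (f j) \<in> borel_measurable M" for j
    by (rule jump_sum_measurable) (use e f_cont f0 in auto)
   show "(%j. jump_sum (e / 2) UNIV (f j) om) \<longlonglongrightarrow> jump_sum (e / 2) UNIV (indicator (- C)) om" for om
    unfolding jump_sum_def by (intro tendsto_sum f_lim)
  qed
  then have "(%om. ennreal (jump_sum (e / 2) UNIV (indicator (- C)) om)) \<in> borel_measurable M" by simp
  moreover have "emeasure (jump_kernel e om) S = ennreal (jump_sum (e / 2) UNIV (indicator (- C)) om)"
   if om: "om \<in> space M" for om
  proof -
   have "jump_sum (e / 2) UNIV (indicator (- C)) om = jump_sum e UNIV (indicator S) om"
    unfolding jump_sum_def Int_UNIV_right
    by (rule sum.mono_neutral_cong_right[OF finite_big_jumps[OF om]])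
      (use e in \<open>auto simp: big_jumps_def C_def indicator_def\<close>)
   moreover have "emeasure (jump_kernel e om) S = ennreal (jump_sum e UNIV (indicator S) om)"
    using nn_integral_jump_kernel[OF om e, of "indicator S"] S by (simp add: ennreal_indicator)
   ultimately show ?thesis by simp
  qed
  ultimately show ?thesis by (simp cong: measurable_cong)
 qed
 have fin: "emeasure (jump_kernel e om) B \<noteq> \<infinity>" if "om \<in> space M" "B \<in> sets borel" for B om
 proof -
  have "finite {s\<in>big_jumps e om. jump L s om \<in> B}" using finite_big_jumps[OF that(1) e] by simp
  then show ?thesis by (simp add: emeasure_jump_kernel[OF that(2)] emeasure_count_space)
 qed
 have "Int_stable {S::real set. open S}" "{S::real set. open S} \<subseteq> Pow UNIV" "A \<in> sigma_sets UNIV {S. open S}"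
  using A by (auto simp: Int_stable_def borel_def)
 then show ?thesis
 proof (induction rule: sigma_sets_induct_disjoint)
  case (compl B)
  then have B: "B \<in> sets borel" by (simp add: borel_def)
  have "emeasure (jump_kernel e om) (UNIV - B) = emeasure (jump_kernel e om) UNIV - emeasure (jump_kernel e om) B"
   if "om \<in> space M" for om
   using emeasure_compl[of B "jump_kernel e om"] fin[OF that B] B by simp
  moreover have "(%om. emeasure (jump_kernel e om) UNIV - emeasure (jump_kernel e om) B) \<in> borel_measurable M"
   using open_case[of UNIV] compl by simp
  ultimately show ?case by (simp cong: measurable_cong)
 next
  case (union B)
  then have B: "B i \<in> sets borel" for i by (auto simp: borel_def)
  have "emeasure (jump_kernel e om) (\<Union>i. B i) = (\<Sum>i. emeasure (jump_kernel e om) (B i))" for om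
   by (rule suminf_emeasure[symmetric]) (use B union in auto)
  then show ?case using union by simp
 qed (auto simp: open_case)
qed

lemma nu_sets [measurable_cong]: "sets \<nu> = sets borel"
 using levy by (simp add: pure_jump_levy_process_def is_levy_measure_def)

text \<open>Campbell's formula, by monotone class induction from the defining identity for sets.
  Measurability is part of the claim since the steps for sums and suprema rely on it.\<close>

lemma nn_integral_nu:
 assumes e: "0 < e" and f: "f \<in> borel_measurable borel"
 shows "(%om. \<integral>\<^sup>+y. f y \<partial>jump_kernel e om) \<in> borel_measurable M \<and>
   (\<integral>\<^sup>+y. f y * indicator {y. e < \<bar>y\<bar>} y \<partial>\<nu>) = (\<integral>\<^sup>+om. \<integral>\<^sup>+y. f y \<partial>jump_kernel e om \<partial>M)"
 using f
proof (induction rule: borel_measurable_induct)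
 case (cong f g)
 then have "f = g" by (auto simp: fun_eq_iff)
 with cong show ?case by simp
next
 case (set A)
 let ?A = "A \<inter> {y. e < \<bar>y\<bar>}"
 have A: "?A \<in> sets borel" using set by measurable
 have A': "{y::real. e < \<bar>y\<bar>} \<in> sets borel" by measurable
 have "(\<integral>\<^sup>+y. indicator A y * indicator {y. e < \<bar>y\<bar>} y \<partial>\<nu>) = emeasure \<nu> ?A"
  using A nu_sets by (simp add: indicator_inter_arith[symmetric])
 also have "\<dots> = (\<integral>\<^sup>+om. emeasure (jump_measure L om) ({0<..1} \<times> ?A) \<partial>M)"
  using levy A e by (auto simp: pure_jump_levy_process_def is_levy_measure_def)
 also have "\<dots> = (\<integral>\<^sup>+om. emeasure (jump_kernel e om) A \<partial>M)"
 proof (rule nn_integral_cong)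
  fix om
  have pr: "{0<..1::real} \<times> ?A \<in> sets (borel \<Otimes>\<^sub>M borel)" using A by (intro pair_measureI) auto
  have "emeasure (jump_measure L om) ({0<..1} \<times> ?A) =
    emeasure (count_space {s. 0 < s \<and> jump L s om \<noteq> 0}) {s. 0 < s \<and> s <= 1 \<and> jump L s om \<in> ?A}"
   unfolding jump_measure_def
   by (subst emeasure_distr[OF _ pr]) (use e in \<open>auto simp: space_pair_measure intro!: arg_cong2[where f = emeasure]\<close>)
  moreover have "{s. 0 < s \<and> s <= 1 \<and> jump L s om \<in> ?A} = {s\<in>big_jumps e om. jump L s om \<in> A}"
   by (auto simp: big_jumps_def)
  moreover have "{s\<in>big_jumps e om. jump L s om \<in> A} \<subseteq> {s. 0 < s \<and> jump L s om \<noteq> 0}"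
   using e by (auto simp: big_jumps_def)
  ultimately show "emeasure (jump_measure L om) ({0<..1} \<times> ?A) = emeasure (jump_kernel e om) A"
   using set by (simp add: emeasure_jump_kernel emeasure_count_space Collect_restrict)
 qed
 finally show ?case using set jump_kernel_measurable[OF e, of A] by simp
next
 case (mult u c)
 note [measurable] = mult.IH[THEN conjunct1]
 from mult show ?case by (simp add: nn_integral_cmult mult.assoc)
next
 case (add u v)
 have [measurable]: "(%y. indicator {y::real. e < \<bar>y\<bar>} y :: ennreal) \<in> borel_measurable borel" by measurable
 note [measurable] = add.IH[THEN conjunct1]
 from add show ?case by (simp add: nn_integral_add distrib_right)
next
 case (seq U)
 have ind [measurable]: "(%y. indicator {y::real. e < \<bar>y\<bar>} y :: ennreal) \<in> borel_measurable borel" by measurable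
 have [measurable]: "(%om. \<integral>\<^sup>+y. U i y \<partial>jump_kernel e om) \<in> borel_measurable M" for i
  using seq.IH by simp
 have mono: "incseq (%i y. U i y * indicator {y. e < \<bar>y\<bar>} y)"
  using seq(3) by (auto simp: incseq_def le_fun_def intro!: mult_right_mono)
 have inner: "(\<integral>\<^sup>+y. (SUP i. U i y) \<partial>jump_kernel e om) = (SUP i. \<integral>\<^sup>+y. U i y \<partial>jump_kernel e om)" for om
  by (rule nn_integral_monotone_convergence_SUP[OF seq(3)]) (use seq(1) in simp)
 have inc2: "incseq (%i om. \<integral>\<^sup>+y. U i y \<partial>jump_kernel e om)"
  using seq(3) by (auto simp: incseq_def le_fun_def intro!: nn_integral_mono)
 have "(\<integral>\<^sup>+y. (SUP i. U i) y * indicator {y. e < \<bar>y\<bar>} y \<partial>\<nu>) = (\<integral>\<^sup>+y. (SUP i. U i y * indicator {y. e < \<bar>y\<bar>} y) \<partial>\<nu>)"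
  by (simp add: SUP_mult_right_ennreal image_comp)
 also have "\<dots> = (SUP i. \<integral>\<^sup>+y. U i y * indicator {y. e < \<bar>y\<bar>} y \<partial>\<nu>)"
  by (rule nn_integral_monotone_convergence_SUP[OF mono]) (use seq(1) in measurable)
 also have "\<dots> = (SUP i. \<integral>\<^sup>+om. \<integral>\<^sup>+y. U i y \<partial>jump_kernel e om \<partial>M)" using seq.IH by simp
 also have "\<dots> = (\<integral>\<^sup>+om. (SUP i. \<integral>\<^sup>+y. U i y \<partial>jump_kernel e om) \<partial>M)"
  by (rule nn_integral_monotone_convergence_SUP[OF inc2, symmetric]) (use seq.IH in simp)
 finally show ?case using seq.IH by (simp add: inner image_comp)
qed

lemma integrable_nu:
 fixes f :: "real => real"
 assumes f: "f \<in> borel_measurable borel" and le: "\<And>y. \<bar>f y\<bar> <= c * y^2"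
 shows "integrable \<nu> f"
proof -
 have i2: "integrable \<nu> (%y. y^2)"
  by (rule integrableI_bounded) (use levy_2 in \<open>simp_all\<close>)
 show ?thesis
  by (rule Bochner_Integration.integrable_bound[where f = "%y. c * y^2"])
    (use i2 f le in \<open>auto intro: order_trans[OF _ abs_ge_self]\<close>)
qed

lemma integral_nu_sq: "integrable \<nu> (%y. y^2)" "(LINT y|\<nu>. y^2) = 1"
proof -
 show i2: "integrable \<nu> (%y. y^2)" by (rule integrable_nu[of _ 1]) auto
 show "(LINT y|\<nu>. y^2) = 1"
  using levy_2 by (subst (asm) nn_integral_eq_integral[OF i2]) auto
qed

text \<open>Campbell's formula for signed functions, by positive and negative parts; the quadratic
  bound makes both integrable since the Levy measure integrates \<open>y^2\<close>.\<close>

lemma jump_sum_expectation: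
 assumes d: "0 < d" and f: "continuous_on UNIV f" "\<And>y. \<bar>y\<bar> <= 2 * d ==> f y = 0" and le: "\<And>y. \<bar>f y\<bar> <= c * y^2"
 shows "integrable M (jump_sum d UNIV f)" and "expectation (jump_sum d UNIV f) = (LINT y|\<nu>. f y)"
proof -
 have pos: "integrable M (jump_sum d UNIV g) \<and> expectation (jump_sum d UNIV g) = (LINT y|\<nu>. g y)"
  if g: "continuous_on UNIV g" "\<And>y. \<bar>y\<bar> <= 2 * d ==> g y = 0" "\<And>y. 0 <= g y" "\<And>y. g y <= c * y^2" for g
 proof -
  have gm: "g \<in> borel_measurable borel" by (intro borel_measurable_continuous_onI g)
  have gi: "integrable \<nu> g" by (rule integrable_nu[OF gm, of c]) (use g in auto)
  have jm: "jump_sum d UNIV g \<in> borel_measurable M" by (rule jump_sum_measurable) (use d g in auto)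
  have jnn: "0 <= jump_sum d UNIV g om" for om unfolding jump_sum_def by (intro sum_nonneg g)
  have "(\<integral>\<^sup>+om. ennreal (jump_sum d UNIV g om) \<partial>M) = (\<integral>\<^sup>+om. \<integral>\<^sup>+y. ennreal (g y) \<partial>jump_kernel d om \<partial>M)"
   by (rule nn_integral_cong) (simp add: nn_integral_jump_kernel d gm g)
  also have "\<dots> = (\<integral>\<^sup>+y. ennreal (g y) * indicator {y. d < \<bar>y\<bar>} y \<partial>\<nu>)"
   using nn_integral_nu[OF d, of "%y. ennreal (g y)"] gm by simp
  also have "\<dots> = (\<integral>\<^sup>+y. ennreal (g y) \<partial>\<nu>)"
   by (rule nn_integral_cong) (use g(2) d in \<open>auto simp: indicator_def\<close>)
  also have "\<dots> = ennreal (LINT y|\<nu>. g y)"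
   by (rule nn_integral_eq_integral[OF gi]) (use g in auto)
  finally have eq: "(\<integral>\<^sup>+om. ennreal (jump_sum d UNIV g om) \<partial>M) = ennreal (LINT y|\<nu>. g y)" .
  have int: "integrable M (jump_sum d UNIV g)"
   by (rule integrableI_bounded[OF jm]) (use eq jnn in simp)
  then show ?thesis using eq jnn g(3)
   by (subst (asm) nn_integral_eq_integral[OF int]) (auto simp: integral_nonneg_AE)
 qed
 let ?p = "%y. max 0 (f y)" and ?n = "%y. max 0 (- f y)"
 have cy: "0 <= c * y^2" for y using le[of y] by (rule order_trans[rotated]) simp
 have P: "integrable M (jump_sum d UNIV ?p) \<and> expectation (jump_sum d UNIV ?p) = (LINT y|\<nu>. ?p y)"
  by (rule pos) (use f le cy in \<open>auto intro!: continuous_intros simp: abs_le_iff\<close>)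
 have N: "integrable M (jump_sum d UNIV ?n) \<and> expectation (jump_sum d UNIV ?n) = (LINT y|\<nu>. ?n y)"
  by (rule pos) (use f le cy in \<open>auto intro!: continuous_intros simp: abs_le_iff\<close>)
 have split: "jump_sum d UNIV f = (%om. jump_sum d UNIV ?p om - jump_sum d UNIV ?n om)"
  unfolding jump_sum_def by (auto simp: fun_eq_iff sum_subtractf[symmetric] intro!: sum.cong)
 show "integrable M (jump_sum d UNIV f)" unfolding split using P N by simp
 have fm: "f \<in> borel_measurable borel" by (intro borel_measurable_continuous_onI f)
 have "integrable \<nu> ?p" "integrable \<nu> ?n"
  by (rule integrable_nu[of _ c]; use fm le cy in \<open>auto simp: abs_le_iff\<close>)+
 then have "(LINT y|\<nu>. ?p y) - (LINT y|\<nu>. ?n y) = (LINT y|\<nu>. ?p y - ?n y)" by simp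
 also have "\<dots> = (LINT y|\<nu>. f y)" by (rule Bochner_Integration.integral_cong) auto
 finally show "expectation (jump_sum d UNIV f) = (LINT y|\<nu>. f y)" unfolding split using P N by simp
qed

end

section \<open>Variance of sums over large jumps\<close>

lemma eventually_inj_on_cell_index:
 assumes fin: "finite J" and pos: "\<And>s. s \<in> J ==> 0 < s"
 shows "eventually (%n. inj_on (cell_index n) J) sequentially"
proof -
 have "eventually (%n. \<forall>s\<in>J. \<forall>s'\<in>J. s < s' \<longrightarrow> 1 / real n < s' - s) sequentially"
 proof (intro eventually_ball_finite fin ballI)
  fix s s' assume "s \<in> J" "s' \<in> J"
  show "eventually (%n. s < s' \<longrightarrow> 1 / real n < s' - s) sequentially"
   by (cases "s < s'") (use order_tendstoD(2)[OF lim_1_over_n, of "s' - s"] in auto)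
 qed
 then show ?thesis using eventually_ge_at_top[of 1]
 proof eventually_elim
  fix n :: nat assume sep: "\<forall>s\<in>J. \<forall>s'\<in>J. s < s' \<longrightarrow> 1 / real n < s' - s" and n: "1 <= n"
  have no: "cell_index n s \<noteq> cell_index n s'" if "s \<in> J" "s' \<in> J" "s < s'" for s s'
  proof
   assume eq: "cell_index n s = cell_index n s'"
   have "grid n (cell_index n s) < s" by (rule cell_index(1)[OF n pos[OF that(1)]])
   moreover have "s' <= grid n (Suc (cell_index n s))"
    unfolding eq by (rule cell_index(2)[OF n pos[OF that(2)]])
   ultimately have "s' - s < 1 / real n" unfolding grid_Suc by linarith
   moreover have "1 / real n < s' - s" using sep that by blast
   ultimately show False by linarith
  qed
  show "inj_on (cell_index n) J"
  proof (rule inj_onI, rule ccontr)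
   fix s s' assume *: "s \<in> J" "s' \<in> J" "cell_index n s = cell_index n s'" "s \<noteq> s'"
   then consider "s < s'" | "s' < s" by linarith
   then show False by cases (use no[of s s'] no[of s' s] * in simp_all)
  qed
 qed
qed

context semi_markov_noise
begin

text \<open>Two truncations at once: the root of the sum of squares makes the square at most that
  sum, and the level \<open>m\<close> keeps everything bounded so that the limit in \<open>q\<close>
  is dominated.\<close>

definition block_jump :: "(real => real) => nat => nat => nat => 'a => real" where
 "block_jump f m q i om = clip (min (sqrt (block_sum (%y. (f y)^2) m q i om)) (real m)) (block_sum f m q i om)"

definition cell_jump :: "real => (real => real) => nat => nat => 'a => real" where
 "cell_jump d f m i om = clip (min (sqrt (jump_sum d (cell_int m i) (%y. (f y)^2) om)) (real m)) (jump_sum d (cell_int m i) f om)"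

lemma block_jump_measurable [measurable]:
 assumes [measurable]: "f \<in> borel_measurable borel"
 shows "block_jump f m q i \<in> borel_measurable M"
 unfolding block_jump_def clip_def by measurable

text \<open>Different blocks use disjoint sets of increments of \<open>L\<close>.\<close>

lemma block_jump_indep:
 assumes f [measurable]: "f \<in> borel_measurable borel"
 shows "indep_vars (%_. borel) (block_jump f m q) {..<m}"
proof -
 let ?n = "m * Suc q" and ?K = "%i. {i * Suc q..<Suc i * Suc q}"
 let ?X = "%l om. L (grid ?n (Suc l)) om - L (grid ?n l) om"
 have ind: "indep_vars (%_. borel) ?X UNIV"
  using levy unfolding pure_jump_levy_process_def levy_process_def by (intro indep_increments_grid) simp
 have disj: "disjoint_family_on ?K {..<m}"
  unfolding disjoint_family_on_def
 proof (intro ballI impI)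
  fix i j :: nat assume ij: "i \<noteq> j"
  have *: "{a * Suc q..<Suc a * Suc q} \<inter> {b * Suc q..<Suc b * Suc q} = {}" if "a < b" for a b
  proof -
   have "Suc a * Suc q <= b * Suc q" using that by (intro mult_le_mono1) simp
   then show ?thesis by auto
  qed
  then show "?K i \<inter> ?K j = {}" using ij *[of i j] *[of j i] by (metis Int_commute linorder_neqE_nat)
 qed
 let ?Y = "%i x. clip (min (sqrt (\<Sum>l\<in>?K i. (f (x l))^2)) (real m)) (\<Sum>l\<in>?K i. f (x l))"
 have "indep_vars (%j. PiM (?K j) (%_. borel)) (%j om. restrict (%i. ?X i om) (?K j)) {..<m}"
  by (rule indep_vars_restrict[OF ind _ disj]) simp
 then have "indep_vars (%_. borel) (%j om. ?Y j (restrict (%i. ?X i om) (?K j))) {..<m}"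
 proof (rule indep_vars_compose2)
  fix i
  show "?Y i \<in> borel_measurable (PiM (?K i) (%_. borel))"
   unfolding clip_def by measurable
 qed
 also have "(%j om. ?Y j (restrict (%i. ?X i om) (?K j))) = block_jump f m q"
  by (intro ext) (simp add: block_jump_def block_sum_def)
 finally show ?thesis .
qed

lemma abs_block_jump_le: "\<bar>block_jump f m q i om\<bar> <= real m"
proof -
 have "0 <= min (sqrt (block_sum (%y. (f y)^2) m q i om)) (real m)"
  by (simp add: block_sum_def sum_nonneg)
 then show ?thesis unfolding block_jump_def by (rule order_trans[OF abs_clip_le(1)]) simp
qed

text \<open>Independent summands: the variance is the sum of the variances, and each is at most the
  second moment. This form survives both limits because it involves no individual mean.\<close>

lemma block_jump_variance:
 assumes f [measurable]: "f \<in> borel_measurable borel"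
 shows "expectation (%om. (\<Sum>i<m. block_jump f m q i om)^2) - (expectation (%om. \<Sum>i<m. block_jump f m q i om))^2
   <= expectation (%om. \<Sum>i<m. (block_jump f m q i om)^2)"
proof -
 let ?J = "block_jump f m q"
 let ?Z = "%i om. ?J i om - expectation (?J i)"
 have int: "integrable M (?J i)" for i
  by (rule integrable_const_bound[of _ "real m"]) (auto simp: abs_block_jump_le)
 have bd: "(?J i om)^2 <= (real m)^2" for i om
  using abs_block_jump_le[of f m q i om] by (simp add: power2_le_iff_abs_le)
 have int2: "integrable M (%om. (?J i om)^2)" for i
  by (rule integrable_const_bound[of _ "(real m)^2"]) (auto simp: bd)
 have Z2: "integrable M (%om. (?Z i om)^2)" for i
  using int int2 by (simp add: power2_diff)
 have sum2: "integrable M (%om. (\<Sum>i<m. ?J i om)^2)"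
  by (rule integrable_square_sum) (auto simp: int2)
 have sum1: "integrable M (%om. \<Sum>i<m. ?J i om)" using int by simp
 have "expectation (%om. (\<Sum>i<m. ?Z i om)^2) = (\<Sum>i<m. expectation (%om. (?Z i om)^2))"
 proof (rule integral_square_sum_orthogonal)
  fix i j assume ij: "i \<in> {..<m}" "j \<in> {..<m}" "i \<noteq> j"
  have "expectation (%om. ?J i om * ?J j om) = expectation (?J i) * expectation (?J j)"
   by (rule indep_var_lebesgue_integral[OF indep_var_pair[OF block_jump_indep[OF f] ij] int int])
  moreover have "integrable M (%om. ?J i om * ?J j om)"
   by (rule integrable_mult_of_squares) (auto simp: int2)
  moreover have "?Z i om * ?Z j om = ?J i om * ?J j om - expectation (?J j) * ?J i om - expectation (?J i) * ?J j om + expectation (?J i) * expectation (?J j)" for om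
   by (simp add: algebra_simps)
  ultimately show "expectation (%om. ?Z i om * ?Z j om) = 0"
   using int by (simp add: prob_space)
 qed (use Z2 in auto)
 also have "\<dots> <= (\<Sum>i<m. expectation (%om. (?J i om)^2))"
 proof (rule sum_mono)
  fix i
  show "expectation (%om. (?Z i om)^2) <= expectation (%om. (?J i om)^2)"
   using variance_eq[OF int int2, of i] by simp
 qed
 also have "\<dots> = expectation (%om. \<Sum>i<m. (?J i om)^2)" using int2 by simp
 also have "expectation (%om. (\<Sum>i<m. ?Z i om)^2) = variance (%om. \<Sum>i<m. ?J i om)"
  using int by (simp add: sum_subtractf)
 finally show ?thesis using variance_eq[OF sum1 sum2] by simp
qed

lemma cell_jump_tendsto:
 assumes "om \<in> space M" "0 < d" "i < m" "continuous_on UNIV f" "\<And>y. \<bar>y\<bar> <= 2 * d ==> f y = 0"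
 shows "(%q. block_jump f m q i om) \<longlonglongrightarrow> cell_jump d f m i om"
 unfolding block_jump_def cell_jump_def
 by (intro tendsto_intros block_sum_tendsto continuous_intros) (use assms in auto)

lemma cell_jump_bounds:
 shows "\<bar>cell_jump d f m i om\<bar> <= real m"
  and "\<bar>cell_jump d f m i om\<bar> <= jump_sum d (cell_int m i) (%y. \<bar>f y\<bar>) om"
  and "(cell_jump d f m i om)^2 <= jump_sum d (cell_int m i) (%y. (f y)^2) om"
proof -
 let ?H = "jump_sum d (cell_int m i) (%y. (f y)^2) om"
 have H: "0 <= ?H" by (simp add: jump_sum_def sum_nonneg)
 then have c: "0 <= min (sqrt ?H) (real m)" by simp
 show "\<bar>cell_jump d f m i om\<bar> <= real m"
  unfolding cell_jump_def by (rule order_trans[OF abs_clip_le(1)[OF c]]) simp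
 have "\<bar>cell_jump d f m i om\<bar> <= \<bar>jump_sum d (cell_int m i) f om\<bar>"
  unfolding cell_jump_def by (rule abs_clip_le(2)[OF c])
 also have "\<dots> <= jump_sum d (cell_int m i) (%y. \<bar>f y\<bar>) om" unfolding jump_sum_def by (rule sum_abs)
 finally show "\<bar>cell_jump d f m i om\<bar> <= jump_sum d (cell_int m i) (%y. \<bar>f y\<bar>) om" .
 have "\<bar>cell_jump d f m i om\<bar> <= sqrt ?H"
  unfolding cell_jump_def by (rule order_trans[OF abs_clip_le(1)[OF c]]) simp
 then have "(cell_jump d f m i om)^2 <= (sqrt ?H)^2" by (rule power2_le_iff_abs_le[THEN iffD2, rotated]) (simp add: H)
 then show "(cell_jump d f m i om)^2 <= ?H" using H by simp
qed

text \<open>Once every cell holds at most one large jump, the modulus of its value equals the root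
  of the sum of squares; once \<open>m\<close> exceeds all values, the second truncation is idle
  too.\<close>

lemma sum_cell_jump_eventually:
 assumes om: "om \<in> space M" and d: "0 < d"
 shows "eventually (%m. (\<Sum>i<m. cell_jump d f m i om) = jump_sum d UNIV f om) sequentially"
proof -
 note fin = finite_big_jumps[OF om d]
 have "eventually (%m. \<forall>s\<in>big_jumps d om. \<bar>f (jump L s om)\<bar> <= real m) sequentially"
 proof (intro eventually_ball_finite fin ballI)
  fix s
  show "eventually (%m. \<bar>f (jump L s om)\<bar> <= real m) sequentially"
   using eventually_ge_at_top[of "nat \<lceil>\<bar>f (jump L s om)\<bar>\<rceil>"]
   by eventually_elim (simp add: nat_ceiling_le_eq)
 qed
 moreover have "eventually (%m. inj_on (cell_index m) (big_jumps d om)) sequentially"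
  by (rule eventually_inj_on_cell_index[OF fin]) (auto simp: big_jumps_def)
 ultimately show ?thesis using eventually_ge_at_top[of 1]
 proof eventually_elim
  fix m :: nat assume le: "\<forall>s\<in>big_jumps d om. \<bar>f (jump L s om)\<bar> <= real m"
   and inj: "inj_on (cell_index m) (big_jumps d om)" and m: "1 <= m"
  have "cell_jump d f m i om = jump_sum d (cell_int m i) f om" for i
  proof (cases "big_jumps d om \<inter> cell_int m i = {}")
   case True
   then show ?thesis by (simp add: cell_jump_def jump_sum_def clip_def)
  next
   case False
   then obtain s where s: "s \<in> big_jumps d om" "s \<in> cell_int m i" by blast
   have "s' = s" if "s' \<in> big_jumps d om" "s' \<in> cell_int m i" for s'
   proof -
    have "0 < s" "0 < s'" using s that by (auto simp: big_jumps_def)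
    then have "cell_index m s = i" "cell_index m s' = i"
     using cell_index(5)[OF m, of s i] cell_index(5)[OF m, of s' i] s that by auto
    then show ?thesis using inj s that by (auto dest: inj_onD)
   qed
   then have "big_jumps d om \<inter> cell_int m i = {s}" using s by blast
   then show ?thesis using le s by (simp add: cell_jump_def jump_sum_def clip_eq)
  qed
  then show "(\<Sum>i<m. cell_jump d f m i om) = jump_sum d UNIV f om"
   using sum_jump_sum_cells[OF om d m, of f] by simp
 qed
qed

text \<open>Replacing the sum of the jumps over a cell by its truncation at the root of the sum of their
 squares makes the variance bound immediate; on fine partitions nothing is truncated.\<close>

lemma jump_sum_variance:
 assumes d: "0 < d" and f: "continuous_on UNIV f" and f0: "\<And>y. \<bar>y\<bar> <= 2 * d ==> f y = 0" and le: "\<And>y. \<bar>f y\<bar> <= \<bar>y\<bar>"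
 shows "integrable M (%om. (jump_sum d UNIV f om - (LINT y|\<nu>. f y))^2)"
  and "expectation (%om. (jump_sum d UNIV f om - (LINT y|\<nu>. f y))^2) <= 1"
  and "expectation (%om. jump_sum d UNIV f om - (LINT y|\<nu>. f y)) = 0"
proof -
 have [measurable]: "f \<in> borel_measurable borel" by (intro borel_measurable_continuous_onI f)
 \<comment> \<open>Since \<open>f\<close> vanishes near 0, its linear bound improves to a quadratic
   one, hence to integrability with respect to the Levy measure.\<close>
 have le2: "\<bar>f y\<bar> <= 1 / (2 * d) * y^2" for y
 proof (cases "\<bar>y\<bar> <= 2 * d")
  case True then show ?thesis using f0[OF True] d by simp
 next
  case False
  have "\<bar>f y\<bar> * (2 * d) <= \<bar>y\<bar> * \<bar>y\<bar>" by (rule mult_mono[OF le]) (use False d in auto)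
  then show ?thesis using d by (simp add: field_simps power2_eq_square abs_mult_self_eq)
 qed
 have fsq: "(f y)^2 <= y^2" for y using le[of y] by (simp add: abs_le_square_iff)
 have f2: "continuous_on UNIV (%y. (f y)^2)" and fa: "continuous_on UNIV (%y. \<bar>f y\<bar>)"
  by (intro continuous_intros f)+
 note E1 = jump_sum_expectation[OF d f f0 le2]
 have Ea: "integrable M (jump_sum d UNIV (%y. \<bar>f y\<bar>))"
  by (rule jump_sum_expectation(1)[OF d fa, of "1 / (2 * d)"]) (use f0 le2 in auto)
 have E2: "integrable M (jump_sum d UNIV (%y. (f y)^2))" "expectation (jump_sum d UNIV (%y. (f y)^2)) = (LINT y|\<nu>. (f y)^2)"
  by (rule jump_sum_expectation[OF d f2, of 1]; use f0 fsq in auto)+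
 have nu2: "(LINT y|\<nu>. (f y)^2) <= 1"
 proof -
  have "(LINT y|\<nu>. (f y)^2) <= (LINT y|\<nu>. y^2)"
   by (rule integral_mono) (use fsq integral_nu_sq in \<open>auto intro!: integrable_nu[of _ 1]\<close>)
  then show ?thesis by (simp add: integral_nu_sq)
 qed
 define V where "V m om = (\<Sum>i<m. cell_jump d f m i om)" for m om
 have cm [measurable]: "cell_jump d f m i \<in> borel_measurable M" if im: "i < m" for m i
 proof -
  have [measurable]: "jump_sum d (cell_int m i) f \<in> borel_measurable M"
   by (rule jump_sum_cell_measurable[OF d im f f0])
  have [measurable]: "jump_sum d (cell_int m i) (%y. (f y)^2) \<in> borel_measurable M"
   by (rule jump_sum_cell_measurable[OF d im f2]) (simp add: f0)
  show ?thesis unfolding cell_jump_def clip_def by measurable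
 qed
 have Vm [measurable]: "V m \<in> borel_measurable M" for m
  unfolding V_def using cm by (intro borel_measurable_sum) auto
 have Vabs: "\<bar>V m om\<bar> <= jump_sum d UNIV (%y. \<bar>f y\<bar>) om" if "om \<in> space M" "1 <= m" for m om
 proof -
  have "\<bar>V m om\<bar> <= (\<Sum>i<m. jump_sum d (cell_int m i) (%y. \<bar>f y\<bar>) om)"
   unfolding V_def by (rule order_trans[OF sum_abs sum_mono]) (rule cell_jump_bounds)
  then show ?thesis using sum_jump_sum_cells[OF that(1) d that(2)] by simp
 qed
 have Vbd: "\<bar>V m om\<bar> <= real m * real m" for m om
  unfolding V_def by (rule order_trans[OF sum_abs order_trans[OF sum_mono[OF cell_jump_bounds(1)]]]) simp
 have V1: "integrable M (V m)" for m
  by (rule integrable_const_bound[of _ "real m * real m"]) (auto simp: Vbd)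
 have V2: "integrable M (%om. (V m om)^2)" for m
  by (rule integrable_const_bound[of _ "(real m * real m)^2"]) (use Vbd in \<open>auto simp: power2_le_iff_abs_le\<close>)
 \<comment> \<open>The inner limit: \<open>q\<close> grows at fixed \<open>m\<close>, where powers
   of \<open>m\<close> dominate. The sum of squares is then compared with the full jump sum of
   \<open>f^2\<close>, whose mean is at most 1.\<close>
 have var: "variance (V m) <= 1" if m: "1 <= m" for m
 proof -
  have lim: "(%q. \<Sum>i<m. block_jump f m q i om) \<longlonglongrightarrow> V m om" if "om \<in> space M" for om
   unfolding V_def by (intro tendsto_sum cell_jump_tendsto) (use that d f f0 in auto)
  have bsum: "\<bar>\<Sum>i<m. block_jump f m q i om\<bar> <= real m * real m" for q om
   by (rule order_trans[OF sum_abs order_trans[OF sum_mono[OF abs_block_jump_le]]]) simp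
  have "(%q. expectation (%om. (\<Sum>i<m. block_jump f m q i om)^2)) \<longlonglongrightarrow> expectation (%om. (V m om)^2)"
   by (rule integral_dominated_convergence[where w = "%_. (real m * real m)^2"])
     (use lim bsum in \<open>auto simp: power2_le_iff_abs_le intro!: tendsto_power\<close>)
  moreover have "(%q. expectation (%om. \<Sum>i<m. block_jump f m q i om)) \<longlonglongrightarrow> expectation (V m)"
   by (rule integral_dominated_convergence[where w = "%_. real m * real m"]) (use lim bsum in auto)
  moreover have "(%q. expectation (%om. \<Sum>i<m. (block_jump f m q i om)^2)) \<longlonglongrightarrow> expectation (%om. \<Sum>i<m. (cell_jump d f m i om)^2)"
  proof (rule integral_dominated_convergence[where w = "%_. real m * (real m)^2"])
   show "AE om in M. (%q. \<Sum>i<m. (block_jump f m q i om)^2) \<longlonglongrightarrow> (\<Sum>i<m. (cell_jump d f m i om)^2)"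
    by (intro AE_I2 tendsto_sum tendsto_power cell_jump_tendsto) (use d f f0 in auto)
   have "(\<Sum>i<m. (block_jump f m q i om)^2) <= (\<Sum>i<m. (real m)^2)" for q om
    by (rule sum_mono) (simp add: power2_le_iff_abs_le abs_block_jump_le)
   then show "AE om in M. norm (\<Sum>i<m. (block_jump f m q i om)^2) <= real m * (real m)^2" for q
    by (simp add: sum_nonneg)
   show "(%om. \<Sum>i<m. (cell_jump d f m i om)^2) \<in> borel_measurable M"
    using cm by (intro borel_measurable_sum borel_measurable_power) auto
  qed auto
  ultimately have "expectation (%om. (V m om)^2) - (expectation (V m))^2 <= expectation (%om. \<Sum>i<m. (cell_jump d f m i om)^2)"
   by (intro LIMSEQ_le[OF tendsto_diff[OF _ tendsto_power]]) (auto intro!: block_jump_variance)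
  also have "\<dots> <= expectation (jump_sum d UNIV (%y. (f y)^2))"
  proof (rule integral_mono_AE)
   have c2: "integrable M (%om. (cell_jump d f m i om)^2)" if "i < m" for i
    by (rule integrable_const_bound[of _ "(real m)^2"])
      (use that cell_jump_bounds(1) in \<open>auto simp: power2_le_iff_abs_le\<close>)
   show "integrable M (%om. \<Sum>i<m. (cell_jump d f m i om)^2)" using c2 by auto
   show "AE om in M. (\<Sum>i<m. (cell_jump d f m i om)^2) <= jump_sum d UNIV (%y. (f y)^2) om"
   proof (rule AE_I2)
    fix om assume "om \<in> space M"
    have "(\<Sum>i<m. (cell_jump d f m i om)^2) <= (\<Sum>i<m. jump_sum d (cell_int m i) (%y. (f y)^2) om)"
     by (intro sum_mono cell_jump_bounds(3))
    also have "\<dots> = jump_sum d UNIV (%y. (f y)^2) om"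
     by (rule sum_jump_sum_cells[OF \<open>om \<in> space M\<close> d m])
    finally show "(\<Sum>i<m. (cell_jump d f m i om)^2) <= jump_sum d UNIV (%y. (f y)^2) om" .
   qed
  qed (rule E2)
  also have "\<dots> <= 1" using E2 nu2 by simp
  finally show ?thesis by (simp add: variance_eq[OF V1 V2])
 qed
 have ptw: "(%m. V (Suc m) om) \<longlonglongrightarrow> jump_sum d UNIV f om" if "om \<in> space M" for om
  unfolding V_def by (rule LIMSEQ_Suc) (rule tendsto_eventually[OF sum_cell_jump_eventually[OF that d]])
 \<comment> \<open>The outer limit in \<open>m\<close> for the mean, dominated by the jump sum of
   \<open>\<bar>f\<bar>\<close>, which is integrable and free of \<open>m\<close>.\<close>
 have "(%m. expectation (V (Suc m))) \<longlonglongrightarrow> expectation (jump_sum d UNIV f)"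
  by (rule integral_dominated_convergence[where w = "jump_sum d UNIV (%y. \<bar>f y\<bar>)"])
    (use ptw Vabs Ea E1(1) in \<open>auto dest: borel_measurable_integrable\<close>)
 then have mlim: "(%m. expectation (V (Suc m))) \<longlonglongrightarrow> (LINT y|\<nu>. f y)"
  by (simp only: E1(2))
 note LB = LIMSEQ_expectation_L2_bounded[where X = "%m om. V (Suc m) om - expectation (V (Suc m))"
   and Y = "%om. jump_sum d UNIV f om - (LINT y|\<nu>. f y)" and C = 1]
 have jm [measurable]: "jump_sum d UNIV f \<in> borel_measurable M" using E1(1) by (rule borel_measurable_integrable)
 have sq: "integrable M (%om. (V (Suc m) om - expectation (V (Suc m)))^2)" for m
  using V1[of "Suc m"] V2[of "Suc m"] by (simp add: power2_diff)
 show "integrable M (%om. (jump_sum d UNIV f om - (LINT y|\<nu>. f y))^2)"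
  and "expectation (%om. (jump_sum d UNIV f om - (LINT y|\<nu>. f y))^2) <= 1"
  by (rule LB(1,2); use ptw mlim sq var in \<open>auto intro!: tendsto_intros\<close>)+
 show "expectation (%om. jump_sum d UNIV f om - (LINT y|\<nu>. f y)) = 0"
  using E1 by (simp add: prob_space)
qed

end

section \<open>From compensated large jumps to the increments of the Levy process\<close>

lemma (in prob_space) indep_square_integrable:
 fixes X Z :: "'a => real"
 assumes ind: "indep_var borel X borel Z" and sq: "integrable M (%x. (X x + Z x)^2)"
 shows "integrable M (%x. (X x)^2)"
proof -
 have [measurable]: "X \<in> borel_measurable M" "Z \<in> borel_measurable M"
  using indep_var_rv1[OF ind] indep_var_rv2[OF ind] by auto
 interpret X: prob_space "distr M borel X" by (rule prob_space_distr) simp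
 interpret Z: prob_space "distr M borel Z" by (rule prob_space_distr) simp
 interpret XZ: pair_prob_space "distr M borel X" "distr M borel Z" ..
 have joint: "distr M borel X \<Otimes>\<^sub>M distr M borel Z = distr M (borel \<Otimes>\<^sub>M borel) (%x. (X x, Z x))"
  using indep_var_distribution_eq[THEN iffD1, OF ind] by blast
 have "(\<integral>\<^sup>+z. (\<integral>\<^sup>+x. ennreal ((x + z)^2) \<partial>distr M borel X) \<partial>distr M borel Z) =
   (\<integral>\<^sup>+p. ennreal ((fst p + snd p)^2) \<partial>(distr M borel X \<Otimes>\<^sub>M distr M borel Z))"
  by (subst XZ.nn_integral_snd[symmetric]) auto
 also have "\<dots> = (\<integral>\<^sup>+x. ennreal ((X x + Z x)^2) \<partial>M)"
  unfolding joint by (subst nn_integral_distr) auto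
 also have "\<dots> < \<infinity>" using sq by (simp add: nn_integral_eq_integral)
 finally have "AE z in distr M borel Z. (\<integral>\<^sup>+x. ennreal ((x + z)^2) \<partial>distr M borel X) \<noteq> \<infinity>"
  by (intro nn_integral_PInf_AE) (auto simp: less_top[symmetric])
 \<comment> \<open>By Tonelli almost every value of \<open>Z\<close> leaves \<open>X\<close> with a
   finite shifted second moment; one such value is enough.\<close>
 then have "\<exists>z. (\<integral>\<^sup>+x. ennreal ((x + z)^2) \<partial>distr M borel X) \<noteq> \<infinity>"
 proof (rule contrapos_pp)
  assume "\<nexists>z. (\<integral>\<^sup>+x. ennreal ((x + z)^2) \<partial>distr M borel X) \<noteq> \<infinity>"
  then have inf: "(\<integral>\<^sup>+x. ennreal ((x + z)^2) \<partial>distr M borel X) = \<infinity>" for z by blast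
  show "\<not> (AE z in distr M borel Z. (\<integral>\<^sup>+x. ennreal ((x + z)^2) \<partial>distr M borel X) \<noteq> \<infinity>)"
   unfolding inf by simp
 qed
 then obtain z where z: "(\<integral>\<^sup>+x. ennreal ((x + z)^2) \<partial>distr M borel X) \<noteq> \<infinity>" by blast
 have "integrable M (%x. (X x + z)^2)"
  by (rule integrableI_bounded) (use z in \<open>simp_all add: nn_integral_distr less_top[symmetric]\<close>)
 then have "integrable M (%x. 2 * (X x + z)^2 + 2 * z^2)" by simp
 then show ?thesis
 proof (rule Bochner_Integration.integrable_bound)
  show "AE x in M. norm ((X x)^2) <= norm (2 * (X x + z)^2 + 2 * z^2)"
  proof (rule AE_I2)
   fix x
   \<comment> \<open>This square is exactly 2 (X + z)^2 + 2 z^2 - X^2.\<close>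
   have "0 <= (X x + 2 * z)^2" by simp
   then show "norm ((X x)^2) <= norm (2 * (X x + z)^2 + 2 * z^2)"
    by (simp add: power2_sum)
  qed
 qed simp
qed

lemma young_ineq: "2 * (a * b) <= \<delta> * a^2 + 1 / \<delta> * b^2" if "0 < \<delta>" for a b \<delta> :: real
proof -
 have "0 <= (\<delta> * a - b)^2 / \<delta>" using that by simp
 also have "\<dots> = \<delta> * a^2 + 1 / \<delta> * b^2 - 2 * (a * b)"
  using that by (simp add: power2_eq_square field_simps)
 finally show ?thesis by simp
qed

context semi_markov_noise
begin

text \<open>Chebyshev's inequality bounds the mass of \<open>\<bar>x\<bar> > 1 / n\<close> by
  \<open>n^2\<close>, and 0 has no mass. This allows Fubini for the compensator.\<close>

lemma sigma_finite_nu: "sigma_finite_measure \<nu>"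
proof
 have fin: "emeasure \<nu> {x. 1 / real (Suc n) < \<bar>x\<bar>} \<noteq> \<infinity>" for n
 proof -
  have "emeasure \<nu> {x. 1 / real (Suc n) < \<bar>x\<bar>} = (\<integral>\<^sup>+x. indicator {x. 1 / real (Suc n) < \<bar>x\<bar>} x \<partial>\<nu>)"
   by (rule nn_integral_indicator[symmetric]) measurable
  also have "\<dots> <= (\<integral>\<^sup>+x. ennreal ((real (Suc n))^2) * ennreal (x^2) \<partial>\<nu>)"
  proof (rule nn_integral_mono)
   fix x :: real
   show "indicator {x. 1 / real (Suc n) < \<bar>x\<bar>} x <= ennreal ((real (Suc n))^2) * ennreal (x^2)"
   proof (cases "1 / real (Suc n) < \<bar>x\<bar>")
    case True
    then have "1 < real (Suc n) * \<bar>x\<bar>" by (simp add: pos_divide_less_eq mult.commute del: of_nat_Suc)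
    then have "1 <= (real (Suc n) * \<bar>x\<bar>)^2" by (simp add: one_le_power del: of_nat_Suc)
    then have "1 <= (real (Suc n))^2 * x^2" by (simp add: power_mult_distrib del: of_nat_Suc)
    then show ?thesis using True
     by (simp add: ennreal_mult[symmetric] indicator_def ennreal_leI[of 1, simplified] del: of_nat_Suc)
   qed simp
  qed
  also have "\<dots> = ennreal ((real (Suc n))^2)" using levy_2 by (simp add: nn_integral_cmult)
  finally show ?thesis by (auto simp: top_unique)
 qed
 show "\<exists>A. countable A \<and> A \<subseteq> sets \<nu> \<and> \<Union> A = space \<nu> \<and> (\<forall>a\<in>A. emeasure \<nu> a \<noteq> \<infinity>)"
 proof (intro exI[of _ "insert {0} (range (%n. {x. 1 / real (Suc n) < \<bar>x\<bar>}))"] conjI)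
  have sp: "space \<nu> = UNIV" using sets_eq_imp_space_eq[OF nu_sets] by simp
  show "\<Union> (insert {0} (range (%n. {x. 1 / real (Suc n) < \<bar>x\<bar>}))) = space \<nu>"
  proof -
   have "\<exists>n. 1 / real (Suc n) < \<bar>x\<bar>" if "x \<noteq> 0" for x :: real
    using reals_Archimedean[of "\<bar>x\<bar>"] that by (auto simp: inverse_eq_divide)
   then show ?thesis unfolding sp by auto
  qed
  show "insert {0} (range (%n. {x. 1 / real (Suc n) < \<bar>x\<bar>})) \<subseteq> sets \<nu>"
   unfolding nu_sets by (auto intro!: borel_open open_Collect_less continuous_intros)
  have "emeasure \<nu> {0} = 0" using levy by (simp add: pure_jump_levy_process_def is_levy_measure_def)
  then show "\<forall>a\<in>insert {0} (range (%n. {x. 1 / real (Suc n) < \<bar>x\<bar>})). emeasure \<nu> a \<noteq> \<infinity>"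
   using fin by auto
 qed auto
qed

definition trunc_id :: "real => real => real" where
 "trunc_id \<epsilon> y = (if \<epsilon> < \<bar>y\<bar> then y else 0)"

lemma trunc_id_measurable [measurable]: "trunc_id \<epsilon> \<in> borel_measurable borel"
 unfolding trunc_id_def by measurable

lemma trunc_id_le: "0 < \<epsilon> ==> \<bar>trunc_id \<epsilon> y\<bar> <= 1 / \<epsilon> * y^2"
proof (cases "\<epsilon> < \<bar>y\<bar>")
 case True
 assume "0 < \<epsilon>"
 moreover have "\<bar>y\<bar> * \<epsilon> <= \<bar>y\<bar> * \<bar>y\<bar>" by (rule mult_left_mono) (use True in auto)
 ultimately show ?thesis by (simp add: trunc_id_def field_simps power2_eq_square abs_mult_self_eq)
qed (simp add: trunc_id_def)

text \<open>The jump part is a finite sum and the compensator a product integral over a time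
  interval of length 1. The lower threshold \<open>\<epsilon> / 2\<close> changes nothing in the sum
  but matches the variance bound for continuous functions.\<close>

lemma truncated_integral_eq:
 assumes om: "om \<in> space M" and e: "0 < \<epsilon>"
 shows "truncated_compensated_integral L \<nu> \<epsilon> 1 om = jump_sum (\<epsilon> / 2) UNIV (trunc_id \<epsilon>) om - (LINT y|\<nu>. trunc_id \<epsilon> y)"
proof -
 define A where "A = {0<..1::real} \<times> {x::real. \<epsilon> < \<bar>x\<bar>}"
 have A: "A \<in> sets (borel \<Otimes>\<^sub>M borel)"
  unfolding A_def
  by (intro pair_measureI) (auto intro!: borel_open open_Collect_less continuous_intros)
 let ?S = "{s. 0 < s \<and> jump L s om \<noteq> 0}"
 have "(LINT z:A|jump_measure L om. snd z) =
   (LINT s|count_space ?S. indicator A (s, jump L s om) *\<^sub>R jump L s om)"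
  unfolding set_lebesgue_integral_def jump_measure_def
  using A by (subst integral_distr) (auto simp: space_pair_measure)
 also have "\<dots> = (LINT s|count_space ?S. (if s \<in> big_jumps \<epsilon> om then jump L s om else 0))"
  by (intro Bochner_Integration.integral_cong) (auto simp: big_jumps_def indicator_def A_def)
 also have "\<dots> = (\<Sum>s\<in>big_jumps \<epsilon> om. jump L s om)"
 proof -
  have sub: "{s \<in> ?S. (if s \<in> big_jumps \<epsilon> om then jump L s om else 0) \<noteq> 0} = big_jumps \<epsilon> om"
   using e by (auto simp: big_jumps_def)
  show ?thesis
   by (subst lebesgue_integral_count_space_finite_support)
     (use finite_big_jumps[OF om e] sub in \<open>auto intro!: sum.cong simp: big_jumps_def\<close>)
 qed
 also have "\<dots> = jump_sum (\<epsilon> / 2) UNIV (trunc_id \<epsilon>) om"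
  unfolding jump_sum_def Int_UNIV_right
  by (rule sum.mono_neutral_cong_left[OF finite_big_jumps[OF om]])
    (use e in \<open>auto simp: big_jumps_def trunc_id_def\<close>)
 finally have 1: "(LINT z:A|jump_measure L om. snd z) = jump_sum (\<epsilon> / 2) UNIV (trunc_id \<epsilon>) om" .
 interpret \<nu>: sigma_finite_measure \<nu> by (rule sigma_finite_nu)
 interpret P: pair_sigma_finite "lborel :: real measure" \<nu> ..
 have ti: "integrable \<nu> (trunc_id \<epsilon>)" by (rule integrable_nu[OF _ trunc_id_le[OF e]]) simp
 let ?g = "%z::real \<times> real. indicator {0<..1} (fst z) * trunc_id \<epsilon> (snd z) :: real"
 have "?g \<in> borel_measurable (borel \<Otimes>\<^sub>M borel)" by measurable
 moreover have "sets (lborel \<Otimes>\<^sub>M \<nu>) = sets (borel \<Otimes>\<^sub>M borel)"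
  by (intro sets_pair_measure_cong nu_sets sets_lborel)
 ultimately have gm: "?g \<in> borel_measurable (lborel \<Otimes>\<^sub>M \<nu>)"
  using measurable_cong_sets by blast
 have gi: "integrable (lborel \<Otimes>\<^sub>M \<nu>) ?g"
 proof (rule P.Fubini_integrable[OF gm])
  have "(LINT y|\<nu>. norm (?g (x, y))) = indicator {0<..1} x * (LINT y|\<nu>. \<bar>trunc_id \<epsilon> y\<bar>)" for x
   by (simp add: abs_mult)
  then show "integrable lborel (%x. LINT y|\<nu>. norm (?g (x, y)))"
   by (auto intro!: integrable_mult_left)
 qed (use ti in auto)
 have "(LINT z:A|(lborel \<Otimes>\<^sub>M \<nu>). snd z) = (LINT z|(lborel \<Otimes>\<^sub>M \<nu>). ?g z)"
  unfolding set_lebesgue_integral_def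
  by (intro Bochner_Integration.integral_cong) (auto simp: indicator_def trunc_id_def A_def)
 also have "\<dots> = (LINT x|lborel. LINT y|\<nu>. ?g (x, y))"
  by (rule P.integral_fst'[OF gi, symmetric])
 also have "\<dots> = (LINT x|lborel. indicator {0<..1::real} x * (LINT y|\<nu>. trunc_id \<epsilon> y))" by simp
 also have "\<dots> = (LINT y|\<nu>. trunc_id \<epsilon> y)"
 proof -
  have "measure lborel {0<..1::real} = 1" by (simp add: measure_def)
  then show ?thesis by simp
 qed
 finally show ?thesis using 1 unfolding truncated_compensated_integral_def A_def by simp
qed

text \<open>The truncated identity is discontinuous at \<open>\<epsilon>\<close> and
  \<open>- \<epsilon>\<close>. Continuous \<open>f k\<close> increase to it in modulus, keep the
  bound by \<open>\<bar>y\<bar>\<close> and vanish up to \<open>\<epsilon>\<close>, so that mean 0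
  and second moment at most 1 pass to the limit.\<close>

lemma truncated_integral_moments:
 assumes e: "0 < \<epsilon>"
 defines "T \<equiv> %om. jump_sum (\<epsilon> / 2) UNIV (trunc_id \<epsilon>) om - (LINT y|\<nu>. trunc_id \<epsilon> y)"
 shows "T \<in> borel_measurable M" and "integrable M (%om. (T om)^2)"
  and "expectation (%om. (T om)^2) <= 1" and "expectation T = 0"
proof -
 define f where "f k y = y * min 1 (real k * max 0 (\<bar>y\<bar> - \<epsilon>))" for k :: nat and y :: real
 have f: "continuous_on UNIV (f k)" for k unfolding f_def by (intro continuous_intros)
 have f0: "\<bar>y\<bar> <= 2 * (\<epsilon> / 2) ==> f k y = 0" for k y by (simp add: f_def)
 have fle: "\<bar>f k y\<bar> <= \<bar>y\<bar>" for k y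
  unfolding f_def abs_mult by (rule mult_left_le) auto
 have fle2: "\<bar>f k y\<bar> <= \<bar>trunc_id \<epsilon> y\<bar>" for k y
  using fle[of k y] f0[of y k] by (auto simp: trunc_id_def)
 have flim: "(%k. f k y) \<longlonglongrightarrow> trunc_id \<epsilon> y" for y
 proof (cases "\<epsilon> < \<bar>y\<bar>")
  case True
  have "eventually (%k. f k y = y) sequentially"
   using eventually_ge_at_top[of "nat \<lceil>1 / (\<bar>y\<bar> - \<epsilon>)\<rceil>"]
  proof eventually_elim
   fix k assume "nat \<lceil>1 / (\<bar>y\<bar> - \<epsilon>)\<rceil> <= k"
   then have "1 / (\<bar>y\<bar> - \<epsilon>) <= real k" by (simp add: nat_ceiling_le_eq)
   then show "f k y = y" using True by (simp add: f_def pos_divide_le_eq)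
  qed
  then show ?thesis using True by (simp add: trunc_id_def tendsto_eventually)
 next
  case False
  then show ?thesis using f0[of y] by (simp add: trunc_id_def)
 qed
 have e2: "0 < \<epsilon> / 2" using e by simp
 note V = jump_sum_variance[OF e2 f f0 fle]
 have [measurable]: "f k \<in> borel_measurable borel" for k by (intro borel_measurable_continuous_onI f)
 have jm [measurable]: "jump_sum (\<epsilon> / 2) UNIV (f k) \<in> borel_measurable M" for k
  by (rule jump_sum_measurable[OF e2 f f0])
 have jlim: "(%k. jump_sum (\<epsilon> / 2) UNIV (f k) om) \<longlonglongrightarrow> jump_sum (\<epsilon> / 2) UNIV (trunc_id \<epsilon>) om" for om
  unfolding jump_sum_def by (intro tendsto_sum flim)
 have tm [measurable]: "jump_sum (\<epsilon> / 2) UNIV (trunc_id \<epsilon>) \<in> borel_measurable M"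
  by (rule borel_measurable_LIMSEQ_real[OF jlim jm])
 show Tm: "T \<in> borel_measurable M" unfolding T_def by measurable
 have "(%k. LINT y|\<nu>. f k y) \<longlonglongrightarrow> (LINT y|\<nu>. trunc_id \<epsilon> y)"
 proof (rule integral_dominated_convergence[where w = "%y. \<bar>trunc_id \<epsilon> y\<bar>"])
  show "integrable \<nu> (%y. \<bar>trunc_id \<epsilon> y\<bar>)"
   by (rule integrable_nu[of _ "1 / \<epsilon>"]) (use trunc_id_le[OF e] in auto)
 qed (use flim fle2 in auto)
 then have lim: "(%k. jump_sum (\<epsilon> / 2) UNIV (f k) om - (LINT y|\<nu>. f k y)) \<longlonglongrightarrow> T om" for om
  unfolding T_def by (intro tendsto_diff jlim)
 note LB = LIMSEQ_expectation_L2_bounded[where X = "%k om. jump_sum (\<epsilon> / 2) UNIV (f k) om - (LINT y|\<nu>. f k y)" and Y = T and C = 1,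
   OF _ Tm AE_I2[OF lim] V(1,2), simplified V(3)]
 show "integrable M (%om. (T om)^2)" "expectation (%om. (T om)^2) <= 1" by (rule LB; measurable)+
 have "(%k. 0) \<longlonglongrightarrow> expectation T" by (rule LB(3)) measurable
 then show "expectation T = 0" by (simp add: LIMSEQ_const_iff)
qed

text \<open>\<open>L 1\<close> is within \<delta> in L2 of a centred variable of second moment at
  most 1. Young's inequality with weight \<delta> bounds the cross term by 2 \<delta>, and \<delta>
  tends to 0.\<close>

lemma levy_unit_moments:
 shows "integrable M (%om. (L 1 om)^2)" "expectation (L 1) = 0" "expectation (%om. (L 1 om)^2) <= 1"
proof -
 have [measurable]: "L 1 \<in> borel_measurable M" by (rule L_measurable) simp
 let ?T = "%\<epsilon> om. jump_sum (\<epsilon> / 2) UNIV (trunc_id \<epsilon>) om - (LINT y|\<nu>. trunc_id \<epsilon> y)"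
 have lim: "((%\<epsilon>. \<integral>\<^sup>+om. ennreal ((L 1 om - truncated_compensated_integral L \<nu> \<epsilon> 1 om)^2) \<partial>M) \<longlongrightarrow> 0) (at_right 0)"
  using levy by (simp add: pure_jump_levy_process_def)
 have appr: "\<exists>\<epsilon>>0. (\<integral>\<^sup>+om. ennreal ((L 1 om - ?T \<epsilon> om)^2) \<partial>M) <= ennreal (\<delta>^2)" if d: "0 < \<delta>" for \<delta> :: real
 proof -
  have "eventually (%\<epsilon>. (\<integral>\<^sup>+om. ennreal ((L 1 om - truncated_compensated_integral L \<nu> \<epsilon> 1 om)^2) \<partial>M) < ennreal (\<delta>^2)) (at_right 0)"
   by (rule order_tendstoD(2)[OF lim]) (use d in simp)
  then have "eventually (%\<epsilon>. 0 < \<epsilon> \<and> (\<integral>\<^sup>+om. ennreal ((L 1 om - truncated_compensated_integral L \<nu> \<epsilon> 1 om)^2) \<partial>M) < ennreal (\<delta>^2)) (at_right 0)"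
   using eventually_at_right_less[of "0::real"] by eventually_elim simp
  then obtain \<epsilon> where e: "0 < \<epsilon>" "(\<integral>\<^sup>+om. ennreal ((L 1 om - truncated_compensated_integral L \<nu> \<epsilon> 1 om)^2) \<partial>M) < ennreal (\<delta>^2)"
   using eventually_happens'[OF trivial_limit_at_right_real] by blast
  have "(\<integral>\<^sup>+om. ennreal ((L 1 om - truncated_compensated_integral L \<nu> \<epsilon> 1 om)^2) \<partial>M) = (\<integral>\<^sup>+om. ennreal ((L 1 om - ?T \<epsilon> om)^2) \<partial>M)"
   by (rule nn_integral_cong) (simp add: truncated_integral_eq e(1))
  then show ?thesis using e by (intro exI[of _ \<epsilon>]) (simp add: less_imp_le)
 qed
 have key: "integrable M (%om. (L 1 om)^2) \<and> \<bar>expectation (L 1)\<bar> <= \<delta> \<and> expectation (%om. (L 1 om)^2) <= 1 + \<delta> * 2 + \<delta>^2" if d: "0 < \<delta>" for \<delta>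
 proof -
  obtain \<epsilon> where e: "0 < \<epsilon>" and le: "(\<integral>\<^sup>+om. ennreal ((L 1 om - ?T \<epsilon> om)^2) \<partial>M) <= ennreal (\<delta>^2)"
   using appr[OF d] by blast
  note T = truncated_integral_moments[OF e]
  let ?Z = "%om. L 1 om - ?T \<epsilon> om"
  have Zm: "?Z \<in> borel_measurable M" using T(1) by measurable
  have Z2: "integrable M (%om. (?Z om)^2)"
   by (rule integrableI_bounded) (use Zm le_less_trans[OF le ennreal_less_top] in simp_all)
  have Z2le: "expectation (%om. (?Z om)^2) <= \<delta>^2"
   using le by (simp add: nn_integral_eq_integral[OF Z2])
  have Z1: "integrable M ?Z" by (rule integrable_of_square[OF Zm Z2])
  have T1: "integrable M (?T \<epsilon>)" by (rule integrable_of_square[OF T(1,2)])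
  have TZ: "integrable M (%om. ?T \<epsilon> om * ?Z om)" by (rule integrable_mult_of_squares[OF T(1) Zm T(2) Z2])
  have sq: "(L 1 om)^2 = (?T \<epsilon> om)^2 + 2 * (?T \<epsilon> om * ?Z om) + (?Z om)^2" for om
   by (simp add: power2_eq_square algebra_simps)
  have L2: "integrable M (%om. (L 1 om)^2)"
   unfolding sq by (intro Bochner_Integration.integrable_add integrable_mult_right T(2) TZ Z2)
  have "(expectation ?Z)^2 <= expectation (%om. (?Z om)^2)"
   using variance_positive[of ?Z] unfolding variance_eq[OF Z1 Z2] by simp
  then have "(expectation ?Z)^2 <= \<delta>^2" using Z2le by simp
  then have EZ: "\<bar>expectation ?Z\<bar> <= \<delta>" using d by (simp add: power2_le_iff_abs_le)
  have "expectation (%om. ?T \<epsilon> om + ?Z om) = expectation (?T \<epsilon>) + expectation ?Z"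
   by (rule Bochner_Integration.integral_add[OF T1 Z1])
  then have E1: "expectation (L 1) = expectation ?Z" using T(4) by simp
  have iTZ: "integrable M (%om. 2 * (?T \<epsilon> om * ?Z om))" by (intro integrable_mult_right TZ)
  have iTd: "integrable M (%om. \<delta> * (?T \<epsilon> om)^2)" and iZd: "integrable M (%om. 1 / \<delta> * (?Z om)^2)"
   by (intro integrable_mult_right T(2) Z2)+
  have "2 * (?T \<epsilon> om * ?Z om) <= \<delta> * (?T \<epsilon> om)^2 + 1 / \<delta> * (?Z om)^2" for om
   by (rule young_ineq[OF d])
  then have "expectation (%om. 2 * (?T \<epsilon> om * ?Z om)) <= expectation (%om. \<delta> * (?T \<epsilon> om)^2 + 1 / \<delta> * (?Z om)^2)"
   by (intro integral_mono iTZ Bochner_Integration.integrable_add iTd iZd)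
  also have "\<dots> = \<delta> * expectation (%om. (?T \<epsilon> om)^2) + 1 / \<delta> * expectation (%om. (?Z om)^2)"
   by (simp only: Bochner_Integration.integral_add[OF iTd iZd] integral_mult_right_zero)
  also have "\<dots> <= \<delta> * 1 + 1 / \<delta> * \<delta>^2"
   by (intro add_mono mult_left_mono T(3) Z2le) (use d in auto)
  also have "\<dots> = \<delta> * 2" using d by (simp add: power2_eq_square)
  finally have X: "expectation (%om. 2 * (?T \<epsilon> om * ?Z om)) <= \<delta> * 2" .
  have "expectation (%om. (L 1 om)^2) = expectation (%om. (?T \<epsilon> om)^2) + expectation (%om. 2 * (?T \<epsilon> om * ?Z om)) + expectation (%om. (?Z om)^2)"
   unfolding sq
   by (simp only: Bochner_Integration.integral_add[OF Bochner_Integration.integrable_add[OF T(2) iTZ] Z2]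
     Bochner_Integration.integral_add[OF T(2) iTZ])
  then have "expectation (%om. (L 1 om)^2) <= 1 + \<delta> * 2 + \<delta>^2" using T(3) X Z2le by linarith
  then show ?thesis using L2 E1 EZ by simp
 qed
 show "integrable M (%om. (L 1 om)^2)" using key[of 1] by simp
 have "\<bar>expectation (L 1)\<bar> <= 0" by (rule field_le_epsilon) (use key in simp)
 then show "expectation (L 1) = 0" by simp
 show "expectation (%om. (L 1 om)^2) <= 1"
 proof (rule field_le_epsilon)
  fix e :: real assume e: "0 < e"
  define \<delta> where "\<delta> = min 1 (e / 3)"
  have d: "0 < \<delta>" "\<delta> <= 1" "\<delta> <= e / 3" using e by (auto simp: \<delta>_def)
  have "\<delta>^2 <= \<delta>" using d by (simp add: power2_eq_square mult_left_le)
  then show "expectation (%om. (L 1 om)^2) <= 1 + e" using key[OF d(1)] d by linarith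
 qed
qed

text \<open>The \<open>N\<close> increments have one law and add up to \<open>L 1\<close> almost
  surely, so means and second moments are divided equally. That a single increment is square
  integrable has to come first; it follows by independence from the sum.\<close>

lemma levy_increment_moments:
 assumes N: "1 <= N"
 defines "X \<equiv> %l om. L (grid N (Suc l)) om - L (grid N l) om"
 shows "integrable M (%om. (X l om)^2)" "expectation (X l) = 0" "expectation (%om. (X l om)^2) <= 1 / real N"
proof -
 have [measurable]: "X l \<in> borel_measurable M" for l unfolding X_def by measurable
 have gm: "L (1 / real N) \<in> borel_measurable M" by (rule L_measurable) simp
 have distr: "distr M borel (X l) = distr M borel (L (1 / real N))" for l
  using levy unfolding pure_jump_levy_process_def levy_process_def X_def grid_Suc by simp
 have tr: "expectation (%om. f (X l om)) = expectation (%om. f (X 0 om))"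
  and tr': "integrable M (%om. f (X l om)) \<longleftrightarrow> integrable M (%om. f (X 0 om))"
  if [measurable]: "f \<in> borel_measurable borel" for f :: "real => real" and l
  using integral_distr[of "X l" M borel f] integral_distr[of "X 0" M borel f]
   integrable_distr_eq[of "X l" M borel f] integrable_distr_eq[of "X 0" M borel f]
  by (simp_all add: distr)
 have ind: "indep_vars (%_. borel) X I" for I
  unfolding X_def using levy
  by (intro indep_increments_grid) (simp add: pure_jump_levy_process_def levy_process_def)
 have tel: "AE om in M. (\<Sum>l<N. X l om) = L 1 om"
 proof -
  have "AE om in M. L 0 om = 0" using levy by (simp add: pure_jump_levy_process_def levy_process_def)
  then show ?thesis
  proof eventually_elim
   case (elim om)
   have "(\<Sum>l<N. X l om) = L (grid N N) om - L (grid N 0) om"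
    unfolding X_def by (rule sum_lessThan_telescope)
   then show ?case using elim N by (simp add: grid_def)
  qed
 qed
 have S2: "integrable M (%om. (\<Sum>l<N. X l om)^2)" "expectation (%om. (\<Sum>l<N. X l om)^2) <= 1"
  "expectation (%om. \<Sum>l<N. X l om) = 0"
 proof -
  have [measurable]: "L 1 \<in> borel_measurable M" by (rule L_measurable) simp
  have ae: "AE om in M. (\<Sum>l<N. X l om)^2 = (L 1 om)^2" using tel by eventually_elim simp
  show "integrable M (%om. (\<Sum>l<N. X l om)^2)"
   using levy_unit_moments(1) ae by (subst integrable_cong_AE[where g = "%om. (L 1 om)^2"]) auto
  show "expectation (%om. (\<Sum>l<N. X l om)^2) <= 1"
   using levy_unit_moments(3) ae by (subst integral_cong_AE[where g = "%om. (L 1 om)^2"]) auto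
  show "expectation (%om. \<Sum>l<N. X l om) = 0"
   using levy_unit_moments(2) tel by (subst integral_cong_AE[where g = "L 1"]) auto
 qed
 have X02: "integrable M (%om. (X 0 om)^2)"
 proof (rule indep_square_integrable)
  have N': "{..<N} = insert 0 {1..<N}" using N by auto
  show "indep_var borel (X 0) borel (%om. \<Sum>l\<in>{1..<N}. X l om)"
   by (rule indep_vars_sum) (auto intro: ind)
  show "integrable M (%om. (X 0 om + (\<Sum>l\<in>{1..<N}. X l om))^2)"
   using S2(1) unfolding N' by simp
 qed
 have X2: "integrable M (%om. (X l om)^2)" for l using tr'[of "%x. x^2" l] X02 by simp
 then show "integrable M (%om. (X l om)^2)" .
 have X1: "integrable M (X l)" for l by (rule integrable_of_square[OF _ X2]) simp
 have tr1: "expectation (X l) = expectation (X 0)" for l using tr[of "%x. x" l] by simp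
 have tr2: "expectation (%om. (X l om)^2) = expectation (%om. (X 0 om)^2)" for l
  using tr[of "%x. x^2" l] by simp
 have "(\<Sum>l<N. expectation (X l)) = 0" using S2(3) X1 by simp
 moreover have "(\<Sum>l<N. expectation (X l)) = (\<Sum>l<N. expectation (X 0))"
  by (rule sum.cong[OF refl]) (rule tr1)
 ultimately have "expectation (X 0) = 0" using N by simp
 then have m: "expectation (X l) = 0" for l unfolding tr1[of l] .
 then show "expectation (X l) = 0" .
 have "expectation (%om. (\<Sum>l<N. X l om)^2) = (\<Sum>l<N. expectation (%om. (X l om)^2))"
  by (rule integral_square_sum_orthogonal)
    (auto simp: X2 m indep_var_lebesgue_integral[OF indep_var_pair[OF ind[of UNIV]] X1 X1])
 also have "\<dots> = (\<Sum>l<N. expectation (%om. (X 0 om)^2))"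
  by (rule sum.cong[OF refl]) (rule tr2)
 also have "\<dots> = real N * expectation (%om. (X 0 om)^2)" by simp
 finally have "real N * expectation (%om. (X 0 om)^2) <= 1" using S2(2) by simp
 then have "expectation (%om. (X 0 om)^2) <= 1 / real N" using N by (simp add: pos_le_divide_eq mult.commute)
 then show "expectation (%om. (X l om)^2) <= 1 / real N" unfolding tr2[of l] .
qed

lemma levy_grid_sum:
 assumes N: "1 <= N"
 shows "integrable M (%om. (grid_sum N m a (%t. L t om))^2)"
  and "expectation (%om. grid_sum N m a (%t. L t om)) = 0"
  and "expectation (%om. (grid_sum N m a (%t. L t om))^2) <= 1 / real N * (\<Sum>l<m. (a l)^2)"
proof -
 have ind: "indep_vars (%_. borel) (%l om. L (grid N (Suc l)) om - L (grid N l) om) {..<m}"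
  using levy by (intro indep_increments_grid) (simp add: pure_jump_levy_process_def levy_process_def)
 note W = weighted_indep_sum[OF finite_lessThan ind levy_increment_moments[OF N], of a]
 show "integrable M (%om. (grid_sum N m a (%t. L t om))^2)"
  and "expectation (%om. grid_sum N m a (%t. L t om)) = 0"
  and "expectation (%om. (grid_sum N m a (%t. L t om))^2) <= 1 / real N * (\<Sum>l<m. (a l)^2)"
  unfolding grid_sum_def by (fact W)+
qed

end

section \<open>The observed path and linear estimators\<close>

lemma cadlag_on_cong: "(\<And>t. t \<in> T ==> f t = g t) ==> cadlag_on T f \<longleftrightarrow> cadlag_on T g"
proof -
 assume eq: "\<And>t. t \<in> T ==> f t = g t"
 have "(f \<longlongrightarrow> l) (at t within T \<inter> A) \<longleftrightarrow> (g \<longlongrightarrow> l) (at t within T \<inter> A)" for l t A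
  by (rule tendsto_cong) (use eq in \<open>auto simp: eventually_at intro!: exI[of _ 1]\<close>)
 then show ?thesis unfolding cadlag_on_def using eq by (intro ball_cong) auto
qed

lemma cadlag_on_add:
 assumes "continuous_on T f" "cadlag_on T g" shows "cadlag_on T (%t. f t + g t)"
 unfolding cadlag_on_def
proof (intro ballI conjI)
 fix t assume t: "t \<in> T"
 have f: "(f \<longlongrightarrow> f t) (at t within T)" using assms(1) t by (simp add: continuous_on_def)
 have f': "(f \<longlongrightarrow> f t) (at t within T \<inter> A)" for A
  by (rule tendsto_within_subset[OF f]) auto
 show "((%t. f t + g t) \<longlongrightarrow> f t + g t) (at t within T \<inter> {t<..})"
  using assms(2) t by (intro tendsto_add f') (auto simp: cadlag_on_def)
 obtain l where "(g \<longlongrightarrow> l) (at t within T \<inter> {..<t})" using assms(2) t by (auto simp: cadlag_on_def)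
 then show "\<exists>l. ((%t. f t + g t) \<longlongrightarrow> l) (at t within T \<inter> {..<t})"
  by (intro exI[of _ "f t + l"] tendsto_add f')
qed

definition path_restrict :: "nat => (real => real) => real => real" where
 "path_restrict n x = (\<lambda>t\<in>{0..real n}. x t)"

abbreviation path_PiM :: "nat => (real => real) measure" where
 "path_PiM n \<equiv> Pi\<^sub>M {0..real n} (%_. borel)"

lemma space_skorokhod: "space (skorokhod_space n) = space (path_PiM n) \<inter> {f. cadlag_on {0..real n} f}"
 by (auto simp: skorokhod_space_def space_restrict_space)

lemma cadlag_on_restrict [simp]: "cadlag_on T (restrict x T) \<longleftrightarrow> cadlag_on T x"
 by (rule cadlag_on_cong) simp

lemma measurable_skorokhodI:
 assumes "f \<in> measurable M (path_PiM n)" "\<And>x. x \<in> space M ==> cadlag_on {0..real n} (f x)"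
 shows "f \<in> measurable M (skorokhod_space n)"
 unfolding skorokhod_space_def by (rule measurable_restrict_space2) (use assms in auto)

lemma measurable_path_eval:
 "t \<in> {0..real n} ==> (%x. x t) \<in> borel_measurable (path_PiM n)"
 by (rule measurable_component_singleton)

lemma measurable_skorokhod_of_PiM:
 "G \<in> measurable (path_PiM n) N ==> G \<in> measurable (skorokhod_space n) N"
 unfolding skorokhod_space_def by (rule measurable_restrict_space1)

lemma measurable_path_shift:
 "(%x. path_restrict n (%t. h t + x t)) \<in> measurable (path_PiM n) (path_PiM n)"
 unfolding path_restrict_def
 by (intro measurable_restrict borel_measurable_add measurable_path_eval) auto

lemma measurable_path_restrict:
 assumes "\<And>t. t \<in> {0..real n} ==> X t \<in> borel_measurable M"
 shows "(%om. path_restrict n (%t. X t om)) \<in> measurable M (path_PiM n)"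
 unfolding path_restrict_def using assms by (intro measurable_restrict) auto

text \<open>The functional is measurable on the full product space because the process may leave the
  Skorokhod space on a null event, where a functional on that space alone could not be
  evaluated.\<close>

lemma nn_integral_path_law:
 assumes Q: "is_path_law M n X Q" and X: "\<And>t. t \<in> {0..real n} ==> X t \<in> borel_measurable M"
  and G: "G \<in> borel_measurable (path_PiM n)"
 shows "(\<integral>\<^sup>+x. G x \<partial>Q) = (\<integral>\<^sup>+om. G (path_restrict n (%t. X t om)) \<partial>M)"
proof -
 have sQ: "sets Q = sets (skorokhod_space n)" using Q by (simp add: is_path_law_def)
 have spQ: "space Q = space (skorokhod_space n)" by (rule sets_eq_imp_space_eq[OF sQ])
 have id: "(%x. x) \<in> measurable Q (path_PiM n)"
  using measurable_skorokhod_of_PiM[OF measurable_ident[of "path_PiM n"]] sQ by (simp add: id_def cong: measurable_cong_sets)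
 note pm = measurable_path_restrict[of n X M, OF X]
 have "distr Q (path_PiM n) (%x. x) = distr M (path_PiM n) (%om. path_restrict n (%t. X t om))"
 proof (rule measure_eqI)
  fix A assume "A \<in> sets (distr Q (path_PiM n) (%x. x))"
  then have A: "A \<in> sets (path_PiM n)" by simp
  have "emeasure (distr Q (path_PiM n) (%x. x)) A = emeasure Q (A \<inter> space (skorokhod_space n))"
   using A id by (simp add: emeasure_distr spQ vimage_def Int_def)
  also have "\<dots> = emeasure M {om\<in>space M. (\<lambda>t\<in>{0..real n}. X t om) \<in> A}"
   using Q A by (simp add: is_path_law_def)
  also have "\<dots> = emeasure (distr M (path_PiM n) (%om. path_restrict n (%t. X t om))) A"
   using A pm by (subst emeasure_distr) (auto simp: path_restrict_def intro!: arg_cong2[where f = emeasure])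
  finally show "emeasure (distr Q (path_PiM n) (%x. x)) A = emeasure (distr M (path_PiM n) (%om. path_restrict n (%t. X t om))) A" .
 qed simp
 then have "(\<integral>\<^sup>+x. G x \<partial>distr Q (path_PiM n) (%x. x)) = (\<integral>\<^sup>+x. G x \<partial>distr M (path_PiM n) (%om. path_restrict n (%t. X t om)))"
  by simp
 then show ?thesis
  using nn_integral_distr[OF id, of G] nn_integral_distr[OF pm, of G] G by simp
qed

section \<open>Primitives of continuous functions and their grid sums\<close>

definition primitive :: "(real => real) => real => real" where
 "primitive f t = (LBINT s:{0..t}. f s)"

lemma primitive_has_derivative:
 assumes f: "continuous_on UNIV f" and t: "0 < t"
 shows "(primitive f has_real_derivative f t) (at t)"
proof -
 have eq: "primitive f u = integral {0..u} f" for u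
  unfolding primitive_def
  by (rule set_borel_integral_eq_integral(2), unfold set_integrable_def, rule borel_integrable_compact)
    (auto intro: continuous_on_subset[OF f])
 have "((%u. integral {0..u} f) has_vector_derivative f t) (at t within {0..t + 1})"
  by (rule integral_has_vector_derivative) (use t in \<open>auto intro: continuous_on_subset[OF f]\<close>)
 then have "((%u. integral {0..u} f) has_real_derivative f t) (at t within {0<..<t + 1})"
  unfolding has_real_derivative_iff_has_vector_derivative
  by (rule has_vector_derivative_within_subset) auto
 moreover have "at t within {0<..<t + 1} = at t" by (rule at_within_open) (use t in auto)
 ultimately show ?thesis unfolding eq[abs_def] by simp
qed

lemma continuous_on_primitive:
 assumes f: "continuous_on UNIV f"
 shows "continuous_on {0..} (primitive f)"
proof -
 have eq: "primitive f u = integral {0..u} f" for u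
  unfolding primitive_def
  by (rule set_borel_integral_eq_integral(2), unfold set_integrable_def, rule borel_integrable_compact)
    (auto intro: continuous_on_subset[OF f])
 have "continuous_on {0..real b} (primitive f)" for b
  unfolding eq[abs_def]
  by (intro indefinite_integral_continuous_1 integrable_continuous_interval continuous_on_subset[OF f]) auto
 then have "continuous (at t within {0..}) (primitive f)" if "0 <= t" for t
 proof -
  obtain b :: nat where b: "t < real b" using reals_Archimedean2 by blast
  have "continuous (at t within {0..real b}) (primitive f)"
   using \<open>continuous_on {0..real b} (primitive f)\<close> that b by (simp add: continuous_on_eq_continuous_within)
  moreover have "at t within {0..} = at t within {0..real b}"
   by (rule at_within_nhd[of t "{..<real b}"]) (use b in auto)
  ultimately show ?thesis by simp
 qed
 then show ?thesis by (simp add: continuous_on_eq_continuous_within)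
qed

lemma primitive_0 [simp]: "primitive f 0 = 0"
 unfolding primitive_def set_lebesgue_integral_def
 by (rule integral_eq_zero_AE) (use AE_lborel_singleton[of "0::real"] in \<open>auto elim!: eventually_mono\<close>)

lemma primitive_1: "primitive f 1 = (LINT s|U01. f s)"
 by (simp add: primitive_def integral_U01)

lemma primitive_mono_deriv:
 assumes cont: "continuous_on {0..} D" and der: "\<And>t. 0 < t ==> u < t ==> t < v ==> (D has_real_derivative D' t) (at t)"
  and np: "\<And>t. u < t ==> t < v ==> D' t <= 0" and uv: "0 <= u" "u <= v"
 shows "D v <= D u"
 by (rule DERIV_nonpos_imp_decreasing_open[OF uv(2)])
   (use der np uv in \<open>force intro!: continuous_on_subset[OF cont]\<close>)+

text \<open>The increment over a unit step has derivative 0 by periodicity, hence equals its value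
  at the start.\<close>

lemma primitive_periodic:
 assumes f: "continuous_on UNIV f" and per: "\<And>x. f (x + 1) = f x"
 shows "primitive f (real n) = real n * primitive f 1"
proof -
 have shift: "primitive f (t + 1) - primitive f t = primitive f 1" if t: "0 <= t" for t
 proof -
  have c: "continuous_on {0..} (%t. primitive f (t + 1) - primitive f t)"
   by (intro continuous_intros continuous_on_primitive f continuous_on_compose2[OF continuous_on_primitive[OF f]]) auto
  have d: "((%t. primitive f (t + 1) - primitive f t) has_real_derivative 0) (at s)" if "0 < s" for s
  proof -
   have "((%t. primitive f (t + 1)) has_real_derivative f (s + 1)) (at s)"
    using primitive_has_derivative[OF f, of "s + 1"] that by (simp add: DERIV_shift)
   then have "((%t. primitive f (t + 1) - primitive f t) has_real_derivative f (s + 1) - f s) (at s)"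
    by (rule DERIV_diff) (rule primitive_has_derivative[OF f that])
   then show ?thesis by (simp add: per)
  qed
  have "primitive f (t + 1) - primitive f t <= primitive f (0 + 1) - primitive f 0"
   by (rule primitive_mono_deriv[OF c d]) (use t in auto)
  moreover have "- (primitive f (t + 1) - primitive f t) <= - (primitive f (0 + 1) - primitive f 0)"
   by (rule primitive_mono_deriv[OF continuous_on_minus[OF c] DERIV_minus[OF d]]) (use t in auto)
  ultimately show ?thesis by simp
 qed
 show ?thesis
 proof (induction n)
  case (Suc n)
  then show ?case using shift[of "real n"] by (simp add: algebra_simps)
 qed simp
qed

lemma cas_lipschitz: "\<bar>cas j u - cas j t\<bar> <= 4 * pi * \<bar>real_of_int j\<bar> * \<bar>u - t\<bar>"
proof -
 have bound: "norm (2 * pi * real_of_int j * cas (- j) x) <= 4 * pi * \<bar>real_of_int j\<bar>" for x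
 proof -
  have "\<bar>2 * pi * real_of_int j * cas (- j) x\<bar> <= (2 * pi * \<bar>real_of_int j\<bar>) * 2"
   unfolding abs_mult by (intro mult_mono abs_cas_le) auto
  then show ?thesis by simp
 qed
 have "norm (cas j u - cas j t) <= 4 * pi * \<bar>real_of_int j\<bar> * norm (u - t)"
  by (rule field_differentiable_bound[OF convex_UNIV cas_has_derivative bound]) auto
 then show ?thesis by simp
qed

text \<open>On a cell the integrand is frozen at the left endpoint; the Lipschitz constant of
  \<open>cas j\<close> times the mesh bounds the change, weighted with \<open>\<bar>f\<bar>\<close>.
  The cells then telescope.\<close>

lemma grid_sum_primitive_error:
 assumes f: "continuous_on UNIV f" and per: "\<And>x. f (x + 1) = f x" and N: "1 <= N"
 shows "\<bar>grid_sum N (n * N) (%l. cas j (grid N l)) (primitive f) - real n * coef f j\<bar>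
   <= 4 * pi * \<bar>real_of_int j\<bar> / real N * (real n * (LINT s|U01. \<bar>f s\<bar>))"
proof -
 define e where "e = 4 * pi * \<bar>real_of_int j\<bar> / real N"
 define C where "C = primitive (%s. f s * cas j s)"
 define P where "P = primitive (%s. \<bar>f s\<bar>)"
 have cc: "continuous_on UNIV (%s. f s * cas j s)" and ca: "continuous_on UNIV (%s. \<bar>f s\<bar>)"
  by (intro continuous_intros f)+
 have cell: "\<bar>cas j (grid N l) * (primitive f (grid N (Suc l)) - primitive f (grid N l)) - (C (grid N (Suc l)) - C (grid N l))\<bar>
   <= e * (P (grid N (Suc l)) - P (grid N l))" for l
 proof -
  let ?u = "grid N l" and ?v = "grid N (Suc l)"
  have small: "\<bar>(cas j ?u - cas j t) * f t\<bar> <= e * \<bar>f t\<bar>" if "?u < t" "t < ?v" for t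
  proof -
   have "\<bar>?u - t\<bar> <= 1 / real N" using that unfolding grid_Suc by simp
   then have "4 * pi * \<bar>real_of_int j\<bar> * \<bar>?u - t\<bar> <= 4 * pi * \<bar>real_of_int j\<bar> * (1 / real N)"
    by (intro mult_left_mono) auto
   then have "\<bar>cas j ?u - cas j t\<bar> <= e" using cas_lipschitz[of j ?u t] by (simp add: e_def)
   then show ?thesis unfolding abs_mult by (intro mult_right_mono) auto
  qed
  \<comment> \<open>Instead of estimating integrals, the signed difference minus its bound is shown
    to have a nonpositive derivative; \<open>s\<close> covers both signs.\<close>
  have one: "D ?v <= D ?u"
   if "D = (%t. s * (cas j ?u * primitive f t - C t) - e * P t)" "s = 1 \<or> s = - 1" for D and s :: real
  proof (rule primitive_mono_deriv[where D = D and u = "grid N l" and v = "grid N (Suc l)" and D' = "%t. s * (cas j ?u * f t - f t * cas j t) - e * \<bar>f t\<bar>"])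
   show "continuous_on {0..} D" unfolding that C_def P_def
    by (intro continuous_intros continuous_on_primitive f cc ca)
   show "(D has_real_derivative s * (cas j ?u * f t - f t * cas j t) - e * \<bar>f t\<bar>) (at t)" if "0 < t" for t
    unfolding \<open>D = _\<close> C_def P_def
    by (intro DERIV_diff DERIV_cmult primitive_has_derivative f cc ca that)
   show "s * (cas j ?u * f t - f t * cas j t) - e * \<bar>f t\<bar> <= 0" if "?u < t" "t < ?v" for t
   proof -
    have "s * (cas j ?u * f t - f t * cas j t) <= \<bar>(cas j ?u - cas j t) * f t\<bar>"
     using \<open>s = 1 \<or> s = - 1\<close> by (auto simp: algebra_simps abs_if)
    then show ?thesis using small[OF that] by linarith
   qed
  qed (auto intro: grid_mono)
  show ?thesis using one[of _ 1] one[of _ "- 1"] by (simp add: algebra_simps abs_le_iff)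
 qed
 have "\<bar>(\<Sum>l<n * N. cas j (grid N l) * (primitive f (grid N (Suc l)) - primitive f (grid N l)) - (C (grid N (Suc l)) - C (grid N l)))\<bar>
   <= (\<Sum>l<n * N. e * (P (grid N (Suc l)) - P (grid N l)))"
  by (rule order_trans[OF sum_abs sum_mono[OF cell]])
 moreover have "(\<Sum>l<n * N. C (grid N (Suc l)) - C (grid N l)) = C (real n) - C 0"
  using N sum_lessThan_telescope[of "%l. C (grid N l)" "n * N"] by (simp add: grid_def)
 moreover have "(\<Sum>l<n * N. P (grid N (Suc l)) - P (grid N l)) = P (real n) - P 0"
  using N sum_lessThan_telescope[of "%l. P (grid N l)" "n * N"] by (simp add: grid_def)
 moreover have "C (real n) = real n * coef f j"
  unfolding C_def by (subst primitive_periodic[OF cc]) (auto simp: per cas_periodic primitive_1 coef_def)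
 moreover have "P (real n) = real n * (LINT s|U01. \<bar>f s\<bar>)"
  unfolding P_def by (subst primitive_periodic[OF ca]) (auto simp: per primitive_1)
 ultimately show ?thesis
  unfolding grid_sum_def sum_subtractf sum_distrib_left[symmetric] e_def[symmetric] by (simp add: C_def P_def)
qed

lemma measurable_observation_shift:
 assumes S: "continuous_on UNIV S"
 shows "(%x. \<lambda>t\<in>{0..real n}. (LBINT s:{0..t}. S s) + x t) \<in> measurable (skorokhod_space n) (skorokhod_space n)"
proof -
 have eq: "(%x. \<lambda>t\<in>{0..real n}. (LBINT s:{0..t}. S s) + x t) = (%x. path_restrict n (%t. primitive S t + x t))"
  by (auto simp: path_restrict_def primitive_def fun_eq_iff)
 show ?thesis unfolding eq
 proof (rule measurable_skorokhodI)
  show "(%x. path_restrict n (%t. primitive S t + x t)) \<in> skorokhod_space n \<rightarrow>\<^sub>M path_PiM n"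
   by (rule measurable_skorokhod_of_PiM[OF measurable_path_shift])
  fix x assume "x \<in> space (skorokhod_space n)"
  then have "cadlag_on {0..real n} x" by (simp add: space_skorokhod)
  then have "cadlag_on {0..real n} (%t. primitive S t + x t)"
   by (intro cadlag_on_add continuous_on_subset[OF continuous_on_primitive[OF S]]) auto
  then show "cadlag_on {0..real n} (path_restrict n (%t. primitive S t + x t))"
   unfolding path_restrict_def by simp
 qed
qed

lemma nn_integral_observation_law:
 assumes S: "continuous_on UNIV S" and Q: "sets Q = sets (skorokhod_space n)"
  and F: "F \<in> borel_measurable (skorokhod_space n)"
 shows "(\<integral>\<^sup>+y. F y \<partial>observation_law n Q S) = (\<integral>\<^sup>+x. F (path_restrict n (%t. primitive S t + x t)) \<partial>Q)"
proof -
 have "(%x. \<lambda>t\<in>{0..real n}. (LBINT s:{0..t}. S s) + x t) \<in> measurable Q (skorokhod_space n)"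
  using measurable_observation_shift[OF S] Q by (simp cong: measurable_cong_sets)
 from nn_integral_distr[OF this, of F] F show ?thesis
  unfolding observation_law_def by (simp add: path_restrict_def primitive_def)
qed


section \<open>Linear estimators and their loss\<close>

definition coef_estimate :: "nat => nat => int => (real => real) => real" where
 "coef_estimate n N j y = grid_sum N (n * N) (%l. cas j (grid N l)) y / real n"

definition linear_estimator :: "nat => nat => nat => (int => real) => (real => real) => real => real" where
 "linear_estimator n N W wt y s = trig W (%j. wt j * coef_estimate n N j y) s"

lemma grid_in_range: "1 <= N ==> l <= n * N ==> grid N l \<in> {0..real n}"
proof -
 assume N: "1 <= N" and l: "l <= n * N"
 have "real l <= real n * real N" using l by (metis of_nat_le_iff of_nat_mult)
 then show ?thesis using N by (simp add: grid_def pos_divide_le_eq)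
qed

lemma grid_sum_restrict:
 assumes "1 <= N" shows "grid_sum N (n * N) a (path_restrict n x) = grid_sum N (n * N) a x"
 unfolding grid_sum_def path_restrict_def
 by (intro sum.cong) (use grid_in_range[OF assms, of _ n] in auto)

lemma grid_sum_add: "grid_sum N m a (%t. f t + g t) = grid_sum N m a f + grid_sum N m a g"
 unfolding grid_sum_def by (simp add: sum.distrib[symmetric] algebra_simps)

lemma grid_sum_cmult: "grid_sum N m a (%t. c * f t) = c * grid_sum N m a f"
 unfolding grid_sum_def by (simp add: sum_distrib_left algebra_simps)

lemma coef_estimate_measurable:
 assumes N: "1 <= N"
 shows "coef_estimate n N j \<in> borel_measurable (path_PiM n)"
proof -
 have [measurable]: "(%x. x (grid N l)) \<in> borel_measurable (path_PiM n)" if "l <= n * N" for l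
  by (rule measurable_path_eval[OF grid_in_range[OF N that]])
 have "(%y. \<Sum>l<n * N. cas j (grid N l) * (y (grid N (Suc l)) - y (grid N l))) \<in> borel_measurable (path_PiM n)"
  by (intro borel_measurable_sum) auto
 then show ?thesis unfolding coef_estimate_def[abs_def] grid_sum_def by simp
qed

lemma linear_estimator_in_estimators:
 assumes N: "1 <= N"
 shows "linear_estimator n N W wt \<in> estimators n"
proof -
 have [measurable]: "coef_estimate n N j \<in> borel_measurable (skorokhod_space n)" for j
  by (rule measurable_skorokhod_of_PiM[OF coef_estimate_measurable[OF N]])
 have c [measurable]: "cas j \<in> borel_measurable (restrict_space borel {0..1})" for j
  by (rule measurable_restrict_space1) measurable
 show ?thesis unfolding estimators_def linear_estimator_def trig_def by measurable
qed

text \<open>The loss depends on finitely many coordinates of the path, so it is measurable on the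
  product space and its mean can be computed on the original probability space.\<close>

lemma risk_linear_estimator:
 assumes S: "continuous_on UNIV S" and Q: "is_path_law M n X Q"
  and X: "\<And>t. t \<in> {0..real n} ==> X t \<in> borel_measurable M" and N: "1 <= N"
 shows "risk n Q (linear_estimator n N W wt) S =
  (\<integral>\<^sup>+om. ennreal ((\<Sum>j\<in>{- int W..int W}. (wt j * coef_estimate n N j (%t. primitive S t + X t om) - coef S j)^2) +
    ((LINT x|U01. (S x)^2) - (\<Sum>j\<in>{- int W..int W}. (coef S j)^2))) \<partial>M)"
proof -
 let ?T = "(LINT x|U01. (S x)^2) - (\<Sum>j\<in>{- int W..int W}. (coef S j)^2)"
 let ?F = "%y. ennreal ((\<Sum>j\<in>{- int W..int W}. (wt j * coef_estimate n N j y - coef S j)^2) + ?T)"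
 have S01: "continuous_on {0..1} S" using S by (rule continuous_on_subset) simp
 have loss: "sq_norm (%s. linear_estimator n N W wt y s - S s) = ?F y" for y
 proof -
  have c: "continuous_on {0..1} (%s. linear_estimator n N W wt y s - S s)"
   unfolding linear_estimator_def by (intro continuous_intros S01)
  show ?thesis
   unfolding sq_norm_eq_integral[OF c] unfolding linear_estimator_def integral_diff_trig_sq[OF S01] ..
 qed
 note [measurable] = coef_estimate_measurable[OF N]
 have F: "?F \<in> borel_measurable (path_PiM n)" by measurable
 have F': "(%x. ?F (path_restrict n (%t. primitive S t + x t))) \<in> borel_measurable (path_PiM n)"
  by (rule measurable_compose[OF measurable_path_shift F])
 have sQ: "sets Q = sets (skorokhod_space n)" using Q by (simp add: is_path_law_def)
 have rr: "coef_estimate n N j (path_restrict n (%t. primitive S t + path_restrict n x t)) = coef_estimate n N j (%t. primitive S t + x t)" for j x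
  unfolding coef_estimate_def grid_sum_restrict[OF N] grid_sum_add by (simp add: grid_sum_restrict[OF N])
 have "risk n Q (linear_estimator n N W wt) S = (\<integral>\<^sup>+x. ?F (path_restrict n (%t. primitive S t + x t)) \<partial>Q)"
  unfolding risk_def loss by (rule nn_integral_observation_law[OF S sQ measurable_skorokhod_of_PiM[OF F]])
 also have "\<dots> = (\<integral>\<^sup>+om. ?F (path_restrict n (%t. primitive S t + path_restrict n (%t. X t om) t)) \<partial>M)"
  by (rule nn_integral_path_law[OF Q X F'])
 finally show ?thesis unfolding rr .
qed

text \<open>Averaging the sum with its reflection turns every pair of squares into the constant
  2.\<close>

lemma pair_sum_cas:
 assumes wt: "\<And>j. wt (- j) = wt j"
 shows "(\<Sum>j\<in>{- int W..int W}. (wt j)^2 * (cas j x)^2) = (\<Sum>j\<in>{- int W..int W}. (wt j)^2)"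
proof -
 have "(\<Sum>j\<in>{- int W..int W}. (wt j)^2 * (cas j x)^2) = (\<Sum>j\<in>{- int W..int W}. (wt j)^2 * (cas (- j) x)^2)"
  by (rule sum.reindex_bij_witness[where i = uminus and j = uminus]) (auto simp: wt)
 then have "2 * (\<Sum>j\<in>{- int W..int W}. (wt j)^2 * (cas j x)^2) =
   (\<Sum>j\<in>{- int W..int W}. (wt j)^2 * ((cas j x)^2 + (cas (- j) x)^2))"
  by (simp add: sum.distrib distrib_left)
 also have "\<dots> = 2 * (\<Sum>j\<in>{- int W..int W}. (wt j)^2)"
  unfolding cas_sq_pair by (simp add: sum_distrib_left mult.commute)
 finally show ?thesis by simp
qed

section \<open>Second moments of the whole noise on a grid\<close>

context semi_markov_noise
begin

lemma noise_measurable: "0 <= t ==> noise \<rho>1 \<rho>2 \<rho>3 t \<in> borel_measurable M"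
 unfolding noise_def[abs_def]
 by (intro borel_measurable_add borel_measurable_times borel_measurable_const w_measurable L_measurable renewal_reward_measurable)

lemma indep_var_sigma_algebras:
 fixes X Z :: "'a => real"
 assumes G: "sigma_algebra (space M) G" and H: "sigma_algebra (space M) H"
  and indep: "\<And>A B. A \<in> G ==> B \<in> H ==> A \<in> events \<and> B \<in> events \<and> prob (A \<inter> B) = prob A * prob B"
  and X: "X \<in> borel_measurable (sigma (space M) G)" and Z: "Z \<in> borel_measurable (sigma (space M) H)"
 shows "indep_var borel X borel Z"
proof -
 have setsG: "sets (sigma (space M) G) = G" using sigma_algebra.sets_measure_of_eq[OF G] by blast
 have setsH: "sets (sigma (space M) H) = H" using sigma_algebra.sets_measure_of_eq[OF H] by blast
 have XG: "X -` A \<inter> space M \<in> G" if "A \<in> sets borel" for A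
  using measurable_sets[OF X that] unfolding setsG by (simp add: space_measure_of_conv)
 have ZH: "Z -` A \<inter> space M \<in> H" if "A \<in> sets borel" for A
  using measurable_sets[OF Z that] unfolding setsH by (simp add: space_measure_of_conv)
 interpret G: sigma_algebra "space M" G by (rule G)
 interpret H: sigma_algebra "space M" H by (rule H)
 note top = G.top H.top
 have subG: "sigma_sets (space M) {X -` A \<inter> space M |A. A \<in> sets borel} \<subseteq> G"
  by (intro sigma_algebra.sigma_sets_subset[OF G]) (auto simp: XG)
 have subH: "sigma_sets (space M) {Z -` A \<inter> space M |A. A \<in> sets borel} \<subseteq> H"
  by (intro sigma_algebra.sigma_sets_subset[OF H]) (auto simp: ZH)
 have evG: "A \<in> G ==> A \<in> events" and evH: "B \<in> H ==> B \<in> events" for A B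
  using indep top by blast+
 have "random_variable borel X" by (rule measurableI) (use XG evG in auto)
 moreover have "random_variable borel Z" by (rule measurableI) (use ZH evH in auto)
 moreover have "indep_set (sigma_sets (space M) {X -` A \<inter> space M |A. A \<in> sets borel})
   (sigma_sets (space M) {Z -` A \<inter> space M |A. A \<in> sets borel})"
  by (rule indep_setI) (use subG subH evG evH indep in blast)+
 ultimately show ?thesis by (simp add: indep_var_eq)
qed

lemma sigma_algebra_sigma_gen: "sigma_algebra (space M) (sigma_gen M I X)"
 unfolding sigma_gen_def by (rule sigma_algebra_sigma_sets) auto

text \<open>The reward process involves two of the four sigma-algebras, counts and marks. They are
  first merged into one, which remains independent of the sigma-algebra at position
  \<open>a\<close>.\<close>

lemma indep_of_reward:
 fixes D :: "'a => real"
 assumes a: "a < 2"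
  and D: "D \<in> borel_measurable (sigma (space M) ([sigma_gen M {0..} w, sigma_gen M {0..} L] ! a))"
 shows "indep_var borel D borel (%om. grid_sum N m c (%t. renewal_reward \<tau> Y t om))"
proof -
 let ?F = "%j. [sigma_gen M {0..} w, sigma_gen M {0..} L,
   sigma_gen M {0..} (%t om. real (renewal_count \<tau> t om)), sigma_gen M {1..} Y] ! j"
 let ?I = "%j::nat. if j = 0 then {a} else {2, 3 :: nat}"
 let ?H = "sigma_sets (space M) (?F 2 \<union> ?F 3)"
 have alg: "sigma_algebra (space M) (?F j)" if "j < 4" for j
 proof -
  have "j \<in> {0, 1, 2, 3}" using that by auto
  then show ?thesis by (auto simp: numeral_2_eq_2 numeral_3_eq_3 sigma_algebra_sigma_gen)
 qed
 have pow: "?F j \<subseteq> Pow (space M)" if "j < 4" for j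
 proof -
  interpret sigma_algebra "space M" "?F j" by (rule alg[OF that])
  show ?thesis by (rule space_closed)
 qed
 have ind: "indep_sets (%j. sigma_sets (space M) (\<Union>i\<in>?I j. ?F i)) {0, 1 :: nat}"
 proof (rule indep_sets_collect_sigma)
  show "indep_sets ?F (\<Union>j\<in>{0, 1 :: nat}. ?I j)"
   by (rule indep_sets_mono_index[OF _ mutual_indep]) (use a in auto)
  show "Int_stable (?F i)" if "j \<in> {0, 1}" "i \<in> ?I j" for i j :: nat
  proof -
   have "i < 4" using that a by (auto split: if_splits)
   then interpret sigma_algebra "space M" "?F i" by (rule alg)
   show ?thesis unfolding Int_stable_def by blast
  qed
  show "disjoint_family_on ?I {0, 1}" using a by (auto simp: disjoint_family_on_def)
 qed
 have Fa: "?F a = [sigma_gen M {0..} w, sigma_gen M {0..} L] ! a"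
  using a by (cases a) (auto simp: less_Suc_eq numeral_2_eq_2)
 have a4: "a < 4" using a by simp
 show ?thesis
 proof (rule indep_var_sigma_algebras)
  show "sigma_algebra (space M) (?F a)" by (rule alg[OF a4])
  show H: "sigma_algebra (space M) ?H" by (rule sigma_algebra_sigma_sets, rule Un_least) (rule pow, simp)+
  show "D \<in> borel_measurable (sigma (space M) (?F a))" using D unfolding Fa .
  show "A \<in> events \<and> B \<in> events \<and> prob (A \<inter> B) = prob A * prob B" if A: "A \<in> ?F a" and B: "B \<in> ?H" for A B
  proof -
   have A': "A \<in> sigma_sets (space M) (\<Union>i\<in>?I 0. ?F i)" using A by auto
   have B': "B \<in> sigma_sets (space M) (\<Union>i\<in>?I 1. ?F i)" using B by simp
   have "A \<in> events" "B \<in> events"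
    using ind A' B' unfolding indep_sets_def by blast+
   moreover have "prob (\<Inter>j\<in>{0, 1::nat}. (if j = 0 then A else B)) = (\<Prod>j\<in>{0, 1::nat}. prob (if j = 0 then A else B))"
    by (rule indep_setsD[OF ind]) (use A' B' in auto)
   ultimately show ?thesis by (auto simp: Int_commute)
  qed
  let ?S = "sigma (space M) ?H"
  have gen: "sigma_gen M {0..} (%t om. real (renewal_count \<tau> t om)) \<subseteq> ?H" "sigma_gen M {1..} Y \<subseteq> ?H"
   by (auto simp: numeral_2_eq_2 numeral_3_eq_3)
  have setsH: "sets ?S = ?H" using sigma_algebra.sets_measure_of_eq[OF H] by blast
  have sub: "f \<in> borel_measurable ?S" if f: "f \<in> borel_measurable (sigma (space M) G)" and G: "G \<subseteq> ?H" "sigma_algebra (space M) G"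
   for f :: "'a => real" and G
  proof (rule measurableI)
   fix A :: "real set" assume "A \<in> sets borel"
   then have "f -` A \<inter> space M \<in> G"
    using measurable_sets[OF f] sigma_algebra.sets_measure_of_eq[OF G(2)] by (simp add: space_measure_of_conv)
   then show "f -` A \<inter> space ?S \<in> sets ?S" using G(1) unfolding setsH by (auto simp: space_measure_of_conv)
  qed simp
  have Y: "Y i \<in> borel_measurable ?S" if "1 <= i" for i
   by (rule sub[OF sigma_gen_measurable gen(2) sigma_algebra_sigma_gen]) (use that in simp)
  have N: "(%om. real (renewal_count \<tau> t om)) \<in> borel_measurable ?S" if "0 <= t" for t
   using sub[OF sigma_gen_measurable[of t "{0..}" "%t om. real (renewal_count \<tau> t om)"] gen(1) sigma_algebra_sigma_gen] that by simp
  have N': "renewal_count \<tau> t \<in> measurable ?S (count_space UNIV)" if "0 <= t" for t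
  proof -
   have "(%om. nat \<lfloor>real (renewal_count \<tau> t om)\<rfloor>) \<in> measurable ?S (count_space UNIV)"
    using N[OF that] by measurable
   then show ?thesis by simp
  qed
  have R: "renewal_reward \<tau> Y t \<in> borel_measurable ?S" if "0 <= t" for t
  proof -
   have "(%om. \<Sum>i=1..k. Y i om) \<in> borel_measurable ?S" for k
    using Y by (intro borel_measurable_sum) auto
   then show ?thesis
    unfolding renewal_reward_def
    by (intro measurable_compose_countable[where f = "%k om. \<Sum>i=1..k. Y i om" and g = "renewal_count \<tau> t"] N' that)
  qed
  show "(%om. grid_sum N m c (%t. renewal_reward \<tau> Y t om)) \<in> borel_measurable ?S"
   by (rule grid_sum_measurable[OF R])
 qed
qed

text \<open>Among the three independent parts at most one, the reward part, has a nonzero mean. All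
  cross terms therefore vanish, and only this part contributes to the mean.\<close>

lemma noise_grid_sum:
 fixes N m a \<rho>1 \<rho>2 \<rho>3
 defines "X \<equiv> %om. grid_sum N m a (%t. noise \<rho>1 \<rho>2 \<rho>3 t om)"
 assumes N: "1 <= N"
 shows "X \<in> borel_measurable M" and "integrable M (%om. (X om)^2)"
  and "expectation (%om. (X om)^2) <= (\<Sum>l<m. (a l)^2 * ((\<rho>1^2 + \<rho>2^2) / real N + \<rho>3^2 * cell_mean N l))"
  and "expectation X = \<rho>3 * expectation (%om. grid_sum N m a (%t. renewal_reward \<tau> Y t om))"
proof -
 define A where "A = (%om. grid_sum N m a (%t. w t om))"
 define B where "B = (%om. grid_sum N m a (%t. L t om))"
 define C where "C = (%om. grid_sum N m a (%t. renewal_reward \<tau> Y t om))"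
 have AS: "A \<in> borel_measurable (sigma (space M) (sigma_gen M {0..} w))"
  unfolding A_def by (intro grid_sum_measurable sigma_gen_measurable) simp
 have BS: "B \<in> borel_measurable (sigma (space M) (sigma_gen M {0..} L))"
  unfolding B_def by (intro grid_sum_measurable sigma_gen_measurable) simp
 have Am [measurable]: "A \<in> borel_measurable M" unfolding A_def by (intro grid_sum_measurable w_measurable)
 have Bm [measurable]: "B \<in> borel_measurable M" unfolding B_def by (intro grid_sum_measurable L_measurable)
 have Cm [measurable]: "C \<in> borel_measurable M" unfolding C_def by (intro grid_sum_measurable renewal_reward_measurable)
 have A: "integrable M (%om. (A om)^2)" "expectation A = 0" "expectation (%om. (A om)^2) <= 1 / real N * (\<Sum>l<m. (a l)^2)"
  unfolding A_def by (fact brownian_grid_sum[OF brownian N])+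
 have B: "integrable M (%om. (B om)^2)" "expectation B = 0" "expectation (%om. (B om)^2) <= 1 / real N * (\<Sum>l<m. (a l)^2)"
  unfolding B_def by (fact levy_grid_sum[OF N])+
 have C: "integrable M (%om. (C om)^2)" "expectation (%om. (C om)^2) <= (\<Sum>l<m. (a l)^2 * cell_mean N l)"
  unfolding C_def by (fact reward_grid_sum)+
 have A1: "integrable M A" and B1: "integrable M B" and C1: "integrable M C"
  by (rule integrable_of_square; fact)+
 have AB: "indep_var borel A borel B"
 proof (rule indep_var_sigma_gen[OF _ AS BS])
  fix E F assume "E \<in> sigma_gen M {0..} w" "F \<in> sigma_gen M {0..} L"
  then show "E \<in> events \<and> F \<in> events \<and> prob (E \<inter> F) = prob E * prob F"
   using mutual_pair[of 0 1 E F] by simp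
 qed
 have AC: "indep_var borel A borel C" unfolding C_def by (rule indep_of_reward[of 0]) (use AS in auto)
 have BC: "indep_var borel B borel C" unfolding C_def by (rule indep_of_reward[of 1]) (use BS in auto)
 have zero: "expectation (%om. A om * B om) = 0" "expectation (%om. A om * C om) = 0" "expectation (%om. B om * C om) = 0"
  using indep_var_lebesgue_integral[OF AB A1 B1] indep_var_lebesgue_integral[OF AC A1 C1]
   indep_var_lebesgue_integral[OF BC B1 C1] A(2) B(2) by simp_all
 have X: "X = (%om. \<rho>1 * A om + \<rho>2 * B om + \<rho>3 * C om)"
  unfolding X_def A_def B_def C_def noise_def grid_sum_add grid_sum_cmult ..
 show "X \<in> borel_measurable M" unfolding X by measurable
 show "expectation X = \<rho>3 * expectation (%om. grid_sum N m a (%t. renewal_reward \<tau> Y t om))"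
  unfolding C_def[symmetric] X using A1 B1 C1 A(2) B(2) by simp
 define Z where "Z i om = (if i = 0 then \<rho>1 * A om else if i = 1 then \<rho>2 * B om else \<rho>3 * C om)" for i :: nat and om
 have ZX: "X = (%om. \<Sum>i\<in>{0, 1, 2}. Z i om)" unfolding X by (simp add: Z_def add.assoc)
 have Zm: "i \<in> {0, 1, 2} ==> Z i \<in> borel_measurable M" for i unfolding Z_def by auto
 have Z2: "i \<in> {0, 1, 2} ==> integrable M (%om. (Z i om)^2)" for i
  unfolding Z_def using A(1) B(1) C(1) by (auto simp: power_mult_distrib)
 show "integrable M (%om. (X om)^2)" unfolding ZX by (rule integrable_square_sum) (use Zm Z2 in auto)
 have "expectation (%om. (X om)^2) = (\<Sum>i\<in>{0, 1, 2}. expectation (%om. (Z i om)^2))"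
  unfolding ZX
 proof (rule integral_square_sum_orthogonal[OF _ Zm Z2])
  fix i j :: nat assume ij: "i \<in> {0, 1, 2}" "j \<in> {0, 1, 2}" "i \<noteq> j"
  have c: "expectation (%om. p * D om * (q * E om)) = 0" if "expectation (%om. D om * E om) = 0" for p q and D E :: "'a => real"
  proof -
   have "(%om. p * D om * (q * E om)) = (%om. (p * q) * (D om * E om))" by (simp add: fun_eq_iff mult_ac)
   then show ?thesis using that by simp
  qed
  have zero': "expectation (%om. B om * A om) = 0" "expectation (%om. C om * A om) = 0" "expectation (%om. C om * B om) = 0"
   using zero by (simp_all add: mult.commute)
  show "expectation (%om. Z i om * Z j om) = 0"
   using ij by (auto simp: Z_def intro!: c zero zero')
 qed auto
 also have "\<dots> = \<rho>1^2 * expectation (%om. (A om)^2) + \<rho>2^2 * expectation (%om. (B om)^2) + \<rho>3^2 * expectation (%om. (C om)^2)"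
  by (simp add: Z_def power_mult_distrib)
 also have "\<dots> <= \<rho>1^2 * (1 / real N * (\<Sum>l<m. (a l)^2)) + \<rho>2^2 * (1 / real N * (\<Sum>l<m. (a l)^2)) + \<rho>3^2 * (\<Sum>l<m. (a l)^2 * cell_mean N l)"
  by (intro add_mono mult_left_mono A(3) B(3) C(2)) auto
 also have "\<dots> = (\<Sum>l<m. (a l)^2 * ((\<rho>1^2 + \<rho>2^2) / real N + \<rho>3^2 * cell_mean N l))"
  by (simp add: sum_distrib_left sum.distrib distrib_left add_divide_distrib mult_ac)
 finally show "expectation (%om. (X om)^2) <= (\<Sum>l<m. (a l)^2 * ((\<rho>1^2 + \<rho>2^2) / real N + \<rho>3^2 * cell_mean N l))" .
qed

end

section \<open>Upper bound\<close>

text \<open>The noise need not be centred, so a cross term of \<open>b\<close> with its mean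
  appears; Young's inequality splits it at the price of the factor
  \<open>1 + \<theta>\<close>.\<close>

lemma (in prob_space) second_moment_shift:
 fixes X :: "'a => real"
 assumes [measurable]: "X \<in> borel_measurable M" and sq: "integrable M (%om. (X om)^2)" and \<theta>: "0 < \<theta>"
 shows "integrable M (%om. (b + c * X om)^2)"
  and "expectation (%om. (b + c * X om)^2) <= (1 + \<theta>) * b^2 + c^2 * (expectation (%om. (X om)^2) + (expectation X)^2 / \<theta>)"
proof -
 have X: "integrable M X" by (rule integrable_of_square[OF _ sq]) simp
 have eq: "(b + c * X om)^2 = b^2 + 2 * b * c * X om + c^2 * (X om)^2" for om
  by (simp add: power2_eq_square algebra_simps)
 show "integrable M (%om. (b + c * X om)^2)" unfolding eq using X sq by simp
 have "expectation (%om. (b + c * X om)^2) = b^2 + 2 * b * c * expectation X + c^2 * expectation (%om. (X om)^2)"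
  unfolding eq using X sq by (simp add: prob_space)
 also have "2 * b * c * expectation X <= \<theta> * b^2 + 1 / \<theta> * (c * expectation X)^2"
  using young_ineq[OF \<theta>, of b "c * expectation X"] by (simp add: mult.assoc)
 finally show "expectation (%om. (b + c * X om)^2) <= (1 + \<theta>) * b^2 + c^2 * (expectation (%om. (X om)^2) + (expectation X)^2 / \<theta>)"
  by (simp add: algebra_simps power_mult_distrib)
qed

lemma sum_square_young:
 fixes a b \<theta> :: real
 assumes \<theta>: "0 < \<theta>" shows "(a + b)^2 <= (1 + \<theta>) * a^2 + (1 + 1 / \<theta>) * b^2"
 using young_ineq[OF \<theta>, of a b] by (simp add: power2_sum algebra_simps)

lemma sobolev_integral_sq_le:
 assumes "S \<in> sobolev_ball k r" "1 <= k" "0 <= r" shows "(LINT x|U01. (S x)^2) <= r"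
proof -
 have "sq_norm ((deriv01 ^^ 0) S) <= (\<Sum>j\<le>k. sq_norm ((deriv01 ^^ j) S))"
  by (rule member_le_sum) auto
 also have "\<dots> <= ennreal r" using assms by (simp add: sobolev_ball_def)
 finally show ?thesis
  using sobolev_ball_facts(1)[OF assms] assms(3)
  by (subst (asm) sq_norm_eq_integral) (auto intro: continuous_on_subset)
qed

context semi_markov_noise
begin

definition renewal_mean :: "nat => real" where
 "renewal_mean n = expectation (%om. real (renewal_count \<tau> (real n) om))"

lemma renewal_mean_nonneg: "0 <= renewal_mean n"
 unfolding renewal_mean_def by simp

text \<open>The inflation of the ideal variance \<open>hi / n\<close>. The maximum compares the
  Brownian and Levy parts, with factor 1, to the renewal part; the other term is the squared mean of
  the noise divided by \<theta>, where 4 is the square of the bound 2 on \<open>cas\<close>.\<close>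

definition noise_factor :: "real => real => real => nat => real" where
 "noise_factor \<theta> B \<epsilon> n = max 1 (tau_mean * renewal_mean n / real n) +
   2 * tau_mean / (\<theta> * real n) * (B^2 + \<epsilon>^2 * (4 * renewal_mean n))"

text \<open>Three terms: the bias of the weights; the discretisation error, which vanishes as
  \<open>N\<close> grows with \<open>n\<close> and \<open>W\<close> fixed; and the stochastic part,
  proportional to the sum of the squared weights.\<close>

lemma estimator_risk_le:
 fixes wt :: "int => real"
 assumes n: "1 <= n" and N: "1 <= N" and \<theta>: "0 < \<theta>" and k: "1 <= k" and r: "0 <= r"
  and S: "S \<in> sobolev_ball k r" and Q: "Q \<in> noise_laws n lo hi"
  and wt: "\<And>j. wt (- j) = wt j" "\<And>j. j \<in> {- int W..int W} ==> \<bar>wt j\<bar> <= 1"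
  and bias: "(\<Sum>j\<in>{- int W..int W}. ((1 - wt j) * coef S j)^2) +
   ((LINT x|U01. (S x)^2) - (\<Sum>j\<in>{- int W..int W}. (coef S j)^2)) <= b"
  and B: "0 <= B" and \<epsilon>: "0 <= \<epsilon>"
  and mean: "\<And>N m a. (\<And>l. \<bar>a l\<bar> <= 2) ==>
   \<bar>expectation (%om. grid_sum N m a (%t. renewal_reward \<tau> Y t om))\<bar> <= B + \<epsilon> * sqrt (\<Sum>l<m. (a l)^2 * cell_mean N l)"
 shows "risk n Q (linear_estimator n N W wt) S <=
  ennreal ((1 + \<theta>)^2 * b + (1 + \<theta>) * (1 + 1 / \<theta>) * (2 * real W + 1) * (4 * pi * real W / real N * (1 + r))^2 +
   hi / real n * noise_factor \<theta> B \<epsilon> n * (\<Sum>j\<in>{- int W..int W}. (wt j)^2))"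
proof -
 let ?I = "{- int W..int W}"
 obtain \<rho>1 \<rho>2 \<rho>3 where Ql: "is_path_law M n (noise \<rho>1 \<rho>2 \<rho>3) Q" and \<sigma>: "noise_sigma \<rho>1 \<rho>2 \<rho>3 <= hi"
  using Q by (auto simp: noise_laws_def)
 have cont: "continuous_on UNIV S" and per: "\<And>x. S (x + 1) = S x"
  using sobolev_ball_facts(1,2)[OF S k r] by auto
 have n0: "0 < real n" using n by simp
 define \<xi> where "\<xi> j om = grid_sum N (n * N) (%l. cas j (grid N l)) (%t. noise \<rho>1 \<rho>2 \<rho>3 t om)" for j om
 define e where "e j = coef_estimate n N j (primitive S) - coef S j" for j
 define E where "E = 4 * pi * real W / real N * (1 + r)"
 \<comment> \<open>From \<open>\<bar>S s\<bar> <= 1 + (S s)^2\<close>; any bound uniform over the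
   ball would do, as it is multiplied by \<open>1 / N\<close>.\<close>
 have L1: "(LINT s|U01. \<bar>S s\<bar>) <= 1 + r"
 proof -
  have c01: "continuous_on {0..1} S" using cont by (rule continuous_on_subset) simp
  have "(LINT s|U01. \<bar>S s\<bar>) <= (LINT s|U01. 1 + (S s)^2)"
  proof (rule integral_mono)
   fix s
   have "0 <= (\<bar>S s\<bar> - 1)^2 + \<bar>S s\<bar>" by simp
   then show "\<bar>S s\<bar> <= 1 + (S s)^2" unfolding power2_diff by simp
  qed (intro integrable_U01 continuous_intros c01)+
  also have "\<dots> = 1 + (LINT s|U01. (S s)^2)"
   by (subst Bochner_Integration.integral_add)
     (auto intro!: integrable_U01 continuous_intros c01 simp: U01.prob_space[simplified])
  finally show ?thesis using sobolev_integral_sq_le[OF S k r] by simp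
 qed
 have e_le: "(e j)^2 <= E^2" if j: "j \<in> ?I" for j
 proof -
  have "\<bar>real n * e j\<bar> = \<bar>grid_sum N (n * N) (%l. cas j (grid N l)) (primitive S) - real n * coef S j\<bar>"
   using n0 by (simp add: e_def coef_estimate_def right_diff_distrib)
  also have "\<dots> <= 4 * pi * \<bar>real_of_int j\<bar> / real N * (real n * (LINT s|U01. \<bar>S s\<bar>))"
   by (rule grid_sum_primitive_error[OF cont per N])
  also have "\<dots> <= 4 * pi * real W / real N * (real n * (1 + r))"
   using j L1 by (intro mult_mono divide_right_mono) auto
  also have "\<dots> = real n * E" by (simp add: E_def)
  finally have "\<bar>e j\<bar> <= E" using n0 by (simp add: abs_mult)
  then show ?thesis by (simp add: abs_le_square_iff[symmetric])
 qed
 have est: "coef_estimate n N j (%t. primitive S t + noise \<rho>1 \<rho>2 \<rho>3 t om) = coef S j + e j + \<xi> j om / real n" for j om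
  by (simp add: e_def coef_estimate_def \<xi>_def grid_sum_add add_divide_distrib)
 \<comment> \<open>The whole deterministic error. Young's inequality is used once against the mean
   of the noise and once between the two terms of \<open>bb\<close>, hence the square of
   \<open>1 + \<theta>\<close> in front of the bias.\<close>
 define bb where "bb j = (wt j - 1) * coef S j + wt j * e j" for j
 have err: "wt j * coef_estimate n N j (%t. primitive S t + noise \<rho>1 \<rho>2 \<rho>3 t om) - coef S j = bb j + wt j / real n * \<xi> j om" for j om
  unfolding est bb_def by (simp add: algebra_simps)
 let ?V = "%j. \<Sum>l<n * N. (cas j (grid N l))^2 * ((\<rho>1^2 + \<rho>2^2) / real N + \<rho>3^2 * cell_mean N l)"
 have \<xi>m: "\<xi> j \<in> borel_measurable M" and \<xi>2: "integrable M (%om. (\<xi> j om)^2)"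
  and \<xi>v: "expectation (%om. (\<xi> j om)^2) <= ?V j"
  and \<xi>e: "expectation (\<xi> j) = \<rho>3 * expectation (%om. grid_sum N (n * N) (%l. cas j (grid N l)) (%t. renewal_reward \<tau> Y t om))" for j
  unfolding \<xi>_def by (fact noise_grid_sum[OF N])+
 have gn: "grid N (n * N) = real n" using N by (simp add: grid_def)
 have cm: "(\<Sum>l<n * N. cell_mean N l) <= renewal_mean n"
  using sum_cell_mean_le[of N "n * N"] unfolding gn renewal_mean_def .
 define m2 where "m2 = \<rho>3^2 * (2 * (B^2 + \<epsilon>^2 * (4 * renewal_mean n)))"
 have \<xi>m2: "(expectation (\<xi> j))^2 <= m2" for j
 proof -
  let ?v = "\<Sum>l<n * N. (cas j (grid N l))^2 * cell_mean N l"
  have v0: "0 <= ?v" by (intro sum_nonneg mult_nonneg_nonneg cell_mean_nonneg) auto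
  have "?v <= (\<Sum>l<n * N. 4 * cell_mean N l)"
  proof (intro sum_mono mult_right_mono cell_mean_nonneg)
   show "(cas j (grid N l))^2 <= 4" for l using cas_sq_le[of j "grid N l"] by linarith
  qed
  also have "\<dots> <= 4 * renewal_mean n" using cm by (simp add: sum_distrib_left[symmetric])
  finally have v: "?v <= 4 * renewal_mean n" .
  have "\<bar>expectation (%om. grid_sum N (n * N) (%l. cas j (grid N l)) (%t. renewal_reward \<tau> Y t om))\<bar> <= B + \<epsilon> * sqrt ?v"
   by (rule mean) (rule abs_cas_le)
  then have "(expectation (%om. grid_sum N (n * N) (%l. cas j (grid N l)) (%t. renewal_reward \<tau> Y t om)))^2 <= (B + \<epsilon> * sqrt ?v)^2"
   using B \<epsilon> v0 by (subst power2_le_iff_abs_le) auto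
  also have "\<dots> <= 2 * B^2 + 2 * (\<epsilon> * sqrt ?v)^2"
   using sum_square_young[of 1 B "\<epsilon> * sqrt ?v"] by simp
  also have "\<dots> = 2 * (B^2 + \<epsilon>^2 * ?v)" using v0 by (simp add: power_mult_distrib)
  also have "\<dots> <= 2 * (B^2 + \<epsilon>^2 * (4 * renewal_mean n))"
   using v by (intro mult_left_mono add_left_mono) auto
  finally show ?thesis unfolding \<xi>e m2_def power_mult_distrib by (rule mult_left_mono) simp
 qed
 let ?T = "(LINT x|U01. (S x)^2) - (\<Sum>j\<in>?I. (coef S j)^2)"
 have T0: "0 <= ?T" using bessel[of S W] cont by (simp add: continuous_on_subset)
 note sm = second_moment_shift[OF \<xi>m \<xi>2 \<theta>]
 have int: "integrable M (%om. (\<Sum>j\<in>?I. (bb j + wt j / real n * \<xi> j om)^2) + ?T)"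
  by (intro Bochner_Integration.integrable_add Bochner_Integration.integrable_sum sm) simp
 have "expectation (%om. (\<Sum>j\<in>?I. (bb j + wt j / real n * \<xi> j om)^2) + ?T) =
   (\<Sum>j\<in>?I. expectation (%om. (bb j + wt j / real n * \<xi> j om)^2)) + ?T"
 proof -
  have "expectation (%om. (\<Sum>j\<in>?I. (bb j + wt j / real n * \<xi> j om)^2) + ?T) =
    expectation (%om. \<Sum>j\<in>?I. (bb j + wt j / real n * \<xi> j om)^2) + expectation (%om. ?T)"
   by (rule Bochner_Integration.integral_add) (intro Bochner_Integration.integrable_sum sm, simp)
  also have "expectation (%om. \<Sum>j\<in>?I. (bb j + wt j / real n * \<xi> j om)^2) = (\<Sum>j\<in>?I. expectation (%om. (bb j + wt j / real n * \<xi> j om)^2))"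
   by (rule Bochner_Integration.integral_sum) (rule sm)
  finally show ?thesis by (simp add: prob_space)
 qed
 also have "\<dots> <= (\<Sum>j\<in>?I. (1 + \<theta>) * (bb j)^2 + (wt j / real n)^2 * (?V j + m2 / \<theta>)) + ?T"
 proof (intro add_right_mono sum_mono)
  fix j
  have "expectation (%om. (bb j + wt j / real n * \<xi> j om)^2) <=
    (1 + \<theta>) * (bb j)^2 + (wt j / real n)^2 * (expectation (%om. (\<xi> j om)^2) + (expectation (\<xi> j))^2 / \<theta>)"
   by (rule sm)
  also have "\<dots> <= (1 + \<theta>) * (bb j)^2 + (wt j / real n)^2 * (?V j + m2 / \<theta>)"
   by (intro add_left_mono mult_left_mono add_mono divide_right_mono \<xi>v \<xi>m2) (use \<theta> in auto)
  finally show "expectation (%om. (bb j + wt j / real n * \<xi> j om)^2) <= (1 + \<theta>) * (bb j)^2 + (wt j / real n)^2 * (?V j + m2 / \<theta>)" .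
 qed
 also have "\<dots> = (1 + \<theta>) * (\<Sum>j\<in>?I. (bb j)^2) + ?T + (\<Sum>j\<in>?I. (wt j / real n)^2 * (?V j + m2 / \<theta>))"
  using sum.distrib[of "%j. (1 + \<theta>) * (bb j)^2" "%j. (wt j / real n)^2 * (?V j + m2 / \<theta>)" ?I]
   sum_distrib_left[of "1 + \<theta>" "%j. (bb j)^2" ?I] by linarith
 also have "\<dots> <= ((1 + \<theta>)^2 * b + (1 + \<theta>) * (1 + 1 / \<theta>) * (2 * real W + 1) * E^2) +
   hi / real n * noise_factor \<theta> B \<epsilon> n * (\<Sum>j\<in>?I. (wt j)^2)"
 proof (rule add_mono)
  have bj: "(bb j)^2 <= (1 + \<theta>) * ((1 - wt j) * coef S j)^2 + (1 + 1 / \<theta>) * E^2" if j: "j \<in> ?I" for j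
  proof -
   have p1: "(bb j)^2 <= (1 + \<theta>) * ((wt j - 1) * coef S j)^2 + (1 + 1 / \<theta>) * (wt j * e j)^2"
    unfolding bb_def by (rule sum_square_young[OF \<theta>])
   have eq: "((wt j - 1) * coef S j)^2 = ((1 - wt j) * coef S j)^2"
    unfolding power_mult_distrib power2_commute[of "wt j" 1] ..
   have "(wt j * e j)^2 <= 1 * E^2"
    unfolding power_mult_distrib by (intro mult_mono e_le j) (use wt(2)[OF j] in \<open>auto simp: abs_square_le_1\<close>)
   then have "(1 + 1 / \<theta>) * (wt j * e j)^2 <= (1 + 1 / \<theta>) * E^2"
    using \<theta> by (intro mult_left_mono) auto
   then show ?thesis using p1 unfolding eq by linarith
  qed
  have "(\<Sum>j\<in>?I. (bb j)^2) <= (\<Sum>j\<in>?I. (1 + \<theta>) * ((1 - wt j) * coef S j)^2 + (1 + 1 / \<theta>) * E^2)"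
   by (rule sum_mono[OF bj])
  also have "\<dots> = (1 + \<theta>) * (\<Sum>j\<in>?I. ((1 - wt j) * coef S j)^2) + (1 + 1 / \<theta>) * (2 * real W + 1) * E^2"
   using sum.distrib[of "%j. (1 + \<theta>) * ((1 - wt j) * coef S j)^2" "%j. (1 + 1 / \<theta>) * E^2" ?I]
    sum_distrib_left[of "1 + \<theta>" "%j. ((1 - wt j) * coef S j)^2" ?I] by simp
  finally have 1: "(1 + \<theta>) * (\<Sum>j\<in>?I. (bb j)^2) <=
    (1 + \<theta>) * ((1 + \<theta>) * (\<Sum>j\<in>?I. ((1 - wt j) * coef S j)^2) + (1 + 1 / \<theta>) * (2 * real W + 1) * E^2)"
   using \<theta> by (intro mult_left_mono) auto
  have "1 <= (1 + \<theta>)^2" using \<theta> by (simp add: one_le_power)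
  then have "?T <= (1 + \<theta>)^2 * ?T" using T0 mult_right_mono[of 1 "(1 + \<theta>)^2" ?T] by simp
  moreover have "(1 + \<theta>)^2 * ((\<Sum>j\<in>?I. ((1 - wt j) * coef S j)^2) + ?T) <= (1 + \<theta>)^2 * b"
   by (rule mult_left_mono[OF bias]) simp
  ultimately have *: "?T <= (1 + \<theta>)^2 * ?T" "(1 + \<theta>)^2 * ((\<Sum>j\<in>?I. ((1 - wt j) * coef S j)^2) + ?T) <= (1 + \<theta>)^2 * b"
   by blast+
  show "(1 + \<theta>) * (\<Sum>j\<in>?I. (bb j)^2) + ?T <= (1 + \<theta>)^2 * b + (1 + \<theta>) * (1 + 1 / \<theta>) * (2 * real W + 1) * E^2"
  proof -
   let ?X = "\<Sum>j\<in>?I. ((1 - wt j) * coef S j)^2"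
   have "(1 + \<theta>) * ((1 + \<theta>) * ?X + (1 + 1 / \<theta>) * (2 * real W + 1) * E^2) =
     (1 + \<theta>)^2 * ?X + (1 + \<theta>) * (1 + 1 / \<theta>) * (2 * real W + 1) * E^2"
    by (simp only: distrib_left[of "1 + \<theta>" "(1 + \<theta>) * ?X"] power2_eq_square[of "1 + \<theta>"] mult.assoc)
   moreover have "(1 + \<theta>)^2 * (?X + ?T) = (1 + \<theta>)^2 * ?X + (1 + \<theta>)^2 * ?T"
    by (rule distrib_left)
   ultimately show ?thesis using 1 *
    by linarith
  qed
 next
  let ?\<Lambda> = "\<Sum>j\<in>?I. (wt j)^2"
  let ?h = "%l. (\<rho>1^2 + \<rho>2^2) / real N + \<rho>3^2 * cell_mean N l"
  \<comment> \<open>Summing over frequencies before times makes the integrand constant in time, and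
    the means over the cells collapse to the total expected count.\<close>
  have "(\<Sum>j\<in>?I. (wt j)^2 * ?V j) = (\<Sum>l<n * N. (\<Sum>j\<in>?I. (wt j)^2 * (cas j (grid N l))^2) * ?h l)"
   unfolding sum_distrib_left sum_distrib_right by (subst sum.swap) (simp add: mult.assoc)
  also have "\<dots> = ?\<Lambda> * (\<Sum>l<n * N. ?h l)"
   unfolding pair_sum_cas[of wt, OF wt(1)] by (simp add: sum_distrib_left)
  also have "\<dots> <= ?\<Lambda> * ((\<rho>1^2 + \<rho>2^2) * real n + \<rho>3^2 * renewal_mean n)"
  proof (rule mult_left_mono)
   have "(\<Sum>l<n * N. ?h l) = (\<rho>1^2 + \<rho>2^2) * real n + \<rho>3^2 * (\<Sum>l<n * N. cell_mean N l)"
    using N by (simp add: sum.distrib sum_distrib_left)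
   also have "\<dots> <= (\<rho>1^2 + \<rho>2^2) * real n + \<rho>3^2 * renewal_mean n"
    by (intro add_left_mono mult_left_mono cm) simp
   finally show "(\<Sum>l<n * N. ?h l) <= (\<rho>1^2 + \<rho>2^2) * real n + \<rho>3^2 * renewal_mean n" .
  qed (simp add: sum_nonneg)
  finally have V: "(\<Sum>j\<in>?I. (wt j)^2 * ?V j) <= ?\<Lambda> * ((\<rho>1^2 + \<rho>2^2) * real n + \<rho>3^2 * renewal_mean n)" .
  have tm: "0 < tau_mean" by (rule tau_mean_pos)
  \<comment> \<open>The share of the renewal part in \<open>noise_sigma\<close>; it converts a bound
    by expected renewals into one by \<open>hi\<close>.\<close>
  define s3 where "s3 = \<rho>3^2 / tau_mean"
  have s3: "0 <= s3" "\<rho>3^2 = s3 * tau_mean" using tm by (auto simp: s3_def)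
  have hi: "(\<rho>1^2 + \<rho>2^2) + s3 <= hi" using \<sigma> by (simp add: noise_sigma_def s3_def)
  have s3hi: "s3 <= hi" using hi zero_le_power2[of \<rho>1] zero_le_power2[of \<rho>2] by linarith
  let ?\<kappa> = "max 1 (tau_mean * renewal_mean n / real n)"
  have "(\<rho>1^2 + \<rho>2^2) * real n + \<rho>3^2 * renewal_mean n <= (\<rho>1^2 + \<rho>2^2) * (real n * ?\<kappa>) + s3 * (real n * ?\<kappa>)"
  proof (rule add_mono)
   have "real n * 1 <= real n * ?\<kappa>" by (intro mult_left_mono) auto
   then show "(\<rho>1^2 + \<rho>2^2) * real n <= (\<rho>1^2 + \<rho>2^2) * (real n * ?\<kappa>)" by (intro mult_left_mono) auto
   have "tau_mean * renewal_mean n = real n * (tau_mean * renewal_mean n / real n)" using n0 by simp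
   also have "\<dots> <= real n * ?\<kappa>" by (intro mult_left_mono) auto
   finally show "\<rho>3^2 * renewal_mean n <= s3 * (real n * ?\<kappa>)"
    unfolding s3(2) mult.assoc by (rule mult_left_mono[OF _ s3(1)])
  qed
  also have "\<dots> = ((\<rho>1^2 + \<rho>2^2) + s3) * (real n * ?\<kappa>)" by (simp add: distrib_right)
  also have "\<dots> <= hi * (real n * ?\<kappa>)" by (rule mult_right_mono[OF hi]) (use n0 in auto)
  finally have p1: "(\<rho>1^2 + \<rho>2^2) * real n + \<rho>3^2 * renewal_mean n <= hi * (real n * ?\<kappa>)" .
  let ?q = "2 * (B^2 + \<epsilon>^2 * (4 * renewal_mean n))"
  have q: "0 <= ?q" using renewal_mean_nonneg by simp
  have "m2 <= hi * (tau_mean * ?q)"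
   unfolding m2_def s3(2) using s3hi q tm by (simp add: mult.assoc mult_right_mono)
  then have p2: "m2 / \<theta> <= hi * (tau_mean * ?q) / \<theta>" using \<theta> by (simp add: divide_right_mono)
  have "(\<Sum>j\<in>?I. (wt j / real n)^2 * (?V j + m2 / \<theta>)) = ((\<Sum>j\<in>?I. (wt j)^2 * ?V j) + ?\<Lambda> * (m2 / \<theta>)) / (real n)^2"
  proof -
   have "(wt j / real n)^2 * (v + q) = ((wt j)^2 * v + (wt j)^2 * q) / (real n)^2" for j v q
    by (simp add: power_divide distrib_left add_divide_distrib)
   then show ?thesis
    by (simp only: sum_divide_distrib[symmetric] sum.distrib[of "%j. (wt j)^2 * ?V j" "%j. (wt j)^2 * (m2 / \<theta>)" ?I] sum_distrib_right[symmetric])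
  qed
  also have "\<dots> <= (?\<Lambda> * (hi * (real n * ?\<kappa>)) + ?\<Lambda> * (hi * (tau_mean * ?q) / \<theta>)) / (real n)^2"
   by (intro divide_right_mono add_mono order_trans[OF V] mult_left_mono p1 p2) (auto intro!: sum_nonneg)
  also have "\<dots> = hi / real n * noise_factor \<theta> B \<epsilon> n * ?\<Lambda>"
   using n0 \<theta> unfolding noise_factor_def by (simp add: field_simps power2_eq_square)
  finally show "(\<Sum>j\<in>?I. (wt j / real n)^2 * (?V j + m2 / \<theta>)) <= hi / real n * noise_factor \<theta> B \<epsilon> n * ?\<Lambda>" .
 qed
 finally have real: "expectation (%om. (\<Sum>j\<in>?I. (bb j + wt j / real n * \<xi> j om)^2) + ?T) <=
   ((1 + \<theta>)^2 * b + (1 + \<theta>) * (1 + 1 / \<theta>) * (2 * real W + 1) * E^2) +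
   hi / real n * noise_factor \<theta> B \<epsilon> n * (\<Sum>j\<in>?I. (wt j)^2)" .
 have "risk n Q (linear_estimator n N W wt) S = (\<integral>\<^sup>+om. ennreal ((\<Sum>j\<in>?I. (bb j + wt j / real n * \<xi> j om)^2) + ?T) \<partial>M)"
  unfolding risk_linear_estimator[OF cont Ql noise_measurable N, simplified] err ..
 also have "\<dots> = ennreal (expectation (%om. (\<Sum>j\<in>?I. (bb j + wt j / real n * \<xi> j om)^2) + ?T))"
  by (rule nn_integral_eq_integral[OF int]) (use T0 in \<open>auto intro!: add_nonneg_nonneg sum_nonneg\<close>)
 finally show ?thesis using ennreal_leI[OF real] unfolding E_def by simp
qed

text \<open>The infimum does not depend on \<open>N\<close>, so the bound may be taken to its limit
  in \<open>N\<close> at fixed \<open>n\<close>.\<close>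

lemma minimax_upper_bound:
 assumes n: "1 <= n" and \<theta>: "0 < \<theta>" and k: "1 <= k" and r: "0 <= r" and W: "1 <= W" and hi: "0 <= hi"
  and B: "0 <= B" and \<epsilon>: "0 <= \<epsilon>"
  and mean: "\<And>N m a. (\<And>l. \<bar>a l\<bar> <= 2) ==>
   \<bar>expectation (%om. grid_sum N m a (%t. renewal_reward \<tau> Y t om))\<bar> <= B + \<epsilon> * sqrt (\<Sum>l<m. (a l)^2 * cell_mean N l)"
 shows "(INF Sh\<in>estimators n. SUP S\<in>sobolev_ball k r. robust_risk n (noise_laws n lo hi) Sh S) <=
   ennreal ((1 + \<theta>)^2 * (r / (2 * pi * real W) ^ (2 * k)) +
    hi / real n * noise_factor \<theta> B \<epsilon> n * (\<Sum>j\<in>{- int W..int W}. (pinsker_weight k W j)^2))"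
  (is "?I <= ennreal (?b + ?v)")
proof -
 let ?c = "%N. (1 + \<theta>) * (1 + 1 / \<theta>) * (2 * real W + 1) * (4 * pi * real W / real N * (1 + r))^2"
 have bound: "?I <= ennreal (?b + ?c N + ?v)" if N: "1 <= N" for N
 proof (rule INF_lower2[OF linear_estimator_in_estimators[OF N, of n W "pinsker_weight k W"]])
  show "(SUP S\<in>sobolev_ball k r. robust_risk n (noise_laws n lo hi) (linear_estimator n N W (pinsker_weight k W)) S) <= ennreal (?b + ?c N + ?v)"
   unfolding robust_risk_def
  proof (intro SUP_least)
   fix S Q assume S: "S \<in> sobolev_ball k r" and Q: "Q \<in> noise_laws n lo hi"
   show "risk n Q (linear_estimator n N W (pinsker_weight k W)) S <= ennreal (?b + ?c N + ?v)"
   proof (rule estimator_risk_le[OF n N \<theta> k r S Q _ _ pinsker_bias[OF S k r W] B \<epsilon> mean])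
    show "pinsker_weight k W (- j) = pinsker_weight k W j" for j by (simp add: pinsker_weight_def)
    show "\<bar>pinsker_weight k W j\<bar> <= 1" if "j \<in> {- int W..int W}" for j
    proof -
     have "\<bar>real_of_int j\<bar> / real W <= 1" using that W by (auto simp: pos_divide_le_eq abs_le_iff)
     then have "(\<bar>real_of_int j\<bar> / real W) ^ k <= 1" by (intro power_le_one) auto
     moreover have "0 <= (\<bar>real_of_int j\<bar> / real W) ^ k" by simp
     ultimately show ?thesis unfolding pinsker_weight_def by linarith
    qed
   qed
  qed
 qed
 have "(%N. ?c (Suc N)) \<longlonglongrightarrow> (1 + \<theta>) * (1 + 1 / \<theta>) * (2 * real W + 1) * (0 * (1 + r))^2"
  by (intro tendsto_intros LIMSEQ_Suc[OF lim_const_over_n])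
 then have "(%N. ennreal (?b + ?c (Suc N) + ?v)) \<longlonglongrightarrow> ennreal (?b + 0 + ?v)"
  by (intro tendsto_ennrealI tendsto_intros) simp
 then have "?I <= ennreal (?b + 0 + ?v)"
  by (rule LIMSEQ_le_const) (intro exI[of _ 0] allI impI bound, simp)
 then show ?thesis by simp
qed

end

section \<open>The Cameron-Martin formula\<close>

lemma increment_bound:
 assumes cont: "continuous_on {0..} D" and der: "\<And>t. u < t ==> t < v ==> (D has_real_derivative D' t) (at t)"
  and bd: "\<And>t. u < t ==> t < v ==> \<bar>D' t\<bar> <= e" and uv: "0 <= u" "u <= v"
 shows "\<bar>D v - D u\<bar> <= e * (v - u)"
proof -
 have one: "s * D v - e * v <= s * D u - e * u" if s: "s = 1 \<or> s = - 1" for s :: real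
 proof (rule primitive_mono_deriv[where D = "%t. s * D t - e * t" and D' = "%t. s * D' t - e"])
  show "continuous_on {0..} (%t. s * D t - e * t)" by (intro continuous_intros cont)
  show "((%t. s * D t - e * t) has_real_derivative s * D' t - e) (at t)" if "0 < t" "u < t" "t < v" for t
   using DERIV_diff[OF DERIV_cmult[OF der[OF that(2,3)], of s] DERIV_cmult_Id[of e]] by simp
  show "s * D' t - e <= 0" if "u < t" "t < v" for t
   using bd[OF that] s by auto
 qed (use uv in auto)
 show ?thesis using one[of 1] one[of "- 1"] by (simp add: right_diff_distrib abs_le_iff)
qed

lemma uniform_osc:
 assumes h: "continuous_on {0..} (h :: real => real)" and e: "0 < e"
 obtains N0 where "1 <= N0" and "\<And>N l t. N0 <= N ==> l < n * N ==> grid N l <= t ==> t <= grid N (Suc l) ==> \<bar>h t - h (grid N l)\<bar> <= e \<and> \<bar>h (grid N (Suc l)) - h t\<bar> <= e"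
proof -
 have "uniformly_continuous_on {0..real n} h"
  by (rule compact_uniformly_continuous) (auto intro: continuous_on_subset[OF h])
 then obtain d where d: "0 < d" "\<And>x y. x \<in> {0..real n} ==> y \<in> {0..real n} ==> dist y x < d ==> dist (h y) (h x) < e"
  unfolding uniformly_continuous_on_def using e by meson
 obtain N0 :: nat where N0: "1 / d < real N0" using reals_Archimedean2 by blast
 show ?thesis
 proof (rule that[of "max 1 N0"])
  fix N l t assume N: "max 1 N0 <= N" and l: "l < n * N" and t: "grid N l <= t" "t <= grid N (Suc l)"
  have "1 / d < real N" using N N0 by simp
  then have "1 / real N < d" using d N by (simp add: field_simps)
  moreover have "grid N l \<in> {0..real n}" "grid N (Suc l) \<in> {0..real n}"
   using N l by (auto intro!: grid_in_range simp del: atLeastAtMost_iff)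
  moreover have "t \<in> {0..real n}"
   using calculation(2,3) t grid_nonneg[of N l] unfolding atLeastAtMost_iff by linarith
  ultimately show "\<bar>h t - h (grid N l)\<bar> <= e \<and> \<bar>h (grid N (Suc l)) - h t\<bar> <= e"
   using d(2)[of "grid N l" t] d(2)[of t "grid N (Suc l)"] t grid_Suc[of N l]
   by (auto simp: dist_real_def)
 qed simp
qed

lemma sum_diff_telescope:
 fixes a F :: "nat => real"
 shows "(\<Sum>l<m. a l) - (F m - F 0) = (\<Sum>l<m. a l - (F (Suc l) - F l))"
 by (simp only: sum_subtractf[of a "%l. F (Suc l) - F l"] sum_lessThan_telescope)

lemma riemann_sum_tendsto:
 assumes h: "continuous_on UNIV h" and k: "\<And>N. k N <= n * N" and lim: "(%N. grid N (k N)) \<longlonglongrightarrow> t" and t: "0 <= t"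
 shows "(%N. \<Sum>l<k N. h (grid N l) / real N) \<longlonglongrightarrow> primitive h t"
proof -
 have hc: "continuous_on {0..} h" using h by (rule continuous_on_subset) simp
 have P: "continuous_on {0..} (primitive h)" by (rule continuous_on_primitive[OF h])
 have lim2: "(%N. primitive h (grid N (k N))) \<longlonglongrightarrow> primitive h t"
  by (rule continuous_on_tendsto_compose[OF P lim]) (use t in auto)
 have "(%N. (\<Sum>l<k N. h (grid N l) / real N) - primitive h (grid N (k N))) \<longlonglongrightarrow> 0"
 proof (rule LIMSEQ_I)
  fix e :: real assume e: "0 < e"
  define e' where "e' = e / (2 * (real n + 1))"
  have e': "0 < e'" using e by (simp add: e'_def)
  obtain N0 where N0: "1 <= N0" "\<And>N l t. N0 <= N ==> l < n * N ==> grid N l <= t ==> t <= grid N (Suc l) ==> \<bar>h t - h (grid N l)\<bar> <= e' \<and> \<bar>h (grid N (Suc l)) - h t\<bar> <= e'"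
   by (rule uniform_osc[OF hc e', of n]) blast
  show "\<exists>N0. \<forall>N\<ge>N0. norm ((\<Sum>l<k N. h (grid N l) / real N) - primitive h (grid N (k N)) - 0) < e"
  proof (intro exI allI impI)
   fix N assume N: "N0 <= N"
   have N1: "1 <= N" using N N0(1) by simp
   have cell: "\<bar>h (grid N l) / real N - (primitive h (grid N (Suc l)) - primitive h (grid N l))\<bar> <= e' / real N" if l: "l < k N" for l
   proof -
    let ?u = "grid N l" and ?v = "grid N (Suc l)"
    let ?D = "%t. h ?u * t - primitive h t"
    have "\<bar>?D ?v - ?D ?u\<bar> <= e' * (?v - ?u)"
    proof (rule increment_bound[where D' = "%t. h ?u - h t"])
     show "continuous_on {0..} ?D" by (intro continuous_intros P)
     show "(?D has_real_derivative h ?u - h t) (at t)" if "?u < t" for t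
     proof -
      have "0 < t" using that grid_nonneg[of N l] by linarith
      from DERIV_diff[OF DERIV_cmult_Id[of "h ?u"] primitive_has_derivative[OF h this]] show ?thesis by simp
     qed
     show "\<bar>h ?u - h t\<bar> <= e'" if "?u < t" "t < ?v" for t
      using N0(2)[OF N, of l t] l k[of N] that by (simp add: abs_minus_commute)
    qed (auto intro: grid_mono)
    then show ?thesis by (simp add: grid_Suc algebra_simps)
   qed
   have "(\<Sum>l<k N. h (grid N l) / real N) - primitive h (grid N (k N)) =
     (\<Sum>l<k N. h (grid N l) / real N - (primitive h (grid N (Suc l)) - primitive h (grid N l)))"
    using sum_diff_telescope[of "%l. h (grid N l) / real N" "k N" "%l. primitive h (grid N l)"]
    by (simp add: grid_def[of N 0])
   also have "\<bar>\<dots>\<bar> <= (\<Sum>l<k N. e' / real N)"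
    by (rule order_trans[OF sum_abs sum_mono]) (use cell in auto)
   also have "\<dots> <= e' * real n"
   proof -
    have "real (k N) <= real n * real N" using k[of N] by (metis of_nat_le_iff of_nat_mult)
    then show ?thesis using N1 e' by (simp add: field_simps)
   qed
   also have "\<dots> < e"
   proof -
    have "e * real n < e * (2 * (real n + 1))" using e by (intro mult_strict_left_mono) auto
    then show ?thesis unfolding e'_def by (simp add: pos_divide_less_eq)
   qed
   finally show "norm ((\<Sum>l<k N. h (grid N l) / real N) - primitive h (grid N (k N)) - 0) < e" by simp
  qed
 qed
 from tendsto_add[OF this lim2] show ?thesis by simp
qed

lemma grid_index_tendsto:
 assumes "0 <= t" shows "(%N. grid N (nat \<lfloor>t * real N\<rfloor>)) \<longlonglongrightarrow> t"
proof (rule real_tendsto_sandwich[where f = "%N. t - 1 / real N" and h = "%_. t"])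
 show "\<forall>\<^sub>F N in sequentially. t - 1 / real N <= grid N (nat \<lfloor>t * real N\<rfloor>)"
  using eventually_gt_at_top[of "0::nat"]
 proof eventually_elim
  fix N :: nat assume N: "0 < N"
  have "0 <= t * real N" using assms by simp
  then have "real (nat \<lfloor>t * real N\<rfloor>) = real_of_int \<lfloor>t * real N\<rfloor>" by simp
  then have "t * real N - 1 <= real (nat \<lfloor>t * real N\<rfloor>)" by linarith
  then have "(t * real N - 1) / real N <= grid N (nat \<lfloor>t * real N\<rfloor>)"
   unfolding grid_def by (rule divide_right_mono) simp
  then show "t - 1 / real N <= grid N (nat \<lfloor>t * real N\<rfloor>)"
   using N by (simp add: diff_divide_distrib)
 qed
 show "\<forall>\<^sub>F N in sequentially. grid N (nat \<lfloor>t * real N\<rfloor>) <= t"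
  using eventually_gt_at_top[of "0::nat"]
 proof eventually_elim
  fix N :: nat assume N: "0 < N"
  have "0 <= t * real N" using assms by simp
  then have "real (nat \<lfloor>t * real N\<rfloor>) <= t * real N" by simp
  then show "grid N (nat \<lfloor>t * real N\<rfloor>) <= t" using N by (simp add: grid_def field_simps)
 qed
 show "(%N. t - 1 / real N) \<longlonglongrightarrow> t"
  using tendsto_diff[OF tendsto_const lim_1_over_n, of t] by simp
qed simp

text \<open>Summation by parts: the Wiener integral of a smooth integrand is defined path by path.\<close>

lemma smooth_grid_sum_convergent:
 assumes x: "continuous_on {0..} x" and f: "\<And>t. (f has_real_derivative f' t) (at t)" and f': "continuous_on UNIV f'"
 shows "convergent (%N. grid_sum N (n * N) (%l. f (grid N l)) x)"
proof -
 \<comment> \<open>The path is continued by its initial value to negative times, so that integrals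
   of functions continuous on the whole line apply.\<close>
 define y where "y t = x (max 0 t)" for t
 have y: "continuous_on UNIV y"
  unfolding y_def by (rule continuous_on_compose2[OF x]) (auto intro!: continuous_intros)
 have yx: "0 <= t ==> y t = x t" for t by (simp add: y_def)
 have yf: "continuous_on UNIV (%t. y t * f' t)" by (intro continuous_intros y f')
 let ?R = "primitive (%t. y t * f' t)"
 have fc: "continuous_on A f" for A
  using f by (intro continuous_at_imp_continuous_on ballI) (auto intro: DERIV_isCont)
 have "compact (f' ` {0..real n})"
  by (rule compact_continuous_image) (auto intro: continuous_on_subset[OF f'])
 then obtain K where K0: "0 < K" and K: "\<And>t. t \<in> {0..real n} ==> \<bar>f' t\<bar> <= K"
  using compact_imp_bounded bounded_pos by (metis image_eqI real_norm_def)
 \<comment> \<open>The complementary sum in Abel's formula. It uses the path at right endpoints, and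
   together with the grid sum it telescopes to the boundary terms.\<close>
 let ?Q = "%N. \<Sum>l<n * N. x (grid N (Suc l)) * (f (grid N (Suc l)) - f (grid N l))"
 have "?Q \<longlonglongrightarrow> ?R (real n)"
 proof (rule LIMSEQ_I)
  fix e :: real assume e: "0 < e"
  define e' where "e' = e / (2 * K * (real n + 1))"
  have e': "0 < e'" using e K0 by (simp add: e'_def)
  obtain N0 where N0: "1 <= N0" "\<And>N l t. N0 <= N ==> l < n * N ==> grid N l <= t ==> t <= grid N (Suc l) ==> \<bar>x t - x (grid N l)\<bar> <= e' \<and> \<bar>x (grid N (Suc l)) - x t\<bar> <= e'"
   by (rule uniform_osc[OF x e', of n]) blast
  show "\<exists>N0. \<forall>N\<ge>N0. norm (?Q N - ?R (real n)) < e"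
  proof (intro exI allI impI)
   fix N assume N: "N0 <= N"
   have N1: "1 <= N" using N N0(1) by simp
   have cell: "\<bar>x (grid N (Suc l)) * (f (grid N (Suc l)) - f (grid N l)) - (?R (grid N (Suc l)) - ?R (grid N l))\<bar> <= e' * K / real N" if l: "l < n * N" for l
   proof -
    let ?u = "grid N l" and ?v = "grid N (Suc l)"
    let ?D = "%t. x ?v * f t - ?R t"
    have rng: "?u \<in> {0..real n}" "?v \<in> {0..real n}" using l by (auto intro!: grid_in_range N1 simp del: atLeastAtMost_iff)
    have "\<bar>?D ?v - ?D ?u\<bar> <= (e' * K) * (?v - ?u)"
    proof (rule increment_bound[where D' = "%t. x ?v * f' t - y t * f' t"])
     show "continuous_on {0..} ?D" by (intro continuous_intros fc continuous_on_primitive yf)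
     show "(?D has_real_derivative x ?v * f' t - y t * f' t) (at t)" if "?u < t" for t
     proof -
      have "0 < t" using that grid_nonneg[of N l] by linarith
      then show ?thesis by (intro DERIV_diff DERIV_cmult f primitive_has_derivative yf)
     qed
     show "\<bar>x ?v * f' t - y t * f' t\<bar> <= e' * K" if t: "?u < t" "t < ?v" for t
     proof -
      have t0: "0 <= t" "t \<in> {0..real n}"
       using t rng(2) grid_nonneg[of N l] unfolding atLeastAtMost_iff by linarith+
      have "x ?v * f' t - y t * f' t = (x ?v - x t) * f' t" using yx[OF t0(1)] by (simp add: left_diff_distrib)
      moreover have "\<bar>x ?v - x t\<bar> <= e'" using N0(2)[OF N l, of t] t by simp
      ultimately show ?thesis using K[OF t0(2)] e' by (simp add: abs_mult mult_mono)
     qed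
    qed (auto intro: grid_mono)
    then show ?thesis by (simp add: grid_Suc algebra_simps)
   qed
   have gn: "grid N (n * N) = real n" using N1 by (simp add: grid_def)
   have "?Q N - ?R (real n) = (\<Sum>l<n * N. x (grid N (Suc l)) * (f (grid N (Suc l)) - f (grid N l)) - (?R (grid N (Suc l)) - ?R (grid N l)))"
    using sum_diff_telescope[of "%l. x (grid N (Suc l)) * (f (grid N (Suc l)) - f (grid N l))" "n * N" "%l. ?R (grid N l)"]
    by (simp add: gn grid_def[of N 0])
   also have "\<bar>\<dots>\<bar> <= (\<Sum>l<n * N. e' * K / real N)"
    by (rule order_trans[OF sum_abs sum_mono]) (use cell in auto)
   also have "\<dots> = e' * K * real n" using N1 by simp
   also have "\<dots> < e"
   proof -
    have "e * real n < e * (2 * (real n + 1))" using e by (intro mult_strict_left_mono) auto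
    then show ?thesis unfolding e'_def using K0 by (simp add: pos_divide_less_eq)
   qed
   finally show "norm (?Q N - ?R (real n)) < e" by simp
  qed
 qed
 then have "(%N. (f (real n) * x (real n) - f 0 * x 0) - ?Q N) \<longlonglongrightarrow> (f (real n) * x (real n) - f 0 * x 0) - ?R (real n)"
  by (intro tendsto_intros)
 moreover have "eventually (%N. (f (real n) * x (real n) - f 0 * x 0) - ?Q N = grid_sum N (n * N) (%l. f (grid N l)) x) sequentially"
  using eventually_ge_at_top[of 1]
 proof eventually_elim
  fix N :: nat assume N1: "1 <= N"
  have gn: "grid N (n * N) = real n" using N1 by (simp add: grid_def)
  have "grid_sum N (n * N) (%l. f (grid N l)) x + ?Q N = (\<Sum>l<n * N. f (grid N (Suc l)) * x (grid N (Suc l)) - f (grid N l) * x (grid N l))"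
   unfolding grid_sum_def sum.distrib[symmetric] by (rule sum.cong) (auto simp: algebra_simps)
  also have "\<dots> = f (real n) * x (real n) - f 0 * x 0"
   using sum_lessThan_telescope[of "%l. f (grid N l) * x (grid N l)" "n * N"] by (simp add: gn grid_def[of N 0])
  finally show "(f (real n) * x (real n) - f 0 * x 0) - ?Q N = grid_sum N (n * N) (%l. f (grid N l)) x" by simp
 qed
 ultimately show ?thesis unfolding convergent_def by (blast intro: Lim_transform_eventually)
qed

section \<open>Product densities and shifts of Gaussian vectors\<close>

lemma PiM_density:
 fixes M :: "'i => 'a measure" and f :: "'i => 'a => ennreal"
 assumes I: "finite I" and M: "\<And>i. sigma_finite_measure (M i)" and Mf: "\<And>i. sigma_finite_measure (density (M i) (f i))"
  and f: "\<And>i. f i \<in> borel_measurable (M i)"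
 shows "PiM I (%i. density (M i) (f i)) = density (PiM I M) (%x. \<Prod>i\<in>I. f i (x i))"
proof -
 interpret M: product_sigma_finite M using M by (simp add: product_sigma_finite_def)
 interpret D: product_sigma_finite "%i. density (M i) (f i)" using Mf by (simp add: product_sigma_finite_def)
 have fm: "(%x. \<Prod>i\<in>I. f i (x i)) \<in> borel_measurable (PiM I M)"
  using f by (intro borel_measurable_prod_ennreal measurable_compose[OF measurable_component_singleton])
 have sets: "sets (PiM I (%i. density (M i) (f i))) = sets (PiM I M)" by (rule sets_PiM_cong) auto
 show ?thesis
 proof (rule D.PiM_eqI[OF I, symmetric])
  fix A assume A: "\<And>i. i \<in> I ==> A i \<in> sets (density (M i) (f i))"
  then have A': "Pi\<^sub>E I A \<in> sets (PiM I M)" using I by (intro sets_PiM_I_finite) auto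
  have "emeasure (density (PiM I M) (%x. \<Prod>i\<in>I. f i (x i))) (Pi\<^sub>E I A) =
    (\<integral>\<^sup>+x. (\<Prod>i\<in>I. f i (x i)) * indicator (Pi\<^sub>E I A) x \<partial>PiM I M)"
   by (rule emeasure_density[OF fm A'])
  also have "\<dots> = (\<integral>\<^sup>+x. (\<Prod>i\<in>I. f i (x i) * indicator (A i) (x i)) \<partial>PiM I M)"
  proof (rule nn_integral_cong)
   fix x assume "x \<in> space (PiM I M)"
   then have "indicator (Pi\<^sub>E I A) x = (\<Prod>i\<in>I. indicator (A i) (x i) :: ennreal)"
    using I by (auto simp: space_PiM PiE_iff indicator_def prod_zero_iff intro!: prod.neutral[symmetric] prod_zero)
   then show "(\<Prod>i\<in>I. f i (x i)) * indicator (Pi\<^sub>E I A) x = (\<Prod>i\<in>I. f i (x i) * indicator (A i) (x i))"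
    by (simp add: prod.distrib)
  qed
  also have "\<dots> = (\<Prod>i\<in>I. \<integral>\<^sup>+x. f i x * indicator (A i) x \<partial>M i)"
   by (rule M.product_nn_integral_prod[OF I]) (use A f in auto)
  also have "\<dots> = (\<Prod>i\<in>I. emeasure (density (M i) (f i)) (A i))"
   by (rule prod.cong) (use A f in \<open>auto simp: emeasure_density\<close>)
  finally show "emeasure (density (PiM I M) (%x. \<Prod>i\<in>I. f i (x i))) (Pi\<^sub>E I A) = (\<Prod>i\<in>I. emeasure (density (M i) (f i)) (A i))" .
 qed (simp add: sets)
qed

text \<open>Completing the square: precisions add. The increment \<open>b\<close> may be negative as
  long as the sum is positive; this case serves for exponential moments of squares.\<close>

lemma normal_density_tilt:
 assumes s: "0 < \<sigma>" and b: "0 < 1 / \<sigma>^2 + b" and v: "v^2 = 1 / (1 / \<sigma>^2 + b)" "0 < v"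
 shows "normal_density 0 \<sigma> x * exp (a * x - b * x^2 / 2) = (v / \<sigma> * exp (a^2 * v^2 / 2)) * normal_density (a * v^2) v x"
proof -
 have vs: "1 / v^2 = 1 / \<sigma>^2 + b" using v b by simp
 have "- (x^2 / (2 * \<sigma>^2)) + (a * x - b * x^2 / 2) = a * x - x^2 / 2 * (1 / \<sigma>^2 + b)"
  by (simp add: algebra_simps add_divide_distrib)
 also have "\<dots> = a * x - x^2 / 2 * (1 / v^2)" unfolding vs ..
 also have "\<dots> = a^2 * v^2 / 2 + (- ((x - a * v^2)^2 / (2 * v^2)))"
  using v(2) by (simp add: power2_diff field_simps power2_eq_square)
 finally have e: "exp (- (x^2 / (2 * \<sigma>^2))) * exp (a * x - b * x^2 / 2) = exp (a^2 * v^2 / 2) * exp (- ((x - a * v^2)^2 / (2 * v^2)))"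
  by (simp add: exp_add[symmetric])
 have c: "1 / sqrt (2 * pi * \<sigma>^2) = (v / \<sigma>) * (1 / sqrt (2 * pi * v^2))"
  using s v(2) by (simp add: real_sqrt_mult field_simps)
 show ?thesis
  unfolding normal_density_def c using e by (simp add: mult_ac)
qed

lemma normal_density_shift:
 assumes "0 < \<sigma>"
 shows "normal_density c \<sigma> x = normal_density 0 \<sigma> x * exp (c * x / \<sigma>^2 - c^2 / (2 * \<sigma>^2))"
proof -
 have "- ((x - c)^2 / (2 * \<sigma>^2)) = - (x^2 / (2 * \<sigma>^2)) + (c * x / \<sigma>^2 - c^2 / (2 * \<sigma>^2))"
  using assms by (simp add: power2_diff field_simps)
 then have "exp (- ((x - c)^2 / (2 * \<sigma>^2))) = exp (- (x^2 / (2 * \<sigma>^2))) * exp (c * x / \<sigma>^2 - c^2 / (2 * \<sigma>^2))"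
  by (simp only: exp_add)
 then show ?thesis unfolding normal_density_def by simp
qed

text \<open>Both vectors have product laws, and the law of the shifted one is the other with the
  product of the one-dimensional likelihood ratios as density.\<close>

lemma (in prob_space) gaussian_shift:
 fixes X :: "nat => 'a => real"
 assumes ind: "indep_vars (%_. borel) X {..<m}" and m: "1 <= m" and \<sigma>: "0 < \<sigma>"
  and X: "\<And>l. l < m ==> distributed M lborel (X l) (normal_density 0 \<sigma>)"
  and G: "G \<in> borel_measurable (PiM {..<m} (%_. borel))"
 shows "(\<integral>\<^sup>+om. G (\<lambda>l\<in>{..<m}. c l + X l om) \<partial>M) =
   (\<integral>\<^sup>+om. G (\<lambda>l\<in>{..<m}. X l om) * ennreal (exp ((\<Sum>l<m. c l * X l om) / \<sigma>^2 - (\<Sum>l<m. (c l)^2) / (2 * \<sigma>^2))) \<partial>M)"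
proof -
 let ?P = "PiM {..<m} (%_::nat. borel :: real measure)"
 let ?\<Phi> = "density lborel (%x. ennreal (normal_density 0 \<sigma> x))"
 let ?N = "%l. density lborel (%x. ennreal (normal_density (c l) \<sigma> x))"
 let ?f = "%l x. ennreal (exp (c l * x / \<sigma>^2 - (c l)^2 / (2 * \<sigma>^2)))"
 have ne: "{..<m} \<noteq> {}" using m by (auto simp: lessThan_empty_iff)
 have Xm [measurable]: "l < m ==> X l \<in> borel_measurable M" for l
  using ind by (auto simp: indep_vars_def)
 have dX: "distr M borel (X l) = ?\<Phi>" if "l < m" for l
 proof -
  have "distr M borel (X l) = distr M lborel (X l)" by (rule distr_cong) auto
  then show ?thesis using X[OF that] by (simp add: distributed_def)
 qed
 have dcX: "distr M borel (%om. c l + X l om) = ?N l" if "l < m" for l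
 proof -
  have "distributed M lborel (%om. c l + 1 * X l om) (normal_density (c l + 1 * 0) (\<bar>1\<bar> * \<sigma>))"
   by (rule normal_density_affine[OF X[OF that] \<sigma>]) simp
  then have "distributed M lborel (%om. c l + X l om) (normal_density (c l) \<sigma>)" by simp
  moreover have "distr M borel (%om. c l + X l om) = distr M lborel (%om. c l + X l om)" by (rule distr_cong) auto
  ultimately show ?thesis by (simp add: distributed_def)
 qed
 have ind': "indep_vars (%_. borel) (%l om. c l + X l om) {..<m}"
  by (rule indep_vars_compose2[OF ind]) measurable
 have law: "distr M ?P (%om. \<lambda>l\<in>{..<m}. X l om) = PiM {..<m} (%_. ?\<Phi>)"
 proof -
  have "distr M ?P (%om. \<lambda>l\<in>{..<m}. X l om) = PiM {..<m} (%l. distr M borel (X l))"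
   using indep_vars_iff_distr_eq_PiM'[OF ne, of X "%_. borel"] ind by auto
  also have "\<dots> = PiM {..<m} (%_. ?\<Phi>)" by (rule PiM_cong) (auto simp: dX)
  finally show ?thesis .
 qed
 have law': "distr M ?P (%om. \<lambda>l\<in>{..<m}. c l + X l om) = PiM {..<m} ?N"
 proof -
  have "distr M ?P (%om. \<lambda>l\<in>{..<m}. c l + X l om) = PiM {..<m} (%l. distr M borel (%om. c l + X l om))"
   using indep_vars_iff_distr_eq_PiM'[OF ne, of "%l om. c l + X l om" "%_. borel"] ind' by auto
  also have "\<dots> = PiM {..<m} ?N" by (rule PiM_cong) (auto simp: dcX)
  finally show ?thesis .
 qed
 have dens: "?N l = density ?\<Phi> (?f l)" for l
  by (subst density_density_eq) (auto simp: normal_density_shift[OF \<sigma>, of "c l"] ennreal_mult intro!: density_cong)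
 have sf: "sigma_finite_measure ?\<Phi>" "sigma_finite_measure (?N l)" for l
  using prob_space_normal_density[OF \<sigma>, of 0] prob_space_normal_density[OF \<sigma>, of "c l"]
  by (auto intro: prob_space_imp_sigma_finite)
 have "PiM {..<m} ?N = density (PiM {..<m} (%_. ?\<Phi>)) (%x. \<Prod>l\<in>{..<m}. ?f l (x l))"
  unfolding dens
  by (rule PiM_density) (use sf in \<open>auto simp: dens[symmetric]\<close>)
 also have "\<dots> = density (distr M ?P (%om. \<lambda>l\<in>{..<m}. X l om)) (%x. \<Prod>l\<in>{..<m}. ?f l (x l))"
  unfolding law ..
 finally have eq: "distr M ?P (%om. \<lambda>l\<in>{..<m}. c l + X l om) =
   density (distr M ?P (%om. \<lambda>l\<in>{..<m}. X l om)) (%x. \<Prod>l\<in>{..<m}. ?f l (x l))" unfolding law' .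
 have mX: "(%om. \<lambda>l\<in>{..<m}. X l om) \<in> measurable M ?P" by (intro measurable_restrict) auto
 have mcX: "(%om. \<lambda>l\<in>{..<m}. c l + X l om) \<in> measurable M ?P" by (intro measurable_restrict) auto
 have fm: "(%x. \<Prod>l\<in>{..<m}. ?f l (x l)) \<in> borel_measurable ?P"
  by (intro borel_measurable_prod_ennreal) measurable
 have "(\<integral>\<^sup>+om. G (\<lambda>l\<in>{..<m}. c l + X l om) \<partial>M) = (\<integral>\<^sup>+x. G x \<partial>distr M ?P (%om. \<lambda>l\<in>{..<m}. c l + X l om))"
  by (rule nn_integral_distr[OF mcX, symmetric]) (use G in simp)
 also have "\<dots> = (\<integral>\<^sup>+x. (\<Prod>l\<in>{..<m}. ?f l (x l)) * G x \<partial>distr M ?P (%om. \<lambda>l\<in>{..<m}. X l om))"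
  unfolding eq by (rule nn_integral_density) (use fm G in simp_all)
 also have "\<dots> = (\<integral>\<^sup>+om. (\<Prod>l\<in>{..<m}. ?f l ((\<lambda>l\<in>{..<m}. X l om) l)) * G (\<lambda>l\<in>{..<m}. X l om) \<partial>M)"
  by (rule nn_integral_distr[OF mX]) (use fm G in simp)
 also have "\<dots> = (\<integral>\<^sup>+om. G (\<lambda>l\<in>{..<m}. X l om) * ennreal (exp ((\<Sum>l<m. c l * X l om) / \<sigma>^2 - (\<Sum>l<m. (c l)^2) / (2 * \<sigma>^2))) \<partial>M)"
 proof (rule nn_integral_cong)
  fix om
  have "(\<Prod>l\<in>{..<m}. ?f l ((\<lambda>l\<in>{..<m}. X l om) l)) = (\<Prod>l\<in>{..<m}. ?f l (X l om))" by simp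
  also have "\<dots> = ennreal (exp (\<Sum>l<m. c l * X l om / \<sigma>^2 - (c l)^2 / (2 * \<sigma>^2)))"
   by (simp add: prod_ennreal exp_sum)
  also have "(\<Sum>l<m. c l * X l om / \<sigma>^2 - (c l)^2 / (2 * \<sigma>^2)) = (\<Sum>l<m. c l * X l om) / \<sigma>^2 - (\<Sum>l<m. (c l)^2) / (2 * \<sigma>^2)"
   by (simp add: sum_subtractf sum_divide_distrib)
  finally show "(\<Prod>l\<in>{..<m}. ?f l ((\<lambda>l\<in>{..<m}. X l om) l)) * G (\<lambda>l\<in>{..<m}. X l om) =
    G (\<lambda>l\<in>{..<m}. X l om) * ennreal (exp ((\<Sum>l<m. c l * X l om) / \<sigma>^2 - (\<Sum>l<m. (c l)^2) / (2 * \<sigma>^2)))"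
   by (simp add: mult.commute)
 qed
 finally show ?thesis .
qed

text \<open>The likelihood ratio of drift \<open>f\<close> against no drift at noise level
  \<open>s\<close>, seen on the grid; the subtracted sum is a Riemann sum for the integral of
  \<open>f^2\<close>.\<close>

definition grid_density :: "real => nat => nat => (real => real) => (real => real) => real" where
 "grid_density s n N f x = exp (grid_sum N (n * N) (%l. f (grid N l)) x / s - (\<Sum>l<n * N. (f (grid N l))^2 / real N) / (2 * s^2))"

lemma (in prob_space) brownian_grid_shift:
 assumes w: "standard_brownian_motion M w" and n: "1 <= n" and N: "1 <= N" and s: "0 < s"
  and G: "G \<in> borel_measurable (PiM {..<n * N} (%_. borel))"
 shows "(\<integral>\<^sup>+om. G (\<lambda>l\<in>{..<n * N}. f (grid N l) / real N + s * (w (grid N (Suc l)) om - w (grid N l) om)) \<partial>M) =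
   (\<integral>\<^sup>+om. G (\<lambda>l\<in>{..<n * N}. s * (w (grid N (Suc l)) om - w (grid N l) om)) * ennreal (grid_density s n N f (%t. w t om)) \<partial>M)"
proof -
 let ?m = "n * N" and ?X = "%l om. s * (w (grid N (Suc l)) om - w (grid N l) om)"
 let ?\<sigma> = "s * sqrt (1 / real N)"
 have N0: "0 < real N" using N by simp
 have \<sigma>: "0 < ?\<sigma>" using s N by simp
 have \<sigma>2: "?\<sigma>^2 = s^2 / real N" by (simp add: power_mult_distrib)
 have m: "1 <= ?m" using n N by simp
 have "indep_vars (%_. borel) (%l om. w (grid N (Suc l)) om - w (grid N l) om) {..<?m}"
  using w unfolding standard_brownian_motion_def by (intro indep_increments_grid) simp
 then have ind: "indep_vars (%_. borel) ?X {..<?m}" by (rule indep_vars_compose2) measurable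
 have D: "distributed M lborel (?X l) (normal_density 0 ?\<sigma>)" for l
 proof -
  have "distributed M lborel (%om. w (grid N (Suc l)) om - w (grid N l) om) (normal_density 0 (sqrt (grid N (Suc l) - grid N l)))"
   using w grid_less[OF N, of l] unfolding standard_brownian_motion_def by simp
  then have "distributed M lborel (%om. 0 + s * (w (grid N (Suc l)) om - w (grid N l) om)) (normal_density (0 + s * 0) (\<bar>s\<bar> * sqrt (1 / real N)))"
   by (intro normal_density_affine) (use s N in \<open>auto simp: grid_Suc\<close>)
  then show ?thesis using s by simp
 qed
 have e: "(\<Sum>l<?m. f (grid N l) / real N * ?X l om) / ?\<sigma>^2 - (\<Sum>l<?m. (f (grid N l) / real N)^2) / (2 * ?\<sigma>^2) =
   grid_sum N ?m (%l. f (grid N l)) (%t. w t om) / s - (\<Sum>l<?m. (f (grid N l))^2 / real N) / (2 * s^2)" for om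
 proof -
  have "(\<Sum>l<?m. f (grid N l) / real N * ?X l om) / ?\<sigma>^2 = grid_sum N ?m (%l. f (grid N l)) (%t. w t om) / s"
   unfolding \<sigma>2 grid_sum_def sum_divide_distrib using N0 s
   by (intro sum.cong) (auto simp: field_simps power2_eq_square)
  moreover have "(\<Sum>l<?m. (f (grid N l) / real N)^2) / (2 * ?\<sigma>^2) = (\<Sum>l<?m. (f (grid N l))^2 / real N) / (2 * s^2)"
   unfolding \<sigma>2 sum_divide_distrib using N0 s
   by (intro sum.cong) (auto simp: field_simps power2_eq_square)
  ultimately show ?thesis by simp
 qed
 show ?thesis
  using gaussian_shift[OF ind m \<sigma> D G, of "%l. f (grid N l) / real N"] unfolding e grid_density_def .
qed

text \<open>Squaring doubles the drift up to a deterministic factor. As likelihood ratios integrate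
  to 1, the second moments follow explicitly and are bounded uniformly in \<open>N\<close>.\<close>

lemma grid_density_sq:
 assumes "0 < s"
 shows "(grid_density s n N f x)^2 = grid_density s n N (%t. 2 * f t) x * exp ((\<Sum>l<n * N. (f (grid N l))^2 / real N) / s^2)"
proof -
 let ?E = "\<Sum>l<n * N. (f (grid N l))^2 / real N"
 have g: "grid_sum N (n * N) (%l. 2 * f (grid N l)) x = 2 * grid_sum N (n * N) (%l. f (grid N l)) x"
  by (simp add: grid_sum_def sum_distrib_left mult.assoc)
 have e: "(\<Sum>l<n * N. (2 * f (grid N l))^2 / real N) = 4 * ?E"
  by (simp add: power_mult_distrib sum_distrib_left)
 show ?thesis
  unfolding grid_density_def g e exp_double[symmetric] exp_add[symmetric]
  using assms by (simp add: field_simps)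
qed

section \<open>The change of measure on path space\<close>

context prob_space
begin

lemma grid_density_moments:
 assumes w: "standard_brownian_motion M w" and n: "1 <= n" and N: "1 <= N" and s: "0 < s"
  and K: "\<And>t. t \<in> {0..real n} ==> \<bar>f t\<bar> <= K"
 shows "(%om. grid_density s n N f (%t. w t om)) \<in> borel_measurable M"
  and "integrable M (%om. (grid_density s n N f (%t. w t om))^2)"
  and "expectation (%om. (grid_density s n N f (%t. w t om))^2) <= exp (real n * K^2 / s^2)"
proof -
 have wm: "0 <= t ==> w t \<in> borel_measurable M" for t using w by (simp add: standard_brownian_motion_def)
 have m [measurable]: "(%om. grid_density s n N f (%t. w t om)) \<in> borel_measurable M" for f
  unfolding grid_density_def using grid_sum_measurable[OF wm] by measurable
 then show "(%om. grid_density s n N f (%t. w t om)) \<in> borel_measurable M" .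
 have one: "(\<integral>\<^sup>+om. ennreal (grid_density s n N f (%t. w t om)) \<partial>M) = 1" for f
  using brownian_grid_shift[OF w n N s, of "%_. 1" f] by (simp add: emeasure_space_1)
 let ?E = "\<Sum>l<n * N. (f (grid N l))^2 / real N"
 have E: "?E <= real n * K^2"
 proof -
  have "?E <= (\<Sum>l<n * N. K^2 / real N)"
  proof (rule sum_mono)
   fix l assume "l \<in> {..<n * N}"
   then have "\<bar>f (grid N l)\<bar> <= K" by (intro K grid_in_range N) simp
   then have "(f (grid N l))^2 <= K^2" by (simp add: abs_le_square_iff[symmetric])
   then show "(f (grid N l))^2 / real N <= K^2 / real N" by (rule divide_right_mono) simp
  qed
  then show ?thesis using N by simp
 qed
 have "(\<integral>\<^sup>+om. ennreal ((grid_density s n N f (%t. w t om))^2) \<partial>M) =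
   (\<integral>\<^sup>+om. ennreal (grid_density s n N (%t. 2 * f t) (%t. w t om)) * ennreal (exp (?E / s^2)) \<partial>M)"
  unfolding grid_density_sq[OF s] by (simp add: ennreal_mult grid_density_def)
 also have "\<dots> = ennreal (exp (?E / s^2))"
  by (subst nn_integral_multc) (simp_all add: one)
 finally have eq: "(\<integral>\<^sup>+om. ennreal ((grid_density s n N f (%t. w t om))^2) \<partial>M) = ennreal (exp (?E / s^2))" .
 show int: "integrable M (%om. (grid_density s n N f (%t. w t om))^2)"
  by (rule integrableI_bounded) (use eq in simp_all)
 have "expectation (%om. (grid_density s n N f (%t. w t om))^2) = exp (?E / s^2)"
  using eq by (subst (asm) nn_integral_eq_integral[OF int]) auto
 also have "\<dots> <= exp (real n * K^2 / s^2)" using E by (simp add: divide_right_mono)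
 finally show "expectation (%om. (grid_density s n N f (%t. w t om))^2) <= exp (real n * K^2 / s^2)" .
qed

text \<open>A limit at each point of the sample space, meaningful for smooth \<open>f\<close>
  because the Brownian paths are continuous at every such point.\<close>

definition wiener_integral :: "nat => (real => 'a => real) => (real => real) => 'a => real" where
 "wiener_integral n w f om = lim (%N. grid_sum N (n * N) (%l. f (grid N l)) (%t. w t om))"

lemma wiener_integral_LIMSEQ:
 assumes w: "standard_brownian_motion M w" and om: "om \<in> space M"
  and f: "\<And>t. (f has_real_derivative f' t) (at t)" "continuous_on UNIV f'"
 shows "(%N. grid_sum N (n * N) (%l. f (grid N l)) (%t. w t om)) \<longlonglongrightarrow> wiener_integral n w f om"
 unfolding wiener_integral_def
 by (rule convergent_LIMSEQ_iff[THEN iffD1], rule smooth_grid_sum_convergent[OF _ f])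
   (use w om in \<open>auto simp: standard_brownian_motion_def\<close>)

lemma wiener_integral_measurable:
 assumes w: "standard_brownian_motion M w"
 shows "wiener_integral n w f \<in> borel_measurable M"
proof -
 have wm: "0 <= t ==> w t \<in> borel_measurable M" for t using w by (simp add: standard_brownian_motion_def)
 show ?thesis unfolding wiener_integral_def[abs_def]
  by (intro borel_measurable_lim_metric grid_sum_measurable wm)
qed

definition girsanov_density :: "real => nat => (real => 'a => real) => (real => real) => 'a => real" where
 "girsanov_density s n w f om = exp (wiener_integral n w f om / s - primitive (%t. (f t)^2) (real n) / (2 * s^2))"

lemma girsanov_density_measurable:
 "standard_brownian_motion M w ==> girsanov_density s n w f \<in> borel_measurable M"
 unfolding girsanov_density_def[abs_def] using wiener_integral_measurable[of w n f] by measurable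

text \<open>The shift formula on grids, with cylinder times moved to grid points on their left.
  Continuous bounded test functions make the left side converge by domination, and the uniform
  second moment of the densities handles the right side.\<close>

lemma cameron_martin_cylinder:
 assumes w: "standard_brownian_motion M w" and n: "1 <= n" and s: "0 < s"
  and f: "\<And>t. (f has_real_derivative f' t) (at t)" "continuous_on UNIV f'"
  and J: "finite J" "J \<subseteq> {0..real n}"
  and g: "\<And>t. continuous_on UNIV (g t)" "\<And>t x. 0 <= g t x" "\<And>t x. g t x <= (1::real)"
 shows "integrable M (girsanov_density s n w f)"
  and "expectation (%om. \<Prod>t\<in>J. g t (primitive f t + s * w t om)) =
   expectation (%om. (\<Prod>t\<in>J. g t (s * w t om)) * girsanov_density s n w f om)"
proof -
 have fc: "continuous_on A f" for A
  using f by (intro continuous_at_imp_continuous_on ballI) (auto intro: DERIV_isCont)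
 have f2: "continuous_on UNIV (%t. (f t)^2)" by (intro continuous_intros fc)
 have wm: "0 <= t ==> w t \<in> borel_measurable M" for t using w by (simp add: standard_brownian_motion_def)
 have wc: "om \<in> space M ==> continuous_on {0..} (%t. w t om)" for om
  using w by (simp add: standard_brownian_motion_def)
 have w0: "AE om in M. w 0 om = 0" using w by (simp add: standard_brownian_motion_def)
 have gm [measurable]: "g t \<in> borel_measurable borel" for t by (intro borel_measurable_continuous_onI g)
 have "compact (f ` {0..real n})" by (rule compact_continuous_image[OF fc]) simp
 then obtain K where K: "\<And>t. t \<in> {0..real n} ==> \<bar>f t\<bar> <= K"
  using compact_imp_bounded bounded_pos by (metis image_eqI real_norm_def)
 \<comment> \<open>The number of grid cells completed by time \<open>t\<close>.\<close>
 define k where "k t N = nat \<lfloor>t * real N\<rfloor>" for t :: real and N :: nat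
 have kle: "k t N <= n * N" if "t \<in> J" for t N
 proof -
  have "t * real N <= real n * real N" using that J by (intro mult_right_mono) auto
  then have "\<lfloor>t * real N\<rfloor> <= int (n * N)" by (metis floor_mono floor_of_nat of_nat_mult)
  then show ?thesis unfolding k_def by linarith
 qed
 define Fs where "Fs t N = (\<Sum>l<k t N. f (grid N l) / real N)" for t N
 define Z where "Z N om = grid_density s n N f (%t. w t om)" for N om
 let ?Z = "girsanov_density s n w f"
 let ?L = "%N om. \<Prod>t\<in>J. g t (Fs t N + s * w (grid N (k t N)) om)"
 let ?R = "%N om. \<Prod>t\<in>J. g t (s * w (grid N (k t N)) om)"
 have mom: "1 <= N ==> Z N \<in> borel_measurable M" "1 <= N ==> integrable M (%om. (Z N om)^2)"
  "1 <= N ==> expectation (%om. (Z N om)^2) <= exp (real n * K^2 / s^2)" for N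
  unfolding Z_def[abs_def] using grid_density_moments[OF w n _ s, of N f K] K by blast+
 have Zlim: "(%N. Z N om) \<longlonglongrightarrow> ?Z om" if om: "om \<in> space M" for om
 proof -
  have "(%N. \<Sum>l<n * N. (f (grid N l))^2 / real N) \<longlonglongrightarrow> primitive (%t. (f t)^2) (real n)"
  proof (rule riemann_sum_tendsto[OF f2])
   show "(%N. grid N (n * N)) \<longlonglongrightarrow> real n"
    by (rule tendsto_eventually, use eventually_gt_at_top[of "0::nat"] in eventually_elim) (simp add: grid_def)
  qed auto
  then show ?thesis unfolding Z_def grid_density_def girsanov_density_def
   using s by (intro tendsto_intros wiener_integral_LIMSEQ[OF w om f]) auto
 qed
 have Zm: "?Z \<in> borel_measurable M" by (rule girsanov_density_measurable[OF w])
 have Z2: "integrable M (%om. (?Z om)^2)"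
  by (rule LIMSEQ_expectation_L2_bounded(1)[of "%N. Z (Suc N)" ?Z "exp (real n * K^2 / s^2)"])
    (use Zm Zlim mom in \<open>auto intro!: LIMSEQ_Suc\<close>)
 show Z1: "integrable M ?Z" by (rule integrable_of_square[OF Zm Z2])
 have pb: "0 <= (\<Prod>t\<in>J. g t (x t)) \<and> (\<Prod>t\<in>J. g t (x t)) <= 1" for x
  by (auto intro!: prod_nonneg prod_le_1 g)
 have Lm: "?L N \<in> borel_measurable M" and Rm: "?R N \<in> borel_measurable M" for N
  using wm by (intro borel_measurable_prod measurable_compose[OF _ gm] borel_measurable_add borel_measurable_times borel_measurable_const wm grid_nonneg)+
 \<comment> \<open>Paths at grid points are partial sums of increments, so both sides are one
   functional \<open>G\<close> of the vector of increments. The identification uses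
   \<open>w 0 = 0\<close>, which holds almost surely.\<close>
 have grid_eq: "expectation (?L N) = expectation (%om. ?R N om * Z N om)" if N: "1 <= N" for N
 proof -
  let ?I = "{..<n * N}"
  define G where "G x = (\<Prod>t\<in>J. g t (\<Sum>l<k t N. x l))" for x :: "nat => real"
  have Gm: "(%x. ennreal (G x)) \<in> borel_measurable (PiM ?I (%_. borel))"
   unfolding G_def
  proof (intro measurable_compose[OF _ measurable_ennreal] borel_measurable_prod measurable_compose[OF _ gm] borel_measurable_sum)
   fix t l assume "t \<in> J" "l \<in> {..<k t N}"
   then have "l \<in> ?I" using kle[of t N] by auto
   then show "(%x. x l) \<in> borel_measurable (PiM ?I (%_. borel))" by (rule measurable_component_singleton)
  qed
  have GL: "G (\<lambda>l\<in>?I. f (grid N l) / real N + s * (w (grid N (Suc l)) om - w (grid N l) om)) = ?L N om"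
   and GR: "G (\<lambda>l\<in>?I. s * (w (grid N (Suc l)) om - w (grid N l) om)) = ?R N om" if w0: "w 0 om = 0" for om
  proof -
   have tel: "(\<Sum>l<k t N. s * (w (grid N (Suc l)) om - w (grid N l) om)) = s * w (grid N (k t N)) om" for t
    using sum_lessThan_telescope[of "%l. w (grid N l) om" "k t N"] w0
    by (simp add: sum_distrib_left[symmetric] grid_def[of N 0])
   show "G (\<lambda>l\<in>?I. s * (w (grid N (Suc l)) om - w (grid N l) om)) = ?R N om"
    unfolding G_def
   proof (intro prod.cong refl arg_cong[of _ _ "g _"])
    fix t assume t: "t \<in> J"
    have "(\<Sum>l<k t N. (\<lambda>l\<in>?I. s * (w (grid N (Suc l)) om - w (grid N l) om)) l) = (\<Sum>l<k t N. s * (w (grid N (Suc l)) om - w (grid N l) om))"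
     by (rule sum.cong) (use kle[OF t, of N] in auto)
    then show "(\<Sum>l<k t N. (\<lambda>l\<in>?I. s * (w (grid N (Suc l)) om - w (grid N l) om)) l) = s * w (grid N (k t N)) om"
     unfolding tel .
   qed
   show "G (\<lambda>l\<in>?I. f (grid N l) / real N + s * (w (grid N (Suc l)) om - w (grid N l) om)) = ?L N om"
    unfolding G_def
   proof (intro prod.cong refl arg_cong[of _ _ "g _"])
    fix t assume t: "t \<in> J"
    have "(\<Sum>l<k t N. (\<lambda>l\<in>?I. f (grid N l) / real N + s * (w (grid N (Suc l)) om - w (grid N l) om)) l) =
      (\<Sum>l<k t N. f (grid N l) / real N + s * (w (grid N (Suc l)) om - w (grid N l) om))"
     by (rule sum.cong) (use kle[OF t, of N] in auto)
    then show "(\<Sum>l<k t N. (\<lambda>l\<in>?I. f (grid N l) / real N + s * (w (grid N (Suc l)) om - w (grid N l) om)) l) = Fs t N + s * w (grid N (k t N)) om"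
     unfolding sum.distrib tel Fs_def .
   qed
  qed
  have "(\<integral>\<^sup>+om. ennreal (?L N om) \<partial>M) = (\<integral>\<^sup>+om. ennreal (G (\<lambda>l\<in>?I. f (grid N l) / real N + s * (w (grid N (Suc l)) om - w (grid N l) om))) \<partial>M)"
   by (rule nn_integral_cong_AE, use w0 in eventually_elim) (simp add: GL)
  also have "\<dots> = (\<integral>\<^sup>+om. ennreal (G (\<lambda>l\<in>?I. s * (w (grid N (Suc l)) om - w (grid N l) om))) * ennreal (Z N om) \<partial>M)"
   unfolding Z_def by (rule brownian_grid_shift[OF w n N s Gm])
  also have "\<dots> = (\<integral>\<^sup>+om. ennreal (?R N om * Z N om) \<partial>M)"
   by (rule nn_integral_cong_AE, use w0 in eventually_elim)
     (use pb in \<open>simp add: GR ennreal_mult Z_def grid_density_def\<close>)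
  finally have eq: "(\<integral>\<^sup>+om. ennreal (?L N om) \<partial>M) = (\<integral>\<^sup>+om. ennreal (?R N om * Z N om) \<partial>M)" .
  have i1: "integrable M (?L N)"
   by (rule integrable_const_bound[of _ 1]) (use Lm pb in auto)
  have i2: "integrable M (%om. ?R N om * Z N om)"
  proof (rule Bochner_Integration.integrable_bound[of _ "Z N"])
   show "integrable M (Z N)" by (rule integrable_of_square[OF mom(1,2)[OF N]])
   show "AE om in M. norm (?R N om * Z N om) <= norm (Z N om)"
    using pb by (intro AE_I2) (simp add: abs_mult mult_left_le_one_le)
  qed (use Rm mom(1)[OF N] in measurable)
  have nn2: "0 <= ?R N om * Z N om" for om using pb by (simp add: Z_def grid_density_def)
  have "ennreal (expectation (?L N)) = ennreal (expectation (%om. ?R N om * Z N om))"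
   using eq nn_integral_eq_integral[OF i1] nn_integral_eq_integral[OF i2] pb nn2 by simp
  then show ?thesis
   by (rule ennreal_inj[THEN iffD1, rotated 2]) (use pb nn2 in \<open>auto intro!: integral_nonneg_AE\<close>)
 qed
 have tlim: "(%N. grid N (k t N)) \<longlonglongrightarrow> t" if "t \<in> J" for t
  unfolding k_def by (rule grid_index_tendsto) (use that J in auto)
 have wlim: "(%N. w (grid N (k t N)) om) \<longlonglongrightarrow> w t om" if "t \<in> J" "om \<in> space M" for t om
  by (rule continuous_on_tendsto_compose[OF wc[OF that(2)] tlim[OF that(1)]]) (use that J in auto)
 have Flim: "(%N. Fs t N) \<longlonglongrightarrow> primitive f t" if "t \<in> J" for t
  unfolding Fs_def by (rule riemann_sum_tendsto[OF fc kle[OF that] tlim[OF that]]) (use that J in auto)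
 have gl: "(%N. g t (x N)) \<longlonglongrightarrow> g t y" if "x \<longlonglongrightarrow> y" for t x y
  by (rule continuous_on_tendsto_compose[OF g(1) that]) auto
 have "(%N. expectation (?L (Suc N))) \<longlonglongrightarrow> expectation (%om. \<Prod>t\<in>J. g t (primitive f t + s * w t om))"
 proof (rule integral_dominated_convergence[where w = "%_. 1"])
  show "(%om. \<Prod>t\<in>J. g t (primitive f t + s * w t om)) \<in> borel_measurable M"
   using wm J by (intro borel_measurable_prod measurable_compose[OF _ gm]) auto
  show "AE om in M. (%N. ?L (Suc N) om) \<longlonglongrightarrow> (\<Prod>t\<in>J. g t (primitive f t + s * w t om))"
   by (rule AE_I2, rule LIMSEQ_Suc) (intro tendsto_prod gl tendsto_add tendsto_mult tendsto_const Flim wlim; assumption)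
 qed (use Lm pb in auto)
 moreover have "(%N. expectation (%om. ?R (Suc N) om * Z (Suc N) om)) \<longlonglongrightarrow> expectation (%om. (\<Prod>t\<in>J. g t (s * w t om)) * ?Z om)"
 proof (rule LIMSEQ_expectation_L2_bounded(3)[where C = "exp (real n * K^2 / s^2)"])
  have RZ: "(?R N om * Z N om)^2 <= (Z N om)^2" for N om
   using pb by (simp add: abs_le_square_iff[symmetric] abs_mult mult_left_le_one_le)
  show m: "(%om. ?R (Suc N) om * Z (Suc N) om) \<in> borel_measurable M" for N
   using Rm[of "Suc N"] mom(1)[of "Suc N"] by simp
  show "(%om. (\<Prod>t\<in>J. g t (s * w t om)) * ?Z om) \<in> borel_measurable M"
   using wm J Zm by (intro borel_measurable_times borel_measurable_prod measurable_compose[OF _ gm]) auto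
  show "AE om in M. (%N. ?R (Suc N) om * Z (Suc N) om) \<longlonglongrightarrow> (\<Prod>t\<in>J. g t (s * w t om)) * ?Z om"
   by (rule AE_I2, rule LIMSEQ_Suc, rule tendsto_mult)
     (intro tendsto_prod gl tendsto_mult tendsto_const wlim Zlim; assumption)+
  show i: "integrable M (%om. (?R (Suc N) om * Z (Suc N) om)^2)" for N
  proof (rule Bochner_Integration.integrable_bound[OF mom(2)[of "Suc N"]])
   show "(%om. (?R (Suc N) om * Z (Suc N) om)^2) \<in> borel_measurable M" by (rule borel_measurable_power[OF m])
   show "AE om in M. norm ((?R (Suc N) om * Z (Suc N) om)^2) <= norm ((Z (Suc N) om)^2)"
    by (rule AE_I2) (use RZ[of "Suc N"] in simp)
  qed simp
  show "expectation (%om. (?R (Suc N) om * Z (Suc N) om)^2) <= exp (real n * K^2 / s^2)" for N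
   by (rule order_trans[OF integral_mono[OF i mom(2)[of "Suc N"] RZ] mom(3)]) auto
 qed
 ultimately show "expectation (%om. \<Prod>t\<in>J. g t (primitive f t + s * w t om)) =
   expectation (%om. (\<Prod>t\<in>J. g t (s * w t om)) * ?Z om)"
  using grid_eq by (simp add: LIMSEQ_unique)
qed


lemma cameron_martin_open_cylinder:
 assumes w: "standard_brownian_motion M w" and n: "1 <= n" and s: "0 < s"
  and f: "\<And>t. (f has_real_derivative f' t) (at t)" "continuous_on UNIV f'"
  and J: "finite J" "J \<subseteq> {0..real n}" and A: "\<And>t. open (A t :: real set)"
 shows "expectation (%om. \<Prod>t\<in>J. indicator (A t) (primitive f t + s * w t om)) =
   expectation (%om. (\<Prod>t\<in>J. indicator (A t) (s * w t om)) * girsanov_density s n w f om)"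
proof -
 have "\<exists>g :: nat => real => real. (\<forall>i. continuous_on UNIV (g i)) \<and> (\<forall>i x. 0 <= g i x) \<and> (\<forall>i x. g i x <= 1) \<and>
  (\<forall>x. (%i. g i x) \<longlonglongrightarrow> indicator (A t) x)" for t
  by (rule open_indicator_limit[OF A[of t]]) blast
 then obtain g :: "real => nat => real => real" where g: "\<And>t i. continuous_on UNIV (g t i)" "\<And>t i x. 0 <= g t i x" "\<And>t i x. g t i x <= 1"
  "\<And>t x. (%i. g t i x) \<longlonglongrightarrow> indicator (A t) x"
  by metis
 have wm: "0 <= t ==> w t \<in> borel_measurable M" for t using w by (simp add: standard_brownian_motion_def)
 have gm [measurable]: "g t i \<in> borel_measurable borel" for t i by (intro borel_measurable_continuous_onI g)
 have Am [measurable]: "A t \<in> sets borel" for t using A by (rule borel_open)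
 have im: "indicator (A t) \<in> borel_measurable (borel :: real measure)" for t by measurable
 let ?Z = "girsanov_density s n w f"
 have Zm: "?Z \<in> borel_measurable M" by (rule girsanov_density_measurable[OF w])
 note Z1 = cameron_martin_cylinder(1)[OF w n s f, of "{}" "%_ _. 0", simplified]
 note eq = cameron_martin_cylinder(2)[OF w n s f J, of "%t. g t i" for i, OF g(1,2,3)]
 have pb: "0 <= (\<Prod>t\<in>J. g t i (x t)) \<and> (\<Prod>t\<in>J. g t i (x t)) <= 1" for i x
  by (auto intro!: prod_nonneg prod_le_1 g)
 have "(%i. expectation (%om. \<Prod>t\<in>J. g t i (primitive f t + s * w t om))) \<longlonglongrightarrow> expectation (%om. \<Prod>t\<in>J. indicator (A t) (primitive f t + s * w t om))"
 proof (rule integral_dominated_convergence[where w = "%_. 1"])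
  show "(%om. \<Prod>t\<in>J. g t i (primitive f t + s * w t om)) \<in> borel_measurable M" for i
   using wm J by (intro borel_measurable_prod measurable_compose[OF _ gm]) auto
  show "(%om. \<Prod>t\<in>J. indicator (A t) (primitive f t + s * w t om) :: real) \<in> borel_measurable M"
   using wm J by (intro borel_measurable_prod measurable_compose[OF _ im]) auto
  show "AE om in M. (%i. \<Prod>t\<in>J. g t i (primitive f t + s * w t om)) \<longlonglongrightarrow> (\<Prod>t\<in>J. indicator (A t) (primitive f t + s * w t om))"
   by (intro AE_I2 tendsto_prod g(4))
 qed (use pb in auto)
 moreover have "(%i. expectation (%om. (\<Prod>t\<in>J. g t i (s * w t om)) * ?Z om)) \<longlonglongrightarrow> expectation (%om. (\<Prod>t\<in>J. indicator (A t) (s * w t om)) * ?Z om)"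
 proof (rule integral_dominated_convergence[where w = ?Z])
  show "(%om. (\<Prod>t\<in>J. g t i (s * w t om)) * ?Z om) \<in> borel_measurable M" for i
   using wm J Zm by (intro borel_measurable_times borel_measurable_prod measurable_compose[OF _ gm]) auto
  show "(%om. (\<Prod>t\<in>J. indicator (A t) (s * w t om)) * ?Z om) \<in> borel_measurable M"
   using wm J Zm by (intro borel_measurable_times borel_measurable_prod measurable_compose[OF _ im]) auto
  show "AE om in M. (%i. (\<Prod>t\<in>J. g t i (s * w t om)) * ?Z om) \<longlonglongrightarrow> (\<Prod>t\<in>J. indicator (A t) (s * w t om)) * ?Z om"
   by (intro AE_I2 tendsto_mult tendsto_prod g(4) tendsto_const)
  show "AE om in M. norm ((\<Prod>t\<in>J. g t i (s * w t om)) * ?Z om) <= ?Z om" for i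
   using pb by (intro AE_I2) (simp add: abs_mult girsanov_density_def mult_left_le_one_le)
 qed (rule Z1)
 ultimately show ?thesis unfolding eq by (rule LIMSEQ_unique)
qed

text \<open>Cylinders over open sets are stable under intersection and generate the product
  sigma-algebra, so agreement on them identifies the two path laws.\<close>

lemma cameron_martin_PiM:
 assumes w: "standard_brownian_motion M w" and n: "1 <= n" and s: "0 < s"
  and f: "\<And>t. (f has_real_derivative f' t) (at t)" "continuous_on UNIV f'"
  and H: "H \<in> borel_measurable (path_PiM n)"
 shows "(\<integral>\<^sup>+om. H (path_restrict n (%t. primitive f t + s * w t om)) \<partial>M) =
   (\<integral>\<^sup>+om. ennreal (girsanov_density s n w f om) * H (path_restrict n (%t. s * w t om)) \<partial>M)"
proof -
 let ?T = "{0..real n}"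
 let ?\<Omega> = "PiE ?T (%_. UNIV :: real set)"
 let ?Z = "girsanov_density s n w f"
 let ?P1 = "%om. path_restrict n (%t. primitive f t + s * w t om)" and ?P2 = "%om. path_restrict n (%t. s * w t om)"
 let ?E = "{{x \<in> ?\<Omega>. \<forall>t\<in>J. x t \<in> A t} | A J. J \<in> {J. finite J \<and> J \<subseteq> ?T} \<and> A \<in> Pi J (%_. Collect open)}"
 have wm: "0 <= t ==> w t \<in> borel_measurable M" for t using w by (simp add: standard_brownian_motion_def)
 have P1: "?P1 \<in> measurable M (path_PiM n)" and P2: "?P2 \<in> measurable M (path_PiM n)"
  using wm by (intro measurable_path_restrict borel_measurable_add borel_measurable_times; simp)+
 have Zm: "?Z \<in> borel_measurable M" by (rule girsanov_density_measurable[OF w])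
 note Z1 = cameron_martin_cylinder(1)[OF w n s f, of "{}" "%_ _. 0", simplified]
 let ?D1 = "distr M (path_PiM n) ?P1" and ?D2 = "distr (density M (%om. ennreal (?Z om))) (path_PiM n) ?P2"
 have P2': "?P2 \<in> measurable (density M (%om. ennreal (?Z om))) (path_PiM n)" using P2 by simp
 have gen: "sets (path_PiM n) = sigma_sets ?\<Omega> ?E"
 proof -
  have "sets (path_PiM n) = sets (Pi\<^sub>M ?T (%_. sigma UNIV (Collect (open :: real set => bool))))"
   by (rule sets_PiM_cong) (auto simp: borel_def)
  also have "\<dots> = sets (sigma ?\<Omega> ?E)"
   by (rule sets_PiM_sigma) (auto intro!: exI[of _ "{UNIV}"])
  also have "\<dots> = sigma_sets ?\<Omega> ?E" by (rule sets_measure_of) auto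
  finally show ?thesis .
 qed
 have EI: "{x \<in> ?\<Omega>. \<forall>t\<in>J. x t \<in> A t} \<in> ?E" if "finite J" "J \<subseteq> ?T" "\<And>t. t \<in> J ==> open (A t)" for A J
  using that by (intro CollectI exI[of _ A] exI[of _ J]) auto
 have stable: "Int_stable ?E"
 proof (rule Int_stableI)
  fix a b assume "a \<in> ?E" "b \<in> ?E"
  then obtain A J B K where a: "a = {x \<in> ?\<Omega>. \<forall>t\<in>J. x t \<in> A t}" "finite J" "J \<subseteq> ?T" "\<And>t. t \<in> J ==> open (A t)"
   and b: "b = {x \<in> ?\<Omega>. \<forall>t\<in>K. x t \<in> B t}" "finite K" "K \<subseteq> ?T" "\<And>t. t \<in> K ==> open (B t)" by blast
  let ?A = "%t. (if t \<in> J then A t else UNIV) \<inter> (if t \<in> K then B t else UNIV)"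
  have ab: "a \<inter> b = {x \<in> ?\<Omega>. \<forall>t\<in>J \<union> K. x t \<in> ?A t}" unfolding a(1) b(1) by auto
  show "a \<inter> b \<in> ?E" unfolding ab by (rule EI) (use a(2-4) b(2-4) in \<open>auto intro!: open_Int\<close>)
 qed
 have em: "emeasure ?D1 C = emeasure ?D2 C" if C: "C \<in> ?E" for C
 proof -
  obtain A J where CA: "C = {x \<in> ?\<Omega>. \<forall>t\<in>J. x t \<in> A t}" and J: "finite J" "J \<subseteq> ?T" and A: "\<And>t. t \<in> J ==> open (A t)" using C by blast
  define B where "B t = (if t \<in> J then A t else UNIV)" for t
  have B: "open (B t)" for t using A by (simp add: B_def)
  have Cs: "C \<in> sets (path_PiM n)" unfolding gen using C by (rule sigma_sets.Basic)
  have ind: "indicator C (path_restrict n x) = (\<Prod>t\<in>J. indicator (B t) (x t) :: real)" for x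
  proof -
   have "path_restrict n x \<in> C \<longleftrightarrow> (\<forall>t\<in>J. x t \<in> B t)"
    using J by (auto simp: CA path_restrict_def B_def)
   then show ?thesis using J by (auto simp: indicator_def)
  qed
  have im: "indicator (B t) \<in> borel_measurable (borel :: real measure)" for t using B by (intro borel_measurable_indicator borel_open)
  have i1: "integrable M (%om. indicator C (?P1 om) :: real)"
   by (rule integrable_const_bound[of _ 1]) (use P1 Cs in \<open>auto intro!: measurable_compose[OF P1]\<close>)
  have i2: "integrable M (%om. indicator C (?P2 om) * ?Z om)"
  proof (rule Bochner_Integration.integrable_bound[OF Z1])
   show "(%om. indicator C (?P2 om) * ?Z om) \<in> borel_measurable M"
    using Zm by (intro borel_measurable_times measurable_compose[OF P2] borel_measurable_indicator Cs) auto
  qed (auto simp: indicator_def)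
  have "emeasure ?D1 C = (\<integral>\<^sup>+x. indicator C x \<partial>?D1)" using Cs by simp
  also have "\<dots> = (\<integral>\<^sup>+om. indicator C (?P1 om) \<partial>M)"
   by (rule nn_integral_distr[OF P1]) (use Cs in simp)
  also have "\<dots> = (\<integral>\<^sup>+om. ennreal (indicator C (?P1 om)) \<partial>M)" by (simp add: ennreal_indicator)
  also have "\<dots> = ennreal (expectation (%om. indicator C (?P1 om)))"
   by (rule nn_integral_eq_integral[OF i1]) simp
  also have "expectation (%om. indicator C (?P1 om)) = expectation (%om. indicator C (?P2 om) * ?Z om)"
   unfolding ind by (rule cameron_martin_open_cylinder[OF w n s f J B])
  also have "ennreal \<dots> = (\<integral>\<^sup>+om. ennreal (indicator C (?P2 om) * ?Z om) \<partial>M)"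
   by (rule nn_integral_eq_integral[OF i2, symmetric]) (auto simp: girsanov_density_def)
  also have "\<dots> = (\<integral>\<^sup>+om. ennreal (?Z om) * indicator C (?P2 om) \<partial>M)"
   by (rule nn_integral_cong) (auto simp: indicator_def)
  also have "\<dots> = (\<integral>\<^sup>+om. indicator C (?P2 om) \<partial>density M (%om. ennreal (?Z om)))"
   by (rule nn_integral_density[symmetric])
     (use Zm in \<open>auto intro!: measurable_compose[OF P2] borel_measurable_indicator Cs\<close>)
  also have "\<dots> = (\<integral>\<^sup>+x. indicator C x \<partial>?D2)"
   by (rule nn_integral_distr[OF P2', symmetric]) (use Cs in simp)
  also have "\<dots> = emeasure ?D2 C" using Cs by simp
  finally show ?thesis .
 qed
 have D: "?D1 = ?D2"
 proof (rule measure_eqI_generator_eq[OF stable, of ?\<Omega> _ _ "%_. ?\<Omega>"])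
  have "{x \<in> ?\<Omega>. \<forall>t\<in>{}. x t \<in> UNIV} \<in> ?E" by (rule EI) auto
  then have "?\<Omega> \<in> ?E" by simp
  then show "range (%_::nat. ?\<Omega>) \<subseteq> ?E" by (rule image_subsetI)
  show "emeasure ?D1 ?\<Omega> \<noteq> \<infinity>" for i :: nat
   using prob_space.emeasure_le_1[OF prob_space_distr[OF P1], of ?\<Omega>] by (auto simp: top_unique)
 qed (use gen em in auto)
 have "(\<integral>\<^sup>+om. H (?P1 om) \<partial>M) = (\<integral>\<^sup>+x. H x \<partial>?D1)" by (rule nn_integral_distr[OF P1, symmetric]) (use H in simp)
 also have "\<dots> = (\<integral>\<^sup>+om. H (?P2 om) \<partial>density M (%om. ennreal (?Z om)))"
  unfolding D by (rule nn_integral_distr[OF P2']) (use H in simp)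
 also have "\<dots> = (\<integral>\<^sup>+om. ennreal (?Z om) * H (?P2 om) \<partial>M)"
  by (rule nn_integral_density) (use Zm H in \<open>auto intro!: measurable_compose[OF P2 H]\<close>)
 finally show ?thesis .
qed

lemma continuous_imp_cadlag_on:
 assumes "continuous_on T x"
 shows "cadlag_on T x"
 unfolding cadlag_on_def
proof (intro ballI conjI)
 fix t assume "t \<in> T"
 then have l: "(x \<longlongrightarrow> x t) (at t within T)" using assms by (simp add: continuous_on_def)
 show "(x \<longlongrightarrow> x t) (at t within T \<inter> {t<..})" "\<exists>l. (x \<longlongrightarrow> l) (at t within T \<inter> {..<t})"
  by (auto intro!: exI[of _ "x t"] tendsto_within_subset[OF l])
qed

text \<open>Measurable sets of the Skorokhod space are traces of product sets, and both paths are
  continuous at every point of the sample space; hence the identity transfers trace by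
  trace.\<close>

lemma cameron_martin:
 assumes w: "standard_brownian_motion M w" and n: "1 <= n" and s: "0 < s"
  and f: "\<And>t. (f has_real_derivative f' t) (at t)" "continuous_on UNIV f'"
  and H: "H \<in> borel_measurable (skorokhod_space n)"
 shows "(\<integral>\<^sup>+om. H (path_restrict n (%t. primitive f t + s * w t om)) \<partial>M) =
   (\<integral>\<^sup>+om. ennreal (girsanov_density s n w f om) * H (path_restrict n (%t. s * w t om)) \<partial>M)"
proof -
 let ?Z = "girsanov_density s n w f"
 let ?P1 = "%om. path_restrict n (%t. primitive f t + s * w t om)" and ?P2 = "%om. path_restrict n (%t. s * w t om)"
 have fc: "continuous_on UNIV f"
  using f by (intro continuous_at_imp_continuous_on ballI) (auto intro: DERIV_isCont)
 have wm: "0 <= t ==> w t \<in> borel_measurable M" for t using w by (simp add: standard_brownian_motion_def)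
 have wc: "om \<in> space M ==> continuous_on {0..real n} (%t. w t om)" for om
  using w by (auto simp: standard_brownian_motion_def intro: continuous_on_subset)
 have pc: "continuous_on {0..real n} (primitive f)" by (rule continuous_on_subset[OF continuous_on_primitive[OF fc]]) auto
 have cad: "om \<in> space M ==> cadlag_on {0..real n} (?P1 om)" "om \<in> space M ==> cadlag_on {0..real n} (?P2 om)" for om
  unfolding path_restrict_def cadlag_on_restrict
  by (intro continuous_imp_cadlag_on continuous_intros pc wc; assumption)+
 have P1: "?P1 \<in> measurable M (skorokhod_space n)" and P2: "?P2 \<in> measurable M (skorokhod_space n)"
  using wm by (intro measurable_skorokhodI cad measurable_path_restrict borel_measurable_add borel_measurable_times; simp)+
 have Zm: "?Z \<in> borel_measurable M" by (rule girsanov_density_measurable[OF w])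
 have P2': "?P2 \<in> measurable (density M (%om. ennreal (?Z om))) (skorokhod_space n)" using P2 by simp
 let ?D1 = "distr M (skorokhod_space n) ?P1" and ?D2 = "distr (density M (%om. ennreal (?Z om))) (skorokhod_space n) ?P2"
 have D: "?D1 = ?D2"
 proof (rule measure_eqI)
  fix B assume "B \<in> sets ?D1"
  then have B: "B \<in> sets (skorokhod_space n)" by simp
  then obtain C where C: "C \<in> sets (path_PiM n)" and BC: "B = {f. cadlag_on {0..real n} f} \<inter> C"
   unfolding skorokhod_space_def sets_restrict_space by blast
  have "emeasure ?D1 B = (\<integral>\<^sup>+x. indicator B x \<partial>?D1)" using B by simp
  also have "\<dots> = (\<integral>\<^sup>+om. indicator B (?P1 om) \<partial>M)"
   by (rule nn_integral_distr[OF P1]) (use B in simp)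
  also have "\<dots> = (\<integral>\<^sup>+om. indicator C (?P1 om) \<partial>M)"
   by (rule nn_integral_cong) (use cad in \<open>auto simp: BC indicator_def\<close>)
  also have "\<dots> = (\<integral>\<^sup>+om. ennreal (?Z om) * indicator C (?P2 om) \<partial>M)"
   by (rule cameron_martin_PiM[OF w n s f]) (use C in simp)
  also have "\<dots> = (\<integral>\<^sup>+om. ennreal (?Z om) * indicator B (?P2 om) \<partial>M)"
   by (rule nn_integral_cong) (use cad in \<open>auto simp: BC indicator_def\<close>)
  also have "\<dots> = (\<integral>\<^sup>+om. indicator B (?P2 om) \<partial>density M (%om. ennreal (?Z om)))"
   by (rule nn_integral_density[symmetric])
     (use Zm in \<open>auto intro!: measurable_compose[OF P2] borel_measurable_indicator B\<close>)
  also have "\<dots> = (\<integral>\<^sup>+x. indicator B x \<partial>?D2)"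
   by (rule nn_integral_distr[OF P2', symmetric]) (use B in simp)
  also have "\<dots> = emeasure ?D2 B" using B by simp
  finally show "emeasure ?D1 B = emeasure ?D2 B" .
 qed simp
 have "(\<integral>\<^sup>+om. H (?P1 om) \<partial>M) = (\<integral>\<^sup>+x. H x \<partial>?D1)" by (rule nn_integral_distr[OF P1, symmetric]) (use H in simp)
 also have "\<dots> = (\<integral>\<^sup>+om. H (?P2 om) \<partial>density M (%om. ennreal (?Z om)))"
  unfolding D by (rule nn_integral_distr[OF P2']) (use H in simp)
 also have "\<dots> = (\<integral>\<^sup>+om. ennreal (?Z om) * H (?P2 om) \<partial>M)"
  by (rule nn_integral_density) (use Zm H in \<open>auto intro!: measurable_compose[OF P2 H]\<close>)
 finally show ?thesis .
qed

lemma trig_smooth: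
 obtains f' where "\<And>t. (trig J c has_real_derivative f' t) (at t)" "continuous_on UNIV f'"
proof (rule that)
 show "(trig J c has_real_derivative (\<Sum>j\<in>{- int J..int J}. c j * (2 * pi * real_of_int j * cas (- j) t))) (at t)" for t
  unfolding trig_def by (auto intro!: derivative_eq_intros cas_has_derivative sum.cong simp: mult_ac)
 show "continuous_on UNIV (%t. \<Sum>j\<in>{- int J..int J}. c j * (2 * pi * real_of_int j * cas (- j) t))"
  by (intro continuous_intros)
qed

text \<open>Orthonormality and periodicity make the exponent linear plus a diagonal quadratic form
  in the coefficients. Under a product Gaussian prior the coordinates thus stay independent in the
  posterior.\<close>

lemma girsanov_density_trig:
 assumes w: "standard_brownian_motion M w" and om: "om \<in> space M"
 shows "girsanov_density s n w (trig J c) om =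
  exp ((\<Sum>j\<in>{- int J..int J}. c j * wiener_integral n w (cas j) om) / s - real n * (\<Sum>j\<in>{- int J..int J}. (c j)^2) / (2 * s^2))"
proof -
 have cd: "(cas j has_real_derivative 2 * pi * real_of_int j * cas (- j) t) (at t)" for j t by (rule cas_has_derivative)
 have cc: "continuous_on UNIV (%t. 2 * pi * real_of_int j * cas (- j) t)" for j by (intro continuous_intros)
 obtain f' where t: "\<And>t. (trig J c has_real_derivative f' t) (at t)" "continuous_on UNIV f'"
  by (rule trig_smooth) blast
 have "(%N. \<Sum>j\<in>{- int J..int J}. c j * grid_sum N (n * N) (%l. cas j (grid N l)) (%t. w t om)) \<longlonglongrightarrow>
   (\<Sum>j\<in>{- int J..int J}. c j * wiener_integral n w (cas j) om)"
  by (intro tendsto_sum tendsto_mult tendsto_const wiener_integral_LIMSEQ[OF w om cd cc])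
 moreover have "(\<Sum>j\<in>{- int J..int J}. c j * grid_sum N (n * N) (%l. cas j (grid N l)) (%t. w t om)) =
   grid_sum N (n * N) (%l. trig J c (grid N l)) (%t. w t om)" for N
  unfolding grid_sum_def trig_def sum_distrib_left sum_distrib_right
  by (subst sum.swap) (simp add: mult.assoc)
 ultimately have "(%N. grid_sum N (n * N) (%l. trig J c (grid N l)) (%t. w t om)) \<longlonglongrightarrow>
   (\<Sum>j\<in>{- int J..int J}. c j * wiener_integral n w (cas j) om)" by simp
 from LIMSEQ_unique[OF wiener_integral_LIMSEQ[OF w om t] this]
 have 1: "wiener_integral n w (trig J c) om = (\<Sum>j\<in>{- int J..int J}. c j * wiener_integral n w (cas j) om)" .
 have "primitive (%t. (trig J c t)^2) (real n) = real n * primitive (%t. (trig J c t)^2) 1"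
  by (rule primitive_periodic) (auto intro!: continuous_intros simp: trig_periodic)
 then have 2: "primitive (%t. (trig J c t)^2) (real n) = real n * (\<Sum>j\<in>{- int J..int J}. (c j)^2)"
  by (simp add: primitive_1 integral_trig_sq)
 show ?thesis unfolding girsanov_density_def 1 2 ..
qed

end

section \<open>Gaussian priors\<close>

abbreviation gaussian :: "real => real => real measure" where
 "gaussian m v \<equiv> density lborel (%x. ennreal (normal_density m v x))"

lemma gaussian_product_moments:
 fixes m v :: "'i => real"
 assumes I: "finite I" and v: "\<And>i. 0 < v i" and i: "i \<in> I"
 shows "integrable (PiM I (%i. gaussian (m i) (v i))) (%\<theta>. \<theta> i - m i)"
  and "integrable (PiM I (%i. gaussian (m i) (v i))) (%\<theta>. (\<theta> i - m i)^2)"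
  and "(LINT \<theta>|PiM I (%i. gaussian (m i) (v i)). \<theta> i - m i) = 0"
  and "(LINT \<theta>|PiM I (%i. gaussian (m i) (v i)). (\<theta> i - m i)^2) = (v i)^2"
  and "j \<in> I ==> i \<noteq> j ==> (LINT \<theta>|PiM I (%i. gaussian (m i) (v i)). (\<theta> i - m i) * (\<theta> j - m j)) = 0"
proof -
 let ?N = "%i. gaussian (m i) (v i)"
 let ?P = "PiM I ?N"
 have pN: "prob_space (?N i)" for i by (rule prob_space_normal_density[OF v])
 interpret P: product_prob_space ?N using pN by (simp add: product_prob_space_def product_prob_space_axioms_def product_sigma_finite_def prob_space_imp_sigma_finite)
 have D: "distr ?P (?N i) (%\<theta>. \<theta> i) = ?N i" if "i \<in> I" for i
  by (rule distr_PiM_component[OF pN that])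
 have cm: "(%\<theta>. \<theta> i) \<in> measurable ?P (?N i)" if "i \<in> I" for i
  using that by (rule measurable_component_singleton)
 have m1: "has_bochner_integral (?N i) (%x. x - m i) 0" for i
 proof -
  have "has_bochner_integral lborel (%x. normal_density (m i) (v i) x *\<^sub>R (x - m i)) 0"
   using normal_moment_odd[OF v, of "m i" i 0] by simp
  then show ?thesis by (intro has_bochner_integral_density) auto
 qed
 have m2: "has_bochner_integral (?N i) (%x. (x - m i)^2) ((v i)^2)" for i
 proof -
  have "has_bochner_integral lborel (%x. normal_density (m i) (v i) x *\<^sub>R ((x - m i)^2)) ((v i)^2)"
   using normal_moment_even[OF v, of "m i" i 1] v[of i] by (simp add: fact_2)
  then show ?thesis by (intro has_bochner_integral_density) auto
 qed
 note i1 = integrable.intros[OF m1] and e1 = has_bochner_integral_integral_eq[OF m1]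
 note i2 = integrable.intros[OF m2] and e2 = has_bochner_integral_integral_eq[OF m2]
 show "integrable ?P (%\<theta>. \<theta> i - m i)" "integrable ?P (%\<theta>. (\<theta> i - m i)^2)"
  by (rule integrable_distr[OF cm[OF i]], unfold D[OF i], rule i1 i2)+
 have "(LINT x|distr ?P (?N i) (%\<theta>. \<theta> i). x - m i) = (LINT \<theta>|?P. \<theta> i - m i)"
  by (rule integral_distr[OF cm[OF i]]) simp
 then show "(LINT \<theta>|?P. \<theta> i - m i) = 0" unfolding D[OF i] e1 by simp
 have "(LINT x|distr ?P (?N i) (%\<theta>. \<theta> i). (x - m i)^2) = (LINT \<theta>|?P. (\<theta> i - m i)^2)"
  by (rule integral_distr[OF cm[OF i]]) simp
 then show "(LINT \<theta>|?P. (\<theta> i - m i)^2) = (v i)^2" unfolding D[OF i] e2 by simp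
 assume j: "j \<in> I" "i \<noteq> j"
 let ?f = "%l x. if l = i \<or> l = j then x - m l else 1 :: real"
 have pe: "(\<Prod>l\<in>I. ?f l (\<theta> l)) = (\<theta> i - m i) * (\<theta> j - m j)" for \<theta>
 proof -
  have "(\<Prod>l\<in>I. ?f l (\<theta> l)) = (\<Prod>l\<in>{i, j}. ?f l (\<theta> l))"
   by (rule prod.mono_neutral_right) (use I i j in auto)
  then show ?thesis using j by simp
 qed
 have "(LINT \<theta>|?P. (\<Prod>l\<in>I. ?f l (\<theta> l))) = (\<Prod>l\<in>I. LINT x|?N l. ?f l x)"
 proof (rule P.product_integral_prod[OF I])
  fix l
  show "integrable (?N l) (?f l)"
   using i1[of l] finite_measure.integrable_const[OF prob_space.finite_measure[OF pN], of l "1::real"]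
   by (cases "l = i \<or> l = j") auto
 qed
 also have "\<dots> = 0" using i I by (intro prod_zero) (auto intro!: bexI[of _ i] simp: e1)
 finally show "(LINT \<theta>|?P. (\<theta> i - m i) * (\<theta> j - m j)) = 0" unfolding pe .
qed

text \<open>For any constant \<open>b\<close> the mean squared error is the variance plus the
  squared distance of \<open>b\<close> from the mean, and the latter is dropped.\<close>

lemma gaussian_product_variance:
 fixes m v e :: "'i => real"
 assumes I: "finite I" and v: "\<And>i. 0 < v i"
 shows "ennreal (\<Sum>i\<in>I. (e i)^2 * (v i)^2) <=
  (\<integral>\<^sup>+\<theta>. ennreal ((b - (\<Sum>i\<in>I. e i * \<theta> i))^2) \<partial>PiM I (%i. gaussian (m i) (v i)))"
proof -
 let ?P = "PiM I (%i. gaussian (m i) (v i))"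
 interpret P: prob_space ?P by (rule prob_space_PiM) (rule prob_space_normal_density[OF v])
 let ?X = "%i \<theta>. e i * (\<theta> i - m i)"
 let ?S = "%\<theta>. \<Sum>i\<in>I. ?X i \<theta>"
 define D where "D = b - (\<Sum>i\<in>I. e i * m i)"
 note mom = gaussian_product_moments[OF I v, where m = m]
 have i1: "integrable ?P (?X i)" if "i \<in> I" for i using mom(1)[OF that] by simp
 have i2: "integrable ?P (%\<theta>. (?X i \<theta>)^2)" if "i \<in> I" for i using mom(2)[OF that] by (simp add: power_mult_distrib)
 have orth: "(LINT \<theta>|?P. ?X i \<theta> * ?X j \<theta>) = 0" if "i \<in> I" "j \<in> I" "i \<noteq> j" for i j
 proof -
  have "(LINT \<theta>|?P. ?X i \<theta> * ?X j \<theta>) = (LINT \<theta>|?P. (e i * e j) * ((\<theta> i - m i) * (\<theta> j - m j)))" by (simp add: mult_ac)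
  also have "\<dots> = 0" using mom(5)[OF that] by simp
  finally show ?thesis .
 qed
 have iS: "integrable ?P ?S" by (rule Bochner_Integration.integrable_sum) (rule i1)
 have iS2: "integrable ?P (%\<theta>. (?S \<theta>)^2)"
  by (rule integrable_square_sum) (use I i1 i2 in auto)
 have eS: "(LINT \<theta>|?P. ?S \<theta>) = 0"
  by (subst Bochner_Integration.integral_sum) (use i1 mom(3) in auto)
 have "(LINT \<theta>|?P. (?S \<theta>)^2) = (\<Sum>i\<in>I. LINT \<theta>|?P. (?X i \<theta>)^2)"
  by (rule integral_square_sum_orthogonal) (use I i1 i2 orth in auto)
 then have eS2: "(LINT \<theta>|?P. (?S \<theta>)^2) = (\<Sum>i\<in>I. (e i)^2 * (v i)^2)" by (simp add: power_mult_distrib mom(4))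
 have eq: "(b - (\<Sum>i\<in>I. e i * \<theta> i))^2 = D^2 - 2 * D * ?S \<theta> + (?S \<theta>)^2" for \<theta>
 proof -
  have "b - (\<Sum>i\<in>I. e i * \<theta> i) = D - ?S \<theta>" by (simp add: D_def right_diff_distrib sum_subtractf)
  then show ?thesis by (simp add: power2_diff)
 qed
 have int: "integrable ?P (%\<theta>. (b - (\<Sum>i\<in>I. e i * \<theta> i))^2)"
  unfolding eq by (intro Bochner_Integration.integrable_add Bochner_Integration.integrable_diff integrable_mult_right iS iS2) simp
 have iDS: "integrable ?P (%\<theta>. 2 * D * ?S \<theta>)" by (intro integrable_mult_right iS)
 have "(LINT \<theta>|?P. (b - (\<Sum>i\<in>I. e i * \<theta> i))^2) = (LINT \<theta>|?P. D^2 - 2 * D * ?S \<theta>) + (LINT \<theta>|?P. (?S \<theta>)^2)"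
  unfolding eq by (rule Bochner_Integration.integral_add[OF Bochner_Integration.integrable_diff[OF P.integrable_const iDS] iS2])
 also have "(LINT \<theta>|?P. D^2 - 2 * D * ?S \<theta>) = (LINT \<theta>|?P. D^2) - (LINT \<theta>|?P. 2 * D * ?S \<theta>)"
  by (rule Bochner_Integration.integral_diff[OF P.integrable_const iDS])
 also have "\<dots> = D^2" using eS P.prob_space by simp
 finally have "(LINT \<theta>|?P. (b - (\<Sum>i\<in>I. e i * \<theta> i))^2) = D^2 + (\<Sum>i\<in>I. (e i)^2 * (v i)^2)" unfolding eS2 .
 then have "(\<Sum>i\<in>I. (e i)^2 * (v i)^2) <= (LINT \<theta>|?P. (b - (\<Sum>i\<in>I. e i * \<theta> i))^2)" by simp
 from ennreal_leI[OF this] show ?thesis by (subst nn_integral_eq_integral[OF int]) auto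
qed

text \<open>Prior precision \<open>1 / \<sigma>^2\<close> plus precision \<kappa> of the data,
  inverted.\<close>

definition posterior_sd :: "real => real => real" where
 "posterior_sd \<kappa> \<sigma> = sqrt (1 / (1 / \<sigma>^2 + \<kappa>))"

text \<open>Bayes' formula: prior times likelihood equals the marginal likelihood, the explicit
  product, times the posterior law.\<close>

lemma gaussian_tilt:
 fixes a \<sigma> :: "'i => real"
 assumes I: "finite I" and \<sigma>: "\<And>i. 0 < \<sigma> i" and \<kappa>: "0 < \<kappa>" and F: "F \<in> borel_measurable (PiM I (%_. borel))"
 shows "(\<integral>\<^sup>+\<theta>. ennreal (exp (\<Sum>i\<in>I. a i * \<theta> i - \<kappa> * (\<theta> i)^2 / 2)) * F \<theta> \<partial>PiM I (%i. gaussian 0 (\<sigma> i))) =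
  ennreal (\<Prod>i\<in>I. posterior_sd \<kappa> (\<sigma> i) / \<sigma> i * exp ((a i)^2 * (posterior_sd \<kappa> (\<sigma> i))^2 / 2)) *
  (\<integral>\<^sup>+\<theta>. F \<theta> \<partial>PiM I (%i. gaussian (a i * (posterior_sd \<kappa> (\<sigma> i))^2) (posterior_sd \<kappa> (\<sigma> i))))"
proof -
 let ?v = "%i. posterior_sd \<kappa> (\<sigma> i)"
 let ?C = "%i. ?v i / \<sigma> i * exp ((a i)^2 * (?v i)^2 / 2)"
 let ?M = "%i. gaussian 0 (\<sigma> i)" and ?D = "%i. gaussian (a i * (?v i)^2) (?v i)"
 let ?q = "%i x. exp (a i * x - \<kappa> * x^2 / 2)"
 let ?f = "%i x. ennreal (?q i x / ?C i)"
 have p: "0 < 1 / (\<sigma> i)^2 + \<kappa>" for i using \<sigma>[of i] \<kappa> by (simp add: add_pos_pos)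
 have v: "0 < ?v i" "(?v i)^2 = 1 / (1 / (\<sigma> i)^2 + \<kappa>)" for i
  using p[of i] by (auto simp: posterior_sd_def less_imp_le)
 have C: "0 < ?C i" for i using v(1)[of i] \<sigma>[of i] by simp
 have dens: "?D i = density (?M i) (?f i)" for i
 proof -
  have "density (?M i) (?f i) = density lborel (%x. ennreal (normal_density 0 (\<sigma> i) x) * ?f i x)"
   by (rule density_density_eq) auto
  also have "\<dots> = ?D i"
  proof (rule arg_cong[of _ _ "density lborel"], rule ext)
   fix x
   have "normal_density 0 (\<sigma> i) x * (?q i x / ?C i) = normal_density (a i * (?v i)^2) (?v i) x"
    unfolding times_divide_eq_right normal_density_tilt[OF \<sigma> p v(2) v(1), of i x "a i"]
    by (rule nonzero_mult_div_cancel_left) (use C[of i] in linarith)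
   then show "ennreal (normal_density 0 (\<sigma> i) x) * ?f i x = ennreal (normal_density (a i * (?v i)^2) (?v i) x)"
    using divide_nonneg_pos[OF exp_ge_zero C[of i], of "a i * x - \<kappa> * x^2 / 2"] by (subst ennreal_mult[symmetric]) auto
  qed
  finally show ?thesis ..
 qed
 have sf: "sigma_finite_measure (gaussian c u)" if "0 < u" for c u
  by (rule prob_space_imp_sigma_finite[OF prob_space_normal_density[OF that]])
 have PD: "PiM I ?D = density (PiM I ?M) (%\<theta>. \<Prod>i\<in>I. ?f i (\<theta> i))"
  unfolding dens
 proof (rule PiM_density[OF I])
  show "sigma_finite_measure (density (?M i) (?f i))" for i
   unfolding dens[symmetric] by (rule sf[OF v(1)])
 qed (auto intro: sf \<sigma>)
 have sM: "sets (PiM I ?M) = sets (PiM I (%_. borel))" by (rule sets_PiM_cong) auto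
 have F': "F \<in> borel_measurable (PiM I ?M)" using F measurable_cong_sets[OF sM refl] by blast
 have fm: "(%\<theta>. \<Prod>i\<in>I. ?f i (\<theta> i)) \<in> borel_measurable (PiM I ?M)"
  by (intro borel_measurable_prod_ennreal measurable_compose[OF measurable_component_singleton]) auto
 have prod: "ennreal (\<Prod>i\<in>I. ?C i) * (\<Prod>i\<in>I. ?f i (\<theta> i)) = ennreal (exp (\<Sum>i\<in>I. a i * \<theta> i - \<kappa> * (\<theta> i)^2 / 2))" for \<theta>
 proof -
  have "(\<Prod>i\<in>I. ?f i (\<theta> i)) = ennreal (\<Prod>i\<in>I. ?q i (\<theta> i) / ?C i)"
   by (rule prod_ennreal) (rule divide_nonneg_pos[OF exp_ge_zero C])
  then have "ennreal (\<Prod>i\<in>I. ?C i) * (\<Prod>i\<in>I. ?f i (\<theta> i)) = ennreal ((\<Prod>i\<in>I. ?C i) * (\<Prod>i\<in>I. ?q i (\<theta> i) / ?C i))"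
   by (simp only: ennreal_mult'[OF prod_nonneg[OF less_imp_le[OF C]]])
  also have "(\<Prod>i\<in>I. ?C i) * (\<Prod>i\<in>I. ?q i (\<theta> i) / ?C i) = (\<Prod>i\<in>I. ?C i * (?q i (\<theta> i) / ?C i))" by (rule prod.distrib[symmetric])
  also have "\<dots> = (\<Prod>i\<in>I. ?q i (\<theta> i))"
  proof (rule prod.cong[OF refl])
   fix i assume "i \<in> I"
   show "?C i * (?q i (\<theta> i) / ?C i) = ?q i (\<theta> i)"
    unfolding times_divide_eq_right by (rule nonzero_mult_div_cancel_left) (use C[of i] in linarith)
  qed
  also have "\<dots> = exp (\<Sum>i\<in>I. a i * \<theta> i - \<kappa> * (\<theta> i)^2 / 2)" using I by (simp add: exp_sum)
  finally show ?thesis .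
 qed
 have "ennreal (\<Prod>i\<in>I. ?C i) * (\<integral>\<^sup>+\<theta>. F \<theta> \<partial>PiM I ?D) = ennreal (\<Prod>i\<in>I. ?C i) * (\<integral>\<^sup>+\<theta>. (\<Prod>i\<in>I. ?f i (\<theta> i)) * F \<theta> \<partial>PiM I ?M)"
  unfolding PD by (subst nn_integral_density[OF fm F']) simp
 also have "\<dots> = (\<integral>\<^sup>+\<theta>. ennreal (\<Prod>i\<in>I. ?C i) * ((\<Prod>i\<in>I. ?f i (\<theta> i)) * F \<theta>) \<partial>PiM I ?M)"
  by (rule nn_integral_cmult[symmetric]) (intro borel_measurable_times_ennreal fm F')
 finally show ?thesis unfolding mult.assoc[symmetric] prod by simp
qed

text \<open>The integral on the left is the marginal likelihood. The observation enters the
  posterior only through its mean, and \<open>b\<close> may be any function of the observation since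
  it is held fixed here.\<close>

lemma gaussian_bayes_risk:
 fixes a e \<sigma> :: "'i => real"
 assumes I: "finite I" and \<sigma>: "\<And>i. 0 < \<sigma> i" and \<kappa>: "0 < \<kappa>"
 shows "ennreal (\<Sum>i\<in>I. (e i)^2 * (1 / (1 / (\<sigma> i)^2 + \<kappa>))) * (\<integral>\<^sup>+\<theta>. ennreal (exp (\<Sum>i\<in>I. a i * \<theta> i - \<kappa> * (\<theta> i)^2 / 2)) \<partial>PiM I (%i. gaussian 0 (\<sigma> i))) <=
  (\<integral>\<^sup>+\<theta>. ennreal (exp (\<Sum>i\<in>I. a i * \<theta> i - \<kappa> * (\<theta> i)^2 / 2)) * ennreal ((b - (\<Sum>i\<in>I. e i * \<theta> i))^2) \<partial>PiM I (%i. gaussian 0 (\<sigma> i)))"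
proof -
 let ?v = "%i. posterior_sd \<kappa> (\<sigma> i)"
 let ?D = "PiM I (%i. gaussian (a i * (?v i)^2) (?v i))"
 have p: "0 < 1 / (\<sigma> i)^2 + \<kappa>" for i using \<sigma>[of i] \<kappa> by (simp add: add_pos_pos)
 have v: "0 < ?v i" "(?v i)^2 = 1 / (1 / (\<sigma> i)^2 + \<kappa>)" for i
  using p[of i] by (auto simp: posterior_sd_def less_imp_le)
 interpret D: prob_space ?D by (rule prob_space_PiM) (rule prob_space_normal_density[OF v(1)])
 have Fm: "(%\<theta>. ennreal ((b - (\<Sum>i\<in>I. e i * \<theta> i))^2)) \<in> borel_measurable (PiM I (%_. borel))"
  by (intro measurable_compose[OF _ measurable_ennreal] borel_measurable_power borel_measurable_diff borel_measurable_sum borel_measurable_times borel_measurable_const measurable_component_singleton)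
 note t = gaussian_tilt[OF I, of \<sigma>, OF \<sigma> \<kappa>, where a = a]
 have one: "(%_. 1) \<in> borel_measurable (PiM I (%_. borel))" by simp
 have "ennreal (\<Sum>i\<in>I. (e i)^2 * (?v i)^2) <= (\<integral>\<^sup>+\<theta>. ennreal ((b - (\<Sum>i\<in>I. e i * \<theta> i))^2) \<partial>?D)"
  by (rule gaussian_product_variance[OF I v(1)])
 then have le: "ennreal (\<Sum>i\<in>I. (e i)^2 * (1 / (1 / (\<sigma> i)^2 + \<kappa>))) <= (\<integral>\<^sup>+\<theta>. ennreal ((b - (\<Sum>i\<in>I. e i * \<theta> i))^2) \<partial>?D)"
  unfolding v(2) .
 have "(\<integral>\<^sup>+\<theta>. 1 \<partial>?D) = 1" by (simp add: D.emeasure_space_1)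
 with t[OF one] have t1: "(\<integral>\<^sup>+\<theta>. ennreal (exp (\<Sum>i\<in>I. a i * \<theta> i - \<kappa> * (\<theta> i)^2 / 2)) \<partial>PiM I (%i. gaussian 0 (\<sigma> i))) =
   ennreal (\<Prod>i\<in>I. ?v i / \<sigma> i * exp ((a i)^2 * (?v i)^2 / 2))"
  by (simp only: mult_1_right)
 show ?thesis
  unfolding t[OF Fm] t1 mult.commute[of "ennreal (\<Sum>i\<in>I. (e i)^2 * (1 / (1 / (\<sigma> i)^2 + \<kappa>)))"] by (rule mult_left_mono[OF le]) simp
qed

text \<open>The Laplace transform of a weighted chi-square sum, one coordinate at a time, by a tilt
  with negative precision increment.\<close>

lemma gaussian_quadratic_exp_moment:
 fixes a \<sigma> :: "'i => real"
 assumes I: "finite I" and \<sigma>: "\<And>i. 0 < \<sigma> i" and lt: "\<And>i. i \<in> I ==> 2 * t * a i * (\<sigma> i)^2 < 1"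
 shows "(\<integral>\<^sup>+\<theta>. ennreal (exp (t * (\<Sum>i\<in>I. a i * (\<theta> i)^2))) \<partial>PiM I (%i. gaussian 0 (\<sigma> i))) = ennreal (\<Prod>i\<in>I. 1 / sqrt (1 - 2 * t * a i * (\<sigma> i)^2))"
proof -
 let ?M = "%i. gaussian 0 (\<sigma> i)"
 interpret P: product_sigma_finite ?M
  by (simp add: product_sigma_finite_def prob_space_imp_sigma_finite[OF prob_space_normal_density[OF \<sigma>]])
 have one: "(\<integral>\<^sup>+x. ennreal (exp (t * a i * x^2)) \<partial>?M i) = ennreal (1 / sqrt (1 - 2 * t * a i * (\<sigma> i)^2))" if i: "i \<in> I" for i
 proof -
  let ?b = "- 2 * t * a i"
  define v where "v = sqrt (1 / (1 / (\<sigma> i)^2 + ?b))"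
  have s2: "0 < (\<sigma> i)^2" using \<sigma>[of i] by simp
  have eqb: "1 / (\<sigma> i)^2 + ?b = (1 - 2 * t * a i * (\<sigma> i)^2) / (\<sigma> i)^2"
   using s2 by (simp add: diff_divide_distrib)
  have pb: "0 < 1 / (\<sigma> i)^2 + ?b" unfolding eqb using lt[OF i] s2 by simp
  have v: "0 < v" "v^2 = 1 / (1 / (\<sigma> i)^2 + ?b)" using pb by (auto simp: v_def less_imp_le)
  have vs: "v / \<sigma> i = 1 / sqrt (1 - 2 * t * a i * (\<sigma> i)^2)"
   unfolding v_def eqb using \<sigma>[of i] by (simp add: real_sqrt_divide)
  have pt: "normal_density 0 (\<sigma> i) x * exp (t * a i * x^2) = v / \<sigma> i * normal_density 0 v x" for x
   using normal_density_tilt[OF \<sigma>[of i] pb v(2) v(1), of x 0] by (simp add: mult_ac)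
  have "(\<integral>\<^sup>+x. ennreal (exp (t * a i * x^2)) \<partial>?M i) = (\<integral>\<^sup>+x. ennreal (normal_density 0 (\<sigma> i) x) * ennreal (exp (t * a i * x^2)) \<partial>lborel)"
   by (rule nn_integral_density) auto
  also have "\<dots> = (\<integral>\<^sup>+x. ennreal (v / \<sigma> i) * ennreal (normal_density 0 v x) \<partial>lborel)"
  proof (rule nn_integral_cong)
   fix x
   show "ennreal (normal_density 0 (\<sigma> i) x) * ennreal (exp (t * a i * x^2)) = ennreal (v / \<sigma> i) * ennreal (normal_density 0 v x)"
    using v(1) \<sigma>[of i] pt[of x] by (subst (1 2) ennreal_mult[symmetric]) auto
  qed
  also have "\<dots> = ennreal (v / \<sigma> i) * (\<integral>\<^sup>+x. ennreal (normal_density 0 v x) \<partial>lborel)" by (rule nn_integral_cmult) simp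
  also have "(\<integral>\<^sup>+x. ennreal (normal_density 0 v x) \<partial>lborel) = 1"
   using v(1) by (subst nn_integral_eq_integral) auto
  finally show ?thesis unfolding vs by simp
 qed
 have "ennreal (exp (t * (\<Sum>i\<in>I. a i * (\<theta> i)^2))) = (\<Prod>i\<in>I. ennreal (exp (t * a i * (\<theta> i)^2)))" for \<theta>
  using I by (simp add: prod_ennreal exp_sum[symmetric] sum_distrib_left mult.assoc)
 then have "(\<integral>\<^sup>+\<theta>. ennreal (exp (t * (\<Sum>i\<in>I. a i * (\<theta> i)^2))) \<partial>PiM I ?M) = (\<integral>\<^sup>+\<theta>. (\<Prod>i\<in>I. ennreal (exp (t * a i * (\<theta> i)^2))) \<partial>PiM I ?M)" by simp
 also have "\<dots> = (\<Prod>i\<in>I. \<integral>\<^sup>+x. ennreal (exp (t * a i * x^2)) \<partial>?M i)"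
  by (rule P.product_nn_integral_prod[OF I]) auto
 also have "\<dots> = (\<Prod>i\<in>I. ennreal (1 / sqrt (1 - 2 * t * a i * (\<sigma> i)^2)))" by (rule prod.cong[OF refl one])
 also have "\<dots> = ennreal (\<Prod>i\<in>I. 1 / sqrt (1 - 2 * t * a i * (\<sigma> i)^2))"
  by (rule prod_ennreal) (use lt in \<open>auto simp: less_imp_le\<close>)
 finally show ?thesis .
qed

text \<open>Chernoff's bound with a linear weight: where the quadratic form U exceeds r, r + U is at
  most (2 r + 1/t) exp (t (U - r)), because 1 + x <= exp x.\<close>

lemma gaussian_quadratic_tail:
 fixes a \<sigma> :: "'i => real"
 assumes I: "finite I" and \<sigma>: "\<And>i. 0 < \<sigma> i" and lt: "\<And>i. i \<in> I ==> 2 * t * a i * (\<sigma> i)^2 < 1"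
  and t: "0 < t" and c: "0 <= c" and r: "0 <= r"
 shows "(\<integral>\<^sup>+\<theta>. (if (\<Sum>i\<in>I. a i * (\<theta> i)^2) <= r then 0 else ennreal (c * (r + (\<Sum>i\<in>I. a i * (\<theta> i)^2)))) \<partial>PiM I (%i. gaussian 0 (\<sigma> i)))
  <= ennreal (c * (2 * r + 1 / t) * exp (- t * r) * (\<Prod>i\<in>I. 1 / sqrt (1 - 2 * t * a i * (\<sigma> i)^2)))"
proof -
 let ?U = "%\<theta>. \<Sum>i\<in>I. a i * (\<theta> i)^2"
 let ?K = "c * (2 * r + 1 / t) * exp (- t * r)"
 have K: "0 <= ?K" using c r t by simp
 have le: "(if ?U \<theta> <= r then 0 else ennreal (c * (r + ?U \<theta>))) <= ennreal ?K * ennreal (exp (t * ?U \<theta>))" for \<theta>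
 proof (cases "?U \<theta> <= r")
  case False
  let ?u = "?U \<theta> - r"
  have u: "0 <= t * ?u" using False t by simp
  have e: "1 + t * ?u <= exp (t * ?u)" by (rule exp_ge_add_one_self)
  have e1: "1 <= exp (t * ?u)" and e2: "t * ?u <= exp (t * ?u)" using e u by linarith+
  have "r + ?U \<theta> = 2 * r * 1 + (1 / t) * (t * ?u)" using t by simp
  also have "\<dots> <= 2 * r * exp (t * ?u) + (1 / t) * exp (t * ?u)"
   by (intro add_mono mult_left_mono e1 e2) (use r t in auto)
  also have "\<dots> = (2 * r + 1 / t) * (exp (- t * r) * exp (t * ?U \<theta>))"
   by (simp add: exp_add[symmetric] algebra_simps)
  finally have "c * (r + ?U \<theta>) <= c * ((2 * r + 1 / t) * (exp (- t * r) * exp (t * ?U \<theta>)))"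
   by (rule mult_left_mono[OF _ c])
  then show ?thesis using False K by (simp add: ennreal_mult[symmetric] ennreal_leI mult.assoc)
 qed simp
 have "(\<integral>\<^sup>+\<theta>. (if ?U \<theta> <= r then 0 else ennreal (c * (r + ?U \<theta>))) \<partial>PiM I (%i. gaussian 0 (\<sigma> i))) <=
  (\<integral>\<^sup>+\<theta>. ennreal ?K * ennreal (exp (t * ?U \<theta>)) \<partial>PiM I (%i. gaussian 0 (\<sigma> i)))"
  by (rule nn_integral_mono) (rule le)
 also have "\<dots> = ennreal ?K * (\<integral>\<^sup>+\<theta>. ennreal (exp (t * ?U \<theta>)) \<partial>PiM I (%i. gaussian 0 (\<sigma> i)))"
  by (rule nn_integral_cmult) measurable
 also have "\<dots> = ennreal (?K * (\<Prod>i\<in>I. 1 / sqrt (1 - 2 * t * a i * (\<sigma> i)^2)))"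
  using gaussian_quadratic_exp_moment[OF I, of \<sigma> t a, OF \<sigma> lt] ennreal_mult'[OF K] by simp
 finally show ?thesis .
qed

section \<open>Bayesian lower bound\<close>

definition sobolev_weight :: "nat => int => real" where
 "sobolev_weight k j = (\<Sum>i\<le>k. (2 * pi * real_of_int j) ^ (2 * i))"

lemma sobolev_weight_ge_1: "1 <= sobolev_weight k j"
proof -
 have "(\<Sum>i\<in>{0}. (2 * pi * real_of_int j) ^ (2 * i)) <= sobolev_weight k j"
  unfolding sobolev_weight_def by (rule sum_mono2) (auto simp: power_mult)
 then show ?thesis by simp
qed

context semi_markov_noise
begin

definition brownian_path :: "nat => real => 'a => real => real" where
 "brownian_path n s om = path_restrict n (%t. s * w t om)"

lemma brownian_path_measurable: "brownian_path n s \<in> measurable M (skorokhod_space n)"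
proof (rule measurable_skorokhodI)
 show "brownian_path n s \<in> measurable M (path_PiM n)"
  unfolding brownian_path_def[abs_def] using w_measurable
  by (intro measurable_path_restrict borel_measurable_times borel_measurable_const) auto
 fix om assume "om \<in> space M"
 then have "continuous_on {0..real n} (%t. s * w t om)"
  using brownian by (intro continuous_intros) (auto simp: standard_brownian_motion_def intro: continuous_on_subset)
 then show "cadlag_on {0..real n} (brownian_path n s om)"
  unfolding brownian_path_def path_restrict_def cadlag_on_restrict by (rule continuous_imp_cadlag_on)
qed

lemma brownian_law_in_noise_laws:
 assumes "0 <= s" "lo <= s^2" "s^2 <= hi"
 shows "distr M (skorokhod_space n) (brownian_path n s) \<in> noise_laws n lo hi"
proof -
 have "is_path_law M n (noise s 0 0) (distr M (skorokhod_space n) (brownian_path n s))"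
  unfolding is_path_law_def
 proof (intro conjI ballI)
  fix A assume A: "A \<in> sets (path_PiM n)"
  have pe: "(\<lambda>t\<in>{0..real n}. noise s 0 0 t om) = brownian_path n s om" for om
   by (simp add: noise_def brownian_path_def path_restrict_def)
  have sub: "A \<subseteq> space (path_PiM n)" by (rule sets.sets_into_space[OF A])
  have eq: "A \<inter> space (skorokhod_space n) = {f. cadlag_on {0..real n} f} \<inter> A"
   using sub by (auto simp: space_skorokhod)
  have As: "A \<inter> space (skorokhod_space n) \<in> sets (skorokhod_space n)"
   unfolding eq unfolding skorokhod_space_def sets_restrict_space using A by (rule imageI)
  have "emeasure (distr M (skorokhod_space n) (brownian_path n s)) (A \<inter> space (skorokhod_space n)) =
    emeasure M (brownian_path n s -` (A \<inter> space (skorokhod_space n)) \<inter> space M)"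
   by (rule emeasure_distr[OF brownian_path_measurable As])
  also have "brownian_path n s -` (A \<inter> space (skorokhod_space n)) \<inter> space M = {om \<in> space M. brownian_path n s om \<in> A}"
   using measurable_space[OF brownian_path_measurable] by auto
  finally show "emeasure (distr M (skorokhod_space n) (brownian_path n s)) (A \<inter> space (skorokhod_space n)) =
    emeasure M {om \<in> space M. (\<lambda>t\<in>{0..real n}. noise s 0 0 t om) \<in> A}"
   unfolding pe .
 qed simp
 moreover have "lo <= noise_sigma s 0 0 \<and> noise_sigma s 0 0 <= hi" using assms by (simp add: noise_sigma_def)
 ultimately show ?thesis unfolding noise_laws_def by blast
qed

text \<open>The drift is moved from the path into the density. The estimator is then evaluated at a
  path free of the coefficients, which allows the prior to be integrated first.\<close>

lemma risk_brownian:
 assumes n: "1 <= n" and s: "0 < s" and Sh: "Sh \<in> estimators n"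
 shows "risk n (distr M (skorokhod_space n) (brownian_path n s)) Sh (trig J c) =
  (\<integral>\<^sup>+om. ennreal (girsanov_density s n w (trig J c) om) *
    (\<integral>\<^sup>+x. ennreal ((Sh (brownian_path n s om) x - trig J c x)^2) \<partial>U01) \<partial>M)"
proof -
 let ?S = "trig J c" and ?Q = "distr M (skorokhod_space n) (brownian_path n s)"
 let ?F = "%y. \<integral>\<^sup>+x. ennreal ((Sh y x - ?S x)^2) \<partial>U01"
 have Sc: "continuous_on UNIV ?S" by (rule continuous_on_trig)
 obtain f' where t: "\<And>t. (trig J c has_real_derivative f' t) (at t)" "continuous_on UNIV f'"
  by (rule trig_smooth) blast
 have Sm: "?S \<in> borel_measurable U01"
  using borel_measurable_continuous_onI[OF Sc] unfolding U01_def by (simp add: measurable_restrict_space1)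
 have "(%(y, x). Sh y x) \<in> borel_measurable (skorokhod_space n \<Otimes>\<^sub>M U01)"
  using Sh measurable_cong_sets[OF sets_pair_measure_cong[OF refl sets_U01] refl] by (auto simp: estimators_def)
 then have "(%(y, x). ennreal ((Sh y x - ?S x)^2)) \<in> borel_measurable (skorokhod_space n \<Otimes>\<^sub>M U01)"
  using Sm by measurable
 then have F: "?F \<in> borel_measurable (skorokhod_space n)"
  by (rule U01.borel_measurable_nn_integral)
 have F': "(%x. ?F (path_restrict n (%t. primitive ?S t + x t))) \<in> borel_measurable (skorokhod_space n)"
  using measurable_compose[OF measurable_observation_shift[OF Sc] F]
  by (simp add: path_restrict_def primitive_def)
 have "risk n ?Q Sh ?S = (\<integral>\<^sup>+y. ?F (path_restrict n (%t. primitive ?S t + y t)) \<partial>?Q)"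
  unfolding risk_def sq_norm_U01 by (rule nn_integral_observation_law[OF Sc _ F]) simp
 also have "\<dots> = (\<integral>\<^sup>+om. ?F (path_restrict n (%t. primitive ?S t + brownian_path n s om t)) \<partial>M)"
  by (rule nn_integral_distr[OF brownian_path_measurable]) (use F' in simp)
 also have "\<dots> = (\<integral>\<^sup>+om. ?F (path_restrict n (%t. primitive ?S t + s * w t om)) \<partial>M)"
 proof -
  have "path_restrict n (%t. h t + path_restrict n x t) = path_restrict n (%t. h t + x t)" for h x
   by (auto simp: path_restrict_def)
  then show ?thesis unfolding brownian_path_def by simp
 qed
 also have "\<dots> = (\<integral>\<^sup>+om. ennreal (girsanov_density s n w ?S om) * ?F (brownian_path n s om) \<partial>M)"
  unfolding brownian_path_def by (rule cameron_martin[OF brownian n s t F])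
 finally show ?thesis .
qed

lemma nn_integral_girsanov:
 assumes n: "1 <= n" and s: "0 < s"
 shows "(\<integral>\<^sup>+om. ennreal (girsanov_density s n w (trig J c) om) \<partial>M) = 1"
proof -
 obtain f' where t: "\<And>t. (trig J c has_real_derivative f' t) (at t)" "continuous_on UNIV f'"
  by (rule trig_smooth) blast
 show ?thesis
  using cameron_martin[OF brownian n s t, of "%_. 1"] by (simp add: emeasure_space_1)
qed

text \<open>One integrand \<open>\<Psi>\<close> is estimated in both orders of integration. With the
  prior outside it is at most the supremum of the risk plus the tail; with the prior inside it is at
  least the Bayes risk at each path and point.\<close>

lemma bayes_lower_bound:
 fixes \<sigma> :: "int => real"
 assumes n: "1 <= n" and hi: "0 < hi" "lo <= hi" and r: "0 <= r" and I: "I \<subseteq> {- int J..int J}"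
  and \<sigma>: "\<And>j. 0 < \<sigma> j" and t: "0 < t" and lt: "\<And>j. j \<in> I ==> 2 * t * sobolev_weight k j * (\<sigma> j)^2 < 1"
  and Sh: "Sh \<in> estimators n"
 shows "ennreal (\<Sum>j\<in>I. 1 / (1 / (\<sigma> j)^2 + real n / hi)) <=
  (SUP S\<in>sobolev_ball k r. robust_risk n (noise_laws n lo hi) Sh S) +
  ennreal (4 * real (card I) * (2 * r + 1 / t) * exp (- t * r) * (\<Prod>j\<in>I. 1 / sqrt (1 - 2 * t * sobolev_weight k j * (\<sigma> j)^2)))"
proof -
 define s where "s = sqrt hi"
 define \<kappa> where "\<kappa> = real n / hi"
 have s: "0 < s" "s^2 = hi" using hi by (auto simp: s_def)
 have \<kappa>: "0 < \<kappa>" using n hi by (simp add: \<kappa>_def)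
 have fin: "finite I" using I by (rule finite_subset) simp
 let ?c = "real (card I)"
 let ?\<mu> = "PiM I (%j. gaussian 0 (\<sigma> j))"
 let ?R = "SUP S\<in>sobolev_ball k r. robust_risk n (noise_laws n lo hi) Sh S"
 define A where "A j om = wiener_integral n w (cas j) om / s" for j om
 define U where "U \<theta> = (\<Sum>j\<in>I. sobolev_weight k j * (\<theta> j)^2)" for \<theta> :: "int => real"
 define S where "S \<theta> x = (\<Sum>j\<in>I. cas j x * \<theta> j)" for \<theta> :: "int => real" and x :: real
 define G where "G \<theta> om = exp (\<Sum>j\<in>I. A j om * \<theta> j - \<kappa> * (\<theta> j)^2 / 2)" for \<theta> :: "int => real" and om
 define ext where "ext \<theta> j = (if j \<in> I then \<theta> j else 0)" for \<theta> :: "int => real" and j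
 \<comment> \<open>Outside the ball nothing is known about the risk, so the loss is replaced there
   by a quantity that dominates the loss of the clipped estimator.\<close>
 define \<Psi> where "\<Psi> \<theta> om x = ennreal (G \<theta> om) * (if U \<theta> <= r then ennreal ((Sh (brownian_path n s om) x - S \<theta> x)^2)
   else ennreal (4 * ?c * (r + U \<theta>)))" for \<theta> om x
 interpret \<mu>: prob_space ?\<mu> by (rule prob_space_PiM) (rule prob_space_normal_density[OF \<sigma>])
 interpret MU: pair_sigma_finite M U01 by standard
 interpret MUp: prob_space "M \<Otimes>\<^sub>M U01" by (intro prob_space_pair prob_space_axioms prob_space_U01)
 interpret PP: pair_sigma_finite ?\<mu> "M \<Otimes>\<^sub>M U01" by standard
 \<comment> \<open>Coefficients outside \<open>I\<close> are set to 0, so that sums over the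
   symmetric range reduce to sums over the support of the prior.\<close>
 have sum_ext: "(\<Sum>j\<in>{- int J..int J}. h j (ext \<theta> j)) = (\<Sum>j\<in>I. h j (\<theta> j))" if "\<And>j. h j 0 = 0" for h :: "int => real => real" and \<theta>
  by (rule sum.mono_neutral_cong_right) (use I that in \<open>auto simp: ext_def\<close>)
 have S_trig: "trig J (ext \<theta>) x = S \<theta> x" for \<theta> x
  unfolding trig_def S_def using sum_ext[of "%j y. y * cas j x" \<theta>] by (simp add: mult.commute)
 have G_girsanov: "girsanov_density s n w (trig J (ext \<theta>)) om = G \<theta> om" if "om \<in> space M" for \<theta> om
 proof -
  have 1: "(\<Sum>j\<in>{- int J..int J}. ext \<theta> j * wiener_integral n w (cas j) om) = (\<Sum>j\<in>I. \<theta> j * wiener_integral n w (cas j) om)"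
   using sum_ext[of "%j y. y * wiener_integral n w (cas j) om" \<theta>] by simp
  have 2: "(\<Sum>j\<in>{- int J..int J}. (ext \<theta> j)^2) = (\<Sum>j\<in>I. (\<theta> j)^2)"
   using sum_ext[of "%j y. y^2" \<theta>] by simp
  have 3: "(\<Sum>j\<in>I. A j om * \<theta> j - \<kappa> * (\<theta> j)^2 / 2) = (\<Sum>j\<in>I. \<theta> j * wiener_integral n w (cas j) om) / s - real n * (\<Sum>j\<in>I. (\<theta> j)^2) / (2 * s^2)"
   unfolding sum_subtractf A_def \<kappa>_def s(2) sum_divide_distrib sum_distrib_left by (simp add: mult_ac)
  show ?thesis unfolding girsanov_density_trig[OF brownian that] 1 2 G_def 3 ..
 qed
 have Am [measurable]: "A j \<in> borel_measurable M" for j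
  unfolding A_def[abs_def] using wiener_integral_measurable[OF brownian] by measurable
 have casU [measurable]: "cas j \<in> borel_measurable U01" for j
 proof -
  have "cas j \<in> borel_measurable borel"
   by (intro borel_measurable_continuous_onI continuous_on_cas)
  then show ?thesis unfolding U01_def by (simp add: measurable_restrict_space1)
 qed
 have comp [measurable]: "(%\<theta>. \<theta> j) \<in> borel_measurable ?\<mu>" if "j \<in> I" for j
  using measurable_component_singleton[OF that, of "%j. gaussian 0 (\<sigma> j)"] by simp
 let ?PP = "?\<mu> \<Otimes>\<^sub>M (M \<Otimes>\<^sub>M U01)"
 have m1: "(%p. (fst p :: int => real) j) \<in> borel_measurable ?PP" if "j \<in> I" for j
  by (rule measurable_compose[OF measurable_fst comp[OF that]])
 have m2: "(%p. A j (fst (snd p))) \<in> borel_measurable ?PP" for j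
  by (intro measurable_compose[OF _ Am] measurable_compose[OF measurable_snd] measurable_fst)
 have m3: "(%p. cas j (snd (snd p))) \<in> borel_measurable ?PP" for j
  by (intro measurable_compose[OF _ casU] measurable_compose[OF measurable_snd] measurable_snd)
 have Shm: "(%z. Sh (fst z) (snd z)) \<in> borel_measurable (skorokhod_space n \<Otimes>\<^sub>M U01)"
  using Sh measurable_cong_sets[OF sets_pair_measure_cong[OF refl sets_U01] refl] by (auto simp: estimators_def case_prod_beta)
 have pm: "(%p. (brownian_path n s (fst (snd p)), snd (snd p))) \<in> measurable ?PP (skorokhod_space n \<Otimes>\<^sub>M U01)"
  by (intro measurable_Pair measurable_compose[OF _ brownian_path_measurable] measurable_compose[OF measurable_snd] measurable_fst measurable_snd)
 have m4: "(%p. Sh (brownian_path n s (fst (snd p))) (snd (snd p))) \<in> borel_measurable ?PP"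
  using measurable_compose[OF pm Shm] by simp
 have mU: "(%p. U (fst p)) \<in> borel_measurable ?PP"
  unfolding U_def by (intro borel_measurable_sum borel_measurable_times borel_measurable_const borel_measurable_power m1)
 have mS: "(%p. S (fst p) (snd (snd p))) \<in> borel_measurable ?PP"
  unfolding S_def by (intro borel_measurable_sum borel_measurable_times m1 m3)
 have mG: "(%p. G (fst p) (fst (snd p))) \<in> borel_measurable ?PP"
  unfolding G_def
  by (intro measurable_compose[OF _ borel_measurable_exp] borel_measurable_sum borel_measurable_diff borel_measurable_times
    borel_measurable_divide borel_measurable_const borel_measurable_power m1 m2)
 have m\<Psi>: "(%p. \<Psi> (fst p) (fst (snd p)) (snd (snd p))) \<in> borel_measurable ?PP"
  unfolding \<Psi>_def
 proof (intro borel_measurable_times_ennreal measurable_If)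
  show "{p \<in> space ?PP. U (fst p) <= r} \<in> sets ?PP" using mU by measurable
 qed (intro measurable_compose[OF _ measurable_ennreal] borel_measurable_power borel_measurable_diff borel_measurable_times
    borel_measurable_add borel_measurable_const mU mS mG m4)+
 have G0: "0 <= G \<theta> om" for \<theta> om by (simp add: G_def)
 have intG: "(\<integral>\<^sup>+om. ennreal (G \<theta> om) \<partial>M) = 1" for \<theta>
 proof -
  have "(\<integral>\<^sup>+om. ennreal (G \<theta> om) \<partial>M) = (\<integral>\<^sup>+om. ennreal (girsanov_density s n w (trig J (ext \<theta>)) om) \<partial>M)"
   by (rule nn_integral_cong) (simp add: G_girsanov)
  then show ?thesis unfolding nn_integral_girsanov[OF n s(1)] .
 qed
 have GM: "(%om. ennreal (G \<theta> om)) \<in> borel_measurable M" for \<theta>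
  unfolding G_def by measurable
 let ?tail = "%\<theta>. if U \<theta> <= r then 0 else ennreal (4 * ?c * (r + U \<theta>))"
 have inner: "(\<integral>\<^sup>+om. \<integral>\<^sup>+x. \<Psi> \<theta> om x \<partial>U01 \<partial>M) <= ?R + ?tail \<theta>" for \<theta>
 proof (cases "U \<theta> <= r")
  case True
  have "(\<Sum>j\<in>{- int J..int J}. sobolev_weight k j * (ext \<theta> j)^2) <= r"
   using sum_ext[of "%j y. sobolev_weight k j * y^2" \<theta>] True by (simp add: U_def)
  then have ball: "trig J (ext \<theta>) \<in> sobolev_ball k r"
   unfolding sobolev_weight_def by (rule trig_in_sobolev_ball)
  have Q: "distr M (skorokhod_space n) (brownian_path n s) \<in> noise_laws n lo hi"
   by (rule brownian_law_in_noise_laws) (use s hi in auto)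
  have "(\<integral>\<^sup>+om. \<integral>\<^sup>+x. \<Psi> \<theta> om x \<partial>U01 \<partial>M) = (\<integral>\<^sup>+om. ennreal (girsanov_density s n w (trig J (ext \<theta>)) om) *
    (\<integral>\<^sup>+x. ennreal ((Sh (brownian_path n s om) x - trig J (ext \<theta>) x)^2) \<partial>U01) \<partial>M)"
  proof (rule nn_integral_cong)
   fix om assume om: "om \<in> space M"
   have "(%x. (brownian_path n s om, x)) \<in> measurable U01 (skorokhod_space n \<Otimes>\<^sub>M U01)"
    using measurable_space[OF brownian_path_measurable om] by (intro measurable_Pair) auto
   from measurable_compose[OF this Shm] have "(%x. Sh (brownian_path n s om) x) \<in> borel_measurable U01" by simp
   then have "(%x. ennreal ((Sh (brownian_path n s om) x - S \<theta> x)^2)) \<in> borel_measurable U01"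
    unfolding S_def by measurable
   then show "(\<integral>\<^sup>+x. \<Psi> \<theta> om x \<partial>U01) = ennreal (girsanov_density s n w (trig J (ext \<theta>)) om) *
    (\<integral>\<^sup>+x. ennreal ((Sh (brownian_path n s om) x - trig J (ext \<theta>) x)^2) \<partial>U01)"
    using True unfolding \<Psi>_def G_girsanov[OF om] S_trig by (simp add: nn_integral_cmult)
  qed
  also have "\<dots> = risk n (distr M (skorokhod_space n) (brownian_path n s)) Sh (trig J (ext \<theta>))"
   by (rule risk_brownian[OF n s(1) Sh, symmetric])
  also have "\<dots> <= robust_risk n (noise_laws n lo hi) Sh (trig J (ext \<theta>))"
   unfolding robust_risk_def by (rule SUP_upper[OF Q])
  also have "\<dots> <= ?R" by (rule SUP_upper[OF ball])
  finally show ?thesis using True by simp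
 next
  case False
  then have "(\<integral>\<^sup>+om. \<integral>\<^sup>+x. \<Psi> \<theta> om x \<partial>U01 \<partial>M) = (\<integral>\<^sup>+om. ennreal (G \<theta> om) * ennreal (4 * ?c * (r + U \<theta>)) \<partial>M)"
   using U01.emeasure_space_1 by (simp add: \<Psi>_def)
  also have "\<dots> = ennreal (4 * ?c * (r + U \<theta>))"
   using intG[of \<theta>] by (subst nn_integral_multc[OF GM]) simp
  finally show ?thesis using False by simp
 qed
 have tail_m: "?tail \<in> borel_measurable ?\<mu>"
  unfolding U_def by measurable
 have "(\<integral>\<^sup>+\<theta>. \<integral>\<^sup>+z. \<Psi> \<theta> (fst z) (snd z) \<partial>(M \<Otimes>\<^sub>M U01) \<partial>?\<mu>) <= (\<integral>\<^sup>+\<theta>. ?R + ?tail \<theta> \<partial>?\<mu>)"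
 proof (rule nn_integral_mono)
  fix \<theta> assume \<theta>: "\<theta> \<in> space ?\<mu>"
  have "(%z. \<Psi> \<theta> (fst z) (snd z)) \<in> borel_measurable (M \<Otimes>\<^sub>M U01)"
   using measurable_compose[OF measurable_Pair1'[OF \<theta>] m\<Psi>] by simp
  from U01.nn_integral_fst[OF this] inner[of \<theta>]
  show "(\<integral>\<^sup>+z. \<Psi> \<theta> (fst z) (snd z) \<partial>(M \<Otimes>\<^sub>M U01)) <= ?R + ?tail \<theta>" by simp
 qed
 also have "\<dots> = ?R + (\<integral>\<^sup>+\<theta>. ?tail \<theta> \<partial>?\<mu>)"
  by (subst nn_integral_add) (use tail_m in \<open>auto simp: \<mu>.emeasure_space_1\<close>)
 also have "\<dots> <= ?R + ennreal (4 * ?c * (2 * r + 1 / t) * exp (- t * r) * (\<Prod>j\<in>I. 1 / sqrt (1 - 2 * t * sobolev_weight k j * (\<sigma> j)^2)))"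
  unfolding U_def by (intro add_left_mono gaussian_quadratic_tail[OF fin \<sigma> lt t]) (use r in auto)
 finally have upper: "(\<integral>\<^sup>+\<theta>. \<integral>\<^sup>+z. \<Psi> \<theta> (fst z) (snd z) \<partial>(M \<Otimes>\<^sub>M U01) \<partial>?\<mu>) <=
  ?R + ennreal (4 * ?c * (2 * r + 1 / t) * exp (- t * r) * (\<Prod>j\<in>I. 1 / sqrt (1 - 2 * t * sobolev_weight k j * (\<sigma> j)^2)))" .

 let ?v = "%j. 1 / (1 / (\<sigma> j)^2 + \<kappa>)"
 let ?g = "%om. \<integral>\<^sup>+\<theta>. ennreal (G \<theta> om) \<partial>?\<mu>"
 have v0: "0 <= ?v j" for j using \<kappa> by simp
 have pointwise: "ennreal (\<Sum>j\<in>I. (cas j x)^2 * ?v j) * ?g om <= (\<integral>\<^sup>+\<theta>. \<Psi> \<theta> om x \<partial>?\<mu>)" for om x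
 proof -
  let ?b = "Sh (brownian_path n s om) x"
  \<comment> \<open>Cauchy-Schwarz with \<open>cas\<close> squared at most 2 and Sobolev weights at
    least 1: no element of the ball supported in \<open>I\<close> exceeds \<open>C\<close> at any
    point, so clipping at \<open>C\<close> cannot increase the loss there.\<close>
  define C where "C = sqrt (2 * ?c * r)"
  define b where "b = max (- C) (min C ?b)"
  have C: "0 <= C" "C^2 = 2 * ?c * r" using r by (auto simp: C_def)
  have S2: "(S \<theta> x)^2 <= 2 * ?c * U \<theta>" for \<theta>
  proof -
   have "(S \<theta> x)^2 <= (\<Sum>j\<in>I. (cas j x)^2) * (\<Sum>j\<in>I. (\<theta> j)^2)"
    unfolding S_def by (rule Cauchy_Schwarz_ineq_sum)
   also have "\<dots> <= (2 * ?c) * U \<theta>"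
   proof (rule mult_mono)
    show "(\<Sum>j\<in>I. (cas j x)^2) <= 2 * ?c"
     using sum_bounded_above[of I "%j. (cas j x)^2" 2] cas_sq_le by (simp add: mult.commute)
    show "(\<Sum>j\<in>I. (\<theta> j)^2) <= U \<theta>"
     unfolding U_def
    proof (rule sum_mono)
     fix j
     show "(\<theta> j)^2 <= sobolev_weight k j * (\<theta> j)^2"
      using mult_right_mono[OF sobolev_weight_ge_1 zero_le_power2, of "\<theta> j" k j] by simp
    qed
   qed (auto intro!: sum_nonneg)
   finally show ?thesis .
  qed
  have b2: "b^2 <= 2 * ?c * r"
  proof -
   have "\<bar>b\<bar> <= \<bar>C\<bar>" using C(1) by (auto simp: b_def)
   then show ?thesis unfolding C(2)[symmetric] by (simp add: abs_le_square_iff)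
  qed
  have le: "ennreal ((b - S \<theta> x)^2) <= (if U \<theta> <= r then ennreal ((?b - S \<theta> x)^2) else ennreal (4 * ?c * (r + U \<theta>)))" for \<theta>
  proof (cases "U \<theta> <= r")
   case True
   have "(S \<theta> x)^2 <= C^2" unfolding C(2) using S2[of \<theta>] mult_left_mono[OF True, of "2 * ?c"] by simp
   then have "\<bar>S \<theta> x\<bar> <= \<bar>C\<bar>" by (simp add: abs_le_square_iff)
   then have "\<bar>b - S \<theta> x\<bar> <= \<bar>?b - S \<theta> x\<bar>" using C(1) by (auto simp: b_def)
   then have "(b - S \<theta> x)^2 <= (?b - S \<theta> x)^2" by (simp add: abs_le_square_iff)
   then show ?thesis using True by (simp add: ennreal_leI)
  next
   case False
   have "(b - S \<theta> x)^2 <= 2 * b^2 + 2 * (S \<theta> x)^2"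
    using zero_le_power2[of "b + S \<theta> x"] by (simp add: power2_diff power2_sum)
   also have "\<dots> <= 4 * ?c * (r + U \<theta>)" using b2 S2[of \<theta>] by (simp add: distrib_left)
   finally show ?thesis using False by (simp add: ennreal_leI)
  qed
  have "ennreal (\<Sum>j\<in>I. (cas j x)^2 * ?v j) * ?g om <= (\<integral>\<^sup>+\<theta>. ennreal (G \<theta> om) * ennreal ((b - S \<theta> x)^2) \<partial>?\<mu>)"
   unfolding G_def S_def by (rule gaussian_bayes_risk[OF fin \<sigma> \<kappa>])
  also have "\<dots> <= (\<integral>\<^sup>+\<theta>. \<Psi> \<theta> om x \<partial>?\<mu>)"
   unfolding \<Psi>_def by (intro nn_integral_mono mult_left_mono le) simp
  finally show ?thesis .
 qed
 have gm: "?g \<in> borel_measurable M"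
 proof (rule \<mu>.borel_measurable_nn_integral)
  show "(%(om, \<theta>). ennreal (G \<theta> om)) \<in> borel_measurable (M \<Otimes>\<^sub>M ?\<mu>)"
   unfolding G_def by measurable
 qed
 have intg: "(\<integral>\<^sup>+om. ?g om \<partial>M) = 1"
 proof -
  interpret MM: pair_sigma_finite M ?\<mu> by standard
  have "(\<integral>\<^sup>+om. ?g om \<partial>M) = (\<integral>\<^sup>+\<theta>. \<integral>\<^sup>+om. ennreal (G \<theta> om) \<partial>M \<partial>?\<mu>)"
   by (rule MM.Fubini'[symmetric]) (unfold G_def, measurable)
  then show ?thesis by (simp add: intG \<mu>.emeasure_space_1)
 qed
 \<comment> \<open>Integration over the point replaces the squared basis functions by 1 and turns
   the pointwise bounds into the sum of the posterior variances.\<close>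
 have int_cas: "(\<integral>\<^sup>+x. ennreal (\<Sum>j\<in>I. (cas j x)^2 * ?v j) \<partial>U01) = ennreal (\<Sum>j\<in>I. ?v j)"
 proof -
  have c: "continuous_on {0..1} (%x. (cas j x)^2 * ?v j)" for j
   by (intro continuous_on_mult continuous_on_power continuous_on_const continuous_on_cas)
  have "(\<integral>\<^sup>+x. ennreal (\<Sum>j\<in>I. (cas j x)^2 * ?v j) \<partial>U01) = ennreal (LINT x|U01. (\<Sum>j\<in>I. (cas j x)^2 * ?v j))"
   by (rule nn_integral_eq_integral)
     (intro Bochner_Integration.integrable_sum integrable_U01 c, intro AE_I2 sum_nonneg mult_nonneg_nonneg v0 zero_le_power2)
  also have "(LINT x|U01. (\<Sum>j\<in>I. (cas j x)^2 * ?v j)) = (\<Sum>j\<in>I. (LINT x|U01. (cas j x)^2 * ?v j))"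
   by (rule Bochner_Integration.integral_sum) (rule integrable_U01[OF c])
  also have "\<dots> = (\<Sum>j\<in>I. ?v j)"
   using cas_orthonormal[of j j for j] by (intro sum.cong) (simp_all add: power2_eq_square)
  finally show ?thesis .
 qed
 have "ennreal (\<Sum>j\<in>I. ?v j) = (\<integral>\<^sup>+om. ennreal (\<Sum>j\<in>I. ?v j) * ?g om \<partial>M)"
  by (simp only: nn_integral_cmult[OF gm] intg mult_1_right)
 also have "\<dots> = (\<integral>\<^sup>+om. \<integral>\<^sup>+x. ennreal (\<Sum>j\<in>I. (cas j x)^2 * ?v j) * ?g om \<partial>U01 \<partial>M)"
  by (subst nn_integral_multc) (measurable, simp only: int_cas)
 also have "\<dots> <= (\<integral>\<^sup>+om. \<integral>\<^sup>+x. \<integral>\<^sup>+\<theta>. \<Psi> \<theta> om x \<partial>?\<mu> \<partial>U01 \<partial>M)"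
  by (intro nn_integral_mono pointwise)
 also have "\<dots> = (\<integral>\<^sup>+z. \<integral>\<^sup>+\<theta>. \<Psi> \<theta> (fst z) (snd z) \<partial>?\<mu> \<partial>(M \<Otimes>\<^sub>M U01))"
 proof -
  have "(%(z, \<theta>). \<Psi> \<theta> (fst z) (snd z)) \<in> borel_measurable ((M \<Otimes>\<^sub>M U01) \<Otimes>\<^sub>M ?\<mu>)"
   using measurable_compose[OF measurable_pair_swap' m\<Psi>] by (simp add: case_prod_beta)
  then have "(%z. \<integral>\<^sup>+\<theta>. \<Psi> \<theta> (fst z) (snd z) \<partial>?\<mu>) \<in> borel_measurable (M \<Otimes>\<^sub>M U01)"
   by (rule \<mu>.borel_measurable_nn_integral)
  from U01.nn_integral_fst[OF this] show ?thesis by simp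
 qed
 also have "\<dots> = (\<integral>\<^sup>+\<theta>. \<integral>\<^sup>+z. \<Psi> \<theta> (fst z) (snd z) \<partial>(M \<Otimes>\<^sub>M U01) \<partial>?\<mu>)"
  by (rule PP.Fubini') (use m\<Psi> in \<open>simp add: case_prod_beta\<close>)
 finally show ?thesis using upper unfolding \<kappa>_def by (rule order_trans)
qed

end

section \<open>Asymptotics\<close>

text \<open>A Riemann sum of x^m. The sum from 1 to \<open>W\<close> exceeds the left-endpoint sum
  by its last term, which contributes \<open>1 / W\<close>.\<close>

lemma power_sum_limit:
 assumes m: "1 <= m"
 shows "(%W. (\<Sum>j=1..W. (real j / real W) ^ m) / real W) \<longlonglongrightarrow> 1 / (real m + 1)"
proof -
 have "(%W. \<Sum>l<W. (grid W l) ^ m / real W) \<longlonglongrightarrow> primitive (%x. x ^ m) 1"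
 proof (rule riemann_sum_tendsto[where n = 1])
  show "(%W. grid W W) \<longlonglongrightarrow> 1"
   by (rule tendsto_eventually, use eventually_gt_at_top[of "0::nat"] in eventually_elim) (simp add: grid_def)
 qed (auto intro!: continuous_intros)
 moreover have "primitive (%x. x ^ m) 1 = 1 / (real m + 1)"
 proof -
  have "primitive (%x. x ^ m) 1 = (LBINT x. x ^ m * indicator {0..1} x)"
   unfolding primitive_def set_lebesgue_integral_def by (simp add: mult.commute)
  also have "\<dots> = 1 / (real m + 1)" using integral_power[of 0 1 m] by (simp add: add.commute)
  finally show ?thesis .
 qed
 ultimately have 1: "(%W. \<Sum>l<W. (grid W l) ^ m / real W) \<longlonglongrightarrow> 1 / (real m + 1)" by simp
 have "(%W. (\<Sum>l<W. (grid W l) ^ m / real W) + 1 / real W) \<longlonglongrightarrow> 1 / (real m + 1) + 0"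
  by (rule tendsto_add[OF 1 lim_const_over_n])
 moreover have "eventually (%W. (\<Sum>l<W. (grid W l) ^ m / real W) + 1 / real W = (\<Sum>j=1..W. (real j / real W) ^ m) / real W) sequentially"
  using eventually_gt_at_top[of "0::nat"]
 proof eventually_elim
  fix W :: nat assume W: "0 < W"
  have "(\<Sum>j=1..W. (real j / real W) ^ m) = (\<Sum>j\<le>W. (real j / real W) ^ m)"
   by (rule sum.mono_neutral_left) (use m in \<open>auto simp: Suc_le_eq\<close>)
  also have "\<dots> = (\<Sum>l<W. (real l / real W) ^ m) + 1"
   using W by (simp add: lessThan_Suc_atMost[symmetric])
  finally show "(\<Sum>l<W. (grid W l) ^ m / real W) + 1 / real W = (\<Sum>j=1..W. (real j / real W) ^ m) / real W"
   by (simp add: grid_def sum_divide_distrib[symmetric] add_divide_distrib)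
 qed
 ultimately show ?thesis by (simp add: tendsto_cong)
qed

text \<open>Frequency 0 is left out since the prior variances contain a division by
  \<open>\<bar>j\<bar>\<close>; one frequency is immaterial in the limit.\<close>

definition sym_range :: "nat => int set" where
 "sym_range W = {j. 1 <= \<bar>j\<bar> \<and> \<bar>j\<bar> <= int W}"

lemma sym_range_Suc: "sym_range (Suc W) = insert (int (Suc W)) (insert (- int (Suc W)) (sym_range W))"
 by (auto simp: sym_range_def)

lemma finite_sym_range [simp]: "finite (sym_range W)"
 by (rule finite_subset[of _ "{- int W..int W}"]) (auto simp: sym_range_def)

lemma sum_sym_range:
 fixes f :: "int => real"
 assumes "\<And>j. f (- j) = f j"
 shows "(\<Sum>j\<in>sym_range W. f j) = 2 * (\<Sum>j=1..W. f (int j))"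
proof (induction W)
 case 0 then show ?case by (auto simp: sym_range_def intro!: sum.neutral)
next
 case (Suc W)
 have "int (Suc W) \<notin> sym_range W" "- int (Suc W) \<notin> sym_range W" "int (Suc W) \<noteq> - int (Suc W)" by (auto simp: sym_range_def)
 then have "(\<Sum>j\<in>sym_range (Suc W). f j) = f (int (Suc W)) + (f (- int (Suc W)) + (\<Sum>j\<in>sym_range W. f j))"
  unfolding sym_range_Suc by (subst sum.insert, simp, simp, subst sum.insert, simp_all)
 then show ?case using Suc assms[of "int (Suc W)"] by simp
qed

lemma card_sym_range: "real (card (sym_range W)) = 2 * real W"
 using sum_sym_range[of "%_. 1" W] by simp

lemma interval_eq_insert_sym_range: "{- int W..int W} = insert 0 (sym_range W)"
 by (auto simp: sym_range_def)

text \<open>Twice the integral of (1 - x^k)^2 over the unit interval, that is 2 (1 - 2/(k+1) +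
  1/(2k+1)); frequency 0 adds \<open>1 / W\<close>.\<close>

lemma pinsker_weight_sum_limit:
 assumes k: "1 <= k"
 shows "(%W. (\<Sum>j\<in>{- int W..int W}. (pinsker_weight k W j)^2) / real W) \<longlonglongrightarrow> 4 * (real k)^2 / ((real k + 1) * (2 * real k + 1))"
proof -
 let ?s = "%m W. (\<Sum>j=1..W. (real j / real W) ^ m) / real W"
 have "(%W. 1 / real W + 2 * (1 - 2 * ?s k W + ?s (2 * k) W)) \<longlonglongrightarrow> 0 + 2 * (1 - 2 * (1 / (real k + 1)) + 1 / (real (2 * k) + 1))"
  by (intro tendsto_intros power_sum_limit lim_const_over_n) (use k in auto)
 also have "0 + 2 * (1 - 2 * (1 / (real k + 1)) + 1 / (real (2 * k) + 1)) = 4 * (real k)^2 / ((real k + 1) * (2 * real k + 1))"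
 proof -
  have "real k + 1 \<noteq> 0" "2 * real k + 1 \<noteq> 0" by linarith+
  then show ?thesis by (simp add: field_simps power2_eq_square)
 qed
 finally have lim: "(%W. 1 / real W + 2 * (1 - 2 * ?s k W + ?s (2 * k) W)) \<longlonglongrightarrow> 4 * (real k)^2 / ((real k + 1) * (2 * real k + 1))" .
 show ?thesis
 proof (rule Lim_transform_eventually[OF lim])
  show "eventually (%W. 1 / real W + 2 * (1 - 2 * ?s k W + ?s (2 * k) W) = (\<Sum>j\<in>{- int W..int W}. (pinsker_weight k W j)^2) / real W) sequentially"
   using eventually_gt_at_top[of "0::nat"]
  proof eventually_elim
   fix W :: nat assume W: "0 < W"
   have "(\<Sum>j\<in>{- int W..int W}. (pinsker_weight k W j)^2) = (pinsker_weight k W 0)^2 + (\<Sum>j\<in>sym_range W. (pinsker_weight k W j)^2)"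
    unfolding interval_eq_insert_sym_range by (subst sum.insert[OF finite_sym_range]) (simp add: sym_range_def, simp)
   also have "(\<Sum>j\<in>sym_range W. (pinsker_weight k W j)^2) = 2 * (\<Sum>j=1..W. (pinsker_weight k W (int j))^2)"
    by (rule sum_sym_range) (simp add: pinsker_weight_def)
   also have "(\<Sum>j=1..W. (pinsker_weight k W (int j))^2) = (\<Sum>j=1..W. 1 - 2 * (real j / real W) ^ k + (real j / real W) ^ (2 * k))"
    by (rule sum.cong) (auto simp: pinsker_weight_def power2_diff power_mult[symmetric] mult.commute)
   also have "\<dots> = real W - 2 * (\<Sum>j=1..W. (real j / real W) ^ k) + (\<Sum>j=1..W. (real j / real W) ^ (2 * k))"
    by (simp add: sum.distrib sum_subtractf sum_distrib_left)
   also have "pinsker_weight k W 0 = 1" using k by (simp add: pinsker_weight_def)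
   finally have E: "(\<Sum>j\<in>{- int W..int W}. (pinsker_weight k W j)^2) =
    1^2 + 2 * (real W - 2 * (\<Sum>j=1..W. (real j / real W) ^ k) + (\<Sum>j=1..W. (real j / real W) ^ (2 * k)))" .
   have "1 / x + 2 * (1 - 2 * (P / x) + Q / x) = (1^2 + 2 * (x - 2 * P + Q)) / x" if "x \<noteq> 0" for x P Q :: real
    using that by (simp add: field_simps)
   from this[of "real W"] W show "1 / real W + 2 * (1 - 2 * ?s k W + ?s (2 * k) W) = (\<Sum>j\<in>{- int W..int W}. (pinsker_weight k W j)^2) / real W"
    unfolding E by simp
  qed
 qed
qed

lemma ceiling_scale_limit:
 fixes u :: "nat => real"
 assumes u: "filterlim u at_top sequentially" and a: "0 < \<alpha>"
 shows "(%n. real (nat \<lceil>\<alpha> * u n\<rceil>) / u n) \<longlonglongrightarrow> \<alpha>" and "filterlim (%n. nat \<lceil>\<alpha> * u n\<rceil>) at_top sequentially"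
proof -
 have pos: "eventually (%n. 0 < u n) sequentially" using u by (rule filterlim_at_top_dense[THEN iffD1, rule_format])
 have inv: "(%n. 1 / u n) \<longlonglongrightarrow> 0" using tendsto_divide_0[OF tendsto_const filterlim_at_top_imp_at_infinity[OF u]] by simp
 have bounds: "\<alpha> * x <= real (nat \<lceil>\<alpha> * x\<rceil>)" "real (nat \<lceil>\<alpha> * x\<rceil>) <= \<alpha> * x + 1" if "0 < x" for x
 proof -
  have "0 < \<alpha> * x" using a that by simp
  then have "0 <= \<lceil>\<alpha> * x\<rceil>" unfolding zero_le_ceiling by linarith
  then show "\<alpha> * x <= real (nat \<lceil>\<alpha> * x\<rceil>)" "real (nat \<lceil>\<alpha> * x\<rceil>) <= \<alpha> * x + 1" by linarith+
 qed
 show "(%n. real (nat \<lceil>\<alpha> * u n\<rceil>) / u n) \<longlonglongrightarrow> \<alpha>"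
 proof (rule tendsto_sandwich)
  show "eventually (%n. \<alpha> <= real (nat \<lceil>\<alpha> * u n\<rceil>) / u n) sequentially"
   using pos by eventually_elim (use bounds in \<open>simp add: pos_le_divide_eq\<close>)
  show "eventually (%n. real (nat \<lceil>\<alpha> * u n\<rceil>) / u n <= \<alpha> + 1 / u n) sequentially"
   using pos by eventually_elim (use bounds in \<open>simp add: pos_divide_le_eq distrib_right\<close>)
  show "(%n. \<alpha> + 1 / u n) \<longlonglongrightarrow> \<alpha>" using tendsto_add[OF tendsto_const inv, of \<alpha>] by simp
 qed simp
 show "filterlim (%n. nat \<lceil>\<alpha> * u n\<rceil>) at_top sequentially"
  unfolding filterlim_at_top
 proof
  fix Z :: nat
  have "eventually (%n. real Z / \<alpha> <= u n) sequentially" using u unfolding filterlim_at_top by blast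
  then show "eventually (%n. Z <= nat \<lceil>\<alpha> * u n\<rceil>) sequentially"
   using pos
  proof eventually_elim
   fix n assume "real Z / \<alpha> <= u n" "0 < u n"
   then have "real Z <= \<alpha> * u n" using a by (simp add: pos_divide_le_eq mult.commute)
   then have "real Z <= real (nat \<lceil>\<alpha> * u n\<rceil>)" using bounds(1)[OF \<open>0 < u n\<close>] by linarith
   then show "Z <= nat \<lceil>\<alpha> * u n\<rceil>" by simp
  qed
 qed
qed

lemma upper_bound_limit:
 fixes u :: "nat => real"
 assumes u: "filterlim u at_top sequentially" and a: "0 < \<alpha>" and k: "1 <= k"
 defines "W \<equiv> %n. nat \<lceil>\<alpha> * u n\<rceil>"
 shows "(%n. (u n) ^ (2 * k) * (b * (r / (2 * pi * real (W n)) ^ (2 * k)) +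
   1 / (u n) ^ (2 * k + 1) * c * (\<Sum>j\<in>{- int (W n)..int (W n)}. (pinsker_weight k (W n) j)^2)))
  \<longlonglongrightarrow> b * (r / (2 * pi * \<alpha>) ^ (2 * k)) + c * (\<alpha> * (4 * (real k)^2 / ((real k + 1) * (2 * real k + 1))))"
proof -
 let ?s = "%W. \<Sum>j\<in>{- int W..int W}. (pinsker_weight k W j)^2"
 have W: "(%n. real (W n) / u n) \<longlonglongrightarrow> \<alpha>" "filterlim W at_top sequentially"
  unfolding W_def by (rule ceiling_scale_limit[OF u a])+
 have "(%n. b * (r / (2 * pi * (real (W n) / u n)) ^ (2 * k)) + c * (real (W n) / u n * (?s (W n) / real (W n))))
  \<longlonglongrightarrow> b * (r / (2 * pi * \<alpha>) ^ (2 * k)) + c * (\<alpha> * (4 * (real k)^2 / ((real k + 1) * (2 * real k + 1))))"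
 proof -
  have l1: "(%n. (2 * pi * (real (W n) / u n)) ^ (2 * k)) \<longlonglongrightarrow> (2 * pi * \<alpha>) ^ (2 * k)"
   by (intro tendsto_power tendsto_mult tendsto_const W(1))
  have l2: "(%n. ?s (W n) / real (W n)) \<longlonglongrightarrow> 4 * (real k)^2 / ((real k + 1) * (2 * real k + 1))"
   by (rule filterlim_compose[OF pinsker_weight_sum_limit[OF k] W(2)])
  have nz: "(2 * pi * \<alpha>) ^ (2 * k) \<noteq> 0" using a by simp
  show ?thesis
   by (rule tendsto_add[OF tendsto_mult[OF tendsto_const tendsto_divide[OF tendsto_const l1 nz]]
      tendsto_mult[OF tendsto_const tendsto_mult[OF W(1) l2]]])
 qed
 moreover have "eventually (%n. 0 < u n) sequentially" using u by (rule filterlim_at_top_dense[THEN iffD1, rule_format])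
 moreover have "eventually (%n. 0 < W n) sequentially" 
  using W(2)[unfolded filterlim_at_top, rule_format, of 1] by eventually_elim simp
 ultimately show ?thesis
 proof (elim Lim_transform_eventually)
  assume "eventually (%n. 0 < u n) sequentially" "eventually (%n. 0 < W n) sequentially"
  then show "eventually (%n. b * (r / (2 * pi * (real (W n) / u n)) ^ (2 * k)) + c * (real (W n) / u n * (?s (W n) / real (W n))) =
   (u n) ^ (2 * k) * (b * (r / (2 * pi * real (W n)) ^ (2 * k)) + 1 / (u n) ^ (2 * k + 1) * c * ?s (W n))) sequentially"
  proof eventually_elim
   fix n assume un: "0 < u n" and Wn: "0 < W n"
   have 1: "(u n) ^ (2 * k) * (b * (r / (2 * pi * real (W n)) ^ (2 * k))) = b * (r / (2 * pi * (real (W n) / u n)) ^ (2 * k))"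
    using un by (simp add: power_divide power_mult_distrib)
   have 2: "(u n) ^ (2 * k) * (1 / (u n) ^ (2 * k + 1) * c * ?s (W n)) = c * (real (W n) / u n * (?s (W n) / real (W n)))"
    using un Wn by simp
   show "b * (r / (2 * pi * (real (W n) / u n)) ^ (2 * k)) + c * (real (W n) / u n * (?s (W n) / real (W n))) =
    (u n) ^ (2 * k) * (b * (r / (2 * pi * real (W n)) ^ (2 * k)) + 1 / (u n) ^ (2 * k + 1) * c * ?s (W n))"
    unfolding distrib_left 1 2 ..
  qed
 qed
qed

text \<open>As 2 pi |j| exceeds 1, each of the \<open>k\<close> lower powers is at most the one of
  exponent 2k - 2.\<close>

lemma sobolev_weight_le:
 assumes k: "1 <= k" and j: "1 <= \<bar>j\<bar>"
 shows "(\<Sum>i\<le>k. (2 * pi * real_of_int j) ^ (2 * i)) <= (2 * pi * \<bar>real_of_int j\<bar>) ^ (2 * k) + real k * (2 * pi * \<bar>real_of_int j\<bar>) ^ (2 * k - 2)"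
proof -
 let ?y = "2 * pi * \<bar>real_of_int j\<bar>"
 have "1 <= 2 * pi" using pi_gt3 by simp
 moreover have "1 <= \<bar>real_of_int j\<bar>" using j by linarith
 ultimately have y: "1 <= ?y" using mult_mono[of 1 "2 * pi" 1 "\<bar>real_of_int j\<bar>"] by simp
 have eq: "(2 * pi * real_of_int j) ^ (2 * i) = ?y ^ (2 * i)" for i
  by (simp add: power_mult power_mult_distrib)
 have "(\<Sum>i\<le>k. ?y ^ (2 * i)) = ?y ^ (2 * k) + (\<Sum>i<k. ?y ^ (2 * i))"
  by (simp add: lessThan_Suc_atMost[symmetric])
 also have "(\<Sum>i<k. ?y ^ (2 * i)) <= (\<Sum>i<k. ?y ^ (2 * k - 2))"
  by (intro sum_mono power_increasing y) auto
 finally show ?thesis unfolding eq by simp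
qed

text \<open>The leading power is kept exactly, because it decides the constant; the lower terms are
  bounded crudely, at one power of \<open>W\<close> less.\<close>

lemma prior_weight_bound:
 fixes x :: real
 assumes k: "1 <= k" and x: "1 <= x" "x <= W"
 shows "((2 * pi * x) ^ (2 * k) + real k * (2 * pi * x) ^ (2 * k - 2)) * ((W / x) ^ k - 1)
   <= (2 * pi) ^ (2 * k) * (x ^ k * W ^ k - x ^ (2 * k)) + real k * (2 * pi) ^ (2 * k - 2) * W ^ (2 * k - 1)"
proof -
 have x0: "0 < x" "0 < W" using x by linarith+
 have 1: "(2 * pi * x) ^ (2 * k) * ((W / x) ^ k - 1) = (2 * pi) ^ (2 * k) * (x ^ k * W ^ k - x ^ (2 * k))"
 proof -
  have "x ^ (2 * k) * (W / x) ^ k = x ^ k * W ^ k" using x0 by (simp add: power_divide mult_2 power_add)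
  then show ?thesis unfolding power_mult_distrib by (simp add: right_diff_distrib mult.assoc)
 qed
 have 2: "(2 * pi * x) ^ (2 * k - 2) * ((W / x) ^ k - 1) <= (2 * pi) ^ (2 * k - 2) * W ^ (2 * k - 1)"
 proof -
  obtain m where m: "k = Suc m" using k by (cases k) auto
  have "x ^ (2 * m) * (W / x) ^ Suc m = x ^ m * W ^ m * (W / x)"
   using x0 by (simp add: power_divide mult_2 power_add)
  also have "\<dots> <= W ^ m * W ^ m * W"
  proof (intro mult_mono power_mono)
   show "W / x <= W" using x x0 mult_left_mono[of 1 x W] by (simp add: pos_divide_le_eq)
  qed (use x0 x in auto)
  also have "\<dots> = W ^ (2 * m + 1)" by (simp add: mult_2 power_add)
  finally have le: "x ^ (2 * m) * (W / x) ^ Suc m <= W ^ (2 * m + 1)" .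
  have "(2 * pi * x) ^ (2 * m) * ((W / x) ^ Suc m - 1) <= (2 * pi * x) ^ (2 * m) * (W / x) ^ Suc m"
   using x0 by (intro mult_left_mono) auto
  also have "\<dots> = (2 * pi) ^ (2 * m) * (x ^ (2 * m) * (W / x) ^ Suc m)" by (simp add: power_mult_distrib)
  also have "\<dots> <= (2 * pi) ^ (2 * m) * W ^ (2 * m + 1)" by (rule mult_left_mono[OF le]) simp
  finally show ?thesis by (simp add: m)
 qed
 have "real k * ((2 * pi * x) ^ (2 * k - 2) * ((W / x) ^ k - 1)) <= real k * ((2 * pi) ^ (2 * k - 2) * W ^ (2 * k - 1))"
  by (rule mult_left_mono[OF 2]) simp
 then show ?thesis
  unfolding distrib_right[of "(2 * pi * x) ^ (2 * k)"] 1 mult.assoc[of "real k"] by (rule add_left_mono)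
qed

text \<open>With x = 2 t y at most \<delta>/4, the bound -ln (1 - x) <= x + 2 x^2 costs a factor 1 +
  \<delta>/2 in the exponent. Against the energy bound (1 - \<delta>/2) r this leaves 1 -
  \<delta>^2/4, hence a decay of t r \<delta>^2/4.\<close>

lemma chernoff_product:
 fixes y :: "'i => real"
 assumes I: "finite I" and \<delta>: "0 < \<delta>" "\<delta> < 1" and t: "0 <= t" and y: "\<And>i. i \<in> I ==> 0 <= y i" "\<And>i. i \<in> I ==> t * y i <= \<delta> / 8"
  and s: "(\<Sum>i\<in>I. y i) <= (1 - \<delta> / 2) * r"
 shows "exp (- t * r) * (\<Prod>i\<in>I. 1 / sqrt (1 - 2 * t * y i)) <= exp (- (t * r * \<delta>^2 / 4))"
proof -
 have le: "1 / sqrt (1 - 2 * t * y i) <= exp (t * y i * (1 + \<delta> / 2))" if i: "i \<in> I" for i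
 proof -
  let ?x = "2 * t * y i"
  have x: "0 <= ?x" "?x <= \<delta> / 4" "?x <= 1 / 2" using y[OF i] \<delta> t by auto
  have "- ?x - 2 * ?x^2 <= ln (1 - ?x)" by (rule ln_one_minus_pos_lower_bound[OF x(1,3)])
  then have "exp (- ?x - 2 * ?x^2) <= 1 - ?x" using x(3) by (subst (asm) ln_ge_iff) auto
  then have "sqrt (exp (- ?x - 2 * ?x^2)) <= sqrt (1 - ?x)" by (rule real_sqrt_le_mono)
  moreover have "sqrt (exp (- ?x - 2 * ?x^2)) = exp (- (?x / 2 + ?x^2))"
   by (rule real_sqrt_unique) (simp_all add: exp_double[symmetric] algebra_simps)
  ultimately have "exp (- (?x / 2 + ?x^2)) <= sqrt (1 - ?x)" by simp
  then have "1 / sqrt (1 - ?x) <= 1 / exp (- (?x / 2 + ?x^2))" by (intro divide_left_mono) (use x(3) in auto)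
  also have "\<dots> = exp (?x / 2 + ?x^2)" by (simp only: exp_minus inverse_eq_divide div_by_1 divide_divide_eq_right mult_1_left)
  also have "\<dots> <= exp (t * y i * (1 + \<delta> / 2))"
  proof -
   have "?x * ?x <= ?x * (\<delta> / 4)" by (rule mult_left_mono[OF x(2,1)])
   then have "?x / 2 + ?x^2 <= ?x / 2 + ?x * (\<delta> / 4)" by (simp add: power2_eq_square)
   also have "\<dots> = t * y i * (1 + \<delta> / 2)" by (simp add: algebra_simps)
   finally show ?thesis by simp
  qed
  finally show ?thesis .
 qed
 have "(\<Prod>i\<in>I. 1 / sqrt (1 - 2 * t * y i)) <= (\<Prod>i\<in>I. exp (t * y i * (1 + \<delta> / 2)))"
 proof (rule prod_mono)
  fix i assume i: "i \<in> I"
  have "0 <= 1 - 2 * t * y i" using y(2)[OF i] \<delta> by simp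
  then show "0 <= 1 / sqrt (1 - 2 * t * y i) \<and> 1 / sqrt (1 - 2 * t * y i) <= exp (t * y i * (1 + \<delta> / 2))" using le[OF i] by simp
 qed
 also have "\<dots> = exp (t * (1 + \<delta> / 2) * (\<Sum>i\<in>I. y i))"
  by (simp add: exp_sum[OF I, symmetric] sum_distrib_left sum_distrib_right mult_ac)
 also have "\<dots> <= exp (t * (1 + \<delta> / 2) * ((1 - \<delta> / 2) * r))"
  using mult_left_mono[OF s, of "t * (1 + \<delta> / 2)"] t \<delta> by simp
 finally have "exp (- t * r) * (\<Prod>i\<in>I. 1 / sqrt (1 - 2 * t * y i)) <= exp (- t * r) * exp (t * (1 + \<delta> / 2) * ((1 - \<delta> / 2) * r))"
  by (rule mult_left_mono) simp
 also have "\<dots> = exp (- (t * r * \<delta>^2 / 4))"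
  unfolding exp_add[symmetric] by (simp add: algebra_simps power2_eq_square)
 finally show ?thesis .
qed

text \<open>\<alpha> minimises the sum of bias and variance in the second claim; its power of order
  2k+1 is where the derivative vanishes. Values are compared through these powers, which removes
  real exponents.\<close>

lemma pinsker_constant_eq:
 assumes k: "1 <= k" and r: "0 < r"
 defines "\<alpha> \<equiv> (r * (real k + 1) * (2 * real k + 1) / (2 * real k * (2 * pi) ^ (2 * k))) powr (1 / (2 * real k + 1))"
 shows "pinsker_constant k r = \<alpha> * (2 * real k / (real k + 1))"
  and "r / (2 * pi * \<alpha>) ^ (2 * k) + \<alpha> * (4 * (real k)^2 / ((real k + 1) * (2 * real k + 1))) = \<alpha> * (2 * real k / (real k + 1))"
  and "0 < \<alpha>" and "\<alpha> ^ (2 * k + 1) = r * (real k + 1) * (2 * real k + 1) / (2 * real k * (2 * pi) ^ (2 * k))"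
proof -
 let ?c = "r * (real k + 1) * (2 * real k + 1) / (2 * real k * (2 * pi) ^ (2 * k))"
 have k0: "0 < real k" using k by simp
 have c: "0 < ?c" using k0 r by simp
 show a: "0 < \<alpha>" unfolding \<alpha>_def powr_gt_zero by (rule less_imp_neq[THEN not_sym, OF c])
 have d: "real (2 * k + 1) = 2 * real k + 1" by simp
 have "\<alpha> ^ (2 * k + 1) = \<alpha> powr real (2 * k + 1)" by (rule powr_realpow[symmetric, OF a])
 also have "\<dots> = ?c powr (1 / (2 * real k + 1) * (2 * real k + 1))" unfolding d \<alpha>_def powr_powr ..
 also have "\<dots> = ?c"
 proof -
  have "1 / (2 * real k + 1) * (2 * real k + 1) = 1" using k0 by simp
  then show ?thesis using powr_one[OF less_imp_le[OF c]] by simp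
 qed
 finally show ad: "\<alpha> ^ (2 * k + 1) = ?c" .
 have P0: "0 <= pinsker_constant k r" unfolding pinsker_constant_def by simp
 have "pinsker_constant k r ^ (2 * k + 1) = (2 * real k + 1) * r * (real k / ((real k + 1) * pi)) ^ (2 * k)"
 proof -
  have p1: "(((2 * real k + 1) * r) powr (1 / (2 * real k + 1))) ^ (2 * k + 1) = (2 * real k + 1) * r"
  proof -
   have b: "0 < (2 * real k + 1) * r" using k0 r by simp
   have "(((2 * real k + 1) * r) powr (1 / (2 * real k + 1))) ^ (2 * k + 1) = (((2 * real k + 1) * r) powr (1 / (2 * real k + 1))) powr real (2 * k + 1)"
    by (rule powr_realpow[symmetric]) (unfold powr_gt_zero, rule less_imp_neq[THEN not_sym, OF b])
   also have "\<dots> = (2 * real k + 1) * r"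
   proof -
    have "1 / (2 * real k + 1) * (2 * real k + 1) = 1" using k0 by simp
    then show ?thesis unfolding powr_powr d using powr_one[OF less_imp_le[OF b]] by simp
   qed
   finally show ?thesis .
  qed
  have p2: "((real k / ((real k + 1) * pi)) powr (2 * real k / (2 * real k + 1))) ^ (2 * k + 1) = (real k / ((real k + 1) * pi)) ^ (2 * k)"
  proof -
   have b: "0 < real k / ((real k + 1) * pi)" using k0 by simp
   have "((real k / ((real k + 1) * pi)) powr (2 * real k / (2 * real k + 1))) ^ (2 * k + 1) =
     ((real k / ((real k + 1) * pi)) powr (2 * real k / (2 * real k + 1))) powr real (2 * k + 1)"
    by (rule powr_realpow[symmetric]) (unfold powr_gt_zero, rule less_imp_neq[THEN not_sym, OF b])
   also have "\<dots> = (real k / ((real k + 1) * pi)) powr real (2 * k)"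
    unfolding powr_powr d using k0 by simp
   also have "\<dots> = (real k / ((real k + 1) * pi)) ^ (2 * k)" by (rule powr_realpow[OF b])
   finally show ?thesis .
  qed
  show ?thesis unfolding pinsker_constant_def power_mult_distrib p1 p2 ..
 qed
 also have "\<dots> = ?c * (2 * real k / (real k + 1)) ^ (2 * k + 1)"
 proof -
  have "2 * real k / (real k + 1) = (2 * pi) * (real k / ((real k + 1) * pi))" by simp
  then have e: "(2 * real k / (real k + 1)) ^ (2 * k + 1) =
    (2 * pi) ^ (2 * k) * (real k / ((real k + 1) * pi)) ^ (2 * k) * (2 * real k / (real k + 1))"
   by (metis power_add power_mult_distrib power_one_right)
  have "d * r * X = r * b * d / (2 * K * Y) * (Y * X * (2 * K / b))" if "K \<noteq> 0" "Y \<noteq> 0" "b \<noteq> 0" for X Y K b d :: real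
   using that by (simp add: field_simps)
  then show ?thesis unfolding e using k0 by simp
 qed
 also have "\<dots> = (\<alpha> * (2 * real k / (real k + 1))) ^ (2 * k + 1)" unfolding power_mult_distrib ad ..
 finally show "pinsker_constant k r = \<alpha> * (2 * real k / (real k + 1))"
  by (rule power_eq_imp_eq_base) (use P0 a k0 in auto)
 have "r / (2 * pi * \<alpha>) ^ (2 * k) = ?c * (2 * real k / ((real k + 1) * (2 * real k + 1))) / \<alpha> ^ (2 * k)"
 proof -
  have "r / (Y * A) = r * b * d / (2 * K * Y) * (2 * K / (b * d)) / A" if "K \<noteq> 0" "Y \<noteq> 0" "b \<noteq> 0" "d \<noteq> 0" for Y A K b d :: real
   using that by (simp add: field_simps)
  from this[of "real k" "(2 * pi) ^ (2 * k)" "real k + 1" "2 * real k + 1" "\<alpha> ^ (2 * k)"] show ?thesis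
   unfolding power_mult_distrib[of "2 * pi" \<alpha>] using k0 by simp
 qed
 also have "\<dots> = \<alpha> * (2 * real k / ((real k + 1) * (2 * real k + 1)))"
  unfolding ad[symmetric] using a by simp
 finally have e: "r / (2 * pi * \<alpha>) ^ (2 * k) = \<alpha> * (2 * real k / ((real k + 1) * (2 * real k + 1)))" .
 have "2 * real k / ((real k + 1) * (2 * real k + 1)) + 4 * (real k)^2 / ((real k + 1) * (2 * real k + 1)) =
   (2 * real k) * (2 * real k + 1) / ((real k + 1) * (2 * real k + 1))"
  by (simp add: add_divide_distrib[symmetric] algebra_simps power2_eq_square)
 also have "\<dots> = 2 * real k / (real k + 1)" using k0 by simp
 finally show "r / (2 * pi * \<alpha>) ^ (2 * k) + \<alpha> * (4 * (real k)^2 / ((real k + 1) * (2 * real k + 1))) = \<alpha> * (2 * real k / (real k + 1))"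
  unfolding e distrib_left[symmetric] by simp
qed


text \<open>Pinsker's least favourable prior at noise level \<open>e\<close>. The value 1 elsewhere
  is a filler that keeps all standard deviations positive; it is used for frequencies outside the
  support.\<close>

definition prior_sd :: "nat => nat => real => int => real" where
 "prior_sd k W e j = (if 1 <= \<bar>j\<bar> \<and> \<bar>j\<bar> < int W then sqrt (e * ((real W / \<bar>real_of_int j\<bar>) ^ k - 1)) else 1)"

text \<open>The range stops at \<open>W - 1\<close> because the variance vanishes at
  \<open>W\<close>. The posterior variance is \<open>e\<close> times Pinsker's weight, and this
  links the two bounds.\<close>

lemma prior_sd_facts:
 assumes k: "1 <= k" and e: "0 < e"
 shows "0 < prior_sd k W e j"
  and "j \<in> sym_range (W - 1) ==> (prior_sd k W e j)^2 = e * ((real W / \<bar>real_of_int j\<bar>) ^ k - 1)"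
  and "j \<in> sym_range (W - 1) ==> 1 / (1 / (prior_sd k W e j)^2 + 1 / e) = e * (1 - (\<bar>real_of_int j\<bar> / real W) ^ k)"
proof -
 have q: "1 < (real W / \<bar>real_of_int j\<bar>) ^ k" if "1 <= \<bar>j\<bar> \<and> \<bar>j\<bar> < int W"
 proof (rule one_less_power)
  have "0 < \<bar>real_of_int j\<bar>" "\<bar>real_of_int j\<bar> < real W" using that by linarith+
  then show "1 < real W / \<bar>real_of_int j\<bar>" by simp
 qed (use k in simp)
 then show "0 < prior_sd k W e j" using e by (simp add: prior_sd_def)
 assume "j \<in> sym_range (W - 1)"
 then have j: "1 <= \<bar>j\<bar> \<and> \<bar>j\<bar> < int W" by (auto simp: sym_range_def)
 show s2: "(prior_sd k W e j)^2 = e * ((real W / \<bar>real_of_int j\<bar>) ^ k - 1)"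
  using q[OF j] j e by (simp add: prior_sd_def)
 have "1 / (1 / (e * (q - 1)) + 1 / e) = e * (1 - 1 / q)" if "1 < q" for q
 proof -
  have "1 / (e * (q - 1)) + 1 / e = q / (e * (q - 1))" using that e by (simp add: field_simps)
  then show ?thesis using that e by (simp add: field_simps)
 qed
 from this[OF q[OF j]] show "1 / (1 / (prior_sd k W e j)^2 + 1 / e) = e * (1 - (\<bar>real_of_int j\<bar> / real W) ^ k)"
  unfolding s2 by (simp add: power_divide)
qed

text \<open>The bound for one frequency limits the admissible exponent in Chernoff's inequality; the
  bound for the sum is the mean energy, to be kept below r.\<close>

lemma prior_energy:
 fixes W k :: nat and e :: real
 assumes k: "1 <= k" and e: "0 < e"
 defines "y \<equiv> %j. (\<Sum>i\<le>k. (2 * pi * real_of_int j) ^ (2 * i)) * (prior_sd k W e j)^2"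
 shows "0 <= y j"
  and "j \<in> sym_range (W - 1) ==> y j <= (real k + 1) * (2 * pi) ^ (2 * k) * (e * real W ^ (2 * k))"
  and "(\<Sum>j\<in>sym_range (W - 1). y j) <= e * ((2 * pi) ^ (2 * k) * (2 * (\<Sum>j=1..W. real j ^ k * real W ^ k - real j ^ (2 * k)))
    + 2 * real k * (2 * pi) ^ (2 * k - 2) * real W ^ (2 * k))"
proof -
 show "0 <= y j" for j unfolding y_def by (intro mult_nonneg_nonneg sum_nonneg) (auto simp: power_mult)
 define Z where "Z = real k * (2 * pi) ^ (2 * k - 2) * real W ^ (2 * k - 1)"
 have Z0: "0 <= Z" by (simp add: Z_def)
 let ?h = "%x. (2 * pi) ^ (2 * k) * (x ^ k * real W ^ k - x ^ (2 * k))"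
 have le: "y j <= e * (?h \<bar>real_of_int j\<bar> + Z)" if j: "j \<in> sym_range (W - 1)" for j
 proof -
  let ?x = "\<bar>real_of_int j\<bar>"
  have j': "1 <= \<bar>j\<bar>" "\<bar>j\<bar> <= int W" using j by (auto simp: sym_range_def)
  have x: "1 <= ?x" "?x <= real W" using j' by linarith+
  have "0 <= (real W / ?x) ^ k - 1" using x by (simp add: one_le_power)
  then have "(\<Sum>i\<le>k. (2 * pi * real_of_int j) ^ (2 * i)) * ((real W / ?x) ^ k - 1) <=
    ((2 * pi * ?x) ^ (2 * k) + real k * (2 * pi * ?x) ^ (2 * k - 2)) * ((real W / ?x) ^ k - 1)"
   by (intro mult_right_mono sobolev_weight_le k j')
  also have "\<dots> <= ?h ?x + Z" unfolding Z_def by (rule prior_weight_bound[OF k x])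
  finally have "e * ((\<Sum>i\<le>k. (2 * pi * real_of_int j) ^ (2 * i)) * ((real W / ?x) ^ k - 1)) <= e * (?h ?x + Z)"
   using e by (intro mult_left_mono) auto
  then show ?thesis unfolding y_def prior_sd_facts(2)[OF k e j] by (simp only: mult.left_commute)
 qed
 show "y j <= (real k + 1) * (2 * pi) ^ (2 * k) * (e * real W ^ (2 * k))" if j: "j \<in> sym_range (W - 1)"
 proof -
  let ?x = "\<bar>real_of_int j\<bar>"
  have j': "1 <= \<bar>j\<bar>" "\<bar>j\<bar> <= int W" using j by (auto simp: sym_range_def)
  have x: "1 <= ?x" "?x <= real W" using j' by linarith+
  have W1: "1 <= real W" using x by linarith
  have F: "?x ^ k * real W ^ k - ?x ^ (2 * k) <= real W ^ (2 * k)"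
  proof -
   have "?x ^ k * real W ^ k <= real W ^ k * real W ^ k" using x by (intro mult_right_mono power_mono) auto
   moreover have "0 <= ?x ^ (2 * k)" by simp
   ultimately show ?thesis unfolding mult_2 power_add by linarith
  qed
  have 1: "?h ?x <= (2 * pi) ^ (2 * k) * real W ^ (2 * k)" by (rule mult_left_mono[OF F]) simp
  have "1 <= 2 * pi" using pi_gt3 by simp
  then have "(2 * pi) ^ (2 * k - 2) * real W ^ (2 * k - 1) <= (2 * pi) ^ (2 * k) * real W ^ (2 * k)"
   using W1 by (intro mult_mono power_increasing) auto
  then have 2: "Z <= real k * ((2 * pi) ^ (2 * k) * real W ^ (2 * k))" unfolding Z_def mult.assoc by (rule mult_left_mono) simp
  have "y j <= e * (?h ?x + Z)" by (rule le[OF j])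
  also have "\<dots> <= e * ((2 * pi) ^ (2 * k) * real W ^ (2 * k) + real k * ((2 * pi) ^ (2 * k) * real W ^ (2 * k)))"
   using e by (intro mult_left_mono add_mono 1 2) auto
  also have "\<dots> = (real k + 1) * (2 * pi) ^ (2 * k) * (e * real W ^ (2 * k))" by (simp add: algebra_simps)
  finally show ?thesis .
 qed
 have "(\<Sum>j\<in>sym_range (W - 1). y j) <= (\<Sum>j\<in>sym_range (W - 1). e * (?h \<bar>real_of_int j\<bar> + Z))"
  by (rule sum_mono) (rule le)
 also have "\<dots> = 2 * (\<Sum>j=1..W - 1. e * (?h \<bar>real_of_int (int j)\<bar> + Z))"
  by (rule sum_sym_range) simp
 \<comment> \<open>The nonnegative term at \<open>j = W\<close> is added back in order to reach sums
   with known limits.\<close>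
 also have "\<dots> <= 2 * (\<Sum>j=1..W. e * (?h (real j) + Z))"
 proof -
  have "0 <= ?h (real j) + Z" if "j \<in> {1..W}" for j
  proof -
   have "real j ^ (2 * k) <= real j ^ k * real W ^ k"
    unfolding mult_2 power_add using that by (intro mult_left_mono power_mono) auto
   then have "0 <= ?h (real j)" by (intro mult_nonneg_nonneg) auto
   then show ?thesis using Z0 by linarith
  qed
  then have "(\<Sum>j=1..W - 1. e * (?h (real j) + Z)) <= (\<Sum>j=1..W. e * (?h (real j) + Z))"
   using e by (intro sum_mono2 mult_nonneg_nonneg) auto
  then show ?thesis by simp
 qed
 also have "\<dots> = e * ((2 * pi) ^ (2 * k) * (2 * (\<Sum>j=1..W. real j ^ k * real W ^ k - real j ^ (2 * k))) + 2 * real W * Z)"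
 proof -
  have 1: "(\<Sum>j=1..W. e * (?h (real j) + Z)) = e * (\<Sum>j=1..W. ?h (real j) + Z)" by (rule sum_distrib_left[symmetric])
  have 2: "(\<Sum>j=1..W. ?h (real j) + Z) = (\<Sum>j=1..W. ?h (real j)) + real W * Z" unfolding sum.distrib by simp
  have 3: "(\<Sum>j=1..W. ?h (real j)) = (2 * pi) ^ (2 * k) * (\<Sum>j=1..W. real j ^ k * real W ^ k - real j ^ (2 * k))"
   by (rule sum_distrib_left[symmetric])
  have "2 * (e * (A * S + w * Z)) = e * (A * (2 * S) + 2 * w * Z)" for A S w :: real by (simp add: algebra_simps)
  then show ?thesis unfolding 1 2 3 .
 qed
 also have "2 * real W * Z = 2 * real k * (2 * pi) ^ (2 * k - 2) * real W ^ (2 * k)"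
 proof -
  obtain m where "k = Suc m" using k by (cases k) auto
  then show ?thesis by (simp add: Z_def)
 qed
 finally show "(\<Sum>j\<in>sym_range (W - 1). y j) <= e * ((2 * pi) ^ (2 * k) * (2 * (\<Sum>j=1..W. real j ^ k * real W ^ k - real j ^ (2 * k)))
    + 2 * real k * (2 * pi) ^ (2 * k - 2) * real W ^ (2 * k))" .
qed

text \<open>The noise level u^-(2k+1) and a cutoff of order u keep the mean energy bounded and make
  the energy of one frequency of order 1/u. The Chernoff exponent can thus be of order u, and the
  exponential beats every power of u.\<close>

lemma
 fixes u :: "nat => real"
 assumes u: "filterlim u at_top sequentially" and a: "0 < \<alpha>" and k: "1 <= k"
 defines "W \<equiv> %n. nat \<lceil>\<alpha> * u n\<rceil>"
 shows prior_energy_limit: "(%n. 1 / (u n) ^ (2 * k + 1) *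
    ((2 * pi) ^ (2 * k) * (2 * (\<Sum>j=1..W n. real j ^ k * real (W n) ^ k - real j ^ (2 * k)))
     + 2 * real k * (2 * pi) ^ (2 * k - 2) * real (W n) ^ (2 * k)))
   \<longlonglongrightarrow> (2 * pi) ^ (2 * k) * 2 * \<alpha> ^ (2 * k + 1) * (1 / (real k + 1) - 1 / (real (2 * k) + 1))"
  and prior_max_limit: "(%n. u n * (C * (1 / (u n) ^ (2 * k + 1) * real (W n) ^ (2 * k)))) \<longlonglongrightarrow> C * \<alpha> ^ (2 * k)"
  and posterior_sum_limit: "(%n. (u n) ^ (2 * k) * (\<Sum>j\<in>sym_range (W n - 1). 1 / (u n) ^ (2 * k + 1) * (1 - (\<bar>real_of_int j\<bar> / real (W n)) ^ k)))
   \<longlonglongrightarrow> \<alpha> * (2 * real k / (real k + 1))"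
  and tail_limit: "0 < c0 ==> (%n. (u n) ^ (2 * k) * (8 * real (W n) * (2 * r + 1 / (\<gamma> * u n)) * exp (- (c0 * u n)))) \<longlonglongrightarrow> 0"
proof -
 have W: "(%n. real (W n) / u n) \<longlonglongrightarrow> \<alpha>" "filterlim W at_top sequentially"
  unfolding W_def by (rule ceiling_scale_limit[OF u a])+
 let ?s = "%m n. (\<Sum>j=1..W n. (real j / real (W n)) ^ m) / real (W n)"
 have s: "(%n. ?s m n) \<longlonglongrightarrow> 1 / (real m + 1)" if "1 <= m" for m
  by (rule filterlim_compose[OF power_sum_limit[OF that] W(2)])
 have pos: "eventually (%n. 0 < u n) sequentially" using u by (rule filterlim_at_top_dense[THEN iffD1, rule_format])
 have Wpos: "eventually (%n. 0 < W n) sequentially" 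
  using W(2)[unfolded filterlim_at_top, rule_format, of 1] by eventually_elim simp
 have inv: "(%n. 1 / u n) \<longlonglongrightarrow> 0" using tendsto_divide_0[OF tendsto_const filterlim_at_top_imp_at_infinity[OF u]] by simp
 have k2: "1 <= 2 * k" using k by simp
 have "(%n. (2 * pi) ^ (2 * k) * 2 * (real (W n) / u n) ^ (2 * k + 1) * (?s k n - ?s (2 * k) n) +
   2 * real k * (2 * pi) ^ (2 * k - 2) * (real (W n) / u n) ^ (2 * k) * (1 / u n))
  \<longlonglongrightarrow> (2 * pi) ^ (2 * k) * 2 * \<alpha> ^ (2 * k + 1) * (1 / (real k + 1) - 1 / (real (2 * k) + 1)) +
   2 * real k * (2 * pi) ^ (2 * k - 2) * \<alpha> ^ (2 * k) * 0"
  by (intro tendsto_add tendsto_mult tendsto_diff tendsto_power tendsto_const W(1) inv s k k2)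
 then have lim: "(%n. (2 * pi) ^ (2 * k) * 2 * (real (W n) / u n) ^ (2 * k + 1) * (?s k n - ?s (2 * k) n) +
   2 * real k * (2 * pi) ^ (2 * k - 2) * (real (W n) / u n) ^ (2 * k) * (1 / u n))
  \<longlonglongrightarrow> (2 * pi) ^ (2 * k) * 2 * \<alpha> ^ (2 * k + 1) * (1 / (real k + 1) - 1 / (real (2 * k) + 1))" by simp
 show "(%n. 1 / (u n) ^ (2 * k + 1) *
    ((2 * pi) ^ (2 * k) * (2 * (\<Sum>j=1..W n. real j ^ k * real (W n) ^ k - real j ^ (2 * k)))
     + 2 * real k * (2 * pi) ^ (2 * k - 2) * real (W n) ^ (2 * k)))
   \<longlonglongrightarrow> (2 * pi) ^ (2 * k) * 2 * \<alpha> ^ (2 * k + 1) * (1 / (real k + 1) - 1 / (real (2 * k) + 1))"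
 proof (rule Lim_transform_eventually[OF lim], use pos Wpos in eventually_elim)
  fix n assume un: "0 < u n" and Wn: "0 < W n"
  have "(\<Sum>j=1..W n. real j ^ k * real (W n) ^ k - real j ^ (2 * k)) =
    (\<Sum>j=1..W n. real (W n) ^ (2 * k) * ((real j / real (W n)) ^ k - (real j / real (W n)) ^ (2 * k)))"
   using Wn by (intro sum.cong refl) (simp add: power_divide right_diff_distrib mult_2 power_add)
  also have "\<dots> = real (W n) ^ (2 * k + 1) * (?s k n - ?s (2 * k) n)"
   using Wn by (simp add: sum_distrib_left[symmetric] sum_subtractf right_diff_distrib)
  finally have S: "(\<Sum>j=1..W n. real j ^ k * real (W n) ^ k - real j ^ (2 * k)) = real (W n) ^ (2 * k + 1) * (?s k n - ?s (2 * k) n)" .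
  have g: "A * 2 * (w ^ (2 * k + 1) / v ^ (2 * k + 1)) * D + B * (w ^ (2 * k) / v ^ (2 * k)) * (1 / v) =
    1 / v ^ (2 * k + 1) * (A * (2 * (w ^ (2 * k + 1) * D)) + B * w ^ (2 * k))" if "v \<noteq> 0" for A B D v w :: real
   using that by (simp add: field_simps)
  show "(2 * pi) ^ (2 * k) * 2 * (real (W n) / u n) ^ (2 * k + 1) * (?s k n - ?s (2 * k) n) +
   2 * real k * (2 * pi) ^ (2 * k - 2) * (real (W n) / u n) ^ (2 * k) * (1 / u n) =
   1 / (u n) ^ (2 * k + 1) *
    ((2 * pi) ^ (2 * k) * (2 * (\<Sum>j=1..W n. real j ^ k * real (W n) ^ k - real j ^ (2 * k)))
     + 2 * real k * (2 * pi) ^ (2 * k - 2) * real (W n) ^ (2 * k))"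
   unfolding S power_divide by (rule g) (use un in simp)
 qed
 have "(%n. C * (real (W n) / u n) ^ (2 * k)) \<longlonglongrightarrow> C * \<alpha> ^ (2 * k)"
  by (intro tendsto_mult tendsto_power tendsto_const W(1))
 then show "(%n. u n * (C * (1 / (u n) ^ (2 * k + 1) * real (W n) ^ (2 * k)))) \<longlonglongrightarrow> C * \<alpha> ^ (2 * k)"
  by (rule Lim_transform_eventually) (use pos in eventually_elim, simp add: power_divide)
 have "(%n. 2 * (real (W n) / u n) * (1 - ?s k n)) \<longlonglongrightarrow> 2 * \<alpha> * (1 - 1 / (real k + 1))"
  by (intro tendsto_mult tendsto_diff tendsto_const W(1) s k)
 also have "2 * \<alpha> * (1 - 1 / (real k + 1)) = \<alpha> * (2 * real k / (real k + 1))"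
  by (simp add: field_simps)
 finally show "(%n. (u n) ^ (2 * k) * (\<Sum>j\<in>sym_range (W n - 1). 1 / (u n) ^ (2 * k + 1) * (1 - (\<bar>real_of_int j\<bar> / real (W n)) ^ k)))
   \<longlonglongrightarrow> \<alpha> * (2 * real k / (real k + 1))"
 proof (rule Lim_transform_eventually, use pos Wpos in eventually_elim)
  fix n assume un: "0 < u n" and Wn: "0 < W n"
  have "(\<Sum>j\<in>sym_range (W n - 1). 1 - (\<bar>real_of_int j\<bar> / real (W n)) ^ k) = 2 * (\<Sum>j=1..W n - 1. 1 - (\<bar>real_of_int (int j)\<bar> / real (W n)) ^ k)"
   by (rule sum_sym_range) simp
  also have "(\<Sum>j=1..W n - 1. 1 - (\<bar>real_of_int (int j)\<bar> / real (W n)) ^ k) = (\<Sum>j=1..W n. 1 - (real j / real (W n)) ^ k)"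
  proof (rule sum.mono_neutral_cong_left)
   show "\<forall>j\<in>{1..W n} - {1..W n - 1}. 1 - (real j / real (W n)) ^ k = 0"
   proof
    fix j assume "j \<in> {1..W n} - {1..W n - 1}"
    then have "j = W n" using Wn by auto
    then show "1 - (real j / real (W n)) ^ k = 0" using Wn by simp
   qed
  qed auto
  also have "\<dots> = real (W n) * (1 - ?s k n)" using Wn by (simp add: sum_subtractf right_diff_distrib)
  finally have S: "(\<Sum>j\<in>sym_range (W n - 1). 1 - (\<bar>real_of_int j\<bar> / real (W n)) ^ k) = 2 * (real (W n) * (1 - ?s k n))" .
  show "2 * (real (W n) / u n) * (1 - ?s k n) = (u n) ^ (2 * k) * (\<Sum>j\<in>sym_range (W n - 1). 1 / (u n) ^ (2 * k + 1) * (1 - (\<bar>real_of_int j\<bar> / real (W n)) ^ k))"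
   unfolding sum_distrib_left[symmetric] S using un by simp
 qed
 assume c0: "0 < c0"
 have cu: "filterlim (%n. c0 * u n) at_top sequentially" by (rule filterlim_tendsto_pos_mult_at_top[OF tendsto_const c0 u])
 have ex: "(%n. (c0 * u n) ^ (2 * k + 1) / exp (c0 * u n)) \<longlonglongrightarrow> 0"
  by (rule filterlim_compose[OF tendsto_power_div_exp_0 cu])
 have "(%n. 8 / c0 ^ (2 * k + 1) * (real (W n) / u n) * (2 * r + 1 / \<gamma> * (1 / u n)) * ((c0 * u n) ^ (2 * k + 1) / exp (c0 * u n)))
   \<longlonglongrightarrow> 8 / c0 ^ (2 * k + 1) * \<alpha> * (2 * r + 1 / \<gamma> * 0) * 0"
  by (intro tendsto_mult tendsto_add tendsto_const W(1) inv ex)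
 then have "(%n. 8 / c0 ^ (2 * k + 1) * (real (W n) / u n) * (2 * r + 1 / \<gamma> * (1 / u n)) * ((c0 * u n) ^ (2 * k + 1) / exp (c0 * u n))) \<longlonglongrightarrow> 0"
  by simp
 then show "(%n. (u n) ^ (2 * k) * (8 * real (W n) * (2 * r + 1 / (\<gamma> * u n)) * exp (- (c0 * u n)))) \<longlonglongrightarrow> 0"
 proof (rule Lim_transform_eventually, use pos in eventually_elim)
  fix n assume un: "0 < u n"
  have g: "8 / c ^ (2 * k + 1) * (w / v) * D * ((c * v) ^ (2 * k + 1) / x) = v ^ (2 * k) * (8 * w * D * inverse x)"
   if "v \<noteq> 0" "c \<noteq> 0" for c v w D x :: real
   using that by (simp add: power_mult_distrib field_simps)
  have d: "1 / \<gamma> * (1 / u n) = 1 / (\<gamma> * u n)" by simp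
  show "8 / c0 ^ (2 * k + 1) * (real (W n) / u n) * (2 * r + 1 / \<gamma> * (1 / u n)) * ((c0 * u n) ^ (2 * k + 1) / exp (c0 * u n)) =
    (u n) ^ (2 * k) * (8 * real (W n) * (2 * r + 1 / (\<gamma> * u n)) * exp (- (c0 * u n)))"
   unfolding exp_minus d by (rule g) (use un c0 in simp_all)
 qed
qed

section \<open>Matching the two bounds\<close>

context semi_markov_noise
begin

text \<open>Each of three excesses is at most \<theta>: the renewal theorem, the constant
  \<open>B\<close> after division by \<open>n\<close>, and the part with
  \<open>\<epsilon>\<close>.\<close>

lemma noise_factor_eventually_le:
 assumes \<theta>: "0 < \<theta>"
 obtains B \<epsilon> where "0 <= B" "0 <= \<epsilon>"
  "\<And>N m a. (\<And>l. \<bar>a l\<bar> <= 2) ==>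
   \<bar>expectation (%om. grid_sum N m a (%t. renewal_reward \<tau> Y t om))\<bar> <= B + \<epsilon> * sqrt (\<Sum>l<m. (a l)^2 * cell_mean N l)"
  "eventually (%n. noise_factor \<theta> B \<epsilon> n <= 1 + 3 * \<theta>) sequentially"
proof -
 \<comment> \<open>The solution of 8 \<epsilon>^2 (1 + \<theta>) / \<theta> = \<theta>, where
   \<open>1 + \<theta>\<close> is the allowance for the renewal count.\<close>
 define \<epsilon> where "\<epsilon> = sqrt (\<theta>^2 / (8 * (1 + \<theta>)))"
 have \<epsilon>: "0 < \<epsilon>" "\<epsilon>^2 = \<theta>^2 / (8 * (1 + \<theta>))" using \<theta> by (auto simp: \<epsilon>_def)
 obtain B where B: "0 <= B" and mean: "\<And>N m a. (\<And>l. \<bar>a l\<bar> <= 2) ==>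
   \<bar>expectation (%om. grid_sum N m a (%t. renewal_reward \<tau> Y t om))\<bar> <= B + \<epsilon> * sqrt (\<Sum>l<m. (a l)^2 * cell_mean N l)"
  using reward_mean_bound[OF \<epsilon>(1)] by blast
 have tm: "0 < tau_mean" by (rule tau_mean_pos)
 have "(%n. 2 * tau_mean * B^2 / \<theta> / real n) \<longlonglongrightarrow> 0" by (rule lim_const_over_n)
 then have ev: "eventually (%n. 2 * tau_mean * B^2 / \<theta> / real n < \<theta>) sequentially" using \<theta> by (rule order_tendstoD(2))
 have "eventually (%n. noise_factor \<theta> B \<epsilon> n <= 1 + 3 * \<theta>) sequentially"
  using ev renewal_mean_limit[OF \<theta>] eventually_gt_at_top[of "0::nat"]
 proof eventually_elim
  fix n :: nat assume e: "2 * tau_mean * B^2 / \<theta> / real n < \<theta>" and n: "0 < n"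
   and "expectation (%om. real (renewal_count \<tau> (real n) om)) <= (1 + \<theta>) * real n / tau_mean"
  then have rm: "renewal_mean n <= (1 + \<theta>) * real n / tau_mean" by (simp add: renewal_mean_def)
  then have "tau_mean * renewal_mean n / real n <= 1 + \<theta>" using tm n by (simp add: field_simps)
  then have 1: "max 1 (tau_mean * renewal_mean n / real n) <= 1 + \<theta>" using \<theta> by simp
  have "2 * tau_mean / (\<theta> * real n) * (\<epsilon>^2 * (4 * renewal_mean n)) <= 2 * tau_mean / (\<theta> * real n) * (\<epsilon>^2 * (4 * ((1 + \<theta>) * real n / tau_mean)))"
   using rm tm \<theta> by (intro mult_left_mono) auto
  also have "\<dots> = \<theta>"
  proof -
   have "2 * m / (a * x) * (a^2 / (8 * (1 + a)) * (4 * ((1 + a) * x / m))) = a" if "0 < a" "0 < x" "0 < m" for a x m :: real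
    using that by (simp add: divide_simps power2_eq_square)
   from this[OF \<theta> _ tm, of "real n"] n show ?thesis unfolding \<epsilon>(2) by simp
  qed
  finally have 2: "2 * tau_mean / (\<theta> * real n) * (\<epsilon>^2 * (4 * renewal_mean n)) <= \<theta>" .
  have 3: "2 * tau_mean / (\<theta> * real n) * B^2 <= \<theta>" using e by (simp add: mult.commute)
  show "noise_factor \<theta> B \<epsilon> n <= 1 + 3 * \<theta>"
   unfolding noise_factor_def distrib_left using 1 2 3 by linarith
 qed
 with that[OF B less_imp_le[OF \<epsilon>(1)] mean] show ?thesis by blast
qed

text \<open>Upper and lower bounds converge to the constant up to factors depending on free
  parameters \<theta> and \<delta>; these are sent to 0 only after \<open>n\<close>.\<close>

lemma minimax_risk_limit:
 fixes lo hi :: "nat => real"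
 assumes bounds: "\<And>n. 1 <= n ==> 0 < lo n \<and> lo n <= hi n" and small: "(%n. hi n / real n) \<longlonglongrightarrow> 0"
  and k: "1 <= k" and r: "0 < r"
 shows "(%n. ennreal ((real n / hi n) powr (2 * real k / (2 * real k + 1))) *
   (INF Sh\<in>estimators n. SUP S\<in>sobolev_ball k r. robust_risk n (noise_laws n (lo n) (hi n)) Sh S))
  \<longlonglongrightarrow> ennreal (pinsker_constant k r)"
proof -
 let ?V = "%n. INF Sh\<in>estimators n. SUP S\<in>sobolev_ball k r. robust_risk n (noise_laws n (lo n) (hi n)) Sh S"
 let ?d = "2 * real k + 1"
 let ?P = "pinsker_constant k r"
 \<comment> \<open>The frequency scale: u^(2k) is the normalising rate and u^-(2k+1) the noise level
   \<open>hi n / real n\<close>.\<close>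
 define u where "u n = (real n / hi n) powr (1 / ?d)" for n
 define \<alpha> where "\<alpha> = (r * (real k + 1) * (2 * real k + 1) / (2 * real k * (2 * pi) ^ (2 * k))) powr (1 / ?d)"
 note P = pinsker_constant_eq[OF k r, folded \<alpha>_def]
 have k0: "0 < real k" using k by simp
 have hi: "0 < hi n" if "1 <= n" for n using bounds[OF that] by linarith
 have nhi: "0 < real n / hi n" if "1 <= n" for n using hi[OF that] that by simp
 have u_at_top: "filterlim u at_top sequentially"
 proof -
  have "eventually (%n. 0 < hi n / real n) sequentially"
   using eventually_ge_at_top[of "1::nat"] by eventually_elim (use hi in simp)
  then have "filterlim (%n. inverse (hi n / real n)) at_top sequentially"
   by (rule filterlim_inverse_at_top[OF small])
  then have "filterlim (%n. real n / hi n) at_top sequentially" by (simp add: inverse_eq_divide)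
  moreover have "0 < 1 / ?d" using k0 by simp
  ultimately show ?thesis unfolding u_def by (intro filterlim_compose[OF real_powr_at_top])
 qed
 have u_pos: "0 < u n" if "1 <= n" for n
  unfolding u_def powr_gt_zero by (rule less_imp_neq[THEN not_sym, OF nhi[OF that]])
 have u_pow: "(real n / hi n) powr (2 * real k / ?d) = (u n) ^ (2 * k)" "1 / (u n) ^ (2 * k + 1) = hi n / real n" if n: "1 <= n" for n
 proof -
  have "(u n) ^ m = (real n / hi n) powr (1 / ?d * real m)" for m
   unfolding powr_realpow[OF u_pos[OF n], symmetric] by (simp add: u_def powr_powr)
  note eq = this
  have "1 / ?d * real (2 * k) = 2 * real k / ?d" by simp
  then show "(real n / hi n) powr (2 * real k / ?d) = (u n) ^ (2 * k)" unfolding eq by simp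
  have "1 / ?d * real (2 * k + 1) = 1" using k0 by simp
  then have "(u n) ^ (2 * k + 1) = real n / hi n" unfolding eq using powr_one[OF less_imp_le[OF nhi[OF n]]] by (simp only:)
  then show "1 / (u n) ^ (2 * k + 1) = hi n / real n" by simp
 qed
 let ?X = "%n. ennreal ((real n / hi n) powr (2 * real k / ?d)) * ?V n"

 have upper: "eventually (%n. ?X n <= ennreal (F n)) sequentially \<and> (F \<longlonglongrightarrow> (1 + 3 * \<theta>) * ?P)"
  if \<theta>: "0 < \<theta>" "\<theta> < 1"
   and F: "F = (%n. (u n) ^ (2 * k) * ((1 + 3 * \<theta>) * (r / (2 * pi * real (nat \<lceil>\<alpha> * u n\<rceil>)) ^ (2 * k)) +
   1 / (u n) ^ (2 * k + 1) * (1 + 3 * \<theta>) * (\<Sum>j\<in>{- int (nat \<lceil>\<alpha> * u n\<rceil>)..int (nat \<lceil>\<alpha> * u n\<rceil>)}. (pinsker_weight k (nat \<lceil>\<alpha> * u n\<rceil>) j)^2)))" for \<theta> F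
 proof
  obtain B \<epsilon> where B: "0 <= B" and \<epsilon>: "0 <= \<epsilon>"
   and mean: "\<And>N m a. (\<And>l. \<bar>a l\<bar> <= 2) ==>
    \<bar>expectation (%om. grid_sum N m a (%t. renewal_reward \<tau> Y t om))\<bar> <= B + \<epsilon> * sqrt (\<Sum>l<m. (a l)^2 * cell_mean N l)"
   and nf: "eventually (%n. noise_factor \<theta> B \<epsilon> n <= 1 + 3 * \<theta>) sequentially"
   by (rule noise_factor_eventually_le[OF \<theta>(1)]) blast
  have W1: "eventually (%n. 1 <= nat \<lceil>\<alpha> * u n\<rceil>) sequentially"
   using ceiling_scale_limit(2)[OF u_at_top P(3)] unfolding filterlim_at_top by blast
  show "eventually (%n. ?X n <= ennreal (F n)) sequentially"
   using nf W1 eventually_ge_at_top[of "1::nat"]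
  proof eventually_elim
   fix n :: nat assume nf: "noise_factor \<theta> B \<epsilon> n <= 1 + 3 * \<theta>" and W: "1 <= nat \<lceil>\<alpha> * u n\<rceil>" and n: "1 <= n"
   let ?W = "nat \<lceil>\<alpha> * u n\<rceil>"
   let ?s = "\<Sum>j\<in>{- int ?W..int ?W}. (pinsker_weight k ?W j)^2"
   let ?b = "r / (2 * pi * real ?W) ^ (2 * k)"
   have V: "?V n <= ennreal ((1 + \<theta>)^2 * ?b + hi n / real n * noise_factor \<theta> B \<epsilon> n * ?s)"
    by (rule minimax_upper_bound[OF n \<theta>(1) k _ W _ B \<epsilon> mean]) (use r hi[OF n] in auto)
   have th: "(1 + \<theta>)^2 <= 1 + 3 * \<theta>"
    using mult_strict_left_mono[OF \<theta>(2,1)] by (simp add: power2_eq_square algebra_simps)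
   have "(1 + \<theta>)^2 * ?b + hi n / real n * noise_factor \<theta> B \<epsilon> n * ?s <= (1 + 3 * \<theta>) * ?b + hi n / real n * (1 + 3 * \<theta>) * ?s"
   proof (rule add_mono)
    show "(1 + \<theta>)^2 * ?b <= (1 + 3 * \<theta>) * ?b" by (rule mult_right_mono[OF th]) (use r in simp)
    show "hi n / real n * noise_factor \<theta> B \<epsilon> n * ?s <= hi n / real n * (1 + 3 * \<theta>) * ?s"
     by (intro mult_right_mono mult_left_mono nf) (use hi[OF n] in \<open>auto intro!: sum_nonneg\<close>)
   qed
   with V have "?V n <= ennreal ((1 + 3 * \<theta>) * ?b + hi n / real n * (1 + 3 * \<theta>) * ?s)"
    by (meson ennreal_leI order_trans)
   then have "?X n <= ennreal ((u n) ^ (2 * k)) * ennreal ((1 + 3 * \<theta>) * ?b + hi n / real n * (1 + 3 * \<theta>) * ?s)"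
    unfolding u_pow(1)[OF n] by (rule mult_left_mono) simp
   also have "\<dots> = ennreal (F n)"
    unfolding F u_pow(2)[OF n] by (rule ennreal_mult'[symmetric]) (use u_pos[OF n] in simp)
   finally show "?X n <= ennreal (F n)" .
  qed
  have "(1 + 3 * \<theta>) * (r / (2 * pi * \<alpha>) ^ (2 * k)) + (1 + 3 * \<theta>) * (\<alpha> * (4 * (real k)^2 / ((real k + 1) * (2 * real k + 1)))) = (1 + 3 * \<theta>) * ?P"
   unfolding distrib_left[symmetric] P(2) P(1) ..
  with upper_bound_limit[OF u_at_top P(3) k, of "1 + 3 * \<theta>" r "1 + 3 * \<theta>"]
  show "F \<longlonglongrightarrow> (1 + 3 * \<theta>) * ?P" unfolding F by simp
 qed

 have lower: "\<exists>G. eventually (%n. ennreal (G n) <= ?X n) sequentially \<and> (G \<longlonglongrightarrow> (1 - \<delta>) powr (1 / ?d) * ?P)"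
  if \<delta>: "0 < \<delta>" "\<delta> < 1" for \<delta>
 proof -
  \<comment> \<open>Scaling \<alpha> by this factor lowers the limiting prior energy from
    \<open>r\<close> to \<open>(1 - \<delta>) * r\<close> and the limit of the bound by the same
    factor.\<close>
  define \<beta> where "\<beta> = (1 - \<delta>) powr (1 / ?d) * \<alpha>"
  have \<beta>: "0 < \<beta>" using P(3) \<delta> by (simp add: \<beta>_def)
  have \<beta>d: "\<beta> ^ (2 * k + 1) = (1 - \<delta>) * (r * (real k + 1) * (2 * real k + 1) / (2 * real k * (2 * pi) ^ (2 * k)))"
  proof -
   have p: "0 < (1 - \<delta>) powr (1 / ?d)" using \<delta> by simp
   have e1: "1 / ?d * real (2 * k + 1) = 1" using k0 by simp
   have "(1 - \<delta>) powr 1 = 1 - \<delta>" using \<delta> by simp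
   then have "((1 - \<delta>) powr (1 / ?d)) ^ (2 * k + 1) = 1 - \<delta>"
    unfolding powr_realpow[OF p, symmetric] powr_powr e1 .
   then show ?thesis unfolding \<beta>_def power_mult_distrib P(4) by simp
  qed
  define W where "W n = nat \<lceil>\<beta> * u n\<rceil>" for n
  define e where "e n = 1 / (u n) ^ (2 * k + 1)" for n
  define C where "C = (real k + 1) * (2 * pi) ^ (2 * k)"
  define M0 where "M0 = C * \<beta> ^ (2 * k)"
  have M0: "0 <= M0" using \<beta> by (simp add: M0_def C_def)
  \<comment> \<open>\<open>M0 + 1\<close> eventually bounds u times the energy of any single
    frequency, so the exponent \<open>t = \<gamma> * u n\<close> keeps t times that energy below
    \<open>\<delta> / 8\<close>, as the Chernoff product asks.\<close>
  define \<gamma> where "\<gamma> = \<delta> / 8 / (M0 + 1)"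
  have \<gamma>: "0 < \<gamma>" using \<delta> M0 by (simp add: \<gamma>_def)
  \<comment> \<open>The Chernoff decay t r \<delta>^2/4, divided by u.\<close>
  define c0 where "c0 = \<gamma> * r * \<delta>^2 / 4"
  have c0: "0 < c0" using \<gamma> r \<delta> by (simp add: c0_def)
  let ?E = "%n. e n * ((2 * pi) ^ (2 * k) * (2 * (\<Sum>j=1..W n. real j ^ k * real (W n) ^ k - real j ^ (2 * k)))
     + 2 * real k * (2 * pi) ^ (2 * k - 2) * real (W n) ^ (2 * k))"
  have "?E \<longlonglongrightarrow> (2 * pi) ^ (2 * k) * 2 * \<beta> ^ (2 * k + 1) * (1 / (real k + 1) - 1 / (real (2 * k) + 1))"
   unfolding e_def W_def by (rule prior_energy_limit[OF u_at_top \<beta> k])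
  also have "(2 * pi) ^ (2 * k) * 2 * \<beta> ^ (2 * k + 1) * (1 / (real k + 1) - 1 / (real (2 * k) + 1)) = (1 - \<delta>) * r"
  proof -
   have gen: "Z * 2 * (c * (r * b * d / (2 * K * Z))) * (K / (b * d)) = c * r"
    if "K \<noteq> 0" "Z \<noteq> 0" "b \<noteq> 0" "d \<noteq> 0" for Z c K b d :: real
    using that by (simp add: field_simps)
   have nz: "real k + 1 \<noteq> 0" "2 * real k + 1 \<noteq> 0" "real k \<noteq> 0" using k0 by linarith+
   then have "1 / (real k + 1) - 1 / (real (2 * k) + 1) = real k / ((real k + 1) * (2 * real k + 1))"
    by (simp add: divide_simps)
   then show ?thesis unfolding \<beta>d by (simp only:) (rule gen, use nz in simp_all)
  qed
  finally have Elim: "?E \<longlonglongrightarrow> (1 - \<delta>) * r" .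
  have "(1 - \<delta>) * r < (1 - \<delta> / 2) * r" using \<delta> r by (intro mult_strict_right_mono) auto
  then have ev1: "eventually (%n. ?E n < (1 - \<delta> / 2) * r) sequentially" using Elim by (intro order_tendstoD(2))
  have "(%n. u n * (C * (e n * real (W n) ^ (2 * k)))) \<longlonglongrightarrow> M0"
   unfolding e_def W_def M0_def by (rule prior_max_limit[OF u_at_top \<beta> k])
  then have ev2: "eventually (%n. u n * (C * (e n * real (W n) ^ (2 * k))) < M0 + 1) sequentially" by (rule order_tendstoD(2)) simp
  define T where "T n = 8 * real (W n) * (2 * r + 1 / (\<gamma> * u n)) * exp (- (c0 * u n))" for n
  define G where "G n = (u n) ^ (2 * k) * (\<Sum>j\<in>sym_range (W n - 1). e n * (1 - (\<bar>real_of_int j\<bar> / real (W n)) ^ k)) - (u n) ^ (2 * k) * T n" for n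
  have "G \<longlonglongrightarrow> \<beta> * (2 * real k / (real k + 1)) - 0"
   unfolding G_def[abs_def] T_def e_def W_def
   by (intro tendsto_diff posterior_sum_limit[OF u_at_top \<beta> k] tail_limit[OF u_at_top \<beta> k c0])
  then have Glim: "G \<longlonglongrightarrow> (1 - \<delta>) powr (1 / ?d) * ?P" unfolding P(1) \<beta>_def by (simp add: mult.assoc)
  have "eventually (%n. ennreal (G n) <= ?X n) sequentially"
   using ev1 ev2 eventually_ge_at_top[of "1::nat"]
  proof eventually_elim
   fix n :: nat assume E: "?E n < (1 - \<delta> / 2) * r" and M: "u n * (C * (e n * real (W n) ^ (2 * k))) < M0 + 1" and n: "1 <= n"
   have un: "0 < u n" by (rule u_pos[OF n])
   have en: "0 < e n" using un by (simp add: e_def)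
   have en': "real n / hi n = 1 / e n" using u_pow(2)[OF n] by (simp add: e_def)
   let ?I = "sym_range (W n - 1)" and ?\<sigma> = "prior_sd k (W n) (e n)" and ?t = "\<gamma> * u n"
   let ?y = "%j. sobolev_weight k j * (?\<sigma> j)^2"
   have t: "0 < ?t" using \<gamma> un by simp
   note pe = prior_energy[OF k en, where W = "W n", folded sobolev_weight_def]
   have ty: "?t * ?y j <= \<delta> / 8" if j: "j \<in> ?I" for j
   proof -
    have "?t * ?y j <= ?t * (C * (e n * real (W n) ^ (2 * k)))"
     unfolding C_def by (rule mult_left_mono[OF pe(2)[OF j]]) (use t in simp)
    also have "\<dots> = \<gamma> * (u n * (C * (e n * real (W n) ^ (2 * k))))" by simp
    also have "\<dots> <= \<gamma> * (M0 + 1)" using M \<gamma> by (intro mult_left_mono) auto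
    also have "\<dots> = \<delta> / 8" using M0 unfolding \<gamma>_def by (intro nonzero_eq_divide_eq[THEN iffD1, OF _ refl]) linarith
    finally show ?thesis .
   qed
   have lt: "2 * ?t * sobolev_weight k j * (?\<sigma> j)^2 < 1" if "j \<in> ?I" for j
   proof -
    have "2 * ?t * sobolev_weight k j * (?\<sigma> j)^2 = 2 * (?t * ?y j)" by (simp only: mult.assoc)
    then show ?thesis using ty[OF that] \<delta> by linarith
   qed
   have sum: "(\<Sum>j\<in>?I. ?y j) <= (1 - \<delta> / 2) * r" using pe(3) E by linarith
   have ch: "exp (- ?t * r) * (\<Prod>j\<in>?I. 1 / sqrt (1 - 2 * ?t * ?y j)) <= exp (- (?t * r * \<delta>^2 / 4))"
    by (rule chernoff_product[OF finite_sym_range \<delta> _ pe(1) ty sum]) (use t in simp_all)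
   have card: "real (card ?I) <= 2 * real (W n)" unfolding card_sym_range by simp
   have tail: "4 * real (card ?I) * (2 * r + 1 / ?t) * exp (- ?t * r) * (\<Prod>j\<in>?I. 1 / sqrt (1 - 2 * ?t * sobolev_weight k j * (?\<sigma> j)^2)) <= T n"
   proof -
    have "4 * real (card ?I) * (2 * r + 1 / ?t) * (exp (- ?t * r) * (\<Prod>j\<in>?I. 1 / sqrt (1 - 2 * ?t * ?y j))) <=
      (4 * real (card ?I) * (2 * r + 1 / ?t)) * exp (- (?t * r * \<delta>^2 / 4))"
     by (rule mult_left_mono[OF ch]) (use r t in simp)
    also have "\<dots> <= (4 * (2 * real (W n)) * (2 * r + 1 / ?t)) * exp (- (?t * r * \<delta>^2 / 4))"
     using card r t by (intro mult_right_mono mult_left_mono) auto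
    also have "\<dots> = T n" by (simp add: T_def c0_def mult_ac)
    finally show ?thesis by (simp only: mult.assoc)
   qed
   have I: "?I \<subseteq> {- int (W n)..int (W n)}" by (auto simp: sym_range_def)
   \<comment> \<open>Subtraction in \<open>ennreal\<close> stops at 0, so the inequality needs no
     comparison of the tail with the sum.\<close>
   have V: "ennreal (\<Sum>j\<in>?I. e n * (1 - (\<bar>real_of_int j\<bar> / real (W n)) ^ k)) - ennreal (T n) <= ?V n"
   proof (rule INF_greatest)
    fix Sh assume Sh: "Sh \<in> estimators n"
    let ?R = "SUP S\<in>sobolev_ball k r. robust_risk n (noise_laws n (lo n) (hi n)) Sh S"
    have "ennreal (\<Sum>j\<in>?I. 1 / (1 / (?\<sigma> j)^2 + real n / hi n)) <= ?R +
     ennreal (4 * real (card ?I) * (2 * r + 1 / ?t) * exp (- ?t * r) * (\<Prod>j\<in>?I. 1 / sqrt (1 - 2 * ?t * sobolev_weight k j * (?\<sigma> j)^2)))"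
     by (rule bayes_lower_bound[OF n hi[OF n] _ _ I prior_sd_facts(1)[OF k en] t lt Sh]) (use bounds[OF n] r in auto)
    also have "\<dots> <= ?R + ennreal (T n)" by (intro add_left_mono ennreal_leI tail)
    also have "(\<Sum>j\<in>?I. 1 / (1 / (?\<sigma> j)^2 + real n / hi n)) = (\<Sum>j\<in>?I. e n * (1 - (\<bar>real_of_int j\<bar> / real (W n)) ^ k))"
     unfolding en' by (intro sum.cong refl prior_sd_facts(3)[OF k en])
    finally show "ennreal (\<Sum>j\<in>?I. e n * (1 - (\<bar>real_of_int j\<bar> / real (W n)) ^ k)) - ennreal (T n) <= ?R"
     unfolding ennreal_minus_le_iff by (simp add: add.commute)
   qed
   have T0: "0 <= T n" using r t by (simp add: T_def)
   have "ennreal (G n) = ennreal ((u n) ^ (2 * k)) * (ennreal (\<Sum>j\<in>?I. e n * (1 - (\<bar>real_of_int j\<bar> / real (W n)) ^ k)) - ennreal (T n))"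
    unfolding ennreal_minus[OF T0] G_def right_diff_distrib[symmetric] by (rule ennreal_mult') (use un in simp)
   also have "\<dots> <= ?X n" unfolding u_pow(1)[OF n] by (rule mult_left_mono[OF V]) simp
   finally show "ennreal (G n) <= ?X n" .
  qed
  with Glim show ?thesis by blast
 qed

 have small_ev: "eventually (%x::real. 0 < x \<and> x < 1) (at_right 0)"
  using eventually_at_right_real[of 0 1] by simp
 show ?thesis
 proof (rule order_tendstoI)
  fix a assume a: "a < ennreal ?P"
  have "((%\<delta>. ennreal ((1 - \<delta>) powr (1 / ?d) * ?P)) \<longlongrightarrow> ennreal ((1 - 0) powr (1 / ?d) * ?P)) (at_right 0)"
   by (intro tendsto_ennrealI tendsto_mult tendsto_powr tendsto_diff tendsto_const tendsto_ident_at) auto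
  then have "eventually (%\<delta>. a < ennreal ((1 - \<delta>) powr (1 / ?d) * ?P)) (at_right 0)"
   using a by (intro order_tendstoD(1)) simp_all
  then have "eventually (%\<delta>. a < ennreal ((1 - \<delta>) powr (1 / ?d) * ?P) \<and> (0 < \<delta> \<and> \<delta> < 1)) (at_right 0)"
   using small_ev by (rule eventually_conj)
  then obtain \<delta> where \<delta>: "0 < \<delta>" "\<delta> < 1" "a < ennreal ((1 - \<delta>) powr (1 / ?d) * ?P)"
   using eventually_happens'[OF trivial_limit_at_right_real] by blast
  obtain G where G: "eventually (%n. ennreal (G n) <= ?X n) sequentially" "G \<longlonglongrightarrow> (1 - \<delta>) powr (1 / ?d) * ?P"
   using lower[OF \<delta>(1,2)] by blast
  have "eventually (%n. a < ennreal (G n)) sequentially"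
   by (rule order_tendstoD(1)[OF tendsto_ennrealI[OF G(2)] \<delta>(3)])
  with G(1) show "eventually (%n. a < ?X n) sequentially" by eventually_elim (rule less_le_trans)
 next
  fix a assume a: "ennreal ?P < a"
  have "((%\<theta>. ennreal ((1 + 3 * \<theta>) * ?P)) \<longlongrightarrow> ennreal ((1 + 3 * 0) * ?P)) (at_right 0)"
   by (intro tendsto_ennrealI tendsto_mult tendsto_add tendsto_const tendsto_ident_at)
  then have "eventually (%\<theta>. ennreal ((1 + 3 * \<theta>) * ?P) < a) (at_right 0)"
   using a by (intro order_tendstoD(2)) simp_all
  then have "eventually (%\<theta>. ennreal ((1 + 3 * \<theta>) * ?P) < a \<and> (0 < \<theta> \<and> \<theta> < 1)) (at_right 0)"
   using small_ev by (rule eventually_conj)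
  then obtain \<theta> where \<theta>: "0 < \<theta>" "\<theta> < 1" "ennreal ((1 + 3 * \<theta>) * ?P) < a"
   using eventually_happens'[OF trivial_limit_at_right_real] by blast
  note F = upper[OF \<theta>(1,2) refl]
  from F[THEN conjunct1] order_tendstoD(2)[OF tendsto_ennrealI[OF F[THEN conjunct2]] \<theta>(3)]
  show "eventually (%n. ?X n < a) sequentially" by eventually_elim (rule le_less_trans)
 qed
qed

end

theorem corollary4p8:
  fixes M :: "'a measure"
    and w L :: "real \<Rightarrow> 'a \<Rightarrow> real"
    and \<nu> \<eta> :: "real measure"
    and \<tau> Y :: "nat \<Rightarrow> 'a \<Rightarrow> real"
    and g :: "real \<Rightarrow> real"
    and \<sigma>_lo \<sigma>_hi :: "nat \<Rightarrow> real"
    and p :: "nat \<Rightarrow> nat"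
    and k :: nat and r :: real
  assumes model: "semi_markov_noise M w L \<nu> \<eta> \<tau> Y"
    and sigma_bounds: "\<And>n. n \<ge> 1 \<Longrightarrow> 0 < \<sigma>_lo n \<and> \<sigma>_lo n \<le> \<sigma>_hi n"
    and sigma_lo: "\<And>\<epsilon>. \<epsilon> > 0 \<Longrightarrow>
          filterlim (\<lambda>n. real n powr \<epsilon> * \<sigma>_lo n) at_top sequentially"
    and sigma_hi: "\<And>\<epsilon>. \<epsilon> > 0 \<Longrightarrow> (\<lambda>n. \<sigma>_hi n / real n powr \<epsilon>) \<longlonglongrightarrow> 0"
    and density: "g \<in> borel_measurable borel" "\<And>x. 0 \<le> g x"
          "\<eta> = density lborel (\<lambda>x. ennreal (g x))"
    and g_limits: "\<And>x. (\<exists>l. (g \<longlongrightarrow> l) (at_left x)) \<and> (\<exists>l. (g \<longlongrightarrow> l) (at_right x))"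
    and g_dini: "\<And>K. K > 0 \<Longrightarrow> \<exists>\<delta>>0.
          (SUP x\<in>{x. \<bar>x\<bar> \<le> K}. \<integral>\<^sup>+t\<in>{0..\<delta>}.
             ennreal (inverse t * \<bar>g (x + t) + g (x - t) - left_limit g x - right_limit g x\<bar>)
             \<partial>lborel) < \<infinity>"
    and g_jumps: "\<And>\<gamma>. \<gamma> > 0 \<Longrightarrow>
          bdd_above ((\<lambda>z. z powr \<gamma> * \<bar>2 * g z - left_limit g z - right_limit g z\<bar>) ` {0..})"
    and g_exp_moment: "\<exists>\<beta>>0. (\<integral>\<^sup>+x. ennreal (exp (\<beta> * x) * g x) \<partial>lborel) < \<infinity>"
    and g_fourier: "\<exists>tstar>0. \<forall>t. 0 \<le> t \<longrightarrow> t \<le> tstar \<longrightarrow>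
          integrable lborel (\<lambda>x. exp (t * x) * g x) \<and>
          integrable lborel (\<lambda>\<theta>. fourier_hat g (complex_of_real \<theta> - \<i> * complex_of_real t))"
    and p_pos: "\<And>n. n \<ge> 1 \<Longrightarrow> p n \<ge> 1"
    and p_large: "\<And>n. n \<ge> 3 \<Longrightarrow> real (p n) \<ge> real n powr (5 / 6)"
    and k: "k \<ge> 1" and r: "r > 0"
  shows "(\<lambda>n. ennreal ((real n / \<sigma>_hi n) powr (2 * real k / (2 * real k + 1))) *
            (INF Sh\<in>estimators n. SUP S\<in>sobolev_ball k r.
               robust_risk n
                 (semi_markov_noise.noise_laws M w L \<eta> \<tau> Y n (\<sigma>_lo n) (\<sigma>_hi n)) Sh S))
         \<longlonglongrightarrow> ennreal (pinsker_constant k r)"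
proof -
 interpret semi_markov_noise M w L \<nu> \<eta> \<tau> Y by (rule model)
 \<comment> \<open>Exponent 1: the noise level tends to 0, so the frequency scale tends to
   infinity.\<close>
 have "(\<lambda>n. \<sigma>_hi n / real n) \<longlonglongrightarrow> 0" using sigma_hi[of 1] by simp
 then show ?thesis using sigma_bounds k r by (intro minimax_risk_limit) auto
qed

end
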